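(* For all $a\in[1,N]$, all $k\in\mathbb Z$ and all integer partitions $\lambda=(\lambda_1\ge\dots\ge\lambda_N\ge0)$, $$\bar D_{a;k}(\Lambda;q)\,\Pi_\lambda(x)=D_{a;k}(x;q)\,\Pi_\lambda(x),$$ where $$D_{a;k}(x;q)=\sum_{I\subset[1,N],\,|I|=a}\ \prod_{i\in I}x_i^k\prod_{i\in I,\,j\notin I}\frac{x_i}{x_i-x_j}\prod_{i\in I}\Gamma_i$$ and $\bar D_{a;k}(\Lambda;q)$ is the solution of the opposite quantum Q-system of type $A_{N-1}^{(1)}$ with initial data $\bar D_{a;0}=\Lambda_1\cdots\Lambda_a$, $\bar D_{a;1}=\Lambda_1\cdots\Lambda_aT_1\cdots T_a$.
   Context: $q\in\mathbb C^*$, $|q|<1$, $[1,N]=\{1,\dots,N\}$; $\Gamma_ix_j=q^{\delta_{ij}}x_j\Gamma_i$; $T_i\Lambda_j=q^{\delta_{ij}}\Lambda_jT_i$ (the $\Lambda$'s commute, the $T$'s commute). The opposite quantum Q-system of type $A_{N-1}^{(1)}$: $\bar D_{b;k+i}\bar D_{a;k}=q^{i\min(a,b)}\bar D_{a;k}\bar D_{b;k+i}$ for $|i|\le1$, and $q^a\bar D_{a;k-1}\bar D_{a;k+1}=\bar D_{a;k}^2-\bar D_{a+1;k}\bar D_{a-1;k}$ for $a\in[1,N]$, $k\in\mathbb Z$, with $\bar D_{0;k}=1$, $\bar D_{N+1;k}=0$. The initial data determine all $\bar D_{a;k}$, which are Laurent polynomials in the $\Lambda_i,T_i$. The monic symmetric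 Macdonald polynomial $P_\lambda(x)$ ($x^\lambda+$ lower terms in dominance order) is the eigenfunction of $\mathcal D_1(x;q,t)=\sum_i\prod_{j\ne i}\frac{tx_i-x_j}{x_i-x_j}\Gamma_i$ with eigenvalue $\sum_is_i$, $s_i=t^{N-i}q^{\lambda_i}$. The $q$-Whittaker polynomials are $\Pi_\lambda(x)=\lim_{t\to\infty}P_\lambda(x)$. $\Lambda_i$ acts on functions of $\lambda$ by multiplication by $q^{\lambda_i}$ and $T_i$ by the shift $\lambda_j\mapsto\lambda_j+\delta_{ij}$. Where the shifts leave the set of partitions, $\Pi_\lambda$ is understood through its extension to arbitrary $\lambda$: the $t\to\infty$ limit of the unique series eigenfunction $x^\lambda\big(1+\sum_{0\ne\beta\in Q_+}c_\beta(s)x^{-\beta}\big)$ of $\mathcal D_1(x;q,t)$ with eigenvalue $\sum_is_i$ ($s_i=t^{N-i}q^{\lambda_i}$, $Q_+$ the nonnegative integer span of the $e_i-e_{i+1}$), which specializes to $\Pi_\lambda(x)$ at integer partitions. *)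

theory Defs
  imports Complex_Main "HOL-Library.Poly_Mapping" "HOL-Combinatorics.Permutations"
begin

text \<open>
  Exponent vectors, weights and partitions are finitely supported functions from positions to
  integers; an element of the lattice of rank N is one supported on the positions 1, ..., N.
\<close>

type_synonym wt = "nat \<Rightarrow>\<^sub>0 int"

abbreviation wt_entry :: "wt \<Rightarrow> nat \<Rightarrow> int" where
  "wt_entry \<equiv> Poly_Mapping.lookup"

abbreviation eps :: "nat \<Rightarrow> wt" where
  "eps i \<equiv> Poly_Mapping.single i 1"

definition lattice :: "nat \<Rightarrow> wt set" where
  "lattice N = {m. Poly_Mapping.keys m \<subseteq> {1..N}}"

definition is_partition :: "nat \<Rightarrow> wt \<Rightarrow> bool" where
  "is_partition N l \<longleftrightarrow>
     l \<in> lattice N \<and> (\<forall>i\<in>{1..N}. wt_entry l i \<ge> 0) \<and>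
     (\<forall>i\<in>{1..<N}. wt_entry l i \<ge> wt_entry l (i + 1))"

definition Qplus :: "nat \<Rightarrow> wt set" where
  "Qplus N = {\<Sum>i\<in>{1..<N}. Poly_Mapping.single i (int (n i)) - Poly_Mapping.single (i + 1) (int (n i))
              | n. True}"


section \<open>Formal series in the variables x\<close>

text \<open>
  A commutative ring of formal Laurent series in which $1/(x_i-x_j)$, expanded for
  $|x_1| > |x_2| > \dots$, exists and which contains $x^\lambda$ times all power series in the
  $x_{i+1}/x_i$. The support condition (finitely many variables; the partial sums
  $\gamma_0+\dots+\gamma_i$ of the exponents bounded above) makes the coefficients of a product
  finite sums. Position 0 is allowed only to avoid side conditions on the index type.
\<close>

definition psum :: "nat \<Rightarrow> wt \<Rightarrow> int" where
  "psum i g = (\<Sum>j\<le>i. wt_entry g j)"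

definition bounded_exps :: "(wt \<Rightarrow> complex) \<Rightarrow> bool" where
  "bounded_exps f \<longleftrightarrow>
     (\<exists>M b. \<forall>g. f g \<noteq> 0 \<longrightarrow> Poly_Mapping.keys g \<subseteq> {..M} \<and> (\<forall>i. psum i g \<le> b))"

lemma psum_add [simp]: "psum i (g + h) = psum i g + psum i h"
  by (simp add: psum_def lookup_add sum.distrib)

lemma psum_diff [simp]: "psum i (g - h) = psum i g - psum i h"
  by (simp add: psum_def lookup_minus sum_subtractf)

lemma psum_0 [simp]: "psum i 0 = 0"
  by (simp add: psum_def)

lemma keys_diff_subset: "Poly_Mapping.keys (g - h :: wt) \<subseteq> Poly_Mapping.keys g \<union> Poly_Mapping.keys h"
  by (auto simp: in_keys_iff lookup_minus)

lemma psum_Suc: "psum (Suc i) g = psum i g + wt_entry g (Suc i)"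
  by (simp add: psum_def)

lemma abs_entry_le:
  assumes "\<And>i. \<bar>psum i g\<bar> \<le> B"
  shows "\<bar>wt_entry g i\<bar> \<le> 2 * B"
proof (cases i)
  case 0
  then show ?thesis using assms[of 0] by (simp add: psum_def)
next
  case (Suc j)
  then show ?thesis using assms[of j] assms[of i] psum_Suc[of j g] by simp
qed

lemma finite_bounded_wts:
  "finite {g :: wt. Poly_Mapping.keys g \<subseteq> {..M} \<and> (\<forall>i. \<bar>psum i g\<bar> \<le> B)}" (is "finite ?S")
proof -
  let ?F = "{f. f \<in> {..M} \<rightarrow>\<^sub>E {-2*B..2*B}}"
  have "finite ?F" by (simp add: finite_PiE)
  moreover have "inj_on (\<lambda>g. restrict (wt_entry g) {..M}) ?S"
  proof (rule inj_onI)
    fix g h assume g: "g \<in> ?S" and h: "h \<in> ?S"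
      and eq: "restrict (wt_entry g) {..M} = restrict (wt_entry h) {..M}"
    show "g = h"
    proof (rule poly_mapping_eqI)
      fix k show "wt_entry g k = wt_entry h k"
      proof (cases "k \<le> M")
        case True
        then show ?thesis using fun_cong[OF eq, of k] by simp
      next
        case False
        then have "k \<notin> Poly_Mapping.keys g" "k \<notin> Poly_Mapping.keys h" using g h by auto
        then show ?thesis by (simp add: in_keys_iff)
      qed
    qed
  qed
  moreover have "(\<lambda>g. restrict (wt_entry g) {..M}) ` ?S \<subseteq> ?F"
  proof
    fix f assume "f \<in> (\<lambda>g. restrict (wt_entry g) {..M}) ` ?S"
    then obtain g where g: "g \<in> ?S" "f = restrict (wt_entry g) {..M}" by blast
    have "\<bar>wt_entry g i\<bar> \<le> 2 * B" for i using abs_entry_le[of g B i] g by simp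
    then have "- (2 * B) \<le> wt_entry g i" "wt_entry g i \<le> 2 * B" for i
      by (smt (verit))+
    then show "f \<in> ?F" using g by auto
  qed
  ultimately show ?thesis by (meson finite_imageD finite_subset)
qed

definition conv :: "(wt \<Rightarrow> complex) \<Rightarrow> (wt \<Rightarrow> complex) \<Rightarrow> wt \<Rightarrow> complex" where
  "conv f g c = (\<Sum>a | f a \<noteq> 0 \<and> g (c - a) \<noteq> 0. f a * g (c - a))"

lemma finite_conv:
  assumes "bounded_exps f" "bounded_exps g"
  shows "finite {a. f a \<noteq> 0 \<and> g (c - a) \<noteq> 0}"
proof -
  obtain M b where f: "\<And>a. f a \<noteq> 0 \<Longrightarrow> Poly_Mapping.keys a \<subseteq> {..M} \<and> (\<forall>i. psum i a \<le> b)"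
    using assms(1) unfolding bounded_exps_def by blast
  obtain M' b' where g: "\<And>a. g a \<noteq> 0 \<Longrightarrow> Poly_Mapping.keys a \<subseteq> {..M'} \<and> (\<forall>i. psum i a \<le> b')"
    using assms(2) unfolding bounded_exps_def by blast
  let ?C = "\<Sum>j\<le>Max (insert 0 (Poly_Mapping.keys c)). \<bar>wt_entry c j\<bar>"
  have C: "\<bar>psum i c\<bar> \<le> ?C" for i
  proof -
    have "\<bar>psum i c\<bar> \<le> (\<Sum>j\<le>i. \<bar>wt_entry c j\<bar>)" by (simp add: psum_def)
    also have "\<dots> = (\<Sum>j\<in>{..i} \<inter> Poly_Mapping.keys c. \<bar>wt_entry c j\<bar>)"
      by (rule sum.mono_neutral_right) (auto simp: in_keys_iff)
    also have "\<dots> \<le> ?C"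
      by (rule sum_mono2) auto
    finally show ?thesis .
  qed
  let ?B = "\<bar>b\<bar> + ?C + \<bar>b'\<bar>"
  have "{a. f a \<noteq> 0 \<and> g (c - a) \<noteq> 0} \<subseteq>
        {a. Poly_Mapping.keys a \<subseteq> {..M} \<and> (\<forall>i. \<bar>psum i a\<bar> \<le> ?B)}"
  proof safe
    fix a i assume a: "f a \<noteq> 0" "g (c - a) \<noteq> 0"
    have "psum i a \<le> b" "psum i c - psum i a \<le> b'"
      using f[OF a(1)] g[OF a(2)] by auto
    with C[of i] show "\<bar>psum i a\<bar> \<le> ?B" by linarith
  qed (use f in blast)
  then show ?thesis using finite_bounded_wts finite_subset by blast
qed

lemma conv_eq_sum:
  assumes "finite A" "{a. f a \<noteq> 0 \<and> g (c - a) \<noteq> 0} \<subseteq> A"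
  shows "conv f g c = (\<Sum>a\<in>A. f a * g (c - a))"
  unfolding conv_def by (rule sum.mono_neutral_left) (use assms in auto)

lemma conv_nonzero:
  assumes "conv f g c \<noteq> 0"
  obtains a where "f a \<noteq> 0" "g (c - a) \<noteq> 0"
proof -
  have "{a. f a \<noteq> 0 \<and> g (c - a) \<noteq> 0} \<noteq> {}"
  proof
    assume "{a. f a \<noteq> 0 \<and> g (c - a) \<noteq> 0} = {}"
    then have "conv f g c = 0" unfolding conv_def by (simp only: sum.empty)
    then show False using assms by simp
  qed
  then show ?thesis using that by blast
qed

lemma bounded_exps_conv_supp:
  assumes "bounded_exps f" "bounded_exps g"
  shows "bounded_exps (\<lambda>c. if \<exists>a. f a \<noteq> 0 \<and> g (c - a) \<noteq> 0 then 1 else 0)"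
proof -
  obtain M b where f: "\<And>a. f a \<noteq> 0 \<Longrightarrow> Poly_Mapping.keys a \<subseteq> {..M} \<and> (\<forall>i. psum i a \<le> b)"
    using assms(1) unfolding bounded_exps_def by blast
  obtain M' b' where g: "\<And>a. g a \<noteq> 0 \<Longrightarrow> Poly_Mapping.keys a \<subseteq> {..M'} \<and> (\<forall>i. psum i a \<le> b')"
    using assms(2) unfolding bounded_exps_def by blast
  show ?thesis unfolding bounded_exps_def
  proof (intro exI[of _ "max M M'"] exI[of _ "b + b'"] allI impI)
    fix c assume "(if \<exists>a. f a \<noteq> 0 \<and> g (c - a) \<noteq> 0 then 1 else 0 :: complex) \<noteq> 0"
    then obtain a where a: "f a \<noteq> 0" "g (c - a) \<noteq> 0" by (auto split: if_splits)
    have "c = a + (c - a)" by simp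
    then have "Poly_Mapping.keys c \<subseteq> Poly_Mapping.keys a \<union> Poly_Mapping.keys (c - a)"
      using Poly_Mapping.keys_add[of a "c - a"] by simp
    also have "\<dots> \<subseteq> {..M} \<union> {..M'}"
      using f[OF a(1)] g[OF a(2)] by (intro Un_mono) simp_all
    also have "\<dots> \<subseteq> {..max M M'}" by auto
    finally have 1: "Poly_Mapping.keys c \<subseteq> {..max M M'}" .
    have "psum i a \<le> b" "psum i c - psum i a \<le> b'" for i
      using f[OF a(1)] g[OF a(2)] by auto
    then have "psum i c \<le> b + b'" for i using add_mono[of "psum i a" b "psum i c - psum i a" b'] by simp
    with 1 show "Poly_Mapping.keys c \<subseteq> {..max M M'} \<and> (\<forall>i. psum i c \<le> b + b')" by blast
  qed
qed

lemma bounded_exps_sum: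
  assumes "bounded_exps f" "bounded_exps g" "\<And>c. f c = 0 \<Longrightarrow> g c = 0 \<Longrightarrow> h c = 0"
  shows "bounded_exps h"
proof -
  obtain M b where f: "\<And>a. f a \<noteq> 0 \<Longrightarrow> Poly_Mapping.keys a \<subseteq> {..M} \<and> (\<forall>i. psum i a \<le> b)"
    using assms(1) unfolding bounded_exps_def by blast
  obtain M' b' where g: "\<And>a. g a \<noteq> 0 \<Longrightarrow> Poly_Mapping.keys a \<subseteq> {..M'} \<and> (\<forall>i. psum i a \<le> b')"
    using assms(2) unfolding bounded_exps_def by blast
  show ?thesis unfolding bounded_exps_def
  proof (intro exI[of _ "max M M'"] exI[of _ "max b b'"] allI impI)
    fix c assume "h c \<noteq> 0"
    then consider "f c \<noteq> 0" | "g c \<noteq> 0" using assms(3) by blast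
    then show "Poly_Mapping.keys c \<subseteq> {..max M M'} \<and> (\<forall>i. psum i c \<le> max b b')"
    proof cases
      case 1
      then show ?thesis using f[OF 1] by (auto simp: le_max_iff_disj)
    next
      case 2
      then show ?thesis using g[OF 2] by (auto simp: le_max_iff_disj)
    qed
  qed
qed

lemma bounded_exps_subset:
  "bounded_exps f \<Longrightarrow> (\<And>c. f c = 0 \<Longrightarrow> h c = 0) \<Longrightarrow> bounded_exps h"
  by (rule bounded_exps_sum[of f f]) auto

lemma bounded_exps_conv:
  assumes "bounded_exps f" "bounded_exps g"
  shows "bounded_exps (conv f g)"
proof (rule bounded_exps_subset[OF bounded_exps_conv_supp[OF assms]])
  fix c assume "(if \<exists>a. f a \<noteq> 0 \<and> g (c - a) \<noteq> 0 then 1 else 0 :: complex) = 0"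
  then have "\<not> (\<exists>a. f a \<noteq> 0 \<and> g (c - a) \<noteq> 0)" by (auto split: if_splits)
  then show "conv f g c = 0" using conv_nonzero[of f g c] by blast
qed

lemma psum_le_total: "psum i m \<le> (\<Sum>j\<in>Poly_Mapping.keys m. \<bar>wt_entry m j\<bar>)"
proof -
  have "psum i m \<le> (\<Sum>j\<le>i. \<bar>wt_entry m j\<bar>)" unfolding psum_def by (rule sum_mono) simp
  also have "\<dots> = (\<Sum>j\<in>{..i} \<inter> Poly_Mapping.keys m. \<bar>wt_entry m j\<bar>)"
    by (rule sum.mono_neutral_right) (auto simp: in_keys_iff)
  also have "\<dots> \<le> (\<Sum>j\<in>Poly_Mapping.keys m. \<bar>wt_entry m j\<bar>)"
    by (rule sum_mono2) auto
  finally show ?thesis .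
qed

lemma bounded_exps_monom: "bounded_exps (\<lambda>g. if g = m then c else 0)"
proof -
  have "Poly_Mapping.keys m \<subseteq> {..Max (insert 0 (Poly_Mapping.keys m))}" by auto
  then show ?thesis unfolding bounded_exps_def using psum_le_total[of _ m]
    by (intro exI[of _ "Max (insert 0 (Poly_Mapping.keys m))"]
              exI[of _ "\<Sum>j\<in>Poly_Mapping.keys m. \<bar>wt_entry m j\<bar>"]) auto
qed

typedef xseries = "{f :: wt \<Rightarrow> complex. bounded_exps f}"
  morphisms xcoeff Abs_xseries
  using bounded_exps_monom by blast

lifting_forget poly_mapping.lifting
setup_lifting type_definition_xseries

lemma xseries_eqI: "(\<And>g. xcoeff F g = xcoeff G g) \<Longrightarrow> F = G"
  by transfer auto

lemma conv_commute: "conv f g = conv g f"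
proof
  fix c
  show "conv f g c = conv g f c" unfolding conv_def
    by (rule sum.reindex_bij_witness[of _ "\<lambda>a. c - a" "\<lambda>a. c - a"]) auto
qed

lemma conv_assoc:
  assumes f: "bounded_exps f" and g: "bounded_exps g" and h: "bounded_exps h"
  shows "conv (conv f g) h = conv f (conv g h)"
proof
  fix c
  let ?fg = "\<lambda>c. if \<exists>a. f a \<noteq> 0 \<and> g (c - a) \<noteq> 0 then 1 else 0 :: complex"
  let ?gh = "\<lambda>c. if \<exists>a. g a \<noteq> 0 \<and> h (c - a) \<noteq> 0 then 1 else 0 :: complex"
  define V where "V = {a. f a \<noteq> 0 \<and> ?gh (c - a) \<noteq> 0}"
  define U where "U = {d. ?fg d \<noteq> 0 \<and> h (c - d) \<noteq> 0}"
  have finV: "finite V" unfolding V_def by (rule finite_conv[OF f bounded_exps_conv_supp[OF g h]])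
  have finU: "finite U" unfolding U_def by (rule finite_conv[OF bounded_exps_conv_supp[OF f g] h])
  have V: "a \<in> V" and U: "d \<in> U" if nz: "f a \<noteq> 0" "g (d - a) \<noteq> 0" "h (c - d) \<noteq> 0" for a d
  proof -
    have "c - a - (d - a) = c - d" by simp
    then have "\<exists>b. g b \<noteq> 0 \<and> h (c - a - b) \<noteq> 0" using nz by metis
    then show "a \<in> V" using nz by (simp add: V_def)
    show "d \<in> U" using nz by (auto simp: U_def)
  qed
  have "conv (conv f g) h c = (\<Sum>d\<in>U. conv f g d * h (c - d))"
  proof (rule conv_eq_sum[OF finU], safe)
    fix d assume "conv f g d \<noteq> 0" "h (c - d) \<noteq> 0"
    then show "d \<in> U" using conv_nonzero[of f g d] U by metis
  qed
  also have "\<dots> = (\<Sum>d\<in>U. \<Sum>a\<in>V. f a * g (d - a) * h (c - d))"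
  proof (rule sum.cong[OF refl])
    fix d assume "d \<in> U"
    show "conv f g d * h (c - d) = (\<Sum>a\<in>V. f a * g (d - a) * h (c - d))"
    proof (cases "h (c - d) = 0")
      case False
      have "conv f g d = (\<Sum>a\<in>V. f a * g (d - a))"
        by (rule conv_eq_sum[OF finV]) (use V False in auto)
      then show ?thesis by (simp add: sum_distrib_right)
    qed simp
  qed
  also have "\<dots> = (\<Sum>a\<in>V. \<Sum>d\<in>U. f a * g (d - a) * h (c - d))"
    by (rule sum.swap)
  also have "\<dots> = (\<Sum>a\<in>V. f a * conv g h (c - a))"
  proof (rule sum.cong[OF refl])
    fix a assume "a \<in> V"
    show "(\<Sum>d\<in>U. f a * g (d - a) * h (c - d)) = f a * conv g h (c - a)"
    proof (cases "f a = 0")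
      case False
      have "conv g h (c - a) = (\<Sum>b\<in>(\<lambda>d. d - a) ` U. g b * h (c - a - b))"
      proof (rule conv_eq_sum)
        show "finite ((\<lambda>d. d - a) ` U)" using finU by simp
        show "{b. g b \<noteq> 0 \<and> h (c - a - b) \<noteq> 0} \<subseteq> (\<lambda>d. d - a) ` U"
        proof safe
          fix b assume "g b \<noteq> 0" "h (c - a - b) \<noteq> 0"
          then have "a + b \<in> U" using U[of a "a + b"] False by (simp add: algebra_simps)
          then show "b \<in> (\<lambda>d. d - a) ` U" by (metis add_diff_cancel_left' image_eqI)
        qed
      qed
      also have "\<dots> = (\<Sum>d\<in>U. g (d - a) * h (c - d))"
        by (subst sum.reindex) (auto simp: inj_on_def algebra_simps)
      finally show ?thesis by (simp add: sum_distrib_left mult.assoc)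
    qed simp
  qed
  also have "\<dots> = conv f (conv g h) c"
  proof (rule conv_eq_sum[OF finV, symmetric], safe)
    fix a assume a: "f a \<noteq> 0" "conv g h (c - a) \<noteq> 0"
    then obtain b where "g b \<noteq> 0" "h (c - a - b) \<noteq> 0" using conv_nonzero by metis
    then show "a \<in> V" using V[of a "a + b"] a by (simp add: algebra_simps)
  qed
  finally show "conv (conv f g) h c = conv f (conv g h) c" .
qed

lemma conv_add_left:
  assumes "bounded_exps f" "bounded_exps g" "bounded_exps h"
  shows "conv (\<lambda>a. f a + g a) h = (\<lambda>c. conv f h c + conv g h c)"
proof
  fix c
  let ?A = "{a. f a \<noteq> 0 \<and> h (c - a) \<noteq> 0} \<union> {a. g a \<noteq> 0 \<and> h (c - a) \<noteq> 0}"
  have fin: "finite ?A" using finite_conv assms by simp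
  have "conv (\<lambda>a. f a + g a) h c = (\<Sum>a\<in>?A. (f a + g a) * h (c - a))"
    by (rule conv_eq_sum[OF fin]) auto
  also have "\<dots> = (\<Sum>a\<in>?A. f a * h (c - a)) + (\<Sum>a\<in>?A. g a * h (c - a))"
    by (simp add: distrib_right sum.distrib)
  also have "\<dots> = conv f h c + conv g h c"
    by (intro arg_cong2[of _ _ _ _ "(+)"]; rule conv_eq_sum[OF fin, symmetric]; auto)
  finally show "conv (\<lambda>a. f a + g a) h c = conv f h c + conv g h c" .
qed

lemma conv_monom: "conv (\<lambda>g. if g = m then k else 0) h c = k * h (c - m)"
  by (subst conv_eq_sum[of "{m}"]) (auto split: if_splits)

instantiation xseries :: comm_ring_1
begin

lift_definition zero_xseries :: xseries is "\<lambda>_. 0"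
  using bounded_exps_monom[of 0 0] by simp

lift_definition one_xseries :: xseries is "\<lambda>g. if g = 0 then 1 else 0"
  by (rule bounded_exps_monom)

lift_definition plus_xseries :: "xseries \<Rightarrow> xseries \<Rightarrow> xseries" is "\<lambda>f g c. f c + g c"
  by (rule bounded_exps_sum, assumption, assumption) auto

lift_definition uminus_xseries :: "xseries \<Rightarrow> xseries" is "\<lambda>f c. - f c"
  by (erule bounded_exps_subset) auto

lift_definition minus_xseries :: "xseries \<Rightarrow> xseries \<Rightarrow> xseries" is "\<lambda>f g c. f c - g c"
  by (rule bounded_exps_sum, assumption, assumption) auto

lift_definition times_xseries :: "xseries \<Rightarrow> xseries \<Rightarrow> xseries" is conv
  by (rule bounded_exps_conv)

instance
proof
  fix a b c :: xseries
  have b: "bounded_exps (xcoeff F)" for F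
    using xcoeff by simp
  note rep = zero_xseries.rep_eq one_xseries.rep_eq plus_xseries.rep_eq
    uminus_xseries.rep_eq minus_xseries.rep_eq times_xseries.rep_eq
  show "a * b * c = a * (b * c)" by (rule xseries_eqI) (simp only: rep conv_assoc[OF b b b])
  show "a * b = b * a"
    by (rule xseries_eqI) (simp only: rep conv_commute[of "xcoeff a"])
  show "1 * a = a" by (rule xseries_eqI) (simp add: times_xseries.rep_eq one_xseries.rep_eq conv_monom)
  show "(a + b) * c = a * c + b * c"
    by (rule xseries_eqI) (simp only: rep conv_add_left[OF b b b])
  show "a + b + c = a + (b + c)" by (rule xseries_eqI) (simp add: rep add.assoc)
  show "a + b = b + a" by (rule xseries_eqI) (simp add: rep add.commute)
  show "0 + a = a" by (rule xseries_eqI) (simp add: rep)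
  show "- a + a = 0" by (rule xseries_eqI) (simp add: rep)
  show "a - b = a + - b" by (rule xseries_eqI) (simp add: rep)
  have "xcoeff 0 0 \<noteq> xcoeff 1 0" by (simp add: zero_xseries.rep_eq one_xseries.rep_eq)
  then show "(0 :: xseries) \<noteq> 1" by metis
qed

end

lift_definition xmonom :: "wt \<Rightarrow> xseries" is "\<lambda>m g. if g = m then 1 else 0"
  by (rule bounded_exps_monom)

lift_definition xconst :: "complex \<Rightarrow> xseries" is "\<lambda>c g. if g = 0 then c else 0"
  by (rule bounded_exps_monom)

abbreviation xvar :: "nat \<Rightarrow> xseries" where
  "xvar i \<equiv> xmonom (eps i)"

abbreviation xvar_power :: "nat \<Rightarrow> int \<Rightarrow> xseries" where
  "xvar_power i k \<equiv> xmonom (Poly_Mapping.single i k)"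

lemma xcoeff_xmonom_mult: "xcoeff (xmonom m * F) g = xcoeff F (g - m)"
  by (simp add: times_xseries.rep_eq xmonom.rep_eq conv_monom)

lemma xmonom_mult: "xmonom m * xmonom m' = xmonom (m + m')"
  by (rule xseries_eqI) (simp add: xcoeff_xmonom_mult xmonom.rep_eq diff_eq_eq add.commute)

text \<open>The expansion of $1/(x_i-x_j) = \sum_{n\ge0} x_j^n x_i^{-n-1}$ for i < j.\<close>

lift_definition inv_diff_less :: "nat \<Rightarrow> nat \<Rightarrow> xseries" is
  "\<lambda>i j g. if i < j \<and> (\<exists>n::nat. g = Poly_Mapping.single j (int n) - Poly_Mapping.single i (int n + 1))
           then 1 else 0"
proof -
  fix i j :: nat
  show "bounded_exps (\<lambda>g. if i < j \<and> (\<exists>n::nat. g = Poly_Mapping.single j (int n)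
          - Poly_Mapping.single i (int n + 1)) then 1 else 0)"
    unfolding bounded_exps_def
  proof (intro exI[of _ j] exI[of _ "0::int"] allI impI)
    fix g :: wt
    assume "(if i < j \<and> (\<exists>n::nat. g = Poly_Mapping.single j (int n)
      - Poly_Mapping.single i (int n + 1)) then 1 else 0 :: complex) \<noteq> 0"
    then obtain n :: nat where ij: "i < j"
      and g: "g = Poly_Mapping.single j (int n) - Poly_Mapping.single i (int n + 1)"
      by (auto split: if_splits)
    have "Poly_Mapping.keys g \<subseteq> {..j}"
      using ij by (auto simp: g in_keys_iff lookup_minus lookup_single when_def split: if_splits)
    moreover have "psum k g \<le> 0" for k
    proof -
      have s: "psum k (Poly_Mapping.single l c) = (if l \<le> k then c else 0)" for l c
        by (simp add: psum_def lookup_single when_def)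
      show ?thesis using ij by (simp add: g s)
    qed
    ultimately show "Poly_Mapping.keys g \<subseteq> {..j} \<and> (\<forall>k. psum k g \<le> 0)" by blast
  qed
qed

definition inv_diff :: "nat \<Rightarrow> nat \<Rightarrow> xseries" where
  "inv_diff i j = (if i < j then inv_diff_less i j else - inv_diff_less j i)"

lemma inv_diff_less_mult:
  assumes "i < j"
  shows "inv_diff_less i j * (xvar i - xvar j) = 1"
proof (rule xseries_eqI)
  fix g
  let ?e = "\<lambda>n::nat. Poly_Mapping.single j (int n) - Poly_Mapping.single i (int n + 1) :: wt"
  let ?f = "\<lambda>n::nat. Poly_Mapping.single j (int n) - Poly_Mapping.single i (int n) :: wt"
  have c: "xcoeff (inv_diff_less i j) h = (if \<exists>n. h = ?e n then 1 else 0)" for h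
    using assms by (simp add: inv_diff_less.rep_eq)
  have dist: "xcoeff (inv_diff_less i j * (xvar i - xvar j)) g
      = xcoeff (xvar i * inv_diff_less i j) g - xcoeff (xvar j * inv_diff_less i j) g"
    by (simp only: right_diff_distrib minus_xseries.rep_eq mult.commute)
  have e1: "g - eps i = ?e n \<longleftrightarrow> g = ?f n" for n
    by (simp add: single_add diff_eq_eq)
  have e2: "g - eps j = ?e n \<longleftrightarrow> g = ?f (Suc n)" for n
    by (simp add: single_add diff_eq_eq algebra_simps)
  have inj: "?f n = ?f n' \<Longrightarrow> n = n'" for n n'
  proof -
    assume "?f n = ?f n'"
    then have "wt_entry (?f n) j = wt_entry (?f n') j" by simp
    then show "n = n'" using assms by (simp add: lookup_minus lookup_single when_def)
  qed
  have f0: "?f 0 = 0" by simp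
  have "(if \<exists>n. g = ?f n then 1 else 0) - (if \<exists>n. g = ?f (Suc n) then 1 else 0)
        = (if g = 0 then 1 else 0 :: complex)"
  proof (cases "\<exists>n. g = ?f n")
    case True
    then obtain n where n: "g = ?f n" by blast
    show ?thesis
    proof (cases n)
      case 0
      then have "g = ?f 0" using n by simp
      then have "g = 0" and "\<not> (\<exists>m. g = ?f (Suc m))" using inj[of 0 "Suc _"] f0 by auto
      then show ?thesis using True by simp
    next
      case (Suc m)
      then have "g \<noteq> 0" using inj[of n 0] n f0 by auto
      moreover have "\<exists>m. g = ?f (Suc m)" using n Suc by blast
      ultimately show ?thesis using True by simp
    qed
  next
    case False
    then have "g \<noteq> 0" using f0 by metis
    moreover have "\<not> (\<exists>m. g = ?f (Suc m))" using False by blast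
    ultimately show ?thesis using False by simp
  qed
  then show "xcoeff (inv_diff_less i j * (xvar i - xvar j)) g = xcoeff 1 g"
    unfolding dist xcoeff_xmonom_mult c e1 e2 by (simp add: one_xseries.rep_eq)
qed

lemma inv_diff_mult: "i \<noteq> j \<Longrightarrow> inv_diff i j * (xvar i - xvar j) = 1"
  using inv_diff_less_mult[of i j] inv_diff_less_mult[of j i]
  by (auto simp: inv_diff_def algebra_simps)


section \<open>Difference operators\<close>

text \<open>The product of the shifts $\Gamma_i$, i in I.\<close>

lift_definition Gamma :: "complex \<Rightarrow> nat set \<Rightarrow> xseries \<Rightarrow> xseries" is
  "\<lambda>q I f g. (\<Prod>i\<in>I. q powi wt_entry g i) * f g"
  by (erule bounded_exps_subset) auto

definition Macdonald_op :: "nat \<Rightarrow> complex \<Rightarrow> complex \<Rightarrow> xseries \<Rightarrow> xseries" where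
  "Macdonald_op N q t F =
     (\<Sum>i\<in>{1..N}. (\<Prod>j\<in>{1..N} - {i}. (xconst t * xvar i - xvar j) * inv_diff i j) * Gamma q {i} F)"

definition D_op :: "nat \<Rightarrow> complex \<Rightarrow> nat \<Rightarrow> int \<Rightarrow> xseries \<Rightarrow> xseries" where
  "D_op N q a k F =
     (\<Sum>I | I \<subseteq> {1..N} \<and> card I = a.
        (\<Prod>i\<in>I. xvar_power i k) * (\<Prod>i\<in>I. \<Prod>j\<in>{1..N} - I. xvar i * inv_diff i j) * Gamma q I F)"


section \<open>Macdonald polynomials and q-Whittaker polynomials\<close>

text \<open>$F = x^\lambda(1 + \sum_{0\neq\beta\in Q_+} c_\beta x^{-\beta})$.\<close>

definition leading_monomial :: "nat \<Rightarrow> wt \<Rightarrow> xseries \<Rightarrow> bool" where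
  "leading_monomial N l F \<longleftrightarrow>
     xcoeff F l = 1 \<and> (\<forall>g. xcoeff F g \<noteq> 0 \<longrightarrow> l - g \<in> Qplus N)"

definition Macdonald_eigen :: "nat \<Rightarrow> complex \<Rightarrow> complex \<Rightarrow> wt \<Rightarrow> xseries \<Rightarrow> bool" where
  "Macdonald_eigen N q t l F \<longleftrightarrow>
     Macdonald_op N q t F = xconst (\<Sum>i\<in>{1..N}. t ^ (N - i) * q powi wt_entry l i) * F"

definition is_sym_poly :: "nat \<Rightarrow> xseries \<Rightarrow> bool" where
  "is_sym_poly N F \<longleftrightarrow>
     finite {g. xcoeff F g \<noteq> 0} \<and>
     (\<forall>g. xcoeff F g \<noteq> 0 \<longrightarrow> g \<in> lattice N \<and> (\<forall>i. wt_entry g i \<ge> 0)) \<and>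
     (\<forall>p g. p permutes {1..N} \<longrightarrow> xcoeff F (Poly_Mapping.map_key p g) = xcoeff F g)"

text \<open>
  On monomials occurring in symmetric polynomials, being lower than $x^\lambda$ in dominance order
  means that the exponent lies in $\lambda - Q_+$.
\<close>

definition is_Macdonald_poly :: "nat \<Rightarrow> complex \<Rightarrow> complex \<Rightarrow> wt \<Rightarrow> xseries \<Rightarrow> bool" where
  "is_Macdonald_poly N q t l P \<longleftrightarrow>
     is_sym_poly N P \<and> leading_monomial N l P \<and> Macdonald_eigen N q t l P"

definition Macdonald_poly :: "nat \<Rightarrow> complex \<Rightarrow> complex \<Rightarrow> wt \<Rightarrow> xseries" where
  "Macdonald_poly N q t l = (THE P. is_Macdonald_poly N q t l P)"

definition is_Macdonald_series :: "nat \<Rightarrow> complex \<Rightarrow> complex \<Rightarrow> wt \<Rightarrow> xseries \<Rightarrow> bool" where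
  "is_Macdonald_series N q t l F \<longleftrightarrow> leading_monomial N l F \<and> Macdonald_eigen N q t l F"

definition Macdonald_series :: "nat \<Rightarrow> complex \<Rightarrow> complex \<Rightarrow> wt \<Rightarrow> xseries" where
  "Macdonald_series N q t l = (THE F. is_Macdonald_series N q t l F)"

definition coeffwise_limit :: "('a \<Rightarrow> xseries) \<Rightarrow> 'a filter \<Rightarrow> xseries" where
  "coeffwise_limit P A = (THE F. \<forall>g. ((\<lambda>t. xcoeff (P t) g) \<longlongrightarrow> xcoeff F g) A)"

definition qWhittaker :: "nat \<Rightarrow> complex \<Rightarrow> wt \<Rightarrow> xseries" where
  "qWhittaker N q l = coeffwise_limit (\<lambda>t. Macdonald_poly N q t l) at_infinity"

text \<open>
  For a fixed weight, the series eigenfunction exists uniquely only for t outside a countable set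
  of resonances, which may be unbounded; so the limit is taken along the remaining t.
\<close>

definition qWhittaker_series :: "nat \<Rightarrow> complex \<Rightarrow> wt \<Rightarrow> xseries" where
  "qWhittaker_series N q l =
     coeffwise_limit (\<lambda>t. Macdonald_series N q t l)
       (inf at_infinity (principal {t. \<exists>!F. is_Macdonald_series N q t l F}))"

definition qWhittaker_ext :: "nat \<Rightarrow> complex \<Rightarrow> wt \<Rightarrow> xseries" where
  "qWhittaker_ext N q l =
     (if is_partition N l then qWhittaker N q l else qWhittaker_series N q l)"


section \<open>The quantum torus and the opposite quantum Q-system\<close>

text \<open>
  An element is a finite combination of the normally ordered monomials $\Lambda^m T^n$, stored at
  the key (m, n); the product follows from $T_i\Lambda_j = q^{\delta_{ij}}\Lambda_j T_i$.
\<close>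

type_synonym qtorus = "(wt \<times> wt) \<Rightarrow>\<^sub>0 complex"

definition wt_pair :: "wt \<Rightarrow> wt \<Rightarrow> int" where
  "wt_pair n m = (\<Sum>i\<in>Poly_Mapping.keys n. wt_entry n i * wt_entry m i)"

definition qt_monom :: "wt \<Rightarrow> wt \<Rightarrow> qtorus" where
  "qt_monom m n = Poly_Mapping.single (m, n) 1"

definition qt_scale :: "complex \<Rightarrow> qtorus \<Rightarrow> qtorus" where
  "qt_scale c u = Poly_Mapping.map (\<lambda>z. c * z) u"

definition qt_mult :: "complex \<Rightarrow> qtorus \<Rightarrow> qtorus \<Rightarrow> qtorus" where
  "qt_mult q u v =
     (\<Sum>(m, n)\<in>Poly_Mapping.keys u. \<Sum>(m', n')\<in>Poly_Mapping.keys v.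
        qt_scale (Poly_Mapping.lookup u (m, n) * Poly_Mapping.lookup v (m', n') * q powi wt_pair n m')
          (qt_monom (m + m') (n + n')))"

lemma qt_mult_monom:
  "qt_mult q (qt_monom m n) (qt_monom m' n')
     = qt_scale (q powi wt_pair n m') (qt_monom (m + m') (n + n'))"
  by (simp add: qt_mult_def qt_monom_def)

lemma qt_T_Lambda:
  "qt_mult q (qt_monom 0 (eps i)) (qt_monom (eps j) 0)
     = qt_scale (if i = j then q else 1) (qt_mult q (qt_monom (eps j) 0) (qt_monom 0 (eps i)))"
proof -
  have "qt_scale 1 u = u" for u :: qtorus
    unfolding qt_scale_def by (rule poly_mapping_eqI) (simp add: map.rep_eq when_def)
  then show ?thesis
    by (simp add: qt_mult_monom wt_pair_def lookup_single when_def)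
qed

definition qt_carrier :: "nat \<Rightarrow> qtorus set" where
  "qt_carrier N = {u. Poly_Mapping.keys u \<subseteq> lattice N \<times> lattice N}"

text \<open>
  The action on functions of the weight: $\Lambda_i$ multiplies by $q^{\lambda_i}$ and $T_i$ shifts
  $\lambda_i$ by 1.
\<close>

definition qt_act :: "complex \<Rightarrow> qtorus \<Rightarrow> (wt \<Rightarrow> xseries) \<Rightarrow> wt \<Rightarrow> xseries" where
  "qt_act q u F l =
     (\<Sum>(m, n)\<in>Poly_Mapping.keys u.
        xconst (Poly_Mapping.lookup u (m, n) * q powi wt_pair m l) * F (l + n))"

definition opposite_Q_system :: "nat \<Rightarrow> complex \<Rightarrow> (nat \<Rightarrow> int \<Rightarrow> qtorus) \<Rightarrow> bool" where
  "opposite_Q_system N q D \<longleftrightarrow>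
     (\<forall>k. D 0 k = qt_monom 0 0) \<and> (\<forall>k. D (N + 1) k = 0) \<and>
     (\<forall>a\<in>{1..N}. \<forall>k. D a k \<in> qt_carrier N) \<and>
     (\<forall>a\<in>{1..N}. \<forall>b\<in>{1..N}. \<forall>k i. \<bar>i\<bar> \<le> 1 \<longrightarrow>
        qt_mult q (D b (k + i)) (D a k)
          = qt_scale (q powi (i * int (min a b))) (qt_mult q (D a k) (D b (k + i)))) \<and>
     (\<forall>a\<in>{1..N}. \<forall>k.
        qt_scale (q ^ a) (qt_mult q (D a (k - 1)) (D a (k + 1)))
          = qt_mult q (D a k) (D a k) - qt_mult q (D (a + 1) k) (D (a - 1) k))"

definition standard_initial_data :: "nat \<Rightarrow> (nat \<Rightarrow> int \<Rightarrow> qtorus) \<Rightarrow> bool" where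
  "standard_initial_data N D \<longleftrightarrow>
     (\<forall>a\<in>{1..N}. D a 0 = qt_monom (\<Sum>i\<in>{1..a}. eps i) 0 \<and>
                  D a 1 = qt_monom (\<Sum>i\<in>{1..a}. eps i) (\<Sum>i\<in>{1..a}. eps i))"

end

theory Submission
  imports Defs "HOL-Computational_Algebra.Polynomial" "HOL-Computational_Algebra.Fraction_Field"
    "HOL-Analysis.Continuum_Not_Denumerable"
begin

text \<open>
  The operators $D_{a;0}$ commute and are triangular on monomials, with eigenvalues
  $q^{\lambda_1 + \dots + \lambda_a}$ which together separate the weights. So for every integer weight
  $\lambda$ there is a unique series $\Psi_\lambda = x^\lambda(1 + \dots)$ in negative roots with
  $D_{a;0}\Psi_\lambda = \Lambda_1\cdots\Lambda_a\Psi_\lambda$ for all a. Dividing the eigenvalue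
  recursion of the Macdonald operator at the weight $\mu$ by $t^{N-a}$, where a is the first index at which the
  partial sums of $\lambda$ and $\mu$ differ, gives as t tends to infinity the recursion for $D_{a;0}$;
  hence $\Pi_\lambda = \Psi_\lambda$.

  The relation $D_{a;0} D_{b;1} = q^{\min(a,b)} D_{b;1} D_{a;0}$ and uniqueness give
  $D_{a;1}\Psi_\lambda = \Lambda_1\cdots\Lambda_a T_1\cdots T_a\Psi_\lambda$. The operators in x satisfy the
  quantum Q-system in the reverse order of multiplication, by identities of rational functions that
  are proved by counting the roots of a polynomial in one of the variables. The claim then propagates
  from k = 0, 1 to all k: the Q-system determines $\bar D_{a;k\pm1}$ up to multiplication by
  $\bar D_{a;k\mp1}$, and a nonzero element of the quantum torus acts injectively on families whose
  coefficients are Laurent polynomials in the $q^{\lambda_i}$.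
\<close>

section \<open>Identities of rational functions\<close>

text \<open>Rescaled, the Macdonald operator tends to the single operator with a = 1 and k = 0,
  whose eigenvalue sees only the first entry of the weight. Hence the whole commuting family is
  needed, and uniqueness of its joint eigenfunctions takes the place of explicit duality or Pieri
  formulas. Operators in x commute with operators in the weight, so a product in the quantum torus
  turns into the composition in the reverse order; this is why the Q-system of the theorem is the
  opposite one. Propagation in k means cancelling a factor of the torus. On arbitrary families this
  is impossible: a shift minus 1 kills every family that is constant in the weight. The class
  \<open>regular\<close> excludes such families, and the joint eigenfunctions belong to it because
  the gaps between their eigenvalues are characters of the weight up to constants. Downwards in k
  the factor to be cancelled stands on the wrong side, so the relation with the two outer factors
  exchanged is derived first, both in the torus and for the operators in x.\<close>

definition cross :: "'a::field \<Rightarrow> (nat \<Rightarrow> 'a) \<Rightarrow> nat set \<Rightarrow> nat set \<Rightarrow> 'a" where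
  "cross q x P R = (\<Prod>i\<in>P. \<Prod>j\<in>R. x i * x j / ((x i - x j) * (x j - q * x i)))"

text \<open>P holds the indices only in the first of two composed operators, L - P those only in the
  second. \<open>cross\<close> collects x_i / (x_i - x_j) from the first coefficient and x_j / (x_j
  - q x_i) from the second one after the first shift. The sum is the part of a composed coefficient
  that depends on how L is divided.\<close>

definition split_sum :: "'a::field \<Rightarrow> (nat \<Rightarrow> 'a) \<Rightarrow> nat set \<Rightarrow> nat \<Rightarrow> nat \<Rightarrow> nat \<Rightarrow> 'a" where
  "split_sum q x L p k l =
     (\<Sum>P | P \<subseteq> L \<and> card P = p. (\<Prod>i\<in>P. x i) ^ k * (\<Prod>j\<in>L - P. x j) ^ l * cross q x P (L - P))"

text \<open>The case i = j is included, so for nonempty L neither q nor q^2 is 1. Excluding x_i =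
  q^2 x_j keeps the roots q x_j and x_i / q of the main argument apart.\<close>

definition generic :: "'a::field \<Rightarrow> (nat \<Rightarrow> 'a) \<Rightarrow> nat set \<Rightarrow> bool" where
  "generic q x L \<longleftrightarrow> q \<noteq> 0 \<and> inj_on x L \<and>
     (\<forall>i\<in>L. x i \<noteq> 0 \<and> (\<forall>j\<in>L. x i \<noteq> q * x j \<and> x i \<noteq> q * (q * x j)))"

lemma cross_empty [simp]: "cross q x {} R = 1" "cross q x P {} = 1"
  by (simp_all add: cross_def)

lemma cross_insert_left:
  assumes "finite P" "u \<notin> P"
  shows "cross q x (insert u P) R = (\<Prod>j\<in>R. x u * x j / ((x u - x j) * (x j - q * x u))) * cross q x P R"
  using assms by (simp add: cross_def)

lemma cross_insert_right:
  assumes "finite R" "u \<notin> R"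
  shows "cross q x P (insert u R) = (\<Prod>i\<in>P. x i * x u / ((x i - x u) * (x u - q * x i))) * cross q x P R"
  unfolding cross_def prod.distrib[symmetric] using assms by simp

lemma generic_subset: "generic q x L \<Longrightarrow> M \<subseteq> L \<Longrightarrow> generic q x M"
  unfolding generic_def by (meson inj_on_subset subsetD)

section \<open>Sums over subsets of fixed size with one element singled out\<close>

lemma sum_subsets_without:
  assumes "finite L" "w \<notin> L" "\<And>P. P \<subseteq> insert w L \<Longrightarrow> w \<in> P \<Longrightarrow> f P = 0"
  shows "(\<Sum>P | P \<subseteq> insert w L \<and> card P = p. f P) = (\<Sum>P | P \<subseteq> L \<and> card P = p. f P)"
proof (rule sum.mono_neutral_right)
  show "finite {P. P \<subseteq> insert w L \<and> card P = p}" using assms(1) by simp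
qed (use assms in auto)

lemma sum_subsets_with:
  fixes f :: "nat set \<Rightarrow> 'b::comm_monoid_add"
  assumes "finite L" "w \<notin> L" "\<And>P. P \<subseteq> L \<Longrightarrow> f P = 0"
  shows "(\<Sum>P | P \<subseteq> insert w L \<and> card P = Suc p. f P) = (\<Sum>P | P \<subseteq> L \<and> card P = p. f (insert w P))"
proof -
  have "(\<Sum>P | P \<subseteq> insert w L \<and> card P = Suc p. f P) = (\<Sum>P | P \<subseteq> insert w L \<and> card P = Suc p \<and> w \<in> P. f P)"
  proof (rule sum.mono_neutral_right)
    show "finite {P. P \<subseteq> insert w L \<and> card P = Suc p}" using assms(1) by simp
  qed (use assms in auto)
  also have "\<dots> = (\<Sum>P | P \<subseteq> L \<and> card P = p. f (insert w P))"
  proof (rule sum.reindex_bij_witness[of _ "insert w" "\<lambda>P. P - {w}"])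
    fix P assume P: "P \<in> {P. P \<subseteq> insert w L \<and> card P = Suc p \<and> w \<in> P}"
    then have fin: "finite P" using assms(1) finite_subset by auto
    show "insert w (P - {w}) = P" using P by auto
    show "P - {w} \<in> {P. P \<subseteq> L \<and> card P = p}" using P fin by auto
    show "f (insert w (P - {w})) = f P" using P by (auto simp: insert_absorb)
  next
    fix P assume P: "P \<in> {P. P \<subseteq> L \<and> card P = p}"
    then have "finite P" "w \<notin> P" using assms finite_subset by auto
    then show "insert w P - {w} = P" "insert w P \<in> {P. P \<subseteq> insert w L \<and> card P = Suc p \<and> w \<in> P}"
      using P by auto
  qed
  finally show ?thesis .
qed

lemma sum_subsets_split:
  fixes f :: "nat set \<Rightarrow> 'b::comm_monoid_add"
  assumes "finite L" "w \<notin> L"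
  shows "(\<Sum>P | P \<subseteq> insert w L \<and> card P = Suc p. f P)
       = (\<Sum>P | P \<subseteq> L \<and> card P = p. f (insert w P)) + (\<Sum>P | P \<subseteq> L \<and> card P = Suc p. f P)"
proof -
  have "(\<Sum>P | P \<subseteq> insert w L \<and> card P = Suc p. f P)
      = (\<Sum>P | P \<subseteq> insert w L \<and> card P = Suc p. (if w \<in> P then f P else 0) + (if w \<in> P then 0 else f P))"
    by (rule sum.cong) auto
  also have "\<dots> = (\<Sum>P | P \<subseteq> L \<and> card P = p. f (insert w P))
      + (\<Sum>P | P \<subseteq> L \<and> card P = Suc p. (if w \<in> P then 0 else f P))"
  proof -
    have "(\<Sum>P | P \<subseteq> insert w L \<and> card P = Suc p. if w \<in> P then f P else 0) = (\<Sum>P | P \<subseteq> L \<and> card P = p. f (insert w P))"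
      by (subst sum_subsets_with[OF assms]) (use assms in auto)
    moreover have "(\<Sum>P | P \<subseteq> insert w L \<and> card P = Suc p. if w \<in> P then 0 else f P)
        = (\<Sum>P | P \<subseteq> L \<and> card P = Suc p. (if w \<in> P then 0 else f P))"
      by (rule sum_subsets_without[OF assms]) auto
    ultimately show ?thesis unfolding sum.distrib by simp
  qed
  also have "(\<Sum>P | P \<subseteq> L \<and> card P = Suc p. (if w \<in> P then 0 else f P)) = (\<Sum>P | P \<subseteq> L \<and> card P = Suc p. f P)"
    by (rule sum.cong) (use assms in auto)
  finally show ?thesis .
qed

text \<open>
  With one variable X singled out and the other variables x indexed by the disjoint union of P and R,
  the summands of a split sum in which X belongs to the first respectively the second part,
  multiplied by the common denominator.
\<close>

definition cleared_left :: "'a::field \<Rightarrow> (nat \<Rightarrow> 'a) \<Rightarrow> nat \<Rightarrow> nat \<Rightarrow> nat set \<Rightarrow> nat set \<Rightarrow> 'a poly" where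
  "cleared_left q x k l P R =
     smult (cross q x P R * (\<Prod>i\<in>P. x i) ^ k * (\<Prod>i\<in>R. x i) ^ (l + 1))
       (monom 1 (k + card R) * (\<Prod>i\<in>P. [:- x i, 1:] * [:x i, - q:]) * (\<Prod>i\<in>P \<union> R. [:- q * x i, 1:]))"

definition cleared_right :: "'a::field \<Rightarrow> (nat \<Rightarrow> 'a) \<Rightarrow> nat \<Rightarrow> nat \<Rightarrow> nat set \<Rightarrow> nat set \<Rightarrow> 'a poly" where
  "cleared_right q x k l P R =
     smult (cross q x P R * (\<Prod>i\<in>P. x i) ^ k * (\<Prod>i\<in>P. - x i) * (\<Prod>i\<in>R. x i) ^ l)
       (monom 1 (l + card P) * (\<Prod>i\<in>R. [:- x i, 1:] * [:- q * x i, 1:]) * (\<Prod>i\<in>P \<union> R. [:x i, - q:]))"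

section \<open>Values and degrees of the cleared summands\<close>

lemma poly_cleared_left:
  "poly (cleared_left q x k l P R) X =
     cross q x P R * (\<Prod>i\<in>P. x i) ^ k * (\<Prod>i\<in>R. x i) ^ (l + 1) *
       (X ^ (k + card R) * (\<Prod>i\<in>P. (X - x i) * (x i - q * X)) * (\<Prod>i\<in>P \<union> R. X - q * x i))"
  by (simp add: cleared_left_def poly_monom poly_prod algebra_simps)

lemma poly_cleared_right:
  "poly (cleared_right q x k l P R) X =
     cross q x P R * (\<Prod>i\<in>P. x i) ^ k * (\<Prod>i\<in>P. - x i) * (\<Prod>i\<in>R. x i) ^ l *
       (X ^ (l + card P) * (\<Prod>i\<in>R. (X - x i) * (X - q * x i)) * (\<Prod>i\<in>P \<union> R. x i - q * X))"
  by (simp add: cleared_right_def poly_monom poly_prod algebra_simps)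

lemma degree_prod_le_card:
  assumes "\<And>i. i \<in> A \<Longrightarrow> degree (f i :: 'a::idom poly) \<le> d"
  shows "degree (prod f A) \<le> d * card A"
proof (cases "finite A")
  case True
  have "degree (prod f A) \<le> (\<Sum>i\<in>A. degree (f i))" using degree_prod_sum_le[OF True] by auto
  also have "\<dots> \<le> (\<Sum>i\<in>A. d)" by (rule sum_mono) (use assms in auto)
  finally show ?thesis by (simp add: mult.commute)
qed auto

lemma degree_pair_le: "degree ([:a, b:] * [:c, d:] :: 'a::idom poly) \<le> 2"
proof -
  have "degree ([:a, b:] * [:c, d:]) \<le> degree [:a, b:] + degree [:c, d:]" by (rule degree_mult_le)
  also have "\<dots> \<le> 1 + 1" by (intro add_mono) (auto simp: degree_pCons_eq_if)
  finally show ?thesis by simp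
qed

lemma degree_cleared_left:
  "degree (cleared_left q x k l P R) \<le> k + card R + 2 * card P + card (P \<union> R)"
proof -
  have "degree (cleared_left q x k l P R)
     \<le> degree (monom (1::'a) (k + card R) * (\<Prod>i\<in>P. [:- x i, 1:] * [:x i, - q:]) * (\<Prod>i\<in>P \<union> R. [:- q * x i, 1:]))"
    unfolding cleared_left_def by (rule degree_smult_le)
  also have "\<dots> \<le> degree (monom (1::'a) (k + card R)) + degree (\<Prod>i\<in>P. [:- x i, 1:] * [:x i, - q:])
      + degree (\<Prod>i\<in>P \<union> R. [:- q * x i, 1:])"
    by (meson add_right_mono degree_mult_le order_trans)
  also have "\<dots> \<le> (k + card R) + 2 * card P + 1 * card (P \<union> R)"
    by (intro add_mono degree_monom_le degree_prod_le_card degree_pair_le) (auto simp: degree_pCons_eq_if)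
  finally show ?thesis by simp
qed

lemma degree_cleared_right:
  "degree (cleared_right q x k l P R) \<le> l + card P + 2 * card R + card (P \<union> R)"
proof -
  have "degree (cleared_right q x k l P R)
     \<le> degree (monom (1::'a) (l + card P) * (\<Prod>i\<in>R. [:- x i, 1:] * [:- q * x i, 1:]) * (\<Prod>i\<in>P \<union> R. [:x i, - q:]))"
    unfolding cleared_right_def by (rule degree_smult_le)
  also have "\<dots> \<le> degree (monom (1::'a) (l + card P)) + degree (\<Prod>i\<in>R. [:- x i, 1:] * [:- q * x i, 1:])
      + degree (\<Prod>i\<in>P \<union> R. [:x i, - q:])"
    by (meson add_right_mono degree_mult_le order_trans)
  also have "\<dots> \<le> (l + card P) + 2 * card R + 1 * card (P \<union> R)"
    by (intro add_mono degree_monom_le degree_prod_le_card degree_pair_le) (auto simp: degree_pCons_eq_if)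
  finally show ?thesis by simp
qed

lemma generic_neq:
  assumes "generic q x L" "i \<in> L" "j \<in> L"
  shows "x i \<noteq> 0" "x i - q * x j \<noteq> 0" "q * x j - x i \<noteq> 0" "x i - q * (q * x j) \<noteq> 0" "i \<noteq> j \<Longrightarrow> x i - x j \<noteq> 0"
  using assms unfolding generic_def inj_on_def by (auto, metis)

text \<open>Putting w into the first part adds the factors of \<open>cross\<close> between w and R.
  The denominator cancels them and leaves one x_w and one x_i for each i in R, whence the exponents
  k + card R and l + 1 in \<open>cleared_left\<close>.\<close>

lemma cleared_left_denominator:
  assumes g: "generic q x (insert w (P \<union> R))" and "finite P" "finite R" "P \<inter> R = {}" "w \<notin> P" "w \<notin> R"
  shows "(\<Prod>i\<in>insert w P. x i) ^ k * (\<Prod>i\<in>R. x i) ^ l * cross q x (insert w P) R *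
      (\<Prod>i\<in>P \<union> R. (x w - x i) * (x i - q * x w) * (x w - q * x i)) = poly (cleared_left q x k l P R) (x w)"
proof -
  have R: "(\<Prod>j\<in>R. x w * x j / ((x w - x j) * (x j - q * x w))) * (\<Prod>i\<in>R. (x w - x i) * (x i - q * x w))
      = x w ^ card R * (\<Prod>i\<in>R. x i)"
  proof -
    have "(\<Prod>j\<in>R. x w * x j / ((x w - x j) * (x j - q * x w))) * (\<Prod>i\<in>R. (x w - x i) * (x i - q * x w))
        = (\<Prod>i\<in>R. x w * x i)"
      unfolding prod.distrib[symmetric]
    proof (rule prod.cong[OF refl])
      fix i assume "i \<in> R"
      then have "x w - x i \<noteq> 0" "x i - q * x w \<noteq> 0"
        using generic_neq[OF g] assms by (metis UnI2 insertI1 insertI2)+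
      then show "x w * x i / ((x w - x i) * (x i - q * x w)) * ((x w - x i) * (x i - q * x w)) = x w * x i"
        by simp
    qed
    then show ?thesis by (simp add: prod.distrib)
  qed
  have S: "(\<Prod>i\<in>P \<union> R. (x w - x i) * (x i - q * x w) * (x w - q * x i))
     = (\<Prod>i\<in>P. (x w - x i) * (x i - q * x w)) * (\<Prod>i\<in>R. (x w - x i) * (x i - q * x w)) * (\<Prod>i\<in>P \<union> R. x w - q * x i)"
    using assms by (simp add: prod.union_disjoint prod.distrib mult_ac)
  have "(\<Prod>i\<in>insert w P. x i) ^ k * (\<Prod>i\<in>R. x i) ^ l * cross q x (insert w P) R *
      (\<Prod>i\<in>P \<union> R. (x w - x i) * (x i - q * x w) * (x w - q * x i))
    = (x w ^ k * (\<Prod>i\<in>P. x i) ^ k) * (\<Prod>i\<in>R. x i) ^ l * cross q x P R *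
      ((\<Prod>j\<in>R. x w * x j / ((x w - x j) * (x j - q * x w))) * (\<Prod>i\<in>R. (x w - x i) * (x i - q * x w))) *
      (\<Prod>i\<in>P. (x w - x i) * (x i - q * x w)) * (\<Prod>i\<in>P \<union> R. x w - q * x i)"
    unfolding S using assms by (simp add: cross_insert_left power_mult_distrib mult_ac)
  also have "\<dots> = poly (cleared_left q x k l P R) (x w)"
    unfolding R poly_cleared_left by (simp add: power_add mult_ac)
  finally show ?thesis .
qed

text \<open>The new factors of \<open>cross\<close> contain x_i - x_w where the denominator has x_w
  - x_i; this is the origin of the product of the - x_i in \<open>cleared_right\<close>.\<close>

lemma cleared_right_denominator:
  assumes g: "generic q x (insert w (P \<union> R))" and "finite P" "finite R" "P \<inter> R = {}" "w \<notin> P" "w \<notin> R"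
  shows "(\<Prod>i\<in>P. x i) ^ k * (\<Prod>i\<in>insert w R. x i) ^ l * cross q x P (insert w R) *
      (\<Prod>i\<in>P \<union> R. (x w - x i) * (x i - q * x w) * (x w - q * x i)) = poly (cleared_right q x k l P R) (x w)"
proof -
  have P: "(\<Prod>i\<in>P. x i * x w / ((x i - x w) * (x w - q * x i))) * (\<Prod>i\<in>P. (x w - x i) * (x w - q * x i))
      = x w ^ card P * (\<Prod>i\<in>P. - x i)"
  proof -
    have "(\<Prod>i\<in>P. x i * x w / ((x i - x w) * (x w - q * x i))) * (\<Prod>i\<in>P. (x w - x i) * (x w - q * x i))
        = (\<Prod>i\<in>P. x w * - x i)"
      unfolding prod.distrib[symmetric]
    proof (rule prod.cong[OF refl])
      fix i assume "i \<in> P"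
      then have "x i - x w \<noteq> 0" "x w - q * x i \<noteq> 0"
        using generic_neq[OF g] assms by (metis UnI1 insertI1 insertI2)+
      moreover have "x w - x i = - (x i - x w)" by simp
      ultimately show "x i * x w / ((x i - x w) * (x w - q * x i)) * ((x w - x i) * (x w - q * x i)) = x w * - x i"
        by (simp add: divide_simps) (simp add: algebra_simps)
    qed
    also have "\<dots> = x w ^ card P * (\<Prod>i\<in>P. - x i)"
      by (simp only: prod.distrib prod_constant)
    finally show ?thesis .
  qed
  have S: "(\<Prod>i\<in>P \<union> R. (x w - x i) * (x i - q * x w) * (x w - q * x i))
     = (\<Prod>i\<in>P. (x w - x i) * (x w - q * x i)) * (\<Prod>i\<in>R. (x w - x i) * (x w - q * x i)) * (\<Prod>i\<in>P \<union> R. x i - q * x w)"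
    using assms by (simp add: prod.union_disjoint prod.distrib mult_ac)
  have "(\<Prod>i\<in>P. x i) ^ k * (\<Prod>i\<in>insert w R. x i) ^ l * cross q x P (insert w R) *
      (\<Prod>i\<in>P \<union> R. (x w - x i) * (x i - q * x w) * (x w - q * x i))
    = (\<Prod>i\<in>P. x i) ^ k * (x w ^ l * (\<Prod>i\<in>R. x i) ^ l) * cross q x P R *
      ((\<Prod>i\<in>P. x i * x w / ((x i - x w) * (x w - q * x i))) * (\<Prod>i\<in>P. (x w - x i) * (x w - q * x i))) *
      (\<Prod>i\<in>R. (x w - x i) * (x w - q * x i)) * (\<Prod>i\<in>P \<union> R. x i - q * x w)"
    unfolding S using assms by (simp add: cross_insert_right power_mult_distrib mult_ac)
  also have "\<dots> = poly (cleared_right q x k l P R) (x w)"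
    unfolding P poly_cleared_right by (simp add: power_add mult_ac)
  finally show ?thesis .
qed

text \<open>The apparent poles on the diagonals cancel between the two kinds of summands.\<close>

lemma cleared_diagonal:
  assumes g: "generic q x (insert j (P \<union> R))" and "finite P" "finite R" "P \<inter> R = {}" "j \<notin> P" "j \<notin> R"
  shows "poly (cleared_left q x k l P (insert j R)) (x j) + poly (cleared_right q x k l (insert j P) R) (x j) = 0"
proof -
  define C where "C = cross q x P R"
  define A where "A = (\<Prod>i\<in>P. x i)"
  define B where "B = (\<Prod>i\<in>R. x i)"
  define U where "U = (\<Prod>i\<in>P. x i - q * x j)"
  define V where "V = (\<Prod>i\<in>R. x j - q * x i)"
  have P: "(\<Prod>i\<in>P. x i * x j / ((x i - x j) * (x j - q * x i))) * (\<Prod>i\<in>P. (x j - x i) * (x i - q * x j)) * (\<Prod>i\<in>P. x j - q * x i)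
      = (- x j) ^ card P * A * U"
  proof -
    have "(\<Prod>i\<in>P. x i * x j / ((x i - x j) * (x j - q * x i))) * (\<Prod>i\<in>P. (x j - x i) * (x i - q * x j)) * (\<Prod>i\<in>P. x j - q * x i)
        = (\<Prod>i\<in>P. - x j * x i * (x i - q * x j))"
      unfolding prod.distrib[symmetric]
    proof (rule prod.cong[OF refl])
      fix i assume "i \<in> P"
      then have "x i - x j \<noteq> 0" "x j - q * x i \<noteq> 0"
        using generic_neq[OF g] assms by (metis UnI1 insertI1 insertI2)+
      moreover have "x j - x i = - (x i - x j)" by simp
      ultimately show "x i * x j / ((x i - x j) * (x j - q * x i)) * ((x j - x i) * (x i - q * x j)) * (x j - q * x i)
          = - x j * x i * (x i - q * x j)"
        by (simp add: divide_simps) (simp add: algebra_simps)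
    qed
    also have "\<dots> = (- x j) ^ card P * A * U"
      by (simp only: prod.distrib prod_constant A_def U_def)
    finally show ?thesis .
  qed
  have R: "(\<Prod>i\<in>R. x j * x i / ((x j - x i) * (x i - q * x j))) * (\<Prod>i\<in>R. (x j - x i) * (x j - q * x i)) * (\<Prod>i\<in>R. x i - q * x j)
      = x j ^ card R * B * V"
  proof -
    have "(\<Prod>i\<in>R. x j * x i / ((x j - x i) * (x i - q * x j))) * (\<Prod>i\<in>R. (x j - x i) * (x j - q * x i)) * (\<Prod>i\<in>R. x i - q * x j)
        = (\<Prod>i\<in>R. x j * x i * (x j - q * x i))"
      unfolding prod.distrib[symmetric]
    proof (rule prod.cong[OF refl])
      fix i assume "i \<in> R"
      then have "x j - x i \<noteq> 0" "x i - q * x j \<noteq> 0"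
        using generic_neq[OF g] assms by (metis UnI2 insertI1 insertI2)+
      then show "x j * x i / ((x j - x i) * (x i - q * x j)) * ((x j - x i) * (x j - q * x i)) * (x i - q * x j)
          = x j * x i * (x j - q * x i)"
        by (simp add: divide_simps)
    qed
    then show ?thesis by (simp add: prod.distrib B_def V_def)
  qed
  have "poly (cleared_left q x k l P (insert j R)) (x j)
     = C * A ^ k * (x j * B) ^ (l + 1) * x j ^ (k + Suc (card R)) * (x j - q * x j) * V *
       ((\<Prod>i\<in>P. x i * x j / ((x i - x j) * (x j - q * x i))) * (\<Prod>i\<in>P. (x j - x i) * (x i - q * x j)) * (\<Prod>i\<in>P. x j - q * x i))"
    unfolding poly_cleared_left using assms
    by (simp add: cross_insert_right prod.union_disjoint C_def A_def B_def V_def mult_ac)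
  also have "\<dots> = C * A ^ k * (x j * B) ^ (l + 1) * x j ^ (k + Suc (card R)) * (x j - q * x j) * V * ((- x j) ^ card P * A * U)"
    unfolding P ..
  finally have 1: "poly (cleared_left q x k l P (insert j R)) (x j) = \<dots>" .
  have neg: "(\<Prod>i\<in>P. - x i) = (-1) ^ card P * A"
    unfolding A_def using prod.distrib[of "\<lambda>_. -1" x P] by simp
  have "poly (cleared_right q x k l (insert j P) R) (x j)
     = C * (x j * A) ^ k * (- x j * ((-1) ^ card P * A)) * B ^ l * x j ^ (l + Suc (card P)) * (x j - q * x j) * U *
       ((\<Prod>i\<in>R. x j * x i / ((x j - x i) * (x i - q * x j))) * (\<Prod>i\<in>R. (x j - x i) * (x j - q * x i)) * (\<Prod>i\<in>R. x i - q * x j))"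
    unfolding poly_cleared_right using assms
    by (simp add: cross_insert_left prod.union_disjoint C_def B_def U_def neg A_def[symmetric] mult_ac)
  also have "\<dots> = C * (x j * A) ^ k * (- x j * ((-1) ^ card P * A)) * B ^ l * x j ^ (l + Suc (card P)) * (x j - q * x j) * U * (x j ^ card R * B * V)"
    unfolding R ..
  finally have 2: "poly (cleared_right q x k l (insert j P) R) (x j) = \<dots>" .
  \<comment> \<open>Both values are now the same product up to sign; the surplus minus sign is the
    one that x_j itself contributes to the product of the - x_i.\<close>
  show ?thesis unfolding 1 2 power_mult_distrib power_add power_minus[of "x j"]
    by (simp add: algebra_simps)
qed

text \<open>At X = q x_j a summand with j in the first part reduces to the summand in which X and
  x_j are both dropped, times a factor that sees P and R only through their union. This is why the
  later inductions remove two variables at a time.\<close>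

lemma cleared_right_residue:
  assumes g: "generic q x (insert j (P \<union> R))" and "finite P" "finite R" "P \<inter> R = {}" "j \<notin> P" "j \<notin> R"
  shows "poly (cleared_right q x k l (insert j P) R) (q * x j)
    = (- 1) ^ Suc (card (P \<union> R)) * q ^ Suc (card (P \<union> R)) * x j ^ (k + l + 2 + card (P \<union> R)) * (\<Prod>i\<in>P \<union> R. x i)
      * (\<Prod>i\<in>insert j (P \<union> R). x i - q * (q * x j))
      * (q ^ l * ((\<Prod>i\<in>P. x i) ^ k * (\<Prod>i\<in>R. x i) ^ l * cross q x P R))"
proof -
  have R: "(\<Prod>i\<in>R. x j * x i / ((x j - x i) * (x i - q * x j))) * (\<Prod>i\<in>R. (q * x j - x i) * (q * x j - q * x i))
      = (-1) ^ card R * q ^ card R * x j ^ card R * (\<Prod>i\<in>R. x i)"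
  proof -
    have "(\<Prod>i\<in>R. x j * x i / ((x j - x i) * (x i - q * x j))) * (\<Prod>i\<in>R. (q * x j - x i) * (q * x j - q * x i))
        = (\<Prod>i\<in>R. (- 1) * q * x j * x i)"
      unfolding prod.distrib[symmetric]
    proof (rule prod.cong[OF refl])
      fix i assume "i \<in> R"
      then have "x j - x i \<noteq> 0" "x i - q * x j \<noteq> 0"
        using generic_neq[OF g] assms by (metis UnI2 insertI1 insertI2)+
      moreover have "(q * x j - x i) * (q * x j - q * x i) = - q * ((x j - x i) * (x i - q * x j))"
        by (simp add: algebra_simps)
      ultimately show "x j * x i / ((x j - x i) * (x i - q * x j)) * ((q * x j - x i) * (q * x j - q * x i)) = (- 1) * q * x j * x i"
        by simp
    qed
    also have "\<dots> = (\<Prod>i\<in>R. ((- 1) * q * x j)) * (\<Prod>i\<in>R. x i)"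
      by (simp only: prod.distrib)
    also have "\<dots> = (-1) ^ card R * q ^ card R * x j ^ card R * (\<Prod>i\<in>R. x i)"
      by (simp only: prod_constant power_mult_distrib)
    finally show ?thesis .
  qed
  have neg: "(\<Prod>i\<in>P. - x i) = (-1) ^ card P * (\<Prod>i\<in>P. x i)"
    using prod.distrib[of "\<lambda>_. -1" x P] by simp
  have card: "card (P \<union> R) = card P + card R" using assms by (simp add: card_Un_disjoint)
  have PR: "(\<Prod>i\<in>P \<union> R. x i) = (\<Prod>i\<in>P. x i) * (\<Prod>i\<in>R. x i)" using assms by (simp add: prod.union_disjoint)
  have "poly (cleared_right q x k l (insert j P) R) (q * x j)
     = cross q x P R * (x j * (\<Prod>i\<in>P. x i)) ^ k * (- x j * ((-1) ^ card P * (\<Prod>i\<in>P. x i))) * (\<Prod>i\<in>R. x i) ^ l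
       * (q * x j) ^ (l + Suc (card P)) * (\<Prod>i\<in>insert j (P \<union> R). x i - q * (q * x j)) *
       ((\<Prod>i\<in>R. x j * x i / ((x j - x i) * (x i - q * x j))) * (\<Prod>i\<in>R. (q * x j - x i) * (q * x j - q * x i)))"
    unfolding poly_cleared_right using assms
    by (simp add: cross_insert_left neg mult_ac)
  then show ?thesis
    unfolding R PR card power_mult_distrib power_add by (simp add: mult_ac power_add power2_eq_square)
qed

text \<open>The power of q in front clears the denominators of x_j / q. It is chosen so that q^l is
  left over, as in \<open>cleared_right_residue\<close>; then one residue condition serves both
  roots.\<close>

lemma cleared_left_residue:
  assumes g: "generic q x (insert j (P \<union> R))" and "finite P" "finite R" "P \<inter> R = {}" "j \<notin> P" "j \<notin> R"
  shows "q ^ (Suc (card (P \<union> R)) + k + l) * poly (cleared_left q x k l P (insert j R)) (x j / q)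
    = x j ^ (k + l + 2 + card (P \<union> R)) * (\<Prod>i\<in>P \<union> R. x i)
      * (\<Prod>i\<in>insert j (P \<union> R). x j / q - q * x i)
      * (q ^ l * ((\<Prod>i\<in>P. x i) ^ k * (\<Prod>i\<in>R. x i) ^ l * cross q x P R))"
proof -
  have q: "q \<noteq> 0" using g by (simp add: generic_def)
  have P: "q ^ card P * ((\<Prod>i\<in>P. x i * x j / ((x i - x j) * (x j - q * x i))) * (\<Prod>i\<in>P. (x j / q - x i) * (x i - q * (x j / q))))
      = x j ^ card P * (\<Prod>i\<in>P. x i)"
  proof -
    have "q ^ card P * ((\<Prod>i\<in>P. x i * x j / ((x i - x j) * (x j - q * x i))) * (\<Prod>i\<in>P. (x j / q - x i) * (x i - q * (x j / q))))
        = (\<Prod>i\<in>P. x j * x i)"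
      unfolding prod_constant[symmetric] prod.distrib[symmetric]
    proof (rule prod.cong[OF refl])
      fix i assume "i \<in> P"
      then have n: "x i - x j \<noteq> 0" "x j - q * x i \<noteq> 0"
        using generic_neq[OF g] assms by (metis UnI1 insertI1 insertI2)+
      have "q * ((x j / q - x i) * (x i - q * (x j / q))) = (x i - x j) * (x j - q * x i)"
        using q by (simp add: field_simps)
      then have "q * (x i * x j / ((x i - x j) * (x j - q * x i)) * ((x j / q - x i) * (x i - q * (x j / q))))
        = x i * x j / ((x i - x j) * (x j - q * x i)) * ((x i - x j) * (x j - q * x i))"
        by (simp only: mult.left_commute[of q])
      then show "q * (x i * x j / ((x i - x j) * (x j - q * x i)) * ((x j / q - x i) * (x i - q * (x j / q)))) = x j * x i"
        using n by simp
    qed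
    then show ?thesis by (simp add: prod.distrib)
  qed
  have card: "card (P \<union> R) = card P + card R" using assms by (simp add: card_Un_disjoint)
  have PR: "(\<Prod>i\<in>P \<union> R. x i) = (\<Prod>i\<in>P. x i) * (\<Prod>i\<in>R. x i)" using assms by (simp add: prod.union_disjoint)
  have pw: "q ^ (k + Suc (card R)) * (x j / q) ^ (k + Suc (card R)) = x j ^ (k + Suc (card R))"
    using q by (simp only: power_mult_distrib[symmetric]) simp
  have "q ^ (Suc (card (P \<union> R)) + k + l) = q ^ card P * q ^ (k + Suc (card R)) * q ^ l"
    unfolding card power_add[symmetric] by (rule arg_cong[where f="power q"]) simp
  then have "q ^ (Suc (card (P \<union> R)) + k + l) * poly (cleared_left q x k l P (insert j R)) (x j / q)
     = cross q x P R * (\<Prod>i\<in>P. x i) ^ k * (x j * (\<Prod>i\<in>R. x i)) ^ (l + 1) * q ^ l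
       * (q ^ (k + Suc (card R)) * (x j / q) ^ (k + Suc (card R))) * (\<Prod>i\<in>insert j (P \<union> R). x j / q - q * x i) *
       (q ^ card P * ((\<Prod>i\<in>P. x i * x j / ((x i - x j) * (x j - q * x i))) * (\<Prod>i\<in>P. (x j / q - x i) * (x i - q * (x j / q)))))"
    unfolding poly_cleared_left using assms
    by (simp only: cross_insert_right card_insert_disjoint prod.insert Un_insert_right mult_ac not_False_eq_True)
  then show ?thesis
    unfolding P pw PR card by (simp add: power_mult_distrib power_add mult_ac power2_eq_square)
qed

text \<open>
  In one variable the cleared combination has degree at most $3(n + 1)$. It vanishes at 0, at the other
  variables $x_j$, and, by the residue condition, at $q x_j$ and $x_j / q$.
\<close>

lemma split_sum_combination_eq_0:
  fixes x :: "nat \<Rightarrow> 'a::field" and T :: "'t set"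
  assumes gen: "generic q x L" and fin: "finite L" and card: "card L = n + 2" and finT: "finite T"
    and T: "\<And>t. t \<in> T \<Longrightarrow> p t + r t = n \<and> k t \<le> Suc (r t) \<and> l t \<le> Suc (p t) \<and> k t + l t = s"
    and residue: "\<And>u v. u \<in> L \<Longrightarrow> v \<in> L \<Longrightarrow> u \<noteq> v \<Longrightarrow>
      (\<Sum>t\<in>T. c t * (q ^ l t * split_sum q x (L - {u, v}) (p t) (k t) (l t))) = 0"
  shows "(\<Sum>t\<in>T. c t * split_sum q x L (Suc (p t)) (k t) (l t)) = 0"
proof -
  \<comment> \<open>The variable x_w becomes the unknown of a polynomial.\<close>
  obtain w where w: "w \<in> L" using card by fastforce
  define L0 where "L0 = L - {w}"
  have L: "L = insert w L0" and w0: "w \<notin> L0" and fin0: "finite L0" and card0: "card L0 = n + 1"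
    using w fin card by (auto simp: L0_def)
  have q: "q \<noteq> 0" using gen by (simp add: generic_def)
  have gen0: "generic q x L0" using gen by (rule generic_subset) (auto simp: L0_def)
  define G1 where "G1 = (\<lambda>t. \<Sum>P | P \<subseteq> L0 \<and> card P = p t. cleared_left q x (k t) (l t) P (L0 - P))"
  define G2 where "G2 = (\<lambda>t. \<Sum>P | P \<subseteq> L0 \<and> card P = Suc (p t). cleared_right q x (k t) (l t) P (L0 - P))"
  define G where "G = (\<Sum>t\<in>T. smult (c t) (G1 t + G2 t))"
  have sub: "P \<union> (L0 - P) = L0 \<and> finite P \<and> finite (L0 - P) \<and> card (L0 - P) = n + 1 - card P \<and> card P \<le> n + 1"
    if "P \<subseteq> L0" for P
    using that fin0 card0 finite_subset[OF that] card_mono[OF fin0 that] by (auto simp: card_Diff_subset)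
  \<comment> \<open>The hypotheses k <= r + 1 and l <= p + 1 are what bounds the left and the right
    summands by the same degree 3 (n + 1).\<close>
  have deg: "degree G \<le> 3 * (n + 1)"
    unfolding G_def
  proof (rule degree_sum_le[OF finT])
    fix t assume t: "t \<in> T"
    have "degree (G1 t) \<le> 3 * (n + 1)" unfolding G1_def
    proof (rule degree_sum_le)
      show "finite {P. P \<subseteq> L0 \<and> card P = p t}" using fin0 by simp
      fix P assume "P \<in> {P. P \<subseteq> L0 \<and> card P = p t}"
      then show "degree (cleared_left q x (k t) (l t) P (L0 - P)) \<le> 3 * (n + 1)"
        using degree_cleared_left[of q x "k t" "l t" P "L0 - P"] sub[of P] T[OF t] card0 by auto
    qed
    moreover have "degree (G2 t) \<le> 3 * (n + 1)" unfolding G2_def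
    proof (rule degree_sum_le)
      show "finite {P. P \<subseteq> L0 \<and> card P = Suc (p t)}" using fin0 by simp
      fix P assume "P \<in> {P. P \<subseteq> L0 \<and> card P = Suc (p t)}"
      then show "degree (cleared_right q x (k t) (l t) P (L0 - P)) \<le> 3 * (n + 1)"
        using degree_cleared_right[of q x "k t" "l t" P "L0 - P"] sub[of P] T[OF t] card0 by auto
    qed
    ultimately have "degree (G1 t + G2 t) \<le> 3 * (n + 1)" by (rule degree_add_le)
    then show "degree (smult (c t) (G1 t + G2 t)) \<le> 3 * (n + 1)"
      using degree_smult_le order_trans by blast
  qed
  have pG: "poly G X = (\<Sum>t\<in>T. c t * (poly (G1 t) X + poly (G2 t) X))" for X
    by (simp add: G_def poly_sum)
  have pG1: "poly (G1 t) X = (\<Sum>P | P \<subseteq> L0 \<and> card P = p t. poly (cleared_left q x (k t) (l t) P (L0 - P)) X)" for t X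
    by (simp add: G1_def poly_sum)
  have pG2: "poly (G2 t) X = (\<Sum>P | P \<subseteq> L0 \<and> card P = Suc (p t). poly (cleared_right q x (k t) (l t) P (L0 - P)) X)" for t X
    by (simp add: G2_def poly_sum)
  have root0: "poly G 0 = 0"
  proof -
    have "poly (G1 t) 0 = 0" if "t \<in> T" for t unfolding pG1
    proof (rule sum.neutral, safe)
      fix P assume "P \<subseteq> L0" "card P = p t"
      \<comment> \<open>The second part has r t + 1 elements, so the power of X is positive even if
        k t = 0.\<close>
      then have "card (L0 - P) > 0" using sub[of P] T[OF that] by auto
      then show "poly (cleared_left q x (k t) (l t) P (L0 - P)) 0 = 0" by (simp add: poly_cleared_left)
    qed
    moreover have "poly (G2 t) 0 = 0" for t
      unfolding pG2 by (rule sum.neutral) (auto simp: poly_cleared_right)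
    ultimately show ?thesis unfolding pG by simp
  qed
  have roots: "poly G (x j) = 0 \<and> poly G (q * x j) = 0 \<and> poly G (x j / q) = 0" if j: "j \<in> L0" for j
  proof -
    define L1 where "L1 = L0 - {j}"
    have L0: "L0 = insert j L1" and j1: "j \<notin> L1" and fin1: "finite L1" and card1: "card L1 = n"
      using j fin0 card0 by (auto simp: L1_def)
    have L1: "L1 = L - {w, j}" using L0_def L1_def by auto
    have jw: "j \<noteq> w" "j \<in> L" using j L0_def by auto
    have diff: "L0 - P = insert j (L1 - P)" "L0 - insert j P = L1 - P" "P \<union> (L1 - P) = L1"
      "finite P" "finite (L1 - P)" "P \<inter> (L1 - P) = {}" "j \<notin> P" "j \<notin> L1 - P" if "P \<subseteq> L1" for P
      using that L0 j1 fin1 finite_subset[OF that] by auto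
    have gP: "generic q x (insert j (P \<union> (L1 - P)))" if "P \<subseteq> L1" for P
      using gen0 L0 diff(3)[OF that] by simp
    \<comment> \<open>Left summands vanish if j lies in the first part, right summands if it lies in
      the second. Moving j from one part to the other pairs the remaining ones, and each pair
      cancels.\<close>
    have "poly G (x j) = 0" unfolding pG
    proof (rule sum.neutral, rule ballI)
      fix t
      have "poly (G1 t) (x j) = (\<Sum>P | P \<subseteq> L1 \<and> card P = p t. poly (cleared_left q x (k t) (l t) P (L0 - P)) (x j))"
        unfolding pG1 L0
      proof (rule sum_subsets_without[OF fin1 j1])
        fix P assume "P \<subseteq> insert j L1" "j \<in> P"
        then have "finite P" using fin1 finite_subset by auto
        then show "poly (cleared_left q x (k t) (l t) P (insert j L1 - P)) (x j) = 0"
          unfolding poly_cleared_left using \<open>j \<in> P\<close> by (auto intro!: prod_zero)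
      qed
      moreover have "poly (G2 t) (x j) = (\<Sum>P | P \<subseteq> L1 \<and> card P = p t. poly (cleared_right q x (k t) (l t) (insert j P) (L0 - insert j P)) (x j))"
        unfolding pG2 L0
      proof (rule sum_subsets_with[OF fin1 j1])
        fix P assume "P \<subseteq> L1"
        then have "finite (insert j L1 - P)" "j \<in> insert j L1 - P" using fin1 j1 by auto
        then show "poly (cleared_right q x (k t) (l t) P (insert j L1 - P)) (x j) = 0"
          unfolding poly_cleared_right by (auto intro!: prod_zero)
      qed
      moreover have "poly (cleared_left q x (k t) (l t) P (L0 - P)) (x j)
          + poly (cleared_right q x (k t) (l t) (insert j P) (L0 - insert j P)) (x j) = 0" if "P \<subseteq> L1" for P
        unfolding diff(1,2)[OF that] by (rule cleared_diagonal[OF gP[OF that] diff(4-8)[OF that]])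
      ultimately have "poly (G1 t) (x j) + poly (G2 t) (x j) = 0"
        by (simp add: sum.distrib[symmetric])
      then show "c t * (poly (G1 t) (x j) + poly (G2 t) (x j)) = 0" by simp
    qed
    moreover have "poly G (q * x j) = 0"
    proof -
      define K where "K = (- 1) ^ Suc n * q ^ Suc n * x j ^ (s + 2 + n) * (\<Prod>i\<in>L1. x i)
        * (\<Prod>i\<in>L0. x i - q * (q * x j))"
      have "poly (G1 t) (q * x j) + poly (G2 t) (q * x j)
          = K * (q ^ l t * split_sum q x L1 (p t) (k t) (l t))" if t: "t \<in> T" for t
      proof -
        \<comment> \<open>Every left summand contains the factor X - q x_i for all i in
          \<open>L0\<close>.\<close>
        have "poly (G1 t) (q * x j) = 0" unfolding pG1
        proof (rule sum.neutral, safe)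
          fix P assume "P \<subseteq> L0"
          then have "(\<Prod>i\<in>P \<union> (L0 - P). q * x j - q * x i) = 0"
            using sub[of P] j fin0 by (auto intro!: prod_zero)
          then show "poly (cleared_left q x (k t) (l t) P (L0 - P)) (q * x j) = 0"
            unfolding poly_cleared_left by simp
        qed
        moreover have "poly (G2 t) (q * x j) = (\<Sum>P | P \<subseteq> L1 \<and> card P = p t. poly (cleared_right q x (k t) (l t) (insert j P) (L0 - insert j P)) (q * x j))"
          unfolding pG2 L0
        proof (rule sum_subsets_with[OF fin1 j1])
          fix P assume "P \<subseteq> L1"
          then have "finite (insert j L1 - P)" "j \<in> insert j L1 - P" using fin1 j1 by auto
          then have "(\<Prod>i\<in>insert j L1 - P. (q * x j - x i) * (q * x j - q * x i)) = 0" by (auto intro!: prod_zero)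
          then show "poly (cleared_right q x (k t) (l t) P (insert j L1 - P)) (q * x j) = 0"
            unfolding poly_cleared_right by simp
        qed
        moreover have "poly (cleared_right q x (k t) (l t) (insert j P) (L0 - insert j P)) (q * x j)
          = K * (q ^ l t * ((\<Prod>i\<in>P. x i) ^ k t * (\<Prod>i\<in>L1 - P. x i) ^ l t * cross q x P (L1 - P)))" if "P \<subseteq> L1" for P
          unfolding diff(2)[OF that] unfolding cleared_right_residue[OF gP[OF that] diff(4-8)[OF that]] diff(3)[OF that] card1
            K_def L0 using T[OF t] by auto
        ultimately show ?thesis
          by (simp add: split_sum_def sum_distrib_left)
      qed
      then have "poly G (q * x j) = (\<Sum>t\<in>T. K * (c t * (q ^ l t * split_sum q x L1 (p t) (k t) (l t))))"
        unfolding pG by (intro sum.cong refl) (simp add: mult_ac)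
      then show ?thesis
        unfolding sum_distrib_left[symmetric] L1 using residue[OF w jw(2)] jw(1) by simp
    qed
    moreover have "poly G (x j / q) = 0"
    proof -
      define K where "K = x j ^ (s + 2 + n) * (\<Prod>i\<in>L1. x i) * (\<Prod>i\<in>L0. x j / q - q * x i)"
      have "q ^ (Suc n + s) * (poly (G1 t) (x j / q) + poly (G2 t) (x j / q))
          = K * (q ^ l t * split_sum q x L1 (p t) (k t) (l t))" if t: "t \<in> T" for t
      proof -
        \<comment> \<open>Every right summand contains x_i - q X for all i in \<open>L0\<close>;
          among the left ones only those with j in the second part survive.\<close>
        have "poly (G2 t) (x j / q) = 0" unfolding pG2
        proof (rule sum.neutral, safe)
          fix P assume "P \<subseteq> L0"
          then have "(\<Prod>i\<in>P \<union> (L0 - P). x i - q * (x j / q)) = 0"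
            using sub[of P] j fin0 q by (auto intro!: prod_zero)
          then show "poly (cleared_right q x (k t) (l t) P (L0 - P)) (x j / q) = 0"
            unfolding poly_cleared_right by simp
        qed
        moreover have "poly (G1 t) (x j / q) = (\<Sum>P | P \<subseteq> L1 \<and> card P = p t. poly (cleared_left q x (k t) (l t) P (L0 - P)) (x j / q))"
          unfolding pG1 L0
        proof (rule sum_subsets_without[OF fin1 j1])
          fix P assume "P \<subseteq> insert j L1" "j \<in> P"
          moreover then have "finite P" using fin1 finite_subset by auto
          ultimately have "(\<Prod>i\<in>P. (x j / q - x i) * (x i - q * (x j / q))) = 0" using q by (auto intro!: prod_zero)
          then show "poly (cleared_left q x (k t) (l t) P (insert j L1 - P)) (x j / q) = 0"
            unfolding poly_cleared_left by simp
        qed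
        moreover have "q ^ (Suc n + s) * poly (cleared_left q x (k t) (l t) P (L0 - P)) (x j / q)
          = K * (q ^ l t * ((\<Prod>i\<in>P. x i) ^ k t * (\<Prod>i\<in>L1 - P. x i) ^ l t * cross q x P (L1 - P)))" if "P \<subseteq> L1" for P
        proof -
          have "k t + l t = s" using T[OF t] by simp
          then have "Suc n + s = Suc n + k t + l t" by simp
          then show ?thesis
            using cleared_left_residue[OF gP[OF that] diff(4-8)[OF that], of "k t" "l t"]
            unfolding diff(1)[OF that] unfolding diff(3)[OF that] card1 K_def L0 \<open>k t + l t = s\<close>
            by (simp add: add.assoc)
        qed
        ultimately show ?thesis
          by (simp add: split_sum_def sum_distrib_left)
      qed
      then have "q ^ (Suc n + s) * poly G (x j / q) = (\<Sum>t\<in>T. K * (c t * (q ^ l t * split_sum q x L1 (p t) (k t) (l t))))"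
        unfolding pG sum_distrib_left by (intro sum.cong refl) (simp add: mult_ac)
      then have "q ^ (Suc n + s) * poly G (x j / q) = 0"
        unfolding sum_distrib_left[symmetric] L1 using residue[OF w jw(2)] jw(1) by simp
      then show ?thesis using q by simp
    qed
    ultimately show ?thesis by blast
  qed
  have "G = 0"
  proof (rule ccontr)
    assume "G \<noteq> 0"
    have inj: "inj_on x L0" using gen0 by (simp add: generic_def)
    let ?A = "x ` L0" and ?B = "(\<lambda>i. q * x i) ` L0" and ?C = "(\<lambda>i. x i / q) ` L0"
    have cards: "card ?A = n + 1" "card ?B = n + 1" "card ?C = n + 1"
      using inj q card0 by (auto simp: card_image inj_on_def)
    have neq: "x i \<noteq> 0" "x i \<noteq> q * x j" "x i \<noteq> x j / q" "q * x i \<noteq> x j / q" if "i \<in> L0" "j \<in> L0" for i j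
    proof -
      show "x i \<noteq> 0" "x i \<noteq> q * x j" using gen0 that by (auto simp: generic_def)
      have "x j \<noteq> q * x i" "x j \<noteq> q * (q * x i)" using gen0 that by (auto simp: generic_def)
      then show "x i \<noteq> x j / q" "q * x i \<noteq> x j / q" using q by (auto simp: field_simps)
    qed
    have disj: "?A \<inter> ?B = {}" "(?A \<union> ?B) \<inter> ?C = {}" "0 \<notin> ?A \<union> ?B \<union> ?C"
      using neq q by fastforce+
    \<comment> \<open>One root more than the degree allows.\<close>
    have "card (insert 0 (?A \<union> ?B \<union> ?C)) = 3 * (n + 1) + 1"
      using disj cards fin0 by (simp add: card_Un_disjoint)
    moreover have "insert 0 (?A \<union> ?B \<union> ?C) \<subseteq> {X. poly G X = 0}" using roots root0 by auto
    then have "card (insert 0 (?A \<union> ?B \<union> ?C)) \<le> card {X. poly G X = 0}"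
      by (rule card_mono[OF poly_roots_finite[OF \<open>G \<noteq> 0\<close>]])
    ultimately show False using card_poly_roots_bound[OF \<open>G \<noteq> 0\<close>] deg by simp
  qed
  define den where "den = (\<Prod>i\<in>L0. (x w - x i) * (x i - q * x w) * (x w - q * x i))"
  have den: "den \<noteq> 0"
  proof -
    have "(x w - x i) * (x i - q * x w) * (x w - q * x i) \<noteq> 0" if "i \<in> L0" for i
    proof -
      have "i \<in> L" "i \<noteq> w" using that L w0 by auto
      then show ?thesis
        using generic_neq(5)[OF gen w \<open>i \<in> L\<close>] generic_neq(2)[OF gen w \<open>i \<in> L\<close>] generic_neq(2)[OF gen \<open>i \<in> L\<close> w] by simp
    qed
    then show ?thesis using fin0 by (simp add: den_def)
  qed
  have "split_sum q x L (Suc (p t)) (k t) (l t) * den = poly (G1 t) (x w) + poly (G2 t) (x w)" for t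
  proof -
    have gP: "generic q x (insert w (P \<union> (L0 - P)))" if "P \<subseteq> L0" for P
      using gen L sub[OF that] by simp
    have "split_sum q x L (Suc (p t)) (k t) (l t) * den =
      (\<Sum>P | P \<subseteq> insert w L0 \<and> card P = Suc (p t). (\<Prod>i\<in>P. x i) ^ k t * (\<Prod>j\<in>L - P. x j) ^ l t * cross q x P (L - P) * den)"
      unfolding split_sum_def L by (simp add: sum_distrib_right)
    also have "\<dots> = (\<Sum>P | P \<subseteq> L0 \<and> card P = p t. (\<Prod>i\<in>insert w P. x i) ^ k t * (\<Prod>j\<in>L0 - P. x j) ^ l t * cross q x (insert w P) (L0 - P) * den)
       + (\<Sum>P | P \<subseteq> L0 \<and> card P = Suc (p t). (\<Prod>i\<in>P. x i) ^ k t * (\<Prod>j\<in>insert w (L0 - P). x j) ^ l t * cross q x P (insert w (L0 - P)) * den)"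
      unfolding sum_subsets_split[OF fin0 w0]
    proof (intro arg_cong2[of _ _ _ _ "(+)"] sum.cong refl; clarify)
      fix P assume "P \<subseteq> L0"
      then have "L - insert w P = L0 - P" "L - P = insert w (L0 - P)" using L w0 by auto
      then show "(\<Prod>i\<in>insert w P. x i) ^ k t * (\<Prod>j\<in>L - insert w P. x j) ^ l t * cross q x (insert w P) (L - insert w P) * den
        = (\<Prod>i\<in>insert w P. x i) ^ k t * (\<Prod>j\<in>L0 - P. x j) ^ l t * cross q x (insert w P) (L0 - P) * den"
        and "(\<Prod>i\<in>P. x i) ^ k t * (\<Prod>j\<in>L - P. x j) ^ l t * cross q x P (L - P) * den
        = (\<Prod>i\<in>P. x i) ^ k t * (\<Prod>j\<in>insert w (L0 - P). x j) ^ l t * cross q x P (insert w (L0 - P)) * den"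
        by simp_all
    qed
    also have "\<dots> = poly (G1 t) (x w) + poly (G2 t) (x w)"
      unfolding pG1 pG2
    proof (intro arg_cong2[of _ _ _ _ "(+)"] sum.cong refl; clarify)
      fix P assume P: "P \<subseteq> L0"
      then have f: "finite P" "finite (L0 - P)" "P \<inter> (L0 - P) = {}" "w \<notin> P" "w \<notin> L0 - P" and u: "P \<union> (L0 - P) = L0"
        using sub[OF P] w0 by auto
      show "(\<Prod>i\<in>insert w P. x i) ^ k t * (\<Prod>j\<in>L0 - P. x j) ^ l t * cross q x (insert w P) (L0 - P) * den
        = poly (cleared_left q x (k t) (l t) P (L0 - P)) (x w)"
        using cleared_left_denominator[OF gP[OF P] f, of "k t" "l t"] unfolding u den_def .
      show "(\<Prod>i\<in>P. x i) ^ k t * (\<Prod>j\<in>insert w (L0 - P). x j) ^ l t * cross q x P (insert w (L0 - P)) * den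
        = poly (cleared_right q x (k t) (l t) P (L0 - P)) (x w)"
        using cleared_right_denominator[OF gP[OF P] f, of "k t" "l t"] unfolding u den_def .
    qed
    finally show ?thesis .
  qed
  then have "(\<Sum>t\<in>T. c t * split_sum q x L (Suc (p t)) (k t) (l t)) * den = poly G (x w)"
    unfolding pG sum_distrib_right by (intro sum.cong refl) (simp add: mult.assoc)
  then show ?thesis using den \<open>G = 0\<close> by simp
qed

section \<open>The four identities between split sums\<close>

lemma split_sum_0: "finite L \<Longrightarrow> split_sum q x L 0 k l = (\<Prod>i\<in>L. x i) ^ l"
proof -
  assume "finite L"
  then have "{P. P \<subseteq> L \<and> card P = 0} = {{}}" using finite_subset by fastforce
  then show ?thesis by (simp add: split_sum_def)
qed

lemma split_sum_full: "finite L \<Longrightarrow> split_sum q x L (card L) k l = (\<Prod>i\<in>L. x i) ^ k"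
proof -
  assume "finite L"
  then have "{P. P \<subseteq> L \<and> card P = card L} = {L}" using card_subset_eq by blast
  then show ?thesis by (simp add: split_sum_def)
qed

lemma card_minus_two:
  "finite L \<Longrightarrow> u \<in> L \<Longrightarrow> v \<in> L \<Longrightarrow> u \<noteq> v \<Longrightarrow> card L = n + 2 \<Longrightarrow> card (L - {u, v}) = n"
  by (simp add: card_Diff_subset)

text \<open>For the difference of the two sides the residue condition is the same identity with two
  variables fewer. The induction ends at the empty and the full subset, where both sums are
  1.\<close>

lemma split_sum_symmetric:
  assumes "generic q x L" "finite L" "card L = p + r"
  shows "split_sum q x L p 0 0 = split_sum q x L r 0 0"
  using assms
proof (induction p arbitrary: r L)
  case 0
  then show ?case using split_sum_0[of L q x 0 0] split_sum_full[of L q x 0 0] by simp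
next
  case (Suc p)
  show ?case
  proof (cases r)
    case 0
    then show ?thesis using split_sum_0[of L q x 0 0] split_sum_full[of L q x 0 0] Suc.prems by simp
  next
    case (Suc r')
    have "(\<Sum>t\<in>UNIV. (if t then 1 else - 1) * split_sum q x L (Suc (if t then p else r')) 0 0) = 0"
    proof (rule split_sum_combination_eq_0[where n = "p + r'" and r = "\<lambda>t. if t then r' else p" and s = 0])
      fix u v assume uv: "u \<in> L" "v \<in> L" "u \<noteq> v"
      have "split_sum q x (L - {u, v}) p 0 0 = split_sum q x (L - {u, v}) r' 0 0"
      proof (rule Suc.IH)
        show "generic q x (L - {u, v})" by (rule generic_subset[OF Suc.prems(1)]) auto
        show "card (L - {u, v}) = p + r'"
          by (rule card_minus_two) (use Suc.prems \<open>r = Suc r'\<close> uv in auto)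
      qed (use Suc.prems in auto)
      then show "(\<Sum>t\<in>UNIV. (if t then 1 else - 1) * (q ^ 0 * split_sum q x (L - {u, v}) (if t then p else r') 0 0)) = 0"
        by (simp add: UNIV_bool)
    qed (use Suc.prems \<open>r = Suc r'\<close> in auto)
    then show ?thesis using \<open>r = Suc r'\<close> by (simp add: UNIV_bool)
  qed
qed

text \<open>In the residue condition the left side carries the weight q^1 and the right side q^0. So
  each removed pair of variables contributes one factor q until p or r is exhausted.\<close>

lemma split_sum_shift:
  assumes "generic q x L" "finite L" "card L = p + r"
  shows "split_sum q x L p 0 1 = q ^ min p r * split_sum q x L r 1 0"
  using assms
proof (induction p arbitrary: r L)
  case 0
  then show ?case using split_sum_0[of L q x 0 1] split_sum_full[of L q x 1 0] by simp
next
  case (Suc p)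
  show ?case
  proof (cases r)
    case 0
    then show ?thesis using split_sum_0[of L q x 1 0] split_sum_full[of L q x 0 1] Suc.prems by simp
  next
    case (Suc r')
    have "(\<Sum>t\<in>UNIV. (if t then 1 else - (q ^ Suc (min p r'))) *
        split_sum q x L (Suc (if t then p else r')) (if t then 0 else 1) (if t then 1 else 0)) = 0"
    proof (rule split_sum_combination_eq_0[where n = "p + r'" and r = "\<lambda>t. if t then r' else p" and s = 1])
      fix u v assume uv: "u \<in> L" "v \<in> L" "u \<noteq> v"
      have "split_sum q x (L - {u, v}) p 0 1 = q ^ min p r' * split_sum q x (L - {u, v}) r' 1 0"
      proof (rule Suc.IH)
        show "generic q x (L - {u, v})" by (rule generic_subset[OF Suc.prems(1)]) auto
        show "card (L - {u, v}) = p + r'"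
          by (rule card_minus_two) (use Suc.prems \<open>r = Suc r'\<close> uv in auto)
      qed (use Suc.prems in auto)
      then show "(\<Sum>t\<in>UNIV. (if t then 1 else - (q ^ Suc (min p r'))) * (q ^ (if t then 1 else 0) *
          split_sum q x (L - {u, v}) (if t then p else r') (if t then 0 else 1) (if t then 1 else 0))) = 0"
        by (simp add: UNIV_bool)
    qed (use Suc.prems \<open>r = Suc r'\<close> in auto)
    then show ?thesis using \<open>r = Suc r'\<close> by (simp add: UNIV_bool)
  qed
qed

lemma split_sum_pair:
  assumes "u \<noteq> v"
  shows "split_sum q x {u, v} 1 k l = x u ^ k * x v ^ l * (x u * x v / ((x u - x v) * (x v - q * x u)))
    + x v ^ k * x u ^ l * (x v * x u / ((x v - x u) * (x u - q * x v)))"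
proof -
  have "{P. P \<subseteq> {u, v} \<and> card P = 1} = {{u}, {v}}"
    by (auto simp: card_1_singleton_iff)
  moreover have "{u, v} - {u} = {v}" "{u, v} - {v} = {u}" "{u} \<noteq> {v}" using assms by auto
  ultimately show ?thesis using assms by (simp add: split_sum_def cross_def)
qed

text \<open>The source of the exchange relation of the Q-system. Two variables are treated by direct
  computation, because the degree bound k <= r + 1 fails for k = 2 and r = 0.\<close>

lemma split_sum_Q_system:
  assumes "generic q x L" "finite L" "card L = 2 * Suc p"
  shows "q ^ Suc p * split_sum q x L (Suc p) 2 0 = split_sum q x L (Suc p) 1 1 - split_sum q x L p 1 1"
  using assms
proof (induction p arbitrary: L)
  case 0
  then obtain u v where L: "L = {u, v}" and uv: "u \<noteq> v"
    by (metis One_nat_def card_2_iff mult.right_neutral)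
  have n: "x u - x v \<noteq> 0" "x v - q * x u \<noteq> 0" "x u - q * x v \<noteq> 0"
    using generic_neq[OF 0(1)] L uv by auto
  have n': "x v - x u = - (x u - x v)" by simp
  define d where "d = (x u - x v) * ((x v - q * x u) * (x u - q * x v))"
  have "d \<noteq> 0" using n by (simp add: d_def)
  have s: "split_sum q x {u, v} (Suc 0) k l = (x u ^ k * x v ^ l * (x u * x v) * (x u - q * x v)
      - x v ^ k * x u ^ l * (x u * x v) * (x v - q * x u)) / d" for k l
    unfolding One_nat_def[symmetric] split_sum_pair[OF uv] d_def n' using n by (simp add: divide_simps) (simp add: algebra_simps)
  \<comment> \<open>Brings the term of the empty subset over the common denominator.\<close>
  have e: "x u * x v = (x u * x v * d) / d" using \<open>d \<noteq> 0\<close> by simp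
  have "q * split_sum q x {u, v} (Suc 0) 2 0 = split_sum q x {u, v} (Suc 0) 1 1 - (x u * x v)"
    by (subst e) (simp only: s diff_divide_distrib[symmetric] times_divide_eq_right d_def,
      rule arg_cong2[of _ _ _ _ "(/)"], simp_all add: algebra_simps power2_eq_square)
  then show ?case using uv by (simp add: L split_sum_0)
next
  case (Suc p)
  let ?T = "{0::nat, 1, 2}"
  \<comment> \<open>The index t = 2 stands for the sum over subsets with one element fewer. The
    residue weights q^l are 1, q, q; cancelling q turns the leading power of q into that of the
    induction hypothesis.\<close>
  have "(\<Sum>t\<in>?T. (if t = 0 then q ^ Suc (Suc p) else if t = 1 then - 1 else 1) *
      split_sum q x L (Suc (if t = 2 then p else Suc p)) (if t = 0 then 2 else 1) (if t = 0 then 0 else 1)) = 0"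
  proof (rule split_sum_combination_eq_0[where n = "2 * Suc p" and r = "\<lambda>t. if t = 2 then Suc (Suc p) else Suc p" and s = 2])
    fix u v assume uv: "u \<in> L" "v \<in> L" "u \<noteq> v"
    have "q ^ Suc p * split_sum q x (L - {u, v}) (Suc p) 2 0
        = split_sum q x (L - {u, v}) (Suc p) 1 1 - split_sum q x (L - {u, v}) p 1 1"
    proof (rule Suc.IH)
      show "generic q x (L - {u, v})" by (rule generic_subset[OF Suc.prems(1)]) auto
      show "card (L - {u, v}) = 2 * Suc p"
        by (rule card_minus_two) (use Suc.prems uv in auto)
    qed (use Suc.prems in auto)
    then have "q * (q ^ Suc p * split_sum q x (L - {u, v}) (Suc p) 2 0)
        = q * (split_sum q x (L - {u, v}) (Suc p) 1 1 - split_sum q x (L - {u, v}) p 1 1)"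
      by simp
    then show "(\<Sum>t\<in>?T. (if t = 0 then q ^ Suc (Suc p) else if t = 1 then - 1 else 1) * (q ^ (if t = 0 then 0 else 1) *
          split_sum q x (L - {u, v}) (if t = 2 then p else Suc p) (if t = 0 then 2 else 1) (if t = 0 then 0 else 1))) = 0"
      by (simp add: algebra_simps)
  qed (use Suc.prems in auto)
  then show ?case by (simp add: algebra_simps)
qed

text \<open>The exchange relation with the exponents of the two parts interchanged, for the opposite
  order of the outer operators. The residue weights q^2, q, q lower both powers of q by one for each
  removed pair.\<close>

lemma split_sum_Q_system':
  assumes "generic q x L" "finite L" "card L = 2 * Suc p"
  shows "split_sum q x L (Suc p) 0 2 = q ^ Suc p * split_sum q x L (Suc p) 1 1 - q ^ p * split_sum q x L p 1 1"
  using assms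
proof (induction p arbitrary: L)
  case 0
  then obtain u v where L: "L = {u, v}" and uv: "u \<noteq> v"
    by (metis One_nat_def card_2_iff mult.right_neutral)
  have n: "x u - x v \<noteq> 0" "x v - q * x u \<noteq> 0" "x u - q * x v \<noteq> 0"
    using generic_neq[OF 0(1)] L uv by auto
  have n': "x v - x u = - (x u - x v)" by simp
  define d where "d = (x u - x v) * ((x v - q * x u) * (x u - q * x v))"
  have "d \<noteq> 0" using n by (simp add: d_def)
  have s: "split_sum q x {u, v} (Suc 0) k l = (x u ^ k * x v ^ l * (x u * x v) * (x u - q * x v)
      - x v ^ k * x u ^ l * (x u * x v) * (x v - q * x u)) / d" for k l
    unfolding One_nat_def[symmetric] split_sum_pair[OF uv] d_def n' using n by (simp add: divide_simps) (simp add: algebra_simps)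
  have e: "x u * x v = (x u * x v * d) / d" using \<open>d \<noteq> 0\<close> by simp
  have "split_sum q x {u, v} (Suc 0) 0 2 = q * split_sum q x {u, v} (Suc 0) 1 1 - (x u * x v)"
    by (subst e) (simp only: s diff_divide_distrib[symmetric] times_divide_eq_right d_def,
      rule arg_cong2[of _ _ _ _ "(/)"], simp_all add: algebra_simps power2_eq_square)
  then show ?case using uv by (simp add: L split_sum_0)
next
  case (Suc p)
  let ?T = "{0::nat, 1, 2}"
  have "(\<Sum>t\<in>?T. (if t = 0 then 1 else if t = 1 then - (q ^ Suc (Suc p)) else q ^ Suc p) *
      split_sum q x L (Suc (if t = 2 then p else Suc p)) (if t = 0 then 0 else 1) (if t = 0 then 2 else 1)) = 0"
  proof (rule split_sum_combination_eq_0[where n = "2 * Suc p" and r = "\<lambda>t. if t = 2 then Suc (Suc p) else Suc p" and s = 2])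
    fix u v assume uv: "u \<in> L" "v \<in> L" "u \<noteq> v"
    have IH: "split_sum q x (L - {u, v}) (Suc p) 0 2
        = q ^ Suc p * split_sum q x (L - {u, v}) (Suc p) 1 1 - q ^ p * split_sum q x (L - {u, v}) p 1 1"
    proof (rule Suc.IH)
      show "generic q x (L - {u, v})" by (rule generic_subset[OF Suc.prems(1)]) auto
      show "card (L - {u, v}) = 2 * Suc p"
        by (rule card_minus_two) (use Suc.prems uv in auto)
    qed (use Suc.prems in auto)
    then show "(\<Sum>t\<in>?T. (if t = 0 then 1 else if t = 1 then - (q ^ Suc (Suc p)) else q ^ Suc p) * (q ^ (if t = 0 then 2 else 1) *
          split_sum q x (L - {u, v}) (if t = 2 then p else Suc p) (if t = 0 then 0 else 1) (if t = 0 then 2 else 1))) = 0"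
      by (simp add: IH algebra_simps power2_eq_square)
  qed (use Suc.prems in auto)
  then show ?case by (simp add: algebra_simps)
qed

section \<open>Exponents\<close>

lemma psum_single [simp]: "psum i (Poly_Mapping.single j c) = (if j \<le> i then c else 0)"
  by (simp add: psum_def lookup_single when_def)

lemma psum_uminus [simp]: "psum i (- g) = - psum i g"
  by (simp add: psum_def sum_negf)

lemma psum_sum: "psum i (\<Sum>j\<in>A. f j) = (\<Sum>j\<in>A. psum i (f j))"
  by (simp add: psum_def lookup_sum) (rule sum.swap)

lemma wt_eq_psumI:
  assumes "\<And>i. psum i g = psum i h"
  shows "g = h"
proof (rule poly_mapping_eqI)
  fix k show "wt_entry g k = wt_entry h k"
  proof (cases k)
    case 0
    then show ?thesis using assms[of 0] by (simp add: psum_def)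
  next
    case (Suc j)
    then show ?thesis using assms[of k] assms[of j] by (simp add: psum_Suc)
  qed
qed

lemma lattice_0 [simp]: "0 \<in> lattice N"
  by (simp add: lattice_def)

lemma lattice_add: "g \<in> lattice N \<Longrightarrow> h \<in> lattice N \<Longrightarrow> g + h \<in> lattice N"
  unfolding lattice_def using Poly_Mapping.keys_add[of g h] by blast

lemma lattice_uminus [simp]: "- g \<in> lattice N \<longleftrightarrow> g \<in> lattice N"
  by (simp add: lattice_def)

lemma lattice_diff: "g \<in> lattice N \<Longrightarrow> h \<in> lattice N \<Longrightarrow> g - h \<in> lattice N"
  using lattice_add[of g N "- h"] by simp

lemma lattice_sum: "(\<And>i. i \<in> A \<Longrightarrow> f i \<in> lattice N) \<Longrightarrow> (\<Sum>i\<in>A. f i) \<in> lattice N"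
  by (induction A rule: infinite_finite_induct) (auto simp: lattice_add)

lemma lattice_single: "i \<in> {1..N} \<Longrightarrow> Poly_Mapping.single i c \<in> lattice N"
  by (auto simp: lattice_def)

lemma wt_entry_lattice: "g \<in> lattice N \<Longrightarrow> i \<notin> {1..N} \<Longrightarrow> wt_entry g i = 0"
  by (auto simp: lattice_def in_keys_iff)

lemma psum_lattice_0: "g \<in> lattice N \<Longrightarrow> psum 0 g = 0"
  by (simp add: psum_def wt_entry_lattice)

lemma psum_lattice_ge:
  assumes "g \<in> lattice N" "N \<le> j"
  shows "psum j g = psum N g"
  unfolding psum_def
  by (rule sum.mono_neutral_right) (use assms in \<open>auto intro!: wt_entry_lattice\<close>)

lemma psum_eq_sum_atLeast1:
  assumes "g \<in> lattice N"
  shows "psum a g = (\<Sum>i\<in>{1..a}. wt_entry g i)"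
  unfolding psum_def
  by (rule sum.mono_neutral_right) (use assms in \<open>auto intro!: wt_entry_lattice\<close>)

text \<open>The j-th partial sum of e_i - e_(i+1) is 1 for i = j and 0 otherwise, so partial sums
  are the coordinates with respect to the simple roots.\<close>

lemma Qplus_iff:
  "g \<in> Qplus N \<longleftrightarrow> g \<in> lattice N \<and> (\<forall>j. psum j g \<ge> 0) \<and> psum N g = 0"
proof
  assume "g \<in> Qplus N"
  then obtain n :: "nat \<Rightarrow> nat" where g: "g = (\<Sum>i\<in>{1..<N}. Poly_Mapping.single i (int (n i)) - Poly_Mapping.single (i + 1) (int (n i)))"
    unfolding Qplus_def by blast
  have "g \<in> lattice N" unfolding g by (intro lattice_sum lattice_diff lattice_single) auto
  moreover have "psum j g \<ge> 0" for j unfolding g psum_sum by (rule sum_nonneg) auto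
  moreover have "psum N g = 0" unfolding g psum_sum by (rule sum.neutral) auto
  ultimately show "g \<in> lattice N \<and> (\<forall>j. psum j g \<ge> 0) \<and> psum N g = 0" by blast
next
  assume g: "g \<in> lattice N \<and> (\<forall>j. psum j g \<ge> 0) \<and> psum N g = 0"
  let ?n = "\<lambda>i. nat (psum i g)"
  let ?s = "\<Sum>i\<in>{1..<N}. Poly_Mapping.single i (int (?n i)) - Poly_Mapping.single (i + 1) (int (?n i))"
  have "g = ?s"
  proof (rule wt_eq_psumI)
    fix j
    have "psum j ?s = (\<Sum>i\<in>{1..<N}. if i = j then psum j g else 0)"
      unfolding psum_sum by (rule sum.cong) (use g in auto)
    also have "\<dots> = (if j \<in> {1..<N} then psum j g else 0)" by (simp add: sum.delta')
    also have "\<dots> = psum j g"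
    proof -
      consider "j = 0" | "j \<in> {1..<N}" | "j \<ge> N" by fastforce
      then show ?thesis using g psum_lattice_0[of g N] psum_lattice_ge[of g N j] by cases auto
    qed
    finally show "psum j g = psum j ?s" by simp
  qed
  then show "g \<in> Qplus N" unfolding Qplus_def mem_Collect_eq by (intro exI[of _ ?n] conjI TrueI)
qed

lemma Qplus_0 [simp]: "0 \<in> Qplus N"
  by (simp add: Qplus_iff)

lemma Qplus_add: "g \<in> Qplus N \<Longrightarrow> h \<in> Qplus N \<Longrightarrow> g + h \<in> Qplus N"
  by (auto simp: Qplus_iff lattice_add)

lemma Qplus_antisym: "g \<in> Qplus N \<Longrightarrow> - g \<in> Qplus N \<Longrightarrow> g = 0"
  by (rule wt_eq_psumI) (auto simp: Qplus_iff intro: antisym)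

lemma wt_less_iff: "g < h \<longleftrightarrow> (\<exists>k. wt_entry g k < wt_entry h k \<and> (\<forall>j<k. wt_entry g j = wt_entry h j))"
  by (simp add: less_poly_mapping.rep_eq less_fun_def)

text \<open>The order on weights is lexicographic, smallest index first. It refines the dominance
  order, because the first nonzero entry is also the first nonzero partial sum.\<close>

lemma Qplus_nonneg: "g \<in> Qplus N \<Longrightarrow> 0 \<le> (g :: wt)"
proof (rule ccontr)
  assume g: "g \<in> Qplus N" and "\<not> 0 \<le> g"
  then obtain k where k: "wt_entry g k < 0" "\<forall>j<k. wt_entry g j = 0"
    unfolding not_le wt_less_iff by auto
  then have "psum k g = wt_entry g k"
    by (cases k) (auto simp: psum_def lessThan_Suc_atMost[symmetric])
  then show False using g k(1) by (metis Qplus_iff not_less)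
qed

text \<open>The entries are maximised one index after the other: once the earlier entries are fixed,
  the bound on the partial sum bounds the next entry. Beyond M all entries vanish, so finitely many
  stages suffice.\<close>

lemma bounded_wts_max:
  fixes S :: "wt set"
  assumes "S \<noteq> {}" and S: "\<And>g. g \<in> S \<Longrightarrow> Poly_Mapping.keys g \<subseteq> {..M} \<and> (\<forall>i. psum i g \<le> b)"
  shows "\<exists>h\<in>S. \<forall>g\<in>S. g \<le> h"
proof -
  have "\<exists>h\<in>S. \<forall>g\<in>S. (\<forall>i<n. wt_entry g i = wt_entry h i) \<or> g < h" for n
  proof (induction n)
    case 0
    then show ?case using assms(1) by auto
  next
    case (Suc n)
    then obtain h where h: "h \<in> S" "\<And>g. g \<in> S \<Longrightarrow> (\<forall>i<n. wt_entry g i = wt_entry h i) \<or> g < h" by blast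
    let ?T = "{g \<in> S. \<forall>i<n. wt_entry g i = wt_entry h i}"
    let ?B = "b - (\<Sum>j<n. wt_entry h j)"
    have le: "wt_entry g n \<le> ?B" if "g \<in> ?T" for g
    proof -
      have "psum n g = (\<Sum>j<n. wt_entry g j) + wt_entry g n"
        by (simp add: psum_def lessThan_Suc_atMost[symmetric])
      also have "(\<Sum>j<n. wt_entry g j) = (\<Sum>j<n. wt_entry h j)" using that by simp
      finally have "psum n g = (\<Sum>j<n. wt_entry h j) + wt_entry g n" .
      moreover have "psum n g \<le> b" using S[of g] that by blast
      ultimately show ?thesis by simp
    qed
    obtain h' where h': "h' \<in> ?T" "\<And>g. g \<in> ?T \<Longrightarrow> nat (?B - wt_entry h' n) \<le> nat (?B - wt_entry g n)"
      using ex_has_least_nat[of "\<lambda>g. g \<in> ?T" h "\<lambda>g. nat (?B - wt_entry g n)"] h by blast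
    have T: "(\<forall>i<Suc n. wt_entry g i = wt_entry h' i) \<or> g < h'" if g: "g \<in> ?T" for g
    proof -
      have "wt_entry g n \<le> wt_entry h' n" using h'(2)[OF g] le[OF g] le[OF h'(1)] by auto
      moreover have "\<forall>i<n. wt_entry g i = wt_entry h' i" using g h'(1) by auto
      ultimately show ?thesis unfolding wt_less_iff less_Suc_eq by (metis order_le_less)
    qed
    have "(\<forall>i<Suc n. wt_entry g i = wt_entry h' i) \<or> g < h'" if g: "g \<in> S" for g
    proof (cases "g \<in> ?T")
      case False
      then have "g < h" using h(2)[OF g] g by blast
      then obtain k where k: "wt_entry g k < wt_entry h k" "\<forall>j<k. wt_entry g j = wt_entry h j"
        unfolding wt_less_iff by blast
      have "k < n"
      proof (rule ccontr)
        assume "\<not> k < n"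
        then have "g \<in> ?T" using g k(2) by auto
        then show False using False by contradiction
      qed
      then have "g < h'" unfolding wt_less_iff using k h'(1) by (intro exI[of _ k]) auto
      then show ?thesis ..
    qed (rule T)
    then show ?case using h'(1) by blast
  qed
  then obtain h where h: "h \<in> S" "\<And>g. g \<in> S \<Longrightarrow> (\<forall>i<Suc M. wt_entry g i = wt_entry h i) \<or> g < h" by blast
  have "g \<le> h" if g: "g \<in> S" for g
  proof (cases "g < h")
    case False
    have "g = h"
    proof (rule poly_mapping_eqI)
      fix k show "wt_entry g k = wt_entry h k"
      proof (cases "k \<le> M")
        case True
        then show ?thesis using h(2)[OF g] False by simp
      next
        case False
        then have "k \<notin> Poly_Mapping.keys g" "k \<notin> Poly_Mapping.keys h" using S[OF g] S[OF h(1)] by auto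
        then show ?thesis by (simp add: in_keys_iff)
      qed
    qed
    then show ?thesis by simp
  qed simp
  then show ?thesis using h(1) by blast
qed

section \<open>The ring of series\<close>

lemma bounded_exps_xcoeff: "bounded_exps (xcoeff F)"
  using xcoeff[of F] by simp

lemma xcoeff_mult_eq_sum:
  assumes "finite A" "\<And>a. xcoeff F a \<noteq> 0 \<Longrightarrow> xcoeff G (c - a) \<noteq> 0 \<Longrightarrow> a \<in> A"
  shows "xcoeff (F * G) c = (\<Sum>a\<in>A. xcoeff F a * xcoeff G (c - a))"
  unfolding times_xseries.rep_eq by (rule conv_eq_sum) (use assms in auto)

lemma finite_xcoeff_mult: "finite {a. xcoeff F a \<noteq> 0 \<and> xcoeff G (c - a) \<noteq> 0}"
  by (rule finite_conv[OF bounded_exps_xcoeff bounded_exps_xcoeff])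

lemma xcoeff_mult_nonzero:
  assumes "xcoeff (F * G) c \<noteq> 0"
  obtains a where "xcoeff F a \<noteq> 0" "xcoeff G (c - a) \<noteq> 0"
  using assms conv_nonzero unfolding times_xseries.rep_eq by blast

lemma xcoeff_simps [simp]:
  "xcoeff 0 g = 0" "xcoeff (F + G) g = xcoeff F g + xcoeff G g" "xcoeff (F - G) g = xcoeff F g - xcoeff G g"
  "xcoeff (- F) g = - xcoeff F g" "xcoeff 1 g = (if g = 0 then 1 else 0)"
  "xcoeff (xconst c) g = (if g = 0 then c else 0)" "xcoeff (xmonom m) g = (if g = m then 1 else 0)"
  by (simp_all add: zero_xseries.rep_eq plus_xseries.rep_eq minus_xseries.rep_eq uminus_xseries.rep_eq
      one_xseries.rep_eq xconst.rep_eq xmonom.rep_eq)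

lemma xcoeff_sum: "xcoeff (\<Sum>i\<in>A. f i) g = (\<Sum>i\<in>A. xcoeff (f i) g)"
  by (induction A rule: infinite_finite_induct) auto

lemma xcoeff_xconst_mult [simp]: "xcoeff (xconst c * F) g = c * xcoeff F g"
  by (simp add: times_xseries.rep_eq xconst.rep_eq conv_monom)

lemma xconst_hom [simp]:
  "xconst 0 = 0" "xconst 1 = 1"
  and xconst_mult: "xconst (c * d) = xconst c * xconst d" and xconst_add: "xconst (c + d) = xconst c + xconst d"
  by (rule xseries_eqI, simp)+

lemma xconst_power: "xconst (c ^ n) = xconst c ^ n"
  by (induction n) (auto simp: xconst_mult)

lemma xconst_uminus: "xconst (- c) = - xconst c"
  by (rule xseries_eqI) simp

lemma xmonom_0 [simp]: "xmonom 0 = 1"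
  by (rule xseries_eqI) simp

lemma xmonom_neq_0 [simp]: "xmonom m \<noteq> 0"
proof
  assume "xmonom m = 0"
  then have "xcoeff (xmonom m) m = xcoeff 0 m" by simp
  then show False by simp
qed

lemma xmonom_sum: "xmonom (\<Sum>i\<in>A. f i) = (\<Prod>i\<in>A. xmonom (f i))"
  by (induction A rule: infinite_finite_induct) (auto simp: xmonom_mult[symmetric])

lemma xcoeff_max:
  assumes "F \<noteq> 0"
  obtains m where "xcoeff F m \<noteq> 0" "\<And>g. xcoeff F g \<noteq> 0 \<Longrightarrow> g \<le> m"
proof -
  obtain M b where *: "\<And>g. xcoeff F g \<noteq> 0 \<Longrightarrow> Poly_Mapping.keys g \<subseteq> {..M} \<and> (\<forall>i. psum i g \<le> b)"
    using bounded_exps_xcoeff[of F] unfolding bounded_exps_def by blast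
  have "{g. xcoeff F g \<noteq> 0} \<noteq> {}" using assms xseries_eqI[of F 0] by auto
  then have "\<exists>m\<in>{g. xcoeff F g \<noteq> 0}. \<forall>g\<in>{g. xcoeff F g \<noteq> 0}. g \<le> m"
    by (rule bounded_wts_max[where M = M and b = b]) (use * in blast)
  then show ?thesis using that by blast
qed

text \<open>The lexicographically largest exponents of two nonzero series add up to an exponent that
  only one pair of terms reaches. The domain property gives access to the fraction field and to
  counting roots of polynomials over this ring.\<close>

instance xseries :: idom
proof
  fix F G :: xseries
  assume "F \<noteq> 0" "G \<noteq> 0"
  then obtain m m' where m: "xcoeff F m \<noteq> 0" "\<And>g. xcoeff F g \<noteq> 0 \<Longrightarrow> g \<le> m"
    and m': "xcoeff G m' \<noteq> 0" "\<And>g. xcoeff G g \<noteq> 0 \<Longrightarrow> g \<le> m'"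
    by (metis xcoeff_max)
  have "xcoeff (F * G) (m + m') = (\<Sum>a\<in>{m}. xcoeff F a * xcoeff G (m + m' - a))"
  proof (rule xcoeff_mult_eq_sum)
    fix a assume a: "xcoeff F a \<noteq> 0" "xcoeff G (m + m' - a) \<noteq> 0"
    have "a \<le> m" using m(2)[OF a(1)] .
    moreover have "m + m' - a \<le> m'" using m'(2)[OF a(2)] .
    then have "m \<le> a" by (simp add: diff_le_eq add.commute)
    ultimately show "a \<in> {m}" by simp
  qed simp
  then have "xcoeff (F * G) (m + m') \<noteq> 0" using m(1) m'(1) by simp
  then show "F * G \<noteq> 0" by auto
qed

section \<open>The shifts as ring homomorphisms\<close>

definition qpow :: "complex \<Rightarrow> nat set \<Rightarrow> wt \<Rightarrow> complex" where
  "qpow q I g = (\<Prod>i\<in>I. q powi wt_entry g i)"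

lemma qpow_add: "q \<noteq> 0 \<Longrightarrow> qpow q I (g + h) = qpow q I g * qpow q I h"
  by (simp add: qpow_def lookup_add power_int_add prod.distrib)

lemma qpow_0 [simp]: "qpow q I 0 = 1"
  by (simp add: qpow_def)

lemma xcoeff_Gamma [simp]: "xcoeff (Gamma q I F) g = qpow q I g * xcoeff F g"
  by (simp add: Gamma.rep_eq qpow_def)

lemma Gamma_add: "Gamma q I (F + G) = Gamma q I F + Gamma q I G"
  by (rule xseries_eqI) (simp add: algebra_simps)

lemma Gamma_diff: "Gamma q I (F - G) = Gamma q I F - Gamma q I G"
  by (rule xseries_eqI) (simp add: algebra_simps)

lemma Gamma_sum: "Gamma q I (\<Sum>i\<in>A. f i) = (\<Sum>i\<in>A. Gamma q I (f i))"
  by (rule xseries_eqI) (simp add: xcoeff_sum sum_distrib_left)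

lemma Gamma_xconst [simp]: "Gamma q I (xconst c) = xconst c"
  by (rule xseries_eqI) simp

lemma Gamma_one [simp]: "Gamma q I 1 = 1"
  by (rule xseries_eqI) simp

lemma Gamma_xmonom: "Gamma q I (xmonom m) = xconst (qpow q I m) * xmonom m"
  by (rule xseries_eqI) simp

lemma Gamma_mult:
  assumes q: "q \<noteq> 0"
  shows "Gamma q I (F * G) = Gamma q I F * Gamma q I G"
proof (rule xseries_eqI)
  fix g
  let ?A = "{a. xcoeff F a \<noteq> 0 \<and> xcoeff G (g - a) \<noteq> 0}"
  have "xcoeff (Gamma q I F * Gamma q I G) g
      = (\<Sum>a\<in>?A. xcoeff (Gamma q I F) a * xcoeff (Gamma q I G) (g - a))"
    by (rule xcoeff_mult_eq_sum[OF finite_xcoeff_mult]) auto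
  also have "\<dots> = (\<Sum>a\<in>?A. qpow q I g * (xcoeff F a * xcoeff G (g - a)))"
  proof (rule sum.cong[OF refl])
    fix a
    have "qpow q I g = qpow q I a * qpow q I (g - a)"
      using qpow_add[OF q, of I a "g - a"] by simp
    then show "xcoeff (Gamma q I F) a * xcoeff (Gamma q I G) (g - a) = qpow q I g * (xcoeff F a * xcoeff G (g - a))"
      by simp
  qed
  also have "\<dots> = xcoeff (Gamma q I (F * G)) g"
    by (simp add: sum_distrib_left[symmetric] xcoeff_mult_eq_sum[OF finite_xcoeff_mult[of F G g]])
  finally show "xcoeff (Gamma q I (F * G)) g = xcoeff (Gamma q I F * Gamma q I G) g" ..
qed

lemma Gamma_prod: "q \<noteq> 0 \<Longrightarrow> Gamma q I (\<Prod>i\<in>A. f i) = (\<Prod>i\<in>A. Gamma q I (f i))"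
  by (induction A rule: infinite_finite_induct) (auto simp: Gamma_mult)

lemma Gamma_xvar:
  "finite I \<Longrightarrow> Gamma q I (xvar i) = xconst (if i \<in> I then q else 1) * xvar i"
proof -
  assume "finite I"
  have "qpow q I (eps i) = (\<Prod>j\<in>I. if j = i then q else 1)"
    unfolding qpow_def by (rule prod.cong) (auto simp: lookup_single when_def)
  also have "\<dots> = (if i \<in> I then q else 1)" using \<open>finite I\<close> by (simp add: prod.delta')
  finally show ?thesis by (simp add: Gamma_xmonom)
qed

section \<open>Series in negative roots\<close>

definition neg_series :: "nat \<Rightarrow> xseries set" where
  "neg_series N = {C. \<forall>g. xcoeff C g \<noteq> 0 \<longrightarrow> - g \<in> Qplus N}"

lemma neg_seriesD:
  assumes "C \<in> neg_series N" "xcoeff C g \<noteq> 0"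
  shows "g \<in> lattice N" "psum j g \<le> 0" "psum N g = 0"
proof -
  have "- g \<in> Qplus N" using assms by (auto simp: neg_series_def)
  then have "- g \<in> lattice N" "psum j (- g) \<ge> 0" "psum N (- g) = 0" unfolding Qplus_iff by blast+
  then show "g \<in> lattice N" "psum j g \<le> 0" "psum N g = 0" by simp_all
qed

lemma neg_series_mult: "C \<in> neg_series N \<Longrightarrow> D \<in> neg_series N \<Longrightarrow> C * D \<in> neg_series N"
  unfolding neg_series_def
proof safe
  fix g assume C: "\<forall>g. xcoeff C g \<noteq> 0 \<longrightarrow> - g \<in> Qplus N" and D: "\<forall>g. xcoeff D g \<noteq> 0 \<longrightarrow> - g \<in> Qplus N"
    and "xcoeff (C * D) g \<noteq> 0"
  then obtain a where "- a \<in> Qplus N" "- (g - a) \<in> Qplus N" by (metis xcoeff_mult_nonzero)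
  then have "- a + - (g - a) \<in> Qplus N" by (rule Qplus_add)
  then show "- g \<in> Qplus N" by simp
qed

lemma neg_series_add: "C \<in> neg_series N \<Longrightarrow> D \<in> neg_series N \<Longrightarrow> C + D \<in> neg_series N"
  unfolding neg_series_def by (auto, metis add.right_neutral)

lemma neg_series_xconst [simp]: "xconst c \<in> neg_series N"
  by (auto simp: neg_series_def)

lemma neg_series_one [simp]: "1 \<in> neg_series N"
  using neg_series_xconst[of 1] by simp

lemma neg_series_zero [simp]: "0 \<in> neg_series N"
  by (simp add: neg_series_def)

lemma neg_series_prod: "(\<And>i. i \<in> A \<Longrightarrow> f i \<in> neg_series N) \<Longrightarrow> (\<Prod>i\<in>A. f i) \<in> neg_series N"
  by (induction A rule: infinite_finite_induct) (auto simp: neg_series_mult)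

text \<open>
  Agreement of the coefficients at all exponents whose first r partial sums are nonnegative.
  For series in negative roots this amounts to setting $x_j/x_i = 0$ for i at most r and j > i.
\<close>

definition top_eq :: "nat \<Rightarrow> xseries \<Rightarrow> xseries \<Rightarrow> bool" where
  "top_eq r C D \<longleftrightarrow> (\<forall>g. (\<forall>j\<le>r. psum j g \<ge> 0) \<longrightarrow> xcoeff C g = xcoeff D g)"

lemma top_eq_refl [simp]: "top_eq r C C"
  by (simp add: top_eq_def)

text \<open>All partial sums of the exponents involved are at most 0. If two of them add up to a
  nonnegative number, both are 0, so only coefficients on which the factors agree enter the
  product.\<close>

lemma top_eq_mult:
  assumes "C \<in> neg_series N" "C' \<in> neg_series N" "D \<in> neg_series N" "D' \<in> neg_series N"
    and "top_eq r C C'" "top_eq r D D'"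
  shows "top_eq r (C * D) (C' * D')"
  unfolding top_eq_def
proof (intro allI impI)
  fix g assume g: "\<forall>j\<le>r. psum j g \<ge> 0"
  let ?A = "{a. xcoeff C a \<noteq> 0 \<and> xcoeff D (g - a) \<noteq> 0} \<union> {a. xcoeff C' a \<noteq> 0 \<and> xcoeff D' (g - a) \<noteq> 0}"
  have fin: "finite ?A" using finite_xcoeff_mult by simp
  have "xcoeff C a * xcoeff D (g - a) = xcoeff C' a * xcoeff D' (g - a)" if a: "a \<in> ?A" for a
  proof -
    have le: "psum j a \<le> 0" "psum j (g - a) \<le> 0" for j using a neg_seriesD(2) assms(1-4) by blast+
    have "psum j a \<ge> 0" "psum j (g - a) \<ge> 0" if "j \<le> r" for j using le[of j] g that by auto
    then show ?thesis using assms(5,6) unfolding top_eq_def by simp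
  qed
  then have "(\<Sum>a\<in>?A. xcoeff C a * xcoeff D (g - a)) = (\<Sum>a\<in>?A. xcoeff C' a * xcoeff D' (g - a))"
    by (rule sum.cong[OF refl])
  moreover have "xcoeff (C * D) g = (\<Sum>a\<in>?A. xcoeff C a * xcoeff D (g - a))"
    "xcoeff (C' * D') g = (\<Sum>a\<in>?A. xcoeff C' a * xcoeff D' (g - a))"
    by (rule xcoeff_mult_eq_sum[OF fin]; blast)+
  ultimately show "xcoeff (C * D) g = xcoeff (C' * D') g" by simp
qed

lemma top_eq_prod:
  assumes "\<And>i. i \<in> A \<Longrightarrow> f i \<in> neg_series N \<and> f' i \<in> neg_series N \<and> top_eq r (f i) (f' i)"
  shows "top_eq r (\<Prod>i\<in>A. f i) (\<Prod>i\<in>A. f' i)"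
  using assms
proof (induction A rule: infinite_finite_induct)
  case (insert x F)
  then show ?case by (auto intro!: top_eq_mult neg_series_prod)
qed auto

section \<open>Expansions of x_i / (x_i - x_j) in negative roots\<close>

definition xratio :: "nat \<Rightarrow> nat \<Rightarrow> xseries" where
  "xratio i j = xvar i * inv_diff i j"

lemma xcoeff_xratio_less:
  assumes "i < j"
  shows "xcoeff (xratio i j) g
    = (if \<exists>n::nat. g = Poly_Mapping.single j (int n) - Poly_Mapping.single i (int n) then 1 else 0)"
proof -
  have "g - eps i = Poly_Mapping.single j (int n) - Poly_Mapping.single i (int n + 1)
     \<longleftrightarrow> g = Poly_Mapping.single j (int n) - Poly_Mapping.single i (int n)" for n
    by (simp add: single_add diff_eq_eq)
  then show ?thesis using assms
    by (simp add: xratio_def xcoeff_xmonom_mult inv_diff_def inv_diff_less.rep_eq)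
qed

lemma xcoeff_xratio_greater:
  assumes "j < i"
  shows "xcoeff (xratio i j) g
    = (if \<exists>n::nat. g = Poly_Mapping.single i (int (Suc n)) - Poly_Mapping.single j (int (Suc n)) then - 1 else 0)"
proof -
  have "g - eps i = Poly_Mapping.single i (int n) - Poly_Mapping.single j (int n + 1)
     \<longleftrightarrow> g = Poly_Mapping.single i (int (Suc n)) - Poly_Mapping.single j (int (Suc n))" for n
    by (simp add: single_add diff_eq_eq algebra_simps)
  then show ?thesis using assms
    by (simp add: xratio_def xcoeff_xmonom_mult inv_diff_def inv_diff_less.rep_eq)
qed

lemma xratio_neg_series:
  assumes "i \<in> {1..N}" "j \<in> {1..N}" "i \<noteq> j"
  shows "xratio i j \<in> neg_series N"
  unfolding neg_series_def
proof safe
  fix g assume g: "xcoeff (xratio i j) g \<noteq> 0"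
  show "- g \<in> Qplus N"
  proof (cases "i < j")
    case True
    then obtain n :: nat where "g = Poly_Mapping.single j (int n) - Poly_Mapping.single i (int n)"
      using g xcoeff_xratio_less[OF True] by (metis)
    then show ?thesis using True assms by (auto simp: Qplus_iff intro!: lattice_diff lattice_single)
  next
    case False
    then have ji: "j < i" using assms by simp
    then obtain n :: nat where "g = Poly_Mapping.single i (int (Suc n)) - Poly_Mapping.single j (int (Suc n))"
      using g xcoeff_xratio_greater[OF ji] by (metis)
    then show ?thesis using ji assms by (auto simp: Qplus_iff intro!: lattice_diff lattice_single)
  qed
qed

text \<open>Every term of the sum of (x_j / x_i)^n except the constant one has a negative i-th
  partial sum.\<close>

lemma xratio_top_eq_1:
  assumes "i < j" "i \<le> r"
  shows "top_eq r (xratio i j) 1"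
  unfolding top_eq_def
proof (intro allI impI)
  fix g assume g: "\<forall>k\<le>r. psum k g \<ge> 0"
  have "(\<exists>n::nat. g = Poly_Mapping.single j (int n) - Poly_Mapping.single i (int n)) \<longleftrightarrow> g = 0"
  proof
    assume "\<exists>n::nat. g = Poly_Mapping.single j (int n) - Poly_Mapping.single i (int n)"
    then obtain n :: nat where n: "g = Poly_Mapping.single j (int n) - Poly_Mapping.single i (int n)" ..
    have "psum i g \<ge> 0" using g assms by simp
    then have "n = 0" using assms n by simp
    then show "g = 0" using n by simp
  qed (auto intro!: exI[of _ 0])
  then show "xcoeff (xratio i j) g = xcoeff 1 g" using assms by (simp add: xcoeff_xratio_less)
qed

text \<open>For j < i the expansion is minus the sum of (x_i / x_j)^n over n >= 1; there is no
  constant term.\<close>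

lemma xratio_top_eq_0:
  assumes "j < i" "j \<le> r"
  shows "top_eq r (xratio i j) 0"
  unfolding top_eq_def
proof (intro allI impI)
  fix g assume g: "\<forall>k\<le>r. psum k g \<ge> 0"
  have "\<not> (\<exists>n::nat. g = Poly_Mapping.single i (int (Suc n)) - Poly_Mapping.single j (int (Suc n)))"
  proof
    assume "\<exists>n::nat. g = Poly_Mapping.single i (int (Suc n)) - Poly_Mapping.single j (int (Suc n))"
    then obtain n :: nat where n: "g = Poly_Mapping.single i (int (Suc n)) - Poly_Mapping.single j (int (Suc n))" ..
    have "psum j g \<ge> 0" using g assms by simp
    then show False using assms n by simp
  qed
  then show "xcoeff (xratio i j) g = xcoeff 0 g" using assms by (simp add: xcoeff_xratio_greater)
qed

section \<open>Composition of the difference operators\<close>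

text \<open>The identities between split sums hold over fields, while the operators have
  coefficients in a ring of series; both meet in its field of fractions.\<close>

definition xfract :: "xseries \<Rightarrow> xseries fract" where
  "xfract F = Fract F 1"

abbreviation cfract :: "complex \<Rightarrow> xseries fract" where
  "cfract c \<equiv> xfract (xconst c)"

abbreviation vfract :: "nat \<Rightarrow> xseries fract" where
  "vfract i \<equiv> xfract (xvar i)"

lemma xfract_simps [simp]:
  "xfract 0 = 0" "xfract 1 = 1" "xfract (F + G) = xfract F + xfract G"
  "xfract (F - G) = xfract F - xfract G" "xfract (F * G) = xfract F * xfract G"
  by (simp_all add: xfract_def Zero_fract_def One_fract_def)

lemma xfract_eq_iff [simp]: "xfract F = xfract G \<longleftrightarrow> F = G"
  by (simp add: xfract_def eq_fract)

lemma xfract_eq_0_iff [simp]: "xfract F = 0 \<longleftrightarrow> F = 0"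
  using xfract_eq_iff[of F 0] by (simp del: xfract_eq_iff)

lemma xfract_sum: "xfract (\<Sum>i\<in>A. f i) = (\<Sum>i\<in>A. xfract (f i))"
  by (induction A rule: infinite_finite_induct) auto

lemma xfract_prod: "xfract (\<Prod>i\<in>A. f i) = (\<Prod>i\<in>A. xfract (f i))"
  by (induction A rule: infinite_finite_induct) auto

lemma xconst_eq_0_iff [simp]: "xconst c = 0 \<longleftrightarrow> c = 0"
proof
  assume "xconst c = 0"
  then have "xcoeff (xconst c) 0 = xcoeff 0 0" by simp
  then show "c = 0" by simp
qed simp

lemma eps_eq_iff [simp]: "eps i = eps j \<longleftrightarrow> i = j"
proof
  assume "eps i = eps j"
  then have "Poly_Mapping.keys (eps i) = Poly_Mapping.keys (eps j)" by simp
  then show "i = j" by simp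
qed simp

lemma cfract_powi:
  assumes "c \<noteq> 0"
  shows "cfract (c powi k) = cfract c powi k"
proof (cases k rule: int_cases2)
  case (nonneg n)
  have "cfract (c ^ n) = cfract c ^ n" by (induction n) (auto simp: xconst_mult)
  then show ?thesis by (simp add: nonneg)
next
  case (nonpos n)
  have "cfract (c ^ n) = cfract c ^ n" by (induction n) (auto simp: xconst_mult)
  moreover have "cfract (inverse (c ^ n)) * cfract (c ^ n) = 1"
    using assms by (simp add: xfract_simps(5)[symmetric] xconst_mult[symmetric] del: xfract_simps(5))
  moreover have "cfract (c ^ n) \<noteq> 0" using assms by simp
  ultimately show ?thesis
    by (simp add: nonpos power_int_minus field_simps)
qed

lemma xfract_xvar_power: "xfract (xvar_power i k) = vfract i powi k"
proof -
  have nat: "xfract (xvar_power i (int n)) = vfract i ^ n" for n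
  proof (induction n)
    case (Suc n)
    have "xvar_power i (int (Suc n)) = xvar i * xvar_power i (int n)"
      by (simp add: xmonom_mult single_add[symmetric])
    then show ?case using Suc by simp
  qed simp
  show ?thesis
  proof (cases k rule: int_cases2)
    case (nonneg n)
    then show ?thesis by (simp add: nat)
  next
    case (nonpos n)
    have "xvar_power i k * xvar_power i (int n) = 1"
      by (simp add: xmonom_mult single_add[symmetric] nonpos)
    then have "xfract (xvar_power i k) * vfract i ^ n = 1"
      by (metis nat xfract_simps(2,5))
    moreover have "vfract i ^ n \<noteq> 0" by simp
    ultimately show ?thesis by (simp add: nonpos power_int_minus field_simps)
  qed
qed

lemma vfract_neq: 
  assumes "i \<noteq> j \<or> c \<noteq> 1"
  shows "vfract i \<noteq> cfract c * vfract j"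
proof
  assume "vfract i = cfract c * vfract j"
  then have "xvar i = xconst c * xvar j" by (simp add: xfract_simps(5)[symmetric] del: xfract_simps(5))
  then have "xcoeff (xvar i) (eps i) = xcoeff (xconst c * xvar j) (eps i)" by simp
  then show False using assms by (auto split: if_splits)
qed

lemma power_neq_1:
  fixes q :: complex
  assumes "norm q < 1" "n > 0"
  shows "q ^ n \<noteq> 1"
proof
  assume "q ^ n = 1"
  then have "norm q ^ n = 1" by (metis norm_one norm_power)
  moreover have "norm q ^ n < 1" using assms by (simp add: power_less_one_iff)
  ultimately show False by simp
qed

text \<open>Distinct variables are not proportional over the constants, and |q| < 1 excludes q = 1
  and q^2 = 1.\<close>

lemma generic_vfract:
  assumes "q \<noteq> 0" "norm q < 1"
  shows "generic (cfract q) vfract L"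
  unfolding generic_def
proof (intro conjI ballI)
  show "inj_on vfract L"
  proof (rule inj_onI)
    fix i j assume "vfract i = vfract j"
    then show "i = j" using vfract_neq[of i j 1] by auto
  qed
  fix i j
  have "q \<noteq> 1" "q * q \<noteq> 1"
    using power_neq_1[OF assms(2), of 1] power_neq_1[OF assms(2), of 2] by (auto simp: power2_eq_square)
  then show "vfract i \<noteq> cfract q * vfract j" "vfract i \<noteq> cfract q * (cfract q * vfract j)"
    using vfract_neq[of i j q] vfract_neq[of i j "q * q"] by (auto simp: xconst_mult mult.assoc)
qed (use assms in auto)

section \<open>Coefficients of the operators as rational functions\<close>

definition D_coeff :: "nat \<Rightarrow> nat set \<Rightarrow> int \<Rightarrow> xseries" where
  "D_coeff N I k = (\<Prod>i\<in>I. xvar_power i k) * (\<Prod>i\<in>I. \<Prod>j\<in>{1..N} - I. xratio i j)"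

lemma D_op_eq: "D_op N q a k F = (\<Sum>I | I \<subseteq> {1..N} \<and> card I = a. D_coeff N I k * Gamma q I F)"
  by (simp add: D_op_def D_coeff_def xratio_def)

definition ratio_prod :: "(nat \<Rightarrow> 'a::field) \<Rightarrow> nat set \<Rightarrow> nat set \<Rightarrow> 'a" where
  "ratio_prod x I J = (\<Prod>i\<in>I. \<Prod>j\<in>J. x i / (x i - x j))"

lemma xfract_xratio: "i \<noteq> j \<Longrightarrow> xfract (xratio i j) = vfract i / (vfract i - vfract j)"
proof -
  assume ij: "i \<noteq> j"
  have "xfract (inv_diff i j) * (vfract i - vfract j) = 1"
    unfolding xfract_simps(4,5)[symmetric] inv_diff_mult[OF ij] by simp
  then have "xfract (inv_diff i j) = 1 / (vfract i - vfract j)"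
    by (metis mult_zero_right nonzero_eq_divide_eq zero_neq_one)
  then show ?thesis by (simp add: xratio_def)
qed

lemma xfract_Gamma_xvar:
  "finite I \<Longrightarrow> xfract (Gamma q I (xvar i)) = (if i \<in> I then cfract q else 1) * vfract i"
  by (simp add: Gamma_xvar)

text \<open>A shift is a ring homomorphism, so it preserves the equation that characterises the
  inverse of x_i - x_j; no expansions have to be compared.\<close>

lemma xfract_Gamma_xratio:
  assumes "q \<noteq> 0" "finite I" "i \<noteq> j"
  defines "g \<equiv> \<lambda>i. (if i \<in> I then cfract q else 1) * vfract i"
  shows "xfract (Gamma q I (xratio i j)) = g i / (g i - g j)"
proof -
  have "Gamma q I (inv_diff i j) * (Gamma q I (xvar i) - Gamma q I (xvar j)) = 1"
    unfolding Gamma_diff[symmetric] Gamma_mult[OF assms(1), symmetric] inv_diff_mult[OF assms(3)] by simp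
  then have "xfract (Gamma q I (inv_diff i j) * (Gamma q I (xvar i) - Gamma q I (xvar j))) = 1"
    by simp
  then have "xfract (Gamma q I (inv_diff i j)) * (g i - g j) = 1"
    unfolding xfract_simps xfract_Gamma_xvar[OF assms(2)] g_def .
  then have "xfract (Gamma q I (inv_diff i j)) = 1 / (g i - g j)"
    by (metis mult_zero_right nonzero_eq_divide_eq zero_neq_one)
  then show ?thesis
    unfolding xratio_def Gamma_mult[OF assms(1)] xfract_simps xfract_Gamma_xvar[OF assms(2)] g_def by simp
qed

lemma xfract_Gamma_xvar_power:
  assumes "q \<noteq> 0" "finite I"
  shows "xfract (Gamma q I (xvar_power i k)) = ((if i \<in> I then cfract q else 1) * vfract i) powi k"
proof -
  have "qpow q I (Poly_Mapping.single i k) = (\<Prod>j\<in>I. if j = i then q powi k else 1)"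
    unfolding qpow_def by (rule prod.cong) (auto simp: lookup_single when_def)
  also have "\<dots> = (if i \<in> I then q powi k else 1)" using assms(2) by (simp add: prod.delta')
  finally have "cfract (qpow q I (Poly_Mapping.single i k)) = (if i \<in> I then cfract q else 1) powi k"
    using assms(1) by (simp add: cfract_powi)
  then show ?thesis
    unfolding Gamma_xmonom xfract_simps xfract_xvar_power[of i k] power_int_mult_distrib by simp
qed

lemma xfract_D_coeff:
  assumes "finite I"
  shows "xfract (D_coeff N I k) = (\<Prod>i\<in>I. vfract i powi k) * ratio_prod vfract I ({1..N} - I)"
  unfolding D_coeff_def xfract_simps xfract_prod ratio_prod_def
  by (intro arg_cong2[of _ _ _ _ "(*)"] prod.cong refl xfract_xratio xfract_xvar_power) auto

lemma xfract_Gamma_D_coeff: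
  assumes "q \<noteq> 0" "finite I"
  defines "g \<equiv> \<lambda>i. (if i \<in> I then cfract q else 1) * vfract i"
  shows "xfract (Gamma q I (D_coeff N J k)) = (\<Prod>i\<in>J. g i powi k) * ratio_prod g J ({1..N} - J)"
  unfolding D_coeff_def Gamma_mult[OF assms(1)] Gamma_prod[OF assms(1)] xfract_simps xfract_prod
    ratio_prod_def g_def
  by (intro arg_cong2[of _ _ _ _ "(*)"] prod.cong refl xfract_Gamma_xratio xfract_Gamma_xvar_power assms(1,2)) auto

lemma ratio_prod_union_left:
  "finite I \<Longrightarrow> finite I' \<Longrightarrow> I \<inter> I' = {} \<Longrightarrow> ratio_prod x (I \<union> I') J = ratio_prod x I J * ratio_prod x I' J"
  by (simp add: ratio_prod_def prod.union_disjoint)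

lemma ratio_prod_union_right:
  "finite J \<Longrightarrow> finite J' \<Longrightarrow> J \<inter> J' = {} \<Longrightarrow> ratio_prod x I (J \<union> J') = ratio_prod x I J * ratio_prod x I J'"
  by (simp add: ratio_prod_def prod.union_disjoint prod.distrib)

lemma prod_powi: "(\<Prod>i\<in>A. f i powi k) = (\<Prod>i\<in>A. f i :: 'a::field) powi k"
  by (induction A rule: infinite_finite_induct) (auto simp: power_int_mult_distrib)

text \<open>
  The part of a composed coefficient that depends only on the index sets K (common to both operators)
  and L (belonging to exactly one of them).
\<close>

definition common_coeff :: "'a::field \<Rightarrow> (nat \<Rightarrow> 'a) \<Rightarrow> nat set \<Rightarrow> nat set \<Rightarrow> nat set \<Rightarrow> 'a" where
  "common_coeff Q x K L R = ratio_prod x K L * ratio_prod x K R * ratio_prod x L R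
     * (\<Prod>i\<in>K. \<Prod>j\<in>R. Q * x i / (Q * x i - x j))"

text \<open>K lies in both index sets, P only in the first, R only in the second, U in neither, and
  g is x after the first shift. Between K and P both variables are shifted and q cancels; pairs from
  P and R occur in both coefficients and form \<open>cross\<close>. The common exponent s
  contributes only factors that do not see how P and R divide their union.\<close>

lemma composed_coeff:
  fixes x :: "nat \<Rightarrow> 'a::field"
  assumes fin: "finite K" "finite P" "finite R" "finite U"
    and disj: "K \<inter> P = {}" "K \<inter> R = {}" "K \<inter> U = {}" "P \<inter> R = {}" "P \<inter> U = {}" "R \<inter> U = {}"
    and nz: "Q \<noteq> 0" "\<And>i. x i \<noteq> 0"
  defines "g \<equiv> \<lambda>i. (if i \<in> K \<union> P then Q else 1) * x i"
  shows "(\<Prod>i\<in>K \<union> P. x i powi (s + int k)) * ratio_prod x (K \<union> P) (R \<union> U)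
      * ((\<Prod>i\<in>K \<union> R. g i powi (s + int l)) * ratio_prod g (K \<union> R) (P \<union> U))
    = common_coeff Q x K (P \<union> R) U * (\<Prod>i\<in>K. x i) powi (2 * s + int (k + l)) * (\<Prod>i\<in>P \<union> R. x i) powi s
      * Q powi ((s + int l) * int (card K))
      * ((\<Prod>i\<in>P. x i) ^ k * (\<Prod>i\<in>R. x i) ^ l * cross Q x P R)"
proof -
  have nzp: "(\<Prod>i\<in>A. x i) \<noteq> 0" for A using nz(2) by (cases "finite A") auto
  have KP: "ratio_prod g K P = ratio_prod x K P"
    unfolding ratio_prod_def
  proof (intro prod.cong refl)
    fix i j assume "i \<in> K" "j \<in> P"
    then have "g i = Q * x i" "g j = Q * x j" by (auto simp: g_def)
    then show "g i / (g i - g j) = x i / (x i - x j)"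
      using nz(1) by (simp add: right_diff_distrib[symmetric])
  qed
  have KU: "ratio_prod g K U = (\<Prod>i\<in>K. \<Prod>j\<in>U. Q * x i / (Q * x i - x j))"
    unfolding ratio_prod_def
  proof (intro prod.cong refl)
    fix i j assume "i \<in> K" "j \<in> U"
    then have "g i = Q * x i" "g j = x j" using disj by (auto simp: g_def)
    then show "g i / (g i - g j) = Q * x i / (Q * x i - x j)" by simp
  qed
  have RU: "ratio_prod g R U = ratio_prod x R U"
    unfolding ratio_prod_def
  proof (intro prod.cong refl)
    fix i j assume "i \<in> R" "j \<in> U"
    then have "g i = x i" "g j = x j" using disj by (auto simp: g_def)
    then show "g i / (g i - g j) = x i / (x i - x j)" by simp
  qed
  have "ratio_prod g R P = (\<Prod>i\<in>P. \<Prod>j\<in>R. g j / (g j - g i))"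
    unfolding ratio_prod_def by (rule prod.swap)
  also have "\<dots> = (\<Prod>i\<in>P. \<Prod>j\<in>R. x j / (x j - Q * x i))"
  proof (intro prod.cong refl)
    fix i j assume "i \<in> P" "j \<in> R"
    then have "g i = Q * x i" "g j = x j" using disj by (auto simp: g_def)
    then show "g j / (g j - g i) = x j / (x j - Q * x i)" by simp
  qed
  finally have PR: "ratio_prod x P R * ratio_prod g R P = cross Q x P R"
    by (simp add: ratio_prod_def cross_def prod.distrib[symmetric])
  have gprod: "(\<Prod>i\<in>K \<union> R. g i) = Q ^ card K * (\<Prod>i\<in>K. x i) * (\<Prod>i\<in>R. x i)"
  proof -
    have "(\<Prod>i\<in>K. g i) = (\<Prod>i\<in>K. Q * x i)" by (rule prod.cong) (auto simp: g_def)
    moreover have "(\<Prod>i\<in>R. g i) = (\<Prod>i\<in>R. x i)" by (rule prod.cong) (use disj in \<open>auto simp: g_def\<close>)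
    ultimately show ?thesis using fin disj by (simp add: prod.union_disjoint prod.distrib)
  qed
  have pw: "(\<Prod>i\<in>K \<union> P. x i powi (s + int k)) * (\<Prod>i\<in>K \<union> R. g i powi (s + int l))
    = (\<Prod>i\<in>K. x i) powi (2 * s + int (k + l)) * (\<Prod>i\<in>P \<union> R. x i) powi s * Q powi ((s + int l) * int (card K))
      * ((\<Prod>i\<in>P. x i) ^ k * (\<Prod>i\<in>R. x i) ^ l)"
  proof -
    have "(\<Prod>i\<in>K. x i) powi (2 * s + int (k + l)) = (\<Prod>i\<in>K. x i) powi (s + int k) * (\<Prod>i\<in>K. x i) powi (s + int l)"
      by (subst power_int_add[symmetric]) (use nzp in \<open>auto simp: algebra_simps\<close>)
    moreover have "Q powi ((s + int l) * int (card K)) = (Q ^ card K) powi (s + int l)"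
      by (metis mult.commute power_int_mult power_int_of_nat)
    moreover have "(\<Prod>i\<in>K \<union> P. x i) = (\<Prod>i\<in>K. x i) * (\<Prod>i\<in>P. x i)" "(\<Prod>i\<in>P \<union> R. x i) = (\<Prod>i\<in>P. x i) * (\<Prod>i\<in>R. x i)"
      using fin disj by (simp_all add: prod.union_disjoint)
    ultimately show ?thesis
      unfolding prod_powi gprod by (simp add: power_int_mult_distrib power_int_add nzp)
  qed
  have e1: "ratio_prod x (K \<union> P) (R \<union> U) = ratio_prod x K R * ratio_prod x K U * ratio_prod x P R * ratio_prod x P U"
    using fin disj by (simp add: ratio_prod_union_left ratio_prod_union_right)
  have e2: "ratio_prod g (K \<union> R) (P \<union> U) = ratio_prod x K P * ratio_prod g K U * ratio_prod g R P * ratio_prod x R U"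
    using fin disj by (simp add: ratio_prod_union_left ratio_prod_union_right KP RU)
  have e3: "common_coeff Q x K (P \<union> R) U = ratio_prod x K P * ratio_prod x K R * ratio_prod x K U
      * (ratio_prod x P U * ratio_prod x R U) * ratio_prod g K U"
    using fin disj by (simp add: common_coeff_def KU ratio_prod_union_left ratio_prod_union_right)
  have "(\<Prod>i\<in>K \<union> P. x i powi (s + int k)) * ratio_prod x (K \<union> P) (R \<union> U)
      * ((\<Prod>i\<in>K \<union> R. g i powi (s + int l)) * ratio_prod g (K \<union> R) (P \<union> U))
    = common_coeff Q x K (P \<union> R) U * ((\<Prod>i\<in>K \<union> P. x i powi (s + int k)) * (\<Prod>i\<in>K \<union> R. g i powi (s + int l)))
      * (ratio_prod x P R * ratio_prod g R P)"
    unfolding e1 e2 e3 by (simp only: mult_ac)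
  then show ?thesis unfolding PR pw by (simp only: mult_ac)
qed

definition splittings :: "nat \<Rightarrow> nat \<Rightarrow> (nat set \<times> nat set) set" where
  "splittings N n = {(K, L). K \<subseteq> {1..N} \<and> L \<subseteq> {1..N} - K \<and> card L + 2 * card K = n}"

lemma finite_splittings: "finite (splittings N n)"
  by (rule finite_subset[of _ "Pow {1..N} \<times> Pow {1..N}"]) (auto simp: splittings_def)

text \<open>A pair (I, J) is encoded by its intersection, its symmetric difference and I - J. The
  first two determine the total shift, so terms with equal shift are collected.\<close>

lemma sum_pairs_splittings:
  fixes f :: "nat set \<Rightarrow> nat set \<Rightarrow> 'b::comm_monoid_add"
  shows "(\<Sum>I | I \<subseteq> {1..N} \<and> card I = a. \<Sum>J | J \<subseteq> {1..N} \<and> card J = b. f I J)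
    = (\<Sum>(K, L)\<in>splittings N (a + b). \<Sum>P | P \<subseteq> L \<and> card K + card P = a. f (K \<union> P) (K \<union> (L - P)))"
proof -
  let ?I = "{I. I \<subseteq> {1..N} \<and> card I = a}" and ?J = "{J. J \<subseteq> {1..N} \<and> card J = b}"
  let ?P = "\<lambda>z. {P. P \<subseteq> snd z \<and> card (fst z) + card P = a}"
  have finP: "finite (?P z)" if "z \<in> splittings N (a + b)" for z
  proof -
    have "snd z \<subseteq> {1..N}" using that by (auto simp: splittings_def)
    then have "finite (snd z)" by (rule finite_subset) simp
    then show ?thesis by simp
  qed
  have "(\<Sum>I\<in>?I. \<Sum>J\<in>?J. f I J) = (\<Sum>(I, J)\<in>?I \<times> ?J. f I J)"
    by (rule sum.cartesian_product)
  also have "\<dots> = (\<Sum>(z, P)\<in>Sigma (splittings N (a + b)) ?P. f (fst z \<union> P) (fst z \<union> (snd z - P)))"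
  proof (rule sum.reindex_bij_witness[of _ "\<lambda>(z, P). (fst z \<union> P, fst z \<union> (snd z - P))"
        "\<lambda>(I, J). ((I \<inter> J, (I \<union> J) - (I \<inter> J)), I - J)"], goal_cases)
    case (1 y)
    obtain I J where y: "y = (I, J)" by (cases y)
    have "I \<inter> J \<union> (I - J) = I" "I \<inter> J \<union> (I \<union> J - I \<inter> J - (I - J)) = J" by blast+
    then show ?case by (simp add: y)
  next
    case (2 y)
    obtain I J where y: "y = (I, J)" by (cases y)
    have IJ: "I \<subseteq> {1..N}" "J \<subseteq> {1..N}" "card I = a" "card J = b" using 2 by (auto simp: y)
    then have fin: "finite I" "finite J" by (auto intro: finite_subset)
    have c1: "card (I \<inter> J) + card (I - J) = a"
      using card_Int_Diff[OF fin(1), of J] IJ by simp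
    have "(I \<union> J) - (I \<inter> J) = (I - J) \<union> (J - I)" by blast
    then have "card ((I \<union> J) - (I \<inter> J)) = card (I - J) + card (J - I)"
      using fin card_Un_disjoint[of "I - J" "J - I"] by auto
    moreover have "card (J \<inter> I) + card (J - I) = b"
      using card_Int_Diff[OF fin(2), of I] IJ by simp
    ultimately have "card ((I \<union> J) - (I \<inter> J)) + 2 * card (I \<inter> J) = a + b"
      using c1 by (simp add: Int_commute)
    then show ?case using IJ c1 by (auto simp: y splittings_def)
  next
    case (3 w)
    obtain K L P where w: "w = ((K, L), P)" by (cases w) auto
    have P: "P \<subseteq> L" "L \<inter> K = {}" using 3 by (auto simp: w splittings_def)
    then have "(K \<union> P) \<inter> (K \<union> (L - P)) = K" "(K \<union> P) \<union> (K \<union> (L - P)) - (K \<union> P) \<inter> (K \<union> (L - P)) = L"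
      "(K \<union> P) - (K \<union> (L - P)) = P" by blast+
    then show ?case by (simp add: w)
  next
    case (4 w)
    obtain K L P where w: "w = ((K, L), P)" by (cases w) auto
    have P: "P \<subseteq> L" "L \<subseteq> {1..N}" "K \<subseteq> {1..N}" "L \<inter> K = {}" "card K + card P = a" "card L + 2 * card K = a + b"
      using 4 by (auto simp: w splittings_def)
    have fin: "finite K" "finite L" "finite P"
      using P by (meson finite_atLeastAtMost finite_subset subset_trans)+
    have "K \<inter> P = {}" "K \<inter> (L - P) = {}" using P by auto
    then have "card (K \<union> P) = a" "card (K \<union> (L - P)) = card K + (card L - card P)"
      using P fin by (simp_all add: card_Un_disjoint card_Diff_subset)
    moreover have "card P \<le> card L" using P fin by (simp add: card_mono)
    ultimately show ?case using P by (auto simp: w)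
  next
    case (5 y)
    obtain I J where y: "y = (I, J)" by (cases y)
    have "I \<inter> J \<union> (I - J) = I" "I \<inter> J \<union> (I \<union> J - I \<inter> J - (I - J)) = J" by blast+
    then show ?case by (simp add: y)
  qed
  also have "\<dots> = (\<Sum>z\<in>splittings N (a + b). \<Sum>P\<in>?P z. f (fst z \<union> P) (fst z \<union> (snd z - P)))"
    by (rule sum.Sigma[symmetric]) (use finite_splittings finP in auto)
  finally show ?thesis by (simp add: case_prod_unfold)
qed

text \<open>The guard is needed because a - card K is truncated subtraction: otherwise card K > a
  would select the sum over the empty subset.\<close>

definition composed_split :: "complex \<Rightarrow> nat \<Rightarrow> nat \<Rightarrow> nat \<Rightarrow> nat set \<Rightarrow> nat set \<Rightarrow> xseries fract" where
  "composed_split q a k l K L = (if card K \<le> a then split_sum (cfract q) vfract L (a - card K) k l else 0)"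

text \<open>Depends on the two operators only through s and the sum n of the extra exponents. It is
  therefore the same in all compositions to be compared, and the relations hold for each (K, L)
  separately.\<close>

definition composed_weight :: "nat \<Rightarrow> complex \<Rightarrow> int \<Rightarrow> nat \<Rightarrow> xseries \<Rightarrow> nat set \<Rightarrow> nat set \<Rightarrow> xseries fract" where
  "composed_weight N q s n F K L =
     common_coeff (cfract q) vfract K L ({1..N} - K - L) * (\<Prod>i\<in>K. vfract i) powi (2 * s + int n)
     * (\<Prod>i\<in>L. vfract i) powi s * xfract (Gamma q K (Gamma q K (Gamma q L F)))"

text \<open>The exponents are written as s + k and s + l with natural k and l because the polynomial
  argument needs nonnegative powers. The explicit power of q arises where the first shift meets
  x_i^(s+l) with i in K.\<close>

lemma D_op_comp:
  assumes q: "q \<noteq> 0"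
  shows "xfract (D_op N q a (s + int k) (D_op N q b (s + int l) F))
    = (\<Sum>(K, L)\<in>splittings N (a + b). composed_weight N q s (k + l) F K L
        * (cfract (q powi ((s + int l) * int (card K))) * composed_split q a k l K L))"
proof -
  let ?c = "\<lambda>I J. xfract (D_coeff N I (s + int k) * Gamma q I (D_coeff N J (s + int l)) * Gamma q I (Gamma q J F))"
  have "xfract (D_op N q a (s + int k) (D_op N q b (s + int l) F))
    = (\<Sum>I | I \<subseteq> {1..N} \<and> card I = a. \<Sum>J | J \<subseteq> {1..N} \<and> card J = b. ?c I J)"
    by (simp add: D_op_eq Gamma_sum Gamma_mult[OF q] xfract_sum sum_distrib_left mult.assoc)
  also have "\<dots> = (\<Sum>(K, L)\<in>splittings N (a + b). \<Sum>P | P \<subseteq> L \<and> card K + card P = a. ?c (K \<union> P) (K \<union> (L - P)))"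
    by (rule sum_pairs_splittings)
  also have "\<dots> = (\<Sum>(K, L)\<in>splittings N (a + b). composed_weight N q s (k + l) F K L
        * (cfract (q powi ((s + int l) * int (card K))) * composed_split q a k l K L))"
  proof (intro sum.cong refl, clarify)
    fix K L assume "(K, L) \<in> splittings N (a + b)"
    then have KL: "K \<subseteq> {1..N}" "L \<subseteq> {1..N}" "K \<inter> L = {}" by (auto simp: splittings_def)
    have fin: "finite K" "finite L" using KL by (auto intro: finite_subset)
    let ?U = "{1..N} - K - L"
    have c: "?c (K \<union> P) (K \<union> (L - P)) = composed_weight N q s (k + l) F K L
        * (cfract (q powi ((s + int l) * int (card K)))
        * ((\<Prod>i\<in>P. vfract i) ^ k * (\<Prod>i\<in>L - P. vfract i) ^ l * cross (cfract q) vfract P (L - P)))" if P: "P \<subseteq> L" for P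
    proof -
      have finP: "finite P" "finite (L - P)" using P fin finite_subset by auto
      have sets: "{1..N} - (K \<union> P) = (L - P) \<union> ?U" "{1..N} - (K \<union> (L - P)) = P \<union> ?U" "P \<union> (L - P) = L"
        using P KL by blast+
      have disj: "K \<inter> P = {}" "K \<inter> (L - P) = {}" "K \<inter> ?U = {}" "P \<inter> (L - P) = {}" "P \<inter> ?U = {}" "(L - P) \<inter> ?U = {}"
        using P KL by blast+
      \<comment> \<open>The composed shift multiplies the variables in K by q^2 and those in L by q,
        however L is divided.\<close>
      have G: "Gamma q (K \<union> P) (Gamma q (K \<union> (L - P)) F) = Gamma q K (Gamma q K (Gamma q L F))"
      proof (rule xseries_eqI)
        fix h
        have "qpow q (K \<union> P) h = qpow q K h * qpow q P h" "qpow q (K \<union> (L - P)) h = qpow q K h * qpow q (L - P) h"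
          unfolding qpow_def using fin finP disj by (simp_all add: prod.union_disjoint)
        moreover have "qpow q L h = qpow q P h * qpow q (L - P) h"
          unfolding qpow_def by (subst sets(3)[symmetric], rule prod.union_disjoint) (use finP in auto)
        ultimately show "xcoeff (Gamma q (K \<union> P) (Gamma q (K \<union> (L - P)) F)) h = xcoeff (Gamma q K (Gamma q K (Gamma q L F))) h"
          by simp
      qed
      have "xfract (D_coeff N (K \<union> P) (s + int k)) * xfract (Gamma q (K \<union> P) (D_coeff N (K \<union> (L - P)) (s + int l)))
        = common_coeff (cfract q) vfract K L ?U * (\<Prod>i\<in>K. vfract i) powi (2 * s + int (k + l)) * (\<Prod>i\<in>L. vfract i) powi s
          * cfract q powi ((s + int l) * int (card K))
          * ((\<Prod>i\<in>P. vfract i) ^ k * (\<Prod>i\<in>L - P. vfract i) ^ l * cross (cfract q) vfract P (L - P))"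
      proof -
        have finKP: "finite (K \<union> P)" using fin finP by simp
        have finKR: "finite (K \<union> (L - P))" using fin finP by simp
        show ?thesis
          unfolding xfract_D_coeff[OF finKP] xfract_Gamma_D_coeff[OF q finKP] sets(1,2)
          using composed_coeff[OF fin(1) finP _ disj, of "cfract q" vfract s k l] q unfolding sets(3) by simp
      qed
      then show ?thesis
        unfolding G composed_weight_def xfract_simps cfract_powi[OF q] by (simp add: mult_ac)
    qed
    have "(\<Sum>P | P \<subseteq> L \<and> card K + card P = a. ?c (K \<union> P) (K \<union> (L - P)))
       = composed_weight N q s (k + l) F K L * (cfract (q powi ((s + int l) * int (card K)))
          * (\<Sum>P | P \<subseteq> L \<and> card K + card P = a. (\<Prod>i\<in>P. vfract i) ^ k * (\<Prod>i\<in>L - P. vfract i) ^ l * cross (cfract q) vfract P (L - P)))"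
      unfolding sum_distrib_left by (intro sum.cong refl c) auto
    also have "(\<Sum>P | P \<subseteq> L \<and> card K + card P = a. (\<Prod>i\<in>P. vfract i) ^ k * (\<Prod>i\<in>L - P. vfract i) ^ l * cross (cfract q) vfract P (L - P))
       = composed_split q a k l K L"
    proof (cases "card K \<le> a")
      case True
      then have "{P. P \<subseteq> L \<and> card K + card P = a} = {P. P \<subseteq> L \<and> card P = a - card K}" by auto
      then show ?thesis using True by (simp add: composed_split_def split_sum_def)
    next
      case False
      then have "{P. P \<subseteq> L \<and> card K + card P = a} = {}" by auto
      then show ?thesis using False by (simp add: composed_split_def)
    qed
    finally show "(\<Sum>P | P \<subseteq> L \<and> card K + card P = a. ?c (K \<union> P) (K \<union> (L - P)))
       = composed_weight N q s (k + l) F K L * (cfract (q powi ((s + int l) * int (card K))) * composed_split q a k l K L)" .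
  qed
  finally show ?thesis .
qed

section \<open>Commutation relations and the Q-system for the operators in x\<close>

lemma split_sum_gt:
  assumes "finite L" "card L < p"
  shows "split_sum q x L p k l = 0"
proof -
  have "{P. P \<subseteq> L \<and> card P = p} = {}" using assms(2) by (auto dest: card_mono[OF assms(1)])
  then show ?thesis by (simp only: split_sum_def sum.empty)
qed

lemma splittingsD:
  assumes "(K, L) \<in> splittings N n"
  shows "finite K" "finite L" "card L + 2 * card K = n"
proof -
  have "K \<subseteq> {1..N}" "L \<subseteq> {1..N}" using assms by (auto simp: splittings_def)
  then show "finite K" "finite L" by (meson finite_atLeastAtMost finite_subset)+
qed (use assms in \<open>simp add: splittings_def\<close>)

theorem D_op_commute:
  assumes "q \<noteq> 0" "norm q < 1"
  shows "D_op N q a 0 (D_op N q b 0 F) = D_op N q b 0 (D_op N q a 0 F)"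
proof -
  have "composed_split q a 0 0 K L = composed_split q b 0 0 K L" if KL: "(K, L) \<in> splittings N (a + b)" for K L
  proof -
    note d = splittingsD[OF KL]
    consider "card K \<le> a" "card K \<le> b" | "card K > a" "card K \<le> b" | "card K \<le> a" "card K > b" | "card K > a" "card K > b" by linarith
    then show ?thesis
    proof cases
      case 1
      then show ?thesis unfolding composed_split_def
        using split_sum_symmetric[OF generic_vfract[OF assms] d(2), of "a - card K" "b - card K"] d(3) by simp
    next
      case 2
      \<comment> \<open>One side is 0 by the guard; on the other the required size b - card K
        exceeds card L = a + b - 2 card K.\<close>
      then show ?thesis using d by (simp add: composed_split_def split_sum_gt)
    next
      case 3
      then show ?thesis using d by (simp add: composed_split_def split_sum_gt)
    qed (simp add: composed_split_def)
  qed
  then have "xfract (D_op N q a (0 + int 0) (D_op N q b (0 + int 0) F)) = xfract (D_op N q b (0 + int 0) (D_op N q a (0 + int 0) F))"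
    unfolding D_op_comp[OF assms(1)] add.commute[of b a] by (intro sum.cong refl) auto
  then show ?thesis by simp
qed

text \<open>Each common index gives one q through the shift of x_i, and
  \<open>split_sum_shift\<close> gives the minimum of a - card K and b - card K. The total exponent
  min a b does not depend on K.\<close>

theorem D_op_0_1_commute:
  assumes "q \<noteq> 0" "norm q < 1"
  shows "D_op N q a 0 (D_op N q b 1 F) = xconst (q ^ min a b) * D_op N q b 1 (D_op N q a 0 F)"
proof -
  have eq: "cfract (q powi int (card K)) * composed_split q a 0 1 K L = cfract (q ^ min a b) * composed_split q b 1 0 K L"
    if KL: "(K, L) \<in> splittings N (a + b)" for K L
  proof -
    note d = splittingsD[OF KL]
    consider "card K \<le> a" "card K \<le> b" | "card K > a" "card K \<le> b" | "card K \<le> a" "card K > b" | "card K > a" "card K > b" by linarith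
    then show ?thesis
    proof cases
      case 1
      have "cfract q ^ card K * cfract q ^ min (a - card K) (b - card K) = cfract q ^ min a b"
        unfolding power_add[symmetric] by (rule arg_cong[where f = "power (cfract q)"]) (use 1 in auto)
      moreover have "cfract (q ^ n) = cfract q ^ n" for n
        using cfract_powi[OF assms(1), of "int n"] by simp
      ultimately show ?thesis unfolding composed_split_def
        using split_sum_shift[OF generic_vfract[OF assms] d(2), of "a - card K" "b - card K"] d(3) 1
        by (simp add: mult.assoc[symmetric])
    next
      case 2
      then show ?thesis using d by (simp add: composed_split_def split_sum_gt)
    next
      case 3
      then show ?thesis using d by (simp add: composed_split_def split_sum_gt)
    qed (simp add: composed_split_def)
  qed
  have "xfract (D_op N q a (0 + int 0) (D_op N q b (0 + int 1) F))
     = (\<Sum>(K, L)\<in>splittings N (a + b). composed_weight N q 0 1 F K L * (cfract (q ^ min a b) * composed_split q b 1 0 K L))"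
    unfolding D_op_comp[OF assms(1)] by (intro sum.cong refl) (auto simp: eq[simplified])
  also have "\<dots> = cfract (q ^ min a b) * xfract (D_op N q b (0 + int 1) (D_op N q a (0 + int 0) F))"
    unfolding D_op_comp[OF assms(1)] add.commute[of b a] sum_distrib_left
    by (intro sum.cong refl) (auto simp: mult_ac)
  finally show ?thesis by (simp add: xfract_simps(5)[symmetric] del: xfract_simps(5))
qed

text \<open>With base exponent k - 1 the three products have extra exponents (2, 0), (1, 1), (1, 1)
  and the same total index, so they share their weights and \<open>split_sum_Q_system\<close>
  applies to each L.\<close>

theorem D_op_Q_system:
  assumes "q \<noteq> 0" "norm q < 1"
  shows "xconst (q ^ Suc a) * D_op N q (Suc a) (k + 1) (D_op N q (Suc a) (k - 1) F)
    = D_op N q (Suc a) k (D_op N q (Suc a) k F) - D_op N q a k (D_op N q (Suc (Suc a)) k F)"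
proof -
  have eq: "cfract (q ^ Suc a) * (cfract (q powi ((k - 1) * int (card K))) * composed_split q (Suc a) 2 0 K L)
     = cfract (q powi (k * int (card K))) * composed_split q (Suc a) 1 1 K L
       - cfract (q powi (k * int (card K))) * composed_split q a 1 1 K L"
    if KL: "(K, L) \<in> splittings N (Suc a + Suc a)" for K L
  proof -
    note d = splittingsD[OF KL]
    have "card K \<le> Suc a" using d(3) by simp
    have pw: "q ^ Suc a * q powi ((k - 1) * int (card K)) = q powi (k * int (card K)) * q ^ (Suc a - card K)"
    proof -
      have "int (Suc a - card K) = int (Suc a) - int (card K)" using \<open>card K \<le> Suc a\<close> by simp
      then have "int (Suc a) + (k - 1) * int (card K) = k * int (card K) + int (Suc a - card K)"
        by (simp add: algebra_simps)
      then show ?thesis using assms(1) by (metis power_int_add power_int_of_nat)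
    qed
    have pw': "cfract (q ^ Suc a) * (cfract (q powi ((k - 1) * int (card K))) * Y)
      = cfract (q powi (k * int (card K))) * (cfract (q ^ (Suc a - card K)) * Y)" for Y
      unfolding mult.assoc[symmetric] xfract_simps(5)[symmetric] xconst_mult[symmetric] pw ..
    show ?thesis
    proof (cases "card K = Suc a")
      case True
      \<comment> \<open>L is empty: the first two sums are 1 and the third term falls to the
        guard.\<close>
      then show ?thesis unfolding pw' using d by (simp add: composed_split_def split_sum_0)
    next
      case False
      then have le: "card K \<le> a" using \<open>card K \<le> Suc a\<close> by simp
      have c: "card L = 2 * Suc (a - card K)" using d(3) le by simp
      have "cfract (q ^ n) = cfract q ^ n" for n
        using cfract_powi[OF assms(1), of "int n"] by simp
      then show ?thesis unfolding pw' composed_split_def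
        using split_sum_Q_system[OF generic_vfract[OF assms] d(2) c] le
        by (simp add: Suc_diff_le right_diff_distrib del: power_Suc)
    qed
  qed
  have k: "k - 1 + int 2 = k + 1" "k - 1 + int 1 = k" "k - 1 + int 0 = k - 1" "(2::nat) + 0 = 2" "(1::nat) + 1 = 2"
      "a + Suc (Suc a) = Suc a + Suc a"
    by simp_all
  note 1 = D_op_comp[OF assms(1), of N "Suc a" "k - 1" 2 "Suc a" 0 F, unfolded k]
  note 2 = D_op_comp[OF assms(1), of N "Suc a" "k - 1" 1 "Suc a" 1 F, unfolded k]
  note 3 = D_op_comp[OF assms(1), of N a "k - 1" 1 "Suc (Suc a)" 1 F, unfolded k]
  have "xfract (xconst (q ^ Suc a) * D_op N q (Suc a) (k + 1) (D_op N q (Suc a) (k - 1) F))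
    = xfract (D_op N q (Suc a) k (D_op N q (Suc a) k F) - D_op N q a k (D_op N q (Suc (Suc a)) k F))"
    unfolding xfract_simps(4,5) 1 2 3 sum_subtractf[symmetric] sum_distrib_left
  proof (rule sum.cong[OF refl], clarify)
    fix K L assume KL: "(K, L) \<in> splittings N (Suc a + Suc a)"
    let ?w = "composed_weight N q (k - 1) 2 F K L"
    have "cfract (q ^ Suc a) * (?w * (cfract (q powi ((k - 1) * int (card K))) * composed_split q (Suc a) 2 0 K L))
      = ?w * (cfract (q ^ Suc a) * (cfract (q powi ((k - 1) * int (card K))) * composed_split q (Suc a) 2 0 K L))"
      by (rule mult.left_commute)
    also have "\<dots> = ?w * (cfract (q powi (k * int (card K))) * composed_split q (Suc a) 1 1 K L)
        - ?w * (cfract (q powi (k * int (card K))) * composed_split q a 1 1 K L)"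
      unfolding eq[OF KL] by (rule right_diff_distrib)
    finally show "cfract (q ^ Suc a) * (?w * (cfract (q powi ((k - 1) * int (card K))) * composed_split q (Suc a) 2 0 K L))
      = \<dots>" .
  qed
  then show ?thesis by (simp only: xfract_eq_iff)
qed

text \<open>Needed for the induction towards negative k, where the operator with k - 1 is applied
  after the one with k + 1.\<close>

theorem D_op_Q_system':
  assumes "q \<noteq> 0" "norm q < 1"
  shows "D_op N q (Suc a) (k - 1) (D_op N q (Suc a) (k + 1) F)
    = xconst (q ^ Suc a) * D_op N q (Suc a) k (D_op N q (Suc a) k F)
      - xconst (q ^ a) * D_op N q a k (D_op N q (Suc (Suc a)) k F)"
proof -
  have eq: "cfract (q powi ((k + 1) * int (card K))) * composed_split q (Suc a) 0 2 K L
     = cfract (q ^ Suc a) * (cfract (q powi (k * int (card K))) * composed_split q (Suc a) 1 1 K L)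
       - cfract (q ^ a) * (cfract (q powi (k * int (card K))) * composed_split q a 1 1 K L)"
    if KL: "(K, L) \<in> splittings N (Suc a + Suc a)" for K L
  proof -
    note d = splittingsD[OF KL]
    have "card K \<le> Suc a" using d(3) by simp
    have "q powi ((k + 1) * int (card K)) = q powi (k * int (card K)) * q ^ card K"
      using assms(1) by (simp add: distrib_right power_int_add)
    then have pw: "cfract (q powi ((k + 1) * int (card K))) * Y
      = cfract (q powi (k * int (card K))) * (cfract (q ^ card K) * Y)" for Y
      by (simp add: xconst_mult)
    have c: "cfract (q ^ n) = cfract q ^ n" for n
      using cfract_powi[OF assms(1), of "int n"] by simp
    show ?thesis
    proof (cases "card K = Suc a")
      case True
      then show ?thesis unfolding pw using d by (simp add: composed_split_def split_sum_0)
    next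
      case False
      then have le: "card K \<le> a" using \<open>card K \<le> Suc a\<close> by simp
      have L: "card L = 2 * Suc (a - card K)" using d(3) le by simp
      have e: "cfract q ^ card K * cfract q ^ Suc (a - card K) = cfract q ^ Suc a"
        "cfract q ^ card K * cfract q ^ (a - card K) = cfract q ^ a"
        unfolding power_add[symmetric] using le by simp_all
      have "cfract q ^ card K * split_sum (cfract q) vfract L (Suc (a - card K)) 0 2
        = (cfract q ^ card K * cfract q ^ Suc (a - card K)) * split_sum (cfract q) vfract L (Suc (a - card K)) 1 1
        - (cfract q ^ card K * cfract q ^ (a - card K)) * split_sum (cfract q) vfract L (a - card K) 1 1"
        unfolding split_sum_Q_system'[OF generic_vfract[OF assms] d(2) L] by (simp only: right_diff_distrib mult.assoc)
      then have e': "cfract (q ^ card K) * composed_split q (Suc a) 0 2 K L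
        = cfract (q ^ Suc a) * composed_split q (Suc a) 1 1 K L - cfract (q ^ a) * composed_split q a 1 1 K L"
        unfolding e c composed_split_def using le by (simp only: Suc_diff_le le_SucI if_True)
      show ?thesis unfolding pw e' by (simp only: right_diff_distrib mult.left_commute)
    qed
  qed
  have k: "k - 1 + int 2 = k + 1" "k - 1 + int 1 = k" "k - 1 + int 0 = k - 1" "(0::nat) + 2 = 2" "(1::nat) + 1 = 2"
      "a + Suc (Suc a) = Suc a + Suc a"
    by simp_all
  note 1 = D_op_comp[OF assms(1), of N "Suc a" "k - 1" 0 "Suc a" 2 F, unfolded k]
  note 2 = D_op_comp[OF assms(1), of N "Suc a" "k - 1" 1 "Suc a" 1 F, unfolded k]
  note 3 = D_op_comp[OF assms(1), of N a "k - 1" 1 "Suc (Suc a)" 1 F, unfolded k]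
  have "xfract (D_op N q (Suc a) (k - 1) (D_op N q (Suc a) (k + 1) F))
    = xfract (xconst (q ^ Suc a) * D_op N q (Suc a) k (D_op N q (Suc a) k F)
      - xconst (q ^ a) * D_op N q a k (D_op N q (Suc (Suc a)) k F))"
    unfolding xfract_simps(4,5) 1 2 3 sum_distrib_left sum_subtractf[symmetric]
  proof (rule sum.cong[OF refl], clarify)
    fix K L assume KL: "(K, L) \<in> splittings N (Suc a + Suc a)"
    show "composed_weight N q (k - 1) 2 F K L * (cfract (q powi ((k + 1) * int (card K))) * composed_split q (Suc a) 0 2 K L)
      = cfract (q ^ Suc a) * (composed_weight N q (k - 1) 2 F K L * (cfract (q powi (k * int (card K))) * composed_split q (Suc a) 1 1 K L))
        - cfract (q ^ a) * (composed_weight N q (k - 1) 2 F K L * (cfract (q powi (k * int (card K))) * composed_split q a 1 1 K L))"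
      unfolding eq[OF KL] right_diff_distrib by (simp only: mult.left_commute)
  qed
  then show ?thesis by (simp only: xfract_eq_iff)
qed

section \<open>Joint eigenfunctions\<close>

definition between :: "nat \<Rightarrow> wt \<Rightarrow> wt \<Rightarrow> wt set" where
  "between N m l = {n. n - m \<in> Qplus N \<and> l - n \<in> Qplus N}"

text \<open>The partial sums of n - m lie between 0 and those of l - m. Finiteness of these
  intervals makes the eigenvalue equations finite recursions.\<close>

lemma finite_between: "finite (between N m l)"
proof -
  let ?B = "\<Sum>j\<in>Poly_Mapping.keys (l - m). \<bar>wt_entry (l - m) j\<bar>"
  let ?S = "{g :: wt. Poly_Mapping.keys g \<subseteq> {..N} \<and> (\<forall>i. \<bar>psum i g\<bar> \<le> ?B)}"
  have "between N m l \<subseteq> (\<lambda>g. m + g) ` ?S"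
  proof
    fix n assume n: "n \<in> between N m l"
    have "n - m \<in> ?S"
    proof (intro CollectI conjI allI)
      show "Poly_Mapping.keys (n - m) \<subseteq> {..N}" using n by (auto simp: between_def Qplus_iff lattice_def)
      fix i
      have "0 \<le> psum i (n - m)" "0 \<le> psum i (l - n)" using n by (auto simp: between_def Qplus_iff simp del: psum_diff)
      moreover have "psum i (l - m) \<le> ?B" by (rule psum_le_total)
      ultimately show "\<bar>psum i (n - m)\<bar> \<le> ?B" by simp
    qed
    then show "n \<in> (\<lambda>g. m + g) ` ?S" by (intro image_eqI[of _ _ "n - m"]) auto
  qed
  then show ?thesis using finite_bounded_wts finite_subset by blast
qed

lemma between_self: "between N l l = {l}"
proof -
  have "n = l" if "n - l \<in> Qplus N" "l - n \<in> Qplus N" for n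
    using Qplus_antisym[of "n - l" N] that by simp
  then show ?thesis by (auto simp: between_def)
qed

text \<open>On Q+ this is the usual height, the sum of the coordinates in the simple roots; it
  serves as induction measure.\<close>

definition height :: "nat \<Rightarrow> wt \<Rightarrow> nat" where
  "height N g = nat (\<Sum>j\<le>N. psum j g)"

lemma Qplus_pos_psum:
  assumes "g \<in> Qplus N" "g \<noteq> 0"
  shows "\<exists>j\<le>N. psum j g > 0"
proof (rule ccontr)
  assume "\<not> (\<exists>j\<le>N. psum j g > 0)"
  then have z: "psum j g = 0" if "j \<le> N" for j using assms that by (force simp: Qplus_iff not_less intro: antisym)
  have "g = 0"
  proof (rule wt_eq_psumI)
    fix j show "psum j g = psum j 0"
      using z[of j] z[of N] psum_lattice_ge[of g N j] assms(1) by (cases "j \<le> N") (auto simp: Qplus_iff)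
  qed
  then show False using assms by simp
qed

lemma height_less:
  assumes "g \<in> Qplus N" "h - g \<in> Qplus N" "h \<noteq> g"
  shows "height N g < height N h"
proof -
  obtain j where j: "j \<le> N" "psum j (h - g) > 0" using Qplus_pos_psum[OF assms(2)] assms(3) by auto
  have "(\<Sum>j\<le>N. psum j (h - g)) > 0"
    by (rule sum_pos2[of _ j]) (use assms(2) j in \<open>auto simp: Qplus_iff simp del: psum_diff\<close>)
  then have "(\<Sum>j\<le>N. psum j g) < (\<Sum>j\<le>N. psum j h)" by (simp add: sum_subtractf)
  moreover have "(\<Sum>j\<le>N. psum j g) \<ge> 0" by (rule sum_nonneg) (use assms(1) in \<open>auto simp: Qplus_iff\<close>)
  ultimately show ?thesis unfolding height_def by simp
qed

lemma between_height_less: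
  "n \<in> between N m l \<Longrightarrow> n \<noteq> m \<Longrightarrow> height N (l - n) < height N (l - m)"
  by (rule height_less) (auto simp: between_def)

lemma mem_betweenI: "l - m \<in> Qplus N \<Longrightarrow> m \<in> between N m l"
  by (simp add: between_def)

section \<open>Operators that are triangular in the dominance order\<close>

definition below_supp :: "nat \<Rightarrow> wt \<Rightarrow> xseries \<Rightarrow> bool" where
  "below_supp N l F \<longleftrightarrow> (\<forall>g. xcoeff F g \<noteq> 0 \<longrightarrow> l - g \<in> Qplus N)"

lemma leading_monomial_iff: "leading_monomial N l F \<longleftrightarrow> xcoeff F l = 1 \<and> below_supp N l F"
  by (simp add: leading_monomial_def below_supp_def)

lemma below_supp_xconst_mult: "below_supp N l F \<Longrightarrow> below_supp N l (xconst c * F)"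
  by (simp add: below_supp_def)

lemma below_supp_diff: "below_supp N l F \<Longrightarrow> below_supp N l G \<Longrightarrow> below_supp N l (F - G)"
  unfolding below_supp_def by (metis diff_0_right minus_xseries.rep_eq)

lemma below_supp_sum: "(\<And>i. i \<in> A \<Longrightarrow> below_supp N l (f i)) \<Longrightarrow> below_supp N l (\<Sum>i\<in>A. f i)"
  unfolding below_supp_def xcoeff_sum by (metis sum.neutral)

lemma below_supp_Gamma: "below_supp N l F \<Longrightarrow> below_supp N l (Gamma q I F)"
  by (simp add: below_supp_def)

lemma below_supp_mult:
  assumes "C \<in> neg_series N" "below_supp N l F"
  shows "below_supp N l (C * F)"
  unfolding below_supp_def
proof (intro allI impI)
  fix g assume "xcoeff (C * F) g \<noteq> 0"
  then obtain a where a: "xcoeff C a \<noteq> 0" "xcoeff F (g - a) \<noteq> 0" by (rule xcoeff_mult_nonzero)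
  then have "- a \<in> Qplus N" "l - (g - a) \<in> Qplus N"
    using assms by (auto simp: neg_series_def below_supp_def)
  then have "- a + (l - (g - a)) \<in> Qplus N" by (rule Qplus_add)
  then show "l - g \<in> Qplus N" by simp
qed

text \<open>A common form of the operators with k = 0 and of the Macdonald operator, so that
  triangularity and the recursion are proved once.\<close>

definition shift_op :: "complex \<Rightarrow> 's set \<Rightarrow> ('s \<Rightarrow> xseries) \<Rightarrow> ('s \<Rightarrow> nat set) \<Rightarrow> xseries \<Rightarrow> xseries" where
  "shift_op q S C I F = (\<Sum>s\<in>S. C s * Gamma q (I s) F)"

definition shift_kernel :: "complex \<Rightarrow> 's set \<Rightarrow> ('s \<Rightarrow> xseries) \<Rightarrow> ('s \<Rightarrow> nat set) \<Rightarrow> wt \<Rightarrow> wt \<Rightarrow> complex" where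
  "shift_kernel q S C I m n = (\<Sum>s\<in>S. xcoeff (C s) (m - n) * qpow q (I s) n)"

lemma xcoeff_mult_Gamma:
  assumes "C \<in> neg_series N" "below_supp N l F"
  shows "xcoeff (C * Gamma q I F) m = (\<Sum>n\<in>between N m l. xcoeff C (m - n) * qpow q I n * xcoeff F n)"
proof -
  have "xcoeff (Gamma q I F * C) m = (\<Sum>n\<in>between N m l. xcoeff (Gamma q I F) n * xcoeff C (m - n))"
  proof (rule xcoeff_mult_eq_sum[OF finite_between])
    fix n assume n: "xcoeff (Gamma q I F) n \<noteq> 0" "xcoeff C (m - n) \<noteq> 0"
    then have "- (m - n) \<in> Qplus N" "l - n \<in> Qplus N"
      using assms by (auto simp: neg_series_def below_supp_def simp del: minus_diff_eq)
    then show "n \<in> between N m l" by (simp add: between_def)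
  qed
  then show ?thesis by (simp add: mult_ac)
qed

lemma xcoeff_shift_op:
  assumes "\<And>s. s \<in> S \<Longrightarrow> C s \<in> neg_series N" "below_supp N l F"
  shows "xcoeff (shift_op q S C I F) m = (\<Sum>n\<in>between N m l. shift_kernel q S C I m n * xcoeff F n)"
proof -
  have "xcoeff (shift_op q S C I F) m
      = (\<Sum>s\<in>S. \<Sum>n\<in>between N m l. xcoeff (C s) (m - n) * qpow q (I s) n * xcoeff F n)"
    unfolding shift_op_def xcoeff_sum
    by (rule sum.cong[OF refl], rule xcoeff_mult_Gamma) (use assms in auto)
  also have "\<dots> = (\<Sum>n\<in>between N m l. \<Sum>s\<in>S. xcoeff (C s) (m - n) * qpow q (I s) n * xcoeff F n)"
    by (rule sum.swap)
  finally show ?thesis by (simp add: shift_kernel_def sum_distrib_right)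
qed

lemma below_supp_shift_op:
  assumes "\<And>s. s \<in> S \<Longrightarrow> C s \<in> neg_series N" "below_supp N l F"
  shows "below_supp N l (shift_op q S C I F)"
  unfolding shift_op_def by (intro below_supp_sum below_supp_mult below_supp_Gamma assms)

lemma shift_op_coeff_diag:
  assumes "\<And>s. s \<in> S \<Longrightarrow> C s \<in> neg_series N" "below_supp N l F" "l - m \<in> Qplus N"
  shows "xcoeff (shift_op q S C I F) m
    = shift_kernel q S C I m m * xcoeff F m + (\<Sum>n\<in>between N m l - {m}. shift_kernel q S C I m n * xcoeff F n)"
proof -
  have "xcoeff (shift_op q S C I F) m = (\<Sum>n\<in>between N m l. shift_kernel q S C I m n * xcoeff F n)"
    by (rule xcoeff_shift_op) (use assms in auto)
  then show ?thesis using sum.remove[OF finite_between mem_betweenI[OF assms(3)]] by simp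
qed

text \<open>The coefficients are found in the order of increasing height of l - m. The kernel may
  come from a different operator at each m, as the joint eigenvalue problem requires.\<close>

lemma triangular_solution:
  assumes d: "\<And>m. l - m \<in> Qplus N \<Longrightarrow> m \<noteq> l \<Longrightarrow> d m \<noteq> (0::complex)"
  obtains F where "leading_monomial N l F"
    "\<And>m. l - m \<in> Qplus N \<Longrightarrow> m \<noteq> l \<Longrightarrow> d m * xcoeff F m = (\<Sum>n\<in>between N m l - {m}. K m n * xcoeff F n)"
proof -
  let ?R = "measure (\<lambda>m. height N (l - m))"
  \<comment> \<open>One step of the recursion; \<open>wfrec\<close> passes it values at smaller
    height only, and all n in the sum have smaller height.\<close>
  define H where "H = (\<lambda>f m. if l - m \<notin> Qplus N then 0 else if m = l then 1 else
    (\<Sum>n\<in>between N m l - {m}. K m n * f n) / d m)"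
  define f where "f = wfrec ?R H"
  have f: "f m = H (cut f ?R m) m" for m
    unfolding f_def by (rule wfrec) simp
  have supp: "f m \<noteq> 0 \<Longrightarrow> l - m \<in> Qplus N" for m
    by (subst (asm) f) (auto simp: H_def split: if_splits)
  have fl: "f l = 1" by (subst f) (simp add: H_def)
  have rec: "d m * f m = (\<Sum>n\<in>between N m l - {m}. K m n * f n)" if "l - m \<in> Qplus N" "m \<noteq> l" for m
  proof -
    have "f m = (\<Sum>n\<in>between N m l - {m}. K m n * cut f ?R m n) / d m"
      by (subst f) (simp add: H_def that)
    also have "(\<Sum>n\<in>between N m l - {m}. K m n * cut f ?R m n) = (\<Sum>n\<in>between N m l - {m}. K m n * f n)"
      by (intro sum.cong refl) (auto simp: cut_apply between_height_less)
    finally show ?thesis using d[OF that] by simp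
  qed
  have "bounded_exps f"
    unfolding bounded_exps_def
  proof (intro exI allI impI)
    fix g assume "f g \<noteq> 0"
    then have Q: "l - g \<in> Qplus N" by (rule supp)
    have "Poly_Mapping.keys g = Poly_Mapping.keys (l - (l - g))" by simp
    also have "\<dots> \<subseteq> Poly_Mapping.keys l \<union> Poly_Mapping.keys (l - g)" by (rule keys_diff_subset)
    also have "\<dots> \<subseteq> {..Max (insert N (Poly_Mapping.keys l))}"
    proof -
      have "Poly_Mapping.keys (l - g) \<subseteq> {1..N}" using Q by (auto simp: Qplus_iff lattice_def)
      then show ?thesis by (fastforce simp: Max_ge_iff)
    qed
    finally have 1: "Poly_Mapping.keys g \<subseteq> {..Max (insert N (Poly_Mapping.keys l))}" .
    have "psum i g \<le> (\<Sum>j\<in>Poly_Mapping.keys l. \<bar>wt_entry l j\<bar>)" for i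
    proof -
      have "psum i (l - g) \<ge> 0" using Q by (simp add: Qplus_iff del: psum_diff)
      then show ?thesis using psum_le_total[of i l] by simp
    qed
    with 1 show "Poly_Mapping.keys g \<subseteq> {..Max (insert N (Poly_Mapping.keys l))} \<and>
       (\<forall>i. psum i g \<le> (\<Sum>j\<in>Poly_Mapping.keys l. \<bar>wt_entry l j\<bar>))" by blast
  qed
  then have c: "xcoeff (Abs_xseries f) = f" by (simp add: Abs_xseries_inverse)
  show ?thesis
    by (rule that[of "Abs_xseries f"]) (use supp fl rec in \<open>auto simp: c leading_monomial_def\<close>)
qed

lemma triangular_unique:
  assumes F: "leading_monomial N l F" "\<And>m. l - m \<in> Qplus N \<Longrightarrow> m \<noteq> l \<Longrightarrow>
      d m * xcoeff F m = (\<Sum>n\<in>between N m l - {m}. K m n * xcoeff F n)"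
    and G: "leading_monomial N l G" "\<And>m. l - m \<in> Qplus N \<Longrightarrow> m \<noteq> l \<Longrightarrow>
      d m * xcoeff G m = (\<Sum>n\<in>between N m l - {m}. K m n * xcoeff G n)"
    and d: "\<And>m. l - m \<in> Qplus N \<Longrightarrow> m \<noteq> l \<Longrightarrow> d m \<noteq> (0::complex)"
  shows "F = G"
proof (rule xseries_eqI)
  fix m show "xcoeff F m = xcoeff G m"
  proof (induction "height N (l - m)" arbitrary: m rule: less_induct)
    case less
    show ?case
    proof (cases "l - m \<in> Qplus N \<and> m \<noteq> l")
      case True
      have "(\<Sum>n\<in>between N m l - {m}. K m n * xcoeff F n) = (\<Sum>n\<in>between N m l - {m}. K m n * xcoeff G n)"
        by (intro sum.cong refl) (use less between_height_less in auto)
      then have "d m * xcoeff F m = d m * xcoeff G m" using F(2)[of m] G(2)[of m] True by simp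
      then show ?thesis using d[of m] True by simp
    next
      case False
      then show ?thesis using F(1) G(1) by (auto simp: leading_monomial_def) metis
    qed
  qed
qed

text \<open>Any index with different partial sums separates the eigenvalues. The least one is taken
  because its equation is the one that survives in the limit of the Macdonald operator.\<close>

definition fst_diff :: "wt \<Rightarrow> nat" where
  "fst_diff g = (LEAST a. psum a g \<noteq> 0)"

lemma fst_diff:
  assumes "g \<in> Qplus N" "g \<noteq> 0"
  shows "fst_diff g \<in> {1..N}" "psum (fst_diff g) g > 0" "\<And>j. j < fst_diff g \<Longrightarrow> psum j g = 0"
proof -
  obtain j where j: "j \<le> N" "psum j g > 0" using Qplus_pos_psum[OF assms] by blast
  have ne: "psum (fst_diff g) g \<noteq> 0" unfolding fst_diff_def by (rule LeastI[of _ j]) (use j in auto)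
  have "fst_diff g \<le> j" unfolding fst_diff_def by (rule Least_le) (use j in auto)
  moreover have "fst_diff g \<noteq> 0" using ne psum_lattice_0[of g N] assms by (metis Qplus_iff)
  ultimately show "fst_diff g \<in> {1..N}" using j by simp
  show "psum (fst_diff g) g > 0" using ne assms by (metis Qplus_iff order_le_less)
  show "psum j g = 0" if "j < fst_diff g" for j using not_less_Least[of j "\<lambda>a. psum a g \<noteq> 0"] that
    unfolding fst_diff_def by blast
qed

lemma powi_inj:
  fixes q :: complex
  assumes "q \<noteq> 0" "norm q < 1" "q powi m = q powi n"
  shows "m = n"
proof (rule ccontr)
  assume "m \<noteq> n"
  have *: False if "i < j" "q powi i = q powi j" for i j :: int
  proof -
    have "q powi (j - i) = 1" using that assms(1) by (simp add: power_int_diff)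
    moreover have "q powi (j - i) = q ^ nat (j - i)" using that by (simp add: power_int_def)
    ultimately show False using power_neq_1[OF assms(2), of "nat (j - i)"] that by simp
  qed
  show False using *[of m n] *[of n m] assms(3) \<open>m \<noteq> n\<close> by fastforce
qed

lemma qpow_psum:
  assumes "q \<noteq> 0" "g \<in> lattice N"
  shows "qpow q {1..a} g = q powi psum a g"
proof -
  have "qpow q A g = q powi (\<Sum>i\<in>A. wt_entry g i)" for A
    unfolding qpow_def by (induction A rule: infinite_finite_induct) (auto simp: power_int_add assms(1))
  then show ?thesis by (simp add: psum_eq_sum_atLeast1[OF assms(2)])
qed

abbreviation index_sets :: "nat \<Rightarrow> nat \<Rightarrow> nat set set" where
  "index_sets N a \<equiv> {I. I \<subseteq> {1..N} \<and> card I = a}"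

lemma D_op_shift_op: "D_op N q a 0 F = shift_op q (index_sets N a) (\<lambda>I. D_coeff N I 0) (\<lambda>I. I) F"
  by (simp add: D_op_eq shift_op_def)

lemma D_coeff_0: "D_coeff N I 0 = (\<Prod>i\<in>I. \<Prod>j\<in>{1..N} - I. xratio i j)"
  by (simp add: D_coeff_def)

lemma D_coeff_neg_series:
  assumes "I \<subseteq> {1..N}"
  shows "D_coeff N I 0 \<in> neg_series N"
  unfolding D_coeff_0 by (intro neg_series_prod xratio_neg_series) (use assms in auto)

lemma top_eq_prod2:
  assumes "\<And>i j. i \<in> A \<Longrightarrow> j \<in> B \<Longrightarrow> f i j \<in> neg_series N \<and> f' i j \<in> neg_series N \<and> top_eq r (f i j) (f' i j)"
  shows "top_eq r (\<Prod>i\<in>A. \<Prod>j\<in>B. f i j) (\<Prod>i\<in>A. \<Prod>j\<in>B. f' i j)"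
proof (rule top_eq_prod, intro conjI)
  fix i assume i: "i \<in> A"
  show "(\<Prod>j\<in>B. f i j) \<in> neg_series N" "(\<Prod>j\<in>B. f' i j) \<in> neg_series N"
    using assms[OF i] by (auto intro: neg_series_prod)
  show "top_eq r (\<Prod>j\<in>B. f i j) (\<Prod>j\<in>B. f' i j)" by (rule top_eq_prod) (rule assms[OF i])
qed

text \<open>Replacing the single factor x_i / (x_i - x_j) with j < i by 0 does not affect the
  coefficients in question, and it annihilates the product.\<close>

lemma D_coeff_top_eq_0:
  assumes I: "I \<subseteq> {1..N}" and "i \<in> I" "j \<in> {1..N} - I" "j < i" "j \<le> r"
  shows "top_eq r (D_coeff N I 0) 0"
proof -
  let ?z = "\<lambda>i' j'. if i' = i \<and> j' = j then 0 else xratio i' j'"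
  have fin: "finite I" using I finite_subset by blast
  have "top_eq r (D_coeff N I 0) (\<Prod>i'\<in>I. \<Prod>j'\<in>{1..N} - I. ?z i' j')"
    unfolding D_coeff_0
  proof (rule top_eq_prod2)
    fix i' j' assume ij: "i' \<in> I" "j' \<in> {1..N} - I"
    have "xratio i' j' \<in> neg_series N" by (rule xratio_neg_series) (use ij I in auto)
    then show "xratio i' j' \<in> neg_series N \<and> ?z i' j' \<in> neg_series N \<and> top_eq r (xratio i' j') (?z i' j')"
      using xratio_top_eq_0[OF assms(4,5)] by simp
  qed
  moreover have "(\<Prod>i'\<in>I. \<Prod>j'\<in>{1..N} - I. ?z i' j') = 0"
  proof (rule prod_zero[OF fin], intro bexI[of _ i])
    show "(\<Prod>j'\<in>{1..N} - I. ?z i j') = 0" by (rule prod_zero) (use assms in auto)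
  qed (use assms in auto)
  ultimately show ?thesis by simp
qed

lemma D_coeff_top_eq_1:
  assumes "a \<le> N"
  shows "top_eq N (D_coeff N {1..a} 0) 1"
proof -
  have "top_eq N (D_coeff N {1..a} 0) (\<Prod>i\<in>{1..a}. \<Prod>j\<in>{1..N} - {1..a}. 1)"
    unfolding D_coeff_0
  proof (rule top_eq_prod2)
    fix i j assume ij: "i \<in> {1..a}" "j \<in> {1..N} - {1..a}"
    have "xratio i j \<in> neg_series N" by (rule xratio_neg_series) (use ij assms in auto)
    moreover have "top_eq N (xratio i j) 1" by (rule xratio_top_eq_1) (use ij assms in auto)
    ultimately show "xratio i j \<in> neg_series N \<and> 1 \<in> neg_series N \<and> top_eq N (xratio i j) 1" by simp
  qed
  then show ?thesis by simp
qed

text \<open>Provides the inversion on which \<open>D_coeff_top_eq_0\<close> works, so that only the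
  initial set contributes to the diagonal.\<close>

lemma initial_or_gap:
  assumes "I \<subseteq> {1..N}" "card I = a" "I \<noteq> {1..a}"
  obtains i j where "i \<in> I" "j \<in> {1..N} - I" "j < i" "j \<le> a"
proof -
  have fin: "finite I" using assms finite_subset by blast
  have "\<not> {1..a} \<subseteq> I" using assms card_subset_eq[OF fin, of "{1..a}"] by auto
  then obtain j where j: "j \<in> {1..a}" "j \<notin> I" by blast
  have "\<not> I \<subseteq> {1..a}" using assms card_subset_eq[of "{1..a}" I] by auto
  then obtain i where i: "i \<in> I" "i \<notin> {1..a}" by blast
  then have "i \<in> {1..N}" "i > a" using assms by fastforce+
  then show ?thesis using that[of i j] i j by auto
qed

lemma D_coeff_coeff_0:
  assumes "I \<subseteq> {1..N}" "card I = a"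
  shows "xcoeff (D_coeff N I 0) 0 = (if I = {1..a} then 1 else 0)"
proof (cases "I = {1..a}")
  case True
  have "a \<le> N" using assms card_mono[OF _ assms(1)] by auto
  then show ?thesis using True D_coeff_top_eq_1[of a N] by (simp add: top_eq_def)
next
  case False
  then obtain i j where "i \<in> I" "j \<in> {1..N} - I" "j < i" "j \<le> a" using initial_or_gap assms by blast
  then show ?thesis using False D_coeff_top_eq_0[OF assms(1), of i j a] by (simp add: top_eq_def)
qed

abbreviation D_kernel :: "nat \<Rightarrow> complex \<Rightarrow> nat \<Rightarrow> wt \<Rightarrow> wt \<Rightarrow> complex" where
  "D_kernel N q a \<equiv> shift_kernel q (index_sets N a) (\<lambda>I. D_coeff N I 0) (\<lambda>I. I)"

lemma D_kernel_diag:
  assumes "q \<noteq> 0" "a \<in> {1..N}" "m \<in> lattice N"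
  shows "D_kernel N q a m m = q powi psum a m"
proof -
  have "D_kernel N q a m m = (\<Sum>I\<in>index_sets N a. if I = {1..a} then qpow q {1..a} m else 0)"
    unfolding shift_kernel_def by (intro sum.cong refl) (auto simp: D_coeff_coeff_0)
  also have "\<dots> = qpow q {1..a} m" using assms by (subst sum.delta) auto
  finally show ?thesis using qpow_psum[OF assms(1,3)] by simp
qed

lemma xcoeff_D_op:
  assumes "q \<noteq> 0" "a \<in> {1..N}" "below_supp N l F" "l - m \<in> Qplus N" "l \<in> lattice N"
  shows "xcoeff (D_op N q a 0 F) m = q powi psum a m * xcoeff F m + (\<Sum>n\<in>between N m l - {m}. D_kernel N q a m n * xcoeff F n)"
proof -
  have "l - m \<in> lattice N" using assms(4) by (simp add: Qplus_iff)
  then have "l - (l - m) \<in> lattice N" by (rule lattice_diff[OF assms(5)])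
  then have m: "m \<in> lattice N" by simp
  show ?thesis
    unfolding D_op_shift_op
    by (subst shift_op_coeff_diag) (use assms D_kernel_diag[OF assms(1,2) m] D_coeff_neg_series in auto)
qed

lemma below_supp_D_op: "below_supp N l F \<Longrightarrow> below_supp N l (D_op N q a 0 F)"
  unfolding D_op_shift_op by (rule below_supp_shift_op) (auto simp: D_coeff_neg_series)

lemma xcoeff_mult_xconst [simp]: "xcoeff (F * xconst c) g = xcoeff F g * c"
  by (simp add: mult.commute[of F])

lemma Gamma_xconst_mult: "Gamma q I (xconst c * F) = xconst c * Gamma q I F"
  by (rule xseries_eqI) simp

lemma D_op_scale: "D_op N q a k (xconst c * F) = xconst c * D_op N q a k F"
  unfolding D_op_eq Gamma_xconst_mult sum_distrib_left by (intro sum.cong refl) (simp only: mult_ac)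

lemma D_op_diff: "D_op N q a k (F - G) = D_op N q a k F - D_op N q a k G"
  unfolding D_op_eq Gamma_diff by (simp add: right_diff_distrib sum_subtractf)

section \<open>Existence and uniqueness of the joint eigenfunctions\<close>

definition joint_eigen :: "nat \<Rightarrow> complex \<Rightarrow> wt \<Rightarrow> xseries \<Rightarrow> bool" where
  "joint_eigen N q l F \<longleftrightarrow> leading_monomial N l F \<and>
     (\<forall>a\<in>{1..N}. D_op N q a 0 F = xconst (q powi psum a l) * F)"

abbreviation eigen_gap :: "complex \<Rightarrow> wt \<Rightarrow> nat \<Rightarrow> wt \<Rightarrow> complex" where
  "eigen_gap q l a m \<equiv> q powi psum a l - q powi psum a m"

lemma eigen_gap_nonzero:
  assumes "q \<noteq> 0" "norm q < 1" "l - m \<in> Qplus N" "m \<noteq> l"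
  shows "eigen_gap q l (fst_diff (l - m)) m \<noteq> 0"
  using powi_inj[OF assms(1,2), of "psum (fst_diff (l - m)) l" "psum (fst_diff (l - m)) m"]
    fst_diff(2)[OF assms(3)] assms(4) by auto

lemma joint_eigen_recursion:
  assumes "q \<noteq> 0" "l \<in> lattice N" "joint_eigen N q l F" "l - m \<in> Qplus N" "a \<in> {1..N}"
  shows "eigen_gap q l a m * xcoeff F m = (\<Sum>n\<in>between N m l - {m}. D_kernel N q a m n * xcoeff F n)"
proof -
  have "xcoeff (D_op N q a 0 F) m = q powi psum a l * xcoeff F m"
    using assms by (simp add: joint_eigen_def)
  then show ?thesis
    using xcoeff_D_op[OF assms(1,5) _ assms(4,2), of F] assms(3)
    by (simp add: joint_eigen_def leading_monomial_iff algebra_simps)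
qed

lemma joint_eigen_unique:
  assumes "q \<noteq> 0" "norm q < 1" "l \<in> lattice N" "joint_eigen N q l F" "joint_eigen N q l G"
  shows "F = G"
proof (rule triangular_unique[where N = N and l = l and d = "\<lambda>m. eigen_gap q l (fst_diff (l - m)) m"
      and K = "\<lambda>m. D_kernel N q (fst_diff (l - m)) m"])
  fix m assume m: "l - m \<in> Qplus N" "m \<noteq> l"
  have a: "fst_diff (l - m) \<in> {1..N}" using fst_diff(1)[OF m(1)] m(2) by simp
  show "eigen_gap q l (fst_diff (l - m)) m * xcoeff F m
      = (\<Sum>n\<in>between N m l - {m}. D_kernel N q (fst_diff (l - m)) m n * xcoeff F n)"
    by (rule joint_eigen_recursion[OF assms(1,3,4) m(1) a])
  show "eigen_gap q l (fst_diff (l - m)) m * xcoeff G m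
      = (\<Sum>n\<in>between N m l - {m}. D_kernel N q (fst_diff (l - m)) m n * xcoeff G n)"
    by (rule joint_eigen_recursion[OF assms(1,3,5) m(1) a])
  show "eigen_gap q l (fst_diff (l - m)) m \<noteq> 0" by (rule eigen_gap_nonzero[OF assms(1,2) m])
qed (use assms in \<open>auto simp: joint_eigen_def\<close>)

text \<open>
  The series solving at each weight the equation of one operator that separates the weight from l
  satisfies all the other equations because the operators commute.
\<close>

lemma joint_eigen_exists:
  assumes q: "q \<noteq> 0" "norm q < 1" and l: "l \<in> lattice N"
  shows "\<exists>F. joint_eigen N q l F"
proof -
  obtain F where F: "leading_monomial N l F"
    and rec: "\<And>m. l - m \<in> Qplus N \<Longrightarrow> m \<noteq> l \<Longrightarrow> eigen_gap q l (fst_diff (l - m)) m * xcoeff F m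
      = (\<Sum>n\<in>between N m l - {m}. D_kernel N q (fst_diff (l - m)) m n * xcoeff F n)"
    by (rule triangular_solution[of l N "\<lambda>m. eigen_gap q l (fst_diff (l - m)) m"
          "\<lambda>m. D_kernel N q (fst_diff (l - m)) m"])
      (rule eigen_gap_nonzero[OF q], assumption, assumption, blast)
  have supp: "below_supp N l F" and Fl: "xcoeff F l = 1" using F by (auto simp: leading_monomial_iff)
  define G where "G = (\<lambda>a. D_op N q a 0 F - xconst (q powi psum a l) * F)"
  have G_supp: "below_supp N l (G a)" for a
    unfolding G_def by (intro below_supp_diff below_supp_D_op below_supp_xconst_mult supp)
  \<comment> \<open>G a is the defect of the a-th equation; the identity is the commutativity of two
    operators, each minus its eigenvalue, applied to F.\<close>
  have comm: "D_op N q a 0 (G b) - xconst (q powi psum a l) * G b = D_op N q b 0 (G a) - xconst (q powi psum b l) * G a" for a b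
    unfolding G_def D_op_diff D_op_scale D_op_commute[OF q, of N a b] by (simp add: algebra_simps)
  have "xcoeff (G b) m = 0" if "b \<in> {1..N}" for b m
    using that
  proof (induction "height N (l - m)" arbitrary: m b rule: less_induct)
    case less
    consider "l - m \<notin> Qplus N" | "m = l" | "l - m \<in> Qplus N" "m \<noteq> l" by blast
    then show ?case
    proof cases
      case 1
      then show ?thesis using G_supp[of b] by (auto simp: below_supp_def)
    next
      case 2
      have "xcoeff (D_op N q b 0 F) l = q powi psum b l * xcoeff F l"
        using xcoeff_D_op[OF q(1) less.prems supp _ l, of l] by (simp add: between_self)
      then show ?thesis using 2 by (simp add: G_def)
    next
      case 3
      define a where "a = fst_diff (l - m)"
      have a: "a \<in> {1..N}" using fst_diff(1)[OF 3(1)] 3(2) by (simp add: a_def)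
      have Ga: "xcoeff (G a) m = 0"
        using rec[OF 3] xcoeff_D_op[OF q(1) a supp 3(1) l] by (simp add: G_def a_def algebra_simps)
      \<comment> \<open>The off-diagonal terms involve defects at smaller height, which vanish by
        induction.\<close>
      have *: "xcoeff (D_op N q c 0 (G c')) m = q powi psum c m * xcoeff (G c') m"
        if "c \<in> {1..N}" "c' \<in> {1..N}" for c c'
      proof -
        have "(\<Sum>n\<in>between N m l - {m}. D_kernel N q c m n * xcoeff (G c') n) = 0"
          by (rule sum.neutral) (use less.hyps that between_height_less in auto)
        then show ?thesis using xcoeff_D_op[OF q(1) that(1) G_supp 3(1) l, of c'] by simp
      qed
      have "xcoeff (D_op N q a 0 (G b) - xconst (q powi psum a l) * G b) m
          = xcoeff (D_op N q b 0 (G a) - xconst (q powi psum b l) * G a) m"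
        unfolding comm[of a b] ..
      \<comment> \<open>The right side vanishes with the coefficient of G a at m, which is 0 by
        construction; the left side is the gap times the coefficient of G b, up to sign.\<close>
      then have "eigen_gap q l a m * xcoeff (G b) m = 0"
        using *[OF a less.prems] *[OF less.prems a] Ga by (auto simp: algebra_simps)
      then show ?thesis using eigen_gap_nonzero[OF q 3] by (simp add: a_def)
    qed
  qed
  then have "G b = 0" if "b \<in> {1..N}" for b using that by (intro xseries_eqI) simp
  then show ?thesis using F by (auto simp: joint_eigen_def G_def)
qed

definition Psi :: "nat \<Rightarrow> complex \<Rightarrow> wt \<Rightarrow> xseries" where
  "Psi N q l = (THE F. joint_eigen N q l F)"

lemma joint_eigen_Psi:
  assumes "q \<noteq> 0" "norm q < 1" "l \<in> lattice N"
  shows "joint_eigen N q l (Psi N q l)"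
  unfolding Psi_def
  by (rule theI') (use joint_eigen_exists[OF assms] joint_eigen_unique[OF assms] in blast)

lemma Psi_eq:
  assumes "q \<noteq> 0" "norm q < 1" "l \<in> lattice N" "joint_eigen N q l F"
  shows "Psi N q l = F"
  using joint_eigen_unique[OF assms(1-3) joint_eigen_Psi[OF assms(1-3)] assms(4)] .

section \<open>Fundamental weights and the operators with k = 1\<close>

definition indicator_wt :: "nat set \<Rightarrow> wt" where
  "indicator_wt I = (\<Sum>i\<in>I. eps i)"

lemma lookup_indicator_wt: "finite I \<Longrightarrow> wt_entry (indicator_wt I) j = (if j \<in> I then 1 else 0)"
  by (simp add: indicator_wt_def lookup_sum lookup_single when_def)

lemma psum_indicator_wt: "finite I \<Longrightarrow> psum j (indicator_wt I) = int (card (I \<inter> {..j}))"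
proof -
  assume "finite I"
  have "psum j (indicator_wt I) = (\<Sum>i\<in>I. if i \<in> {..j} then 1 else 0)"
    by (simp add: indicator_wt_def psum_sum)
  also have "\<dots> = (\<Sum>i\<in>I \<inter> {..j}. 1)" by (rule sum.inter_restrict[OF \<open>finite I\<close>, symmetric])
  finally show ?thesis by simp
qed

lemma indicator_wt_lattice: "I \<subseteq> {1..N} \<Longrightarrow> indicator_wt I \<in> lattice N"
  unfolding indicator_wt_def by (intro lattice_sum lattice_single) auto

lemma psum_fundamental: "psum j (indicator_wt {1..a}) = int (min a j)"
proof -
  have "{1..a} \<inter> {..j} = {1..min a j}" by auto
  then show ?thesis by (simp add: psum_indicator_wt)
qed

text \<open>Among all sets of size a the initial one has the most elements up to any bound
  j.\<close>

lemma fundamental_minus_indicator: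
  assumes "I \<subseteq> {1..N}" "card I = a"
  shows "indicator_wt {1..a} - indicator_wt I \<in> Qplus N"
  unfolding Qplus_iff
proof (intro conjI allI)
  have fin: "finite I" using assms finite_subset by blast
  have "a \<le> N" using assms card_mono[OF _ assms(1)] by auto
  then show "indicator_wt {1..a} - indicator_wt I \<in> lattice N"
    by (intro lattice_diff indicator_wt_lattice assms) auto
  show "0 \<le> psum j (indicator_wt {1..a} - indicator_wt I)" for j
  proof -
    have "card (I \<inter> {..j}) \<le> a" using card_mono[OF fin, of "I \<inter> {..j}"] assms by auto
    moreover have "card (I \<inter> {..j}) \<le> card {1..j}" by (rule card_mono) (use assms in auto)
    ultimately show ?thesis by (simp add: psum_fundamental psum_indicator_wt fin)
  qed
  have "I \<inter> {..N} = I" using assms by auto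
  then show "psum N (indicator_wt {1..a} - indicator_wt I) = 0"
    using assms \<open>a \<le> N\<close> by (simp add: psum_fundamental psum_indicator_wt fin)
qed

lemma indicator_wt_inj: "finite I \<Longrightarrow> finite J \<Longrightarrow> indicator_wt I = indicator_wt J \<Longrightarrow> I = J"
  by (metis lookup_indicator_wt subsetI subset_antisym zero_neq_one)

lemma D_coeff_1: "D_coeff N I 1 = xmonom (indicator_wt I) * D_coeff N I 0"
  by (simp add: D_coeff_def indicator_wt_def xmonom_sum)

text \<open>The summand of I is moved by the indicator of I, and the indicators of all other sets
  are strictly below that of \<open>{1..a}\<close>. So one summand reaches the top, with the factor
  of its shift.\<close>

lemma D_op_1_leading:
  assumes q: "q \<noteq> 0" and l: "l \<in> lattice N" and F: "leading_monomial N l F" and a: "a \<in> {1..N}"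
  shows "below_supp N (l + indicator_wt {1..a}) (D_op N q a 1 F)"
    and "xcoeff (D_op N q a 1 F) (l + indicator_wt {1..a}) = q powi psum a l"
proof -
  have supp: "below_supp N l F" and Fl: "xcoeff F l = 1" using F by (auto simp: leading_monomial_iff)
  let ?T = "\<lambda>I. D_coeff N I 0 * Gamma q I F"
  have c: "xcoeff (D_op N q a 1 F) g = (\<Sum>I\<in>index_sets N a. xcoeff (?T I) (g - indicator_wt I))" for g
    unfolding D_op_eq xcoeff_sum D_coeff_1 mult.assoc xcoeff_xmonom_mult ..
  have T: "below_supp N l (?T I)" if "I \<in> index_sets N a" for I
    using that by (intro below_supp_mult below_supp_Gamma supp D_coeff_neg_series) auto
  show "below_supp N (l + indicator_wt {1..a}) (D_op N q a 1 F)"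
    unfolding below_supp_def
  proof (intro allI impI)
    fix g assume "xcoeff (D_op N q a 1 F) g \<noteq> 0"
    then obtain I where I: "I \<in> index_sets N a" "xcoeff (?T I) (g - indicator_wt I) \<noteq> 0"
      unfolding c by (meson sum.neutral)
    have "l - (g - indicator_wt I) \<in> Qplus N" using T[OF I(1)] I(2) by (auto simp: below_supp_def)
    moreover have "indicator_wt {1..a} - indicator_wt I \<in> Qplus N" using I by (intro fundamental_minus_indicator) auto
    ultimately have "(l - (g - indicator_wt I)) + (indicator_wt {1..a} - indicator_wt I) \<in> Qplus N" by (rule Qplus_add)
    then show "l + indicator_wt {1..a} - g \<in> Qplus N" by (simp add: algebra_simps)
  qed
  have "xcoeff (D_op N q a 1 F) (l + indicator_wt {1..a}) = (\<Sum>I\<in>index_sets N a. if I = {1..a} then q powi psum a l else 0)"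
    unfolding c
  proof (intro sum.cong refl)
    fix I assume I: "I \<in> index_sets N a"
    show "xcoeff (?T I) (l + indicator_wt {1..a} - indicator_wt I) = (if I = {1..a} then q powi psum a l else 0)"
    proof (cases "I = {1..a}")
      case True
      have "xcoeff (?T I) l = xcoeff (D_coeff N I 0) 0 * qpow q I l"
        using I by (subst xcoeff_mult_Gamma[OF _ supp]) (auto simp: between_self Fl D_coeff_neg_series)
      then show ?thesis using True I qpow_psum[OF q l] by (simp add: D_coeff_coeff_0)
    next
      case False
      have fin: "finite I" using I finite_subset by blast
      have Q: "indicator_wt {1..a} - indicator_wt I \<in> Qplus N" using I by (intro fundamental_minus_indicator) auto
      have "xcoeff (?T I) (l + indicator_wt {1..a} - indicator_wt I) = 0"
      proof (rule ccontr)
        assume "xcoeff (?T I) (l + indicator_wt {1..a} - indicator_wt I) \<noteq> 0"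
        then have "l - (l + indicator_wt {1..a} - indicator_wt I) \<in> Qplus N" using T[OF I] by (auto simp: below_supp_def)
        then have "- (indicator_wt {1..a} - indicator_wt I) \<in> Qplus N" by (simp add: algebra_simps)
        then have "indicator_wt {1..a} = indicator_wt I" using Qplus_antisym[OF Q] by simp
        then show False using indicator_wt_inj[OF _ fin, of "{1..a}"] False by simp
      qed
      then show ?thesis using False by simp
    qed
  qed
  also have "\<dots> = q powi psum a l" using a by (subst sum.delta) auto
  finally show "xcoeff (D_op N q a 1 F) (l + indicator_wt {1..a}) = q powi psum a l" .
qed

text \<open>By q-commutation the image is again a joint eigenfunction, the a-th eigenvalue being
  multiplied by q^(min a b). As min a b is the a-th partial sum of the b-th fundamental weight,
  uniqueness identifies the image up to its leading coefficient.\<close>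

lemma D_op_1_Psi:
  assumes q: "q \<noteq> 0" "norm q < 1" and l: "l \<in> lattice N" and b: "b \<in> {1..N}"
  shows "D_op N q b 1 (Psi N q l) = xconst (q powi psum b l) * Psi N q (l + indicator_wt {1..b})"
proof -
  let ?F = "Psi N q l" and ?c = "q powi psum b l"
  have J: "joint_eigen N q l ?F" by (rule joint_eigen_Psi[OF q l])
  then have F: "leading_monomial N l ?F" by (simp add: joint_eigen_def)
  have c: "?c \<noteq> 0" using q by simp
  define G where "G = xconst (1 / ?c) * D_op N q b 1 ?F"
  have "leading_monomial N (l + indicator_wt {1..b}) G"
    unfolding leading_monomial_iff G_def
    using D_op_1_leading[OF q(1) l F b] c by (auto intro: below_supp_xconst_mult)
  moreover have "D_op N q a 0 G = xconst (q powi psum a (l + indicator_wt {1..b})) * G" if a: "a \<in> {1..N}" for a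
  proof -
    have "D_op N q a 0 ?F = xconst (q powi psum a l) * ?F" using J a by (simp add: joint_eigen_def)
    then have "D_op N q a 0 G = xconst (1 / ?c) * (xconst (q ^ min a b) * (xconst (q powi psum a l) * D_op N q b 1 ?F))"
      by (simp only: G_def D_op_scale D_op_0_1_commute[OF q])
    then have "D_op N q a 0 G = xconst (q ^ min a b * q powi psum a l) * G"
      unfolding G_def xconst_mult by (simp only: mult_ac)
    moreover have "q ^ min a b * q powi psum a l = q powi psum a (l + indicator_wt {1..b})"
      using q(1) psum_fundamental[of a b] by (simp add: power_int_add min.commute)
    ultimately show ?thesis by simp
  qed
  ultimately have "joint_eigen N q (l + indicator_wt {1..b}) G" by (simp add: joint_eigen_def)
  moreover have "l + indicator_wt {1..b} \<in> lattice N"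
    using b by (intro lattice_add l indicator_wt_lattice) auto
  ultimately have "Psi N q (l + indicator_wt {1..b}) = G" using Psi_eq[OF q] by blast
  moreover have "xconst ?c * G = D_op N q b 1 ?F"
    unfolding G_def mult.assoc[symmetric] xconst_mult[symmetric] using q(1) by simp
  ultimately show ?thesis by simp
qed

section \<open>The action of the quantum torus\<close>

lemma wt_pair_superset:
  assumes "finite A" "Poly_Mapping.keys n \<subseteq> A"
  shows "wt_pair n m = (\<Sum>i\<in>A. wt_entry n i * wt_entry m i)"
  unfolding wt_pair_def by (rule sum.mono_neutral_left) (use assms in \<open>auto simp: in_keys_iff\<close>)

lemma wt_pair_add_left: "wt_pair (m + m') l = wt_pair m l + wt_pair m' l"
proof -
  let ?A = "Poly_Mapping.keys m \<union> Poly_Mapping.keys m'"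
  have A: "finite ?A" "Poly_Mapping.keys m \<subseteq> ?A" "Poly_Mapping.keys m' \<subseteq> ?A" "Poly_Mapping.keys (m + m') \<subseteq> ?A"
    using Poly_Mapping.keys_add[of m m'] by auto
  show ?thesis
    by (simp add: wt_pair_superset[OF A(1,2)] wt_pair_superset[OF A(1,3)] wt_pair_superset[OF A(1,4)]
        lookup_add algebra_simps sum.distrib)
qed

lemma wt_pair_add_right: "wt_pair m (l + l') = wt_pair m l + wt_pair m l'"
  by (simp add: wt_pair_def lookup_add algebra_simps sum.distrib)

lemma wt_pair_commute: "wt_pair m n = wt_pair n m"
proof -
  let ?A = "Poly_Mapping.keys m \<union> Poly_Mapping.keys n"
  have A: "finite ?A" "Poly_Mapping.keys m \<subseteq> ?A" "Poly_Mapping.keys n \<subseteq> ?A" by auto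
  show ?thesis
    by (simp add: wt_pair_superset[OF A(1,2)] wt_pair_superset[OF A(1,3)] mult.commute)
qed

lemma wt_pair_0 [simp]: "wt_pair 0 l = 0"
  by (simp add: wt_pair_def)

lemma wt_pair_indicator: "finite I \<Longrightarrow> wt_pair (indicator_wt I) l = (\<Sum>i\<in>I. wt_entry l i)"
proof -
  assume I: "finite I"
  have "Poly_Mapping.keys (indicator_wt I) \<subseteq> I" by (auto simp: in_keys_iff lookup_indicator_wt[OF I] split: if_splits)
  then show ?thesis by (simp add: wt_pair_superset[OF I] lookup_indicator_wt[OF I])
qed

lemma wt_pair_fundamental: "l \<in> lattice N \<Longrightarrow> wt_pair (indicator_wt {1..a}) l = psum a l"
  using wt_pair_indicator[of "{1..a}" l] by (simp add: psum_eq_sum_atLeast1)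

lemma qpow_wt_pair: "q \<noteq> 0 \<Longrightarrow> finite I \<Longrightarrow> qpow q I l = q powi wt_pair (indicator_wt I) l"
proof -
  assume q: "q \<noteq> 0" and I: "finite I"
  have "qpow q I l = q powi (\<Sum>i\<in>I. wt_entry l i)"
    unfolding qpow_def using I by (induction I rule: finite_induct) (auto simp: power_int_add q)
  then show ?thesis using I by (simp add: wt_pair_indicator)
qed

lemma lookup_qt_scale [simp]: "Poly_Mapping.lookup (qt_scale c u) k = c * Poly_Mapping.lookup u k"
  by (simp add: qt_scale_def map.rep_eq when_def)

lemma lookup_qt_monom: "Poly_Mapping.lookup (qt_monom m n) k = (if k = (m, n) then 1 else 0)"
  by (auto simp: qt_monom_def lookup_single when_def)

lemma qt_act_superset:
  assumes "finite A" "Poly_Mapping.keys u \<subseteq> A"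
  shows "qt_act q u F l = (\<Sum>(m, n)\<in>A. xconst (Poly_Mapping.lookup u (m, n) * q powi wt_pair m l) * F (l + n))"
  unfolding qt_act_def by (rule sum.mono_neutral_left) (use assms in \<open>auto simp: in_keys_iff\<close>)

lemma qt_act_0 [simp]: "qt_act q 0 F l = 0"
  by (simp add: qt_act_def)

lemma qt_act_add: "qt_act q (u + v) F l = qt_act q u F l + qt_act q v F l"
proof -
  let ?A = "Poly_Mapping.keys u \<union> Poly_Mapping.keys v"
  have A: "finite ?A" "Poly_Mapping.keys u \<subseteq> ?A" "Poly_Mapping.keys v \<subseteq> ?A" "Poly_Mapping.keys (u + v) \<subseteq> ?A"
    using Poly_Mapping.keys_add[of u v] by auto
  show ?thesis
    by (simp add: qt_act_superset[OF A(1,2)] qt_act_superset[OF A(1,3)] qt_act_superset[OF A(1,4)]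
        lookup_add distrib_right xconst_add sum.distrib case_prod_unfold)
qed

lemma qt_act_scale: "qt_act q (qt_scale c u) F l = xconst c * qt_act q u F l"
proof -
  have "Poly_Mapping.keys (qt_scale c u) \<subseteq> Poly_Mapping.keys u" by (auto simp: in_keys_iff)
  then show ?thesis
    by (simp add: qt_act_superset[of "Poly_Mapping.keys u"] qt_act_superset[of "Poly_Mapping.keys u" u]
        case_prod_unfold xconst_mult sum_distrib_left mult.assoc)
qed

lemma qt_act_uminus: "qt_act q (- u) F l = - qt_act q u F l"
  using qt_act_add[of q u "- u" F l] by (simp add: eq_neg_iff_add_eq_0 add.commute)

lemma qt_act_diff: "qt_act q (u - v) F l = qt_act q u F l - qt_act q v F l"
  using qt_act_add[of q u "- v" F l] by (simp add: qt_act_uminus)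

lemma qt_act_sum: "qt_act q (\<Sum>i\<in>A. f i) F l = (\<Sum>i\<in>A. qt_act q (f i) F l)"
  by (induction A rule: infinite_finite_induct) (auto simp: qt_act_add)

lemma qt_act_monom: "qt_act q (qt_monom m n) F l = xconst (q powi wt_pair m l) * F (l + n)"
  by (simp add: qt_act_def qt_monom_def)

text \<open>The power of q from moving T^n past the second Lambda-monomial is the one that arises
  when that monomial is evaluated at the shifted weight l + n.\<close>

lemma qt_act_mult:
  assumes q: "q \<noteq> 0"
  shows "qt_act q (qt_mult q u v) F l = qt_act q u (qt_act q v F) l"
proof -
  have tm: "qt_act q (qt_scale (c * d * q powi wt_pair n m') (qt_monom (m + m') (n + n'))) F l
     = xconst (c * q powi wt_pair m l) * (xconst (d * q powi wt_pair m' (l + n)) * F (l + n + n'))" for c d m n m' n'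
  proof -
    have "c * d * q powi wt_pair n m' * q powi wt_pair (m + m') l
      = c * q powi wt_pair m l * (d * q powi wt_pair m' (l + n))"
      using q by (simp add: wt_pair_add_left wt_pair_add_right power_int_add wt_pair_commute[of n])
    then have "xconst (c * d * q powi wt_pair n m' * q powi wt_pair (m + m') l) * F (l + (n + n'))
      = xconst (c * q powi wt_pair m l * (d * q powi wt_pair m' (l + n))) * F (l + (n + n'))" by (simp only:)
    then show ?thesis
      unfolding qt_act_scale qt_act_monom by (simp only: xconst_mult mult.assoc add.assoc)
  qed
  show ?thesis
    unfolding qt_mult_def
    by (simp add: qt_act_sum case_prod_unfold tm) (simp add: qt_act_def case_prod_unfold sum_distrib_left)
qed

lemma qt_act_cong: 
  assumes "u \<in> qt_carrier N" "l \<in> lattice N" "\<And>l. l \<in> lattice N \<Longrightarrow> F l = G l"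
  shows "qt_act q u F l = qt_act q u G l"
  unfolding qt_act_def
proof (intro sum.cong refl, clarify)
  fix m n assume "(m, n) \<in> Poly_Mapping.keys u"
  then have "n \<in> lattice N" using assms(1) by (auto simp: qt_carrier_def)
  then have "l + n \<in> lattice N" using assms(2) by (simp add: lattice_add)
  then show "xconst (Poly_Mapping.lookup u (m, n) * q powi wt_pair m l) * F (l + n)
      = xconst (Poly_Mapping.lookup u (m, n) * q powi wt_pair m l) * G (l + n)"
    using assms(3) by simp
qed

lemma D_op_add: "D_op N q a k (F + G) = D_op N q a k F + D_op N q a k G"
  unfolding D_op_eq Gamma_add by (simp add: distrib_left sum.distrib)

lemma D_op_sum: "D_op N q a k (\<Sum>i\<in>A. f i) = (\<Sum>i\<in>A. D_op N q a k (f i))"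
proof -
  have "D_op N q a k 0 = 0" using D_op_diff[of N q a k 0 0] by simp
  then show ?thesis by (induction A rule: infinite_finite_induct) (auto simp: D_op_add)
qed

text \<open>The two operators act on different variables. This is the source of the order reversal
  in \<open>intertwines_mult\<close>.\<close>

lemma D_op_qt_act: "D_op N q a k (qt_act q u F l) = qt_act q u (\<lambda>l. D_op N q a k (F l)) l"
  by (simp add: qt_act_def D_op_sum case_prod_unfold D_op_scale)

lemma qt_act_diff_right: "qt_act q u (\<lambda>l. F l - G l) l = qt_act q u F l - qt_act q u G l"
  by (simp add: qt_act_def case_prod_unfold right_diff_distrib sum_subtractf)

lemma qt_mult_0_right [simp]: "qt_mult q u 0 = 0"
  by (simp add: qt_mult_def case_prod_unfold)

lemma qt_mult_0_left [simp]: "qt_mult q 0 u = 0"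
  by (simp add: qt_mult_def)

section \<open>Supports of products in the quantum torus\<close>

lemma lookup_qt_mult:
  "Poly_Mapping.lookup (qt_mult q u v) w = (\<Sum>x\<in>Poly_Mapping.keys u. \<Sum>y\<in>Poly_Mapping.keys v.
     if w = (fst x + fst y, snd x + snd y)
     then Poly_Mapping.lookup u x * Poly_Mapping.lookup v y * q powi wt_pair (snd x) (fst y) else 0)"
  unfolding qt_mult_def lookup_sum case_prod_unfold lookup_qt_scale lookup_qt_monom
  by (intro sum.cong refl) simp

lemma qt_mult_nonzero:
  assumes "Poly_Mapping.lookup (qt_mult q u v) w \<noteq> 0"
  obtains x y where "Poly_Mapping.lookup u x \<noteq> 0" "Poly_Mapping.lookup v y \<noteq> 0" "w = (fst x + fst y, snd x + snd y)"
proof -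
  obtain x where x: "x \<in> Poly_Mapping.keys u" "(\<Sum>y\<in>Poly_Mapping.keys v.
     if w = (fst x + fst y, snd x + snd y)
     then Poly_Mapping.lookup u x * Poly_Mapping.lookup v y * q powi wt_pair (snd x) (fst y) else 0) \<noteq> 0"
    using assms unfolding lookup_qt_mult by (rule sum.not_neutral_contains_not_neutral)
  from x(2) obtain y where y: "y \<in> Poly_Mapping.keys v" "(if w = (fst x + fst y, snd x + snd y)
     then Poly_Mapping.lookup u x * Poly_Mapping.lookup v y * q powi wt_pair (snd x) (fst y) else 0) \<noteq> 0"
    by (rule sum.not_neutral_contains_not_neutral)
  have "Poly_Mapping.lookup u x \<noteq> 0" using x(1) by (simp only: in_keys_iff not_False_eq_True)
  moreover have "Poly_Mapping.lookup v y \<noteq> 0" using y(1) by (simp only: in_keys_iff not_False_eq_True)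
  moreover have "w = (fst x + fst y, snd x + snd y)" using y(2) by (meson)
  ultimately show ?thesis by (rule that)
qed

lemma qt_carrier_mult:
  assumes "u \<in> qt_carrier N" "v \<in> qt_carrier N"
  shows "qt_mult q u v \<in> qt_carrier N"
  unfolding qt_carrier_def
proof safe
  fix m n assume "(m, n) \<in> Poly_Mapping.keys (qt_mult q u v)"
  then obtain x y where *: "Poly_Mapping.lookup u x \<noteq> 0" "Poly_Mapping.lookup v y \<noteq> 0" "(m, n) = (fst x + fst y, snd x + snd y)"
    by (metis in_keys_iff qt_mult_nonzero)
  then have "x \<in> lattice N \<times> lattice N" "y \<in> lattice N \<times> lattice N"
    using assms by (auto simp: qt_carrier_def in_keys_iff)
  then show "m \<in> lattice N" "n \<in> lattice N" using *(3) by (auto simp: lattice_add mem_Times_iff)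
qed

lemma qt_carrier_scale: "u \<in> qt_carrier N \<Longrightarrow> qt_scale c u \<in> qt_carrier N"
  by (auto simp: qt_carrier_def in_keys_iff)

lemma qt_carrier_diff:
  assumes "u \<in> qt_carrier N" "v \<in> qt_carrier N"
  shows "u - v \<in> qt_carrier N"
proof -
  have "Poly_Mapping.keys (u - v) \<subseteq> Poly_Mapping.keys u \<union> Poly_Mapping.keys v"
    by (auto simp: in_keys_iff lookup_minus)
  then show ?thesis using assms unfolding qt_carrier_def by blast
qed

lemma qt_carrier_add:
  assumes "u \<in> qt_carrier N" "v \<in> qt_carrier N"
  shows "u + v \<in> qt_carrier N"
proof -
  have "Poly_Mapping.keys (u + v) \<subseteq> Poly_Mapping.keys u \<union> Poly_Mapping.keys v"
    by (auto simp: in_keys_iff lookup_add)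
  then show ?thesis using assms unfolding qt_carrier_def by blast
qed

text \<open>
  Leading keys, comparing first the exponents of $\Lambda$. In this order the leading key of
  $\bar D_{a;k}$ is $\Lambda_1\cdots\Lambda_a T_1^k\cdots T_a^k$ for all k, which shows that it is not zero.
\<close>

definition key_less :: "wt \<times> wt \<Rightarrow> wt \<times> wt \<Rightarrow> bool" where
  "key_less x y \<longleftrightarrow> fst x < fst y \<or> fst x = fst y \<and> snd x < snd y"

definition is_lead :: "qtorus \<Rightarrow> wt \<times> wt \<Rightarrow> bool" where
  "is_lead u x \<longleftrightarrow> Poly_Mapping.lookup u x \<noteq> 0 \<and> (\<forall>y. Poly_Mapping.lookup u y \<noteq> 0 \<longrightarrow> y = x \<or> key_less y x)"

lemma is_leadD: "is_lead u x \<Longrightarrow> Poly_Mapping.lookup u y \<noteq> 0 \<Longrightarrow> y = x \<or> key_less y x"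
  unfolding is_lead_def by blast

lemma is_lead_exists:
  assumes "u \<noteq> 0"
  obtains x where "is_lead u x"
proof -
  let ?A = "fst ` Poly_Mapping.keys u"
  have A: "finite ?A" "?A \<noteq> {}" using assms by auto
  define m where "m = Max ?A"
  have m: "m \<in> ?A" "\<And>m'. m' \<in> ?A \<Longrightarrow> m' \<le> m" using A by (auto simp: m_def simp del: finite_imageI)
  let ?B = "{n. (m, n) \<in> Poly_Mapping.keys u}"
  have "?B \<subseteq> snd ` Poly_Mapping.keys u" by force
  then have "finite ?B" by (rule finite_subset) simp
  moreover have "?B \<noteq> {}" using m(1) by force
  ultimately have B: "finite ?B" "?B \<noteq> {}" .
  define n where "n = Max ?B"
  have n: "n \<in> ?B" "\<And>n'. n' \<in> ?B \<Longrightarrow> n' \<le> n" using Max_in[OF B] Max_ge[OF B(1)] by (auto simp: n_def)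
  have "is_lead u (m, n)"
    unfolding is_lead_def
  proof (intro conjI allI impI)
    show "Poly_Mapping.lookup u (m, n) \<noteq> 0" using n(1) by (simp add: in_keys_iff)
    fix y assume "Poly_Mapping.lookup u y \<noteq> 0"
    then have y: "y \<in> Poly_Mapping.keys u" by (simp add: in_keys_iff)
    then have "fst y \<le> m" using m(2) by blast
    moreover have "snd y \<le> n" if "fst y = m" using n(2)[of "snd y"] y that by (metis mem_Collect_eq prod.collapse)
    ultimately show "y = (m, n) \<or> key_less y (m, n)" by (auto simp: key_less_def prod_eq_iff)
  qed
  then show ?thesis using that by blast
qed

lemma is_lead_unique: "is_lead u x \<Longrightarrow> is_lead u y \<Longrightarrow> x = y"
  unfolding is_lead_def key_less_def by (metis less_asym less_irrefl)

text \<open>The order is compatible with addition, so the sum of two largest keys arises in one way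
  only and its coefficient cannot cancel.\<close>

lemma key_less_add_cancel:
  assumes "x' = x \<or> key_less x' x" "y' = y \<or> key_less y' y"
    and "(fst x' + fst y', snd x' + snd y') = (fst x + fst y, snd x + snd y)"
  shows "x' = x \<and> y' = y"
proof -
  have le: "fst x' \<le> fst x" "fst y' \<le> fst y" using assms by (auto simp: key_less_def)
  have "fst x' = fst x" "fst y' = fst y"
    using le assms(3) by (metis add_less_le_mono add_le_less_mono less_irrefl order_le_less fst_conv)+
  then have le': "snd x' \<le> snd x" "snd y' \<le> snd y" using assms by (auto simp: key_less_def)
  have "snd x' = snd x" "snd y' = snd y"
    using le' assms(3) by (metis add_less_le_mono add_le_less_mono less_irrefl order_le_less snd_conv)+
  then show ?thesis using \<open>fst x' = fst x\<close> \<open>fst y' = fst y\<close> by (simp add: prod_eq_iff)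
qed

lemma is_lead_mult:
  assumes q: "q \<noteq> 0" and u: "is_lead u x" and v: "is_lead v y"
  shows "is_lead (qt_mult q u v) (fst x + fst y, snd x + snd y)"
  unfolding is_lead_def
proof (intro conjI allI impI)
  let ?f = "\<lambda>x' y'. if (fst x + fst y, snd x + snd y) = (fst x' + fst y', snd x' + snd y')
     then Poly_Mapping.lookup u x' * Poly_Mapping.lookup v y' * q powi wt_pair (snd x') (fst y') else 0"
  have x: "x \<in> Poly_Mapping.keys u" and y: "y \<in> Poly_Mapping.keys v" using u v by (auto simp: is_lead_def in_keys_iff)
  have z: "?f x' y' = 0" if "x' \<in> Poly_Mapping.keys u" "y' \<in> Poly_Mapping.keys v" "x' \<noteq> x \<or> y' \<noteq> y" for x' y'
  proof -
    have "x' = x \<or> key_less x' x" "y' = y \<or> key_less y' y"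
      using is_leadD[OF u] is_leadD[OF v] that(1,2) by (simp_all add: in_keys_iff)
    then have "(fst x + fst y, snd x + snd y) \<noteq> (fst x' + fst y', snd x' + snd y')"
      using key_less_add_cancel[of x' x y' y] that(3) by metis
    then show ?thesis by (simp only: if_False)
  qed
  define g where "g = (\<lambda>x'. \<Sum>y'\<in>Poly_Mapping.keys v. ?f x' y')"
  have "Poly_Mapping.lookup (qt_mult q u v) (fst x + fst y, snd x + snd y) = (\<Sum>x'\<in>Poly_Mapping.keys u. g x')"
    unfolding lookup_qt_mult g_def ..
  also have "\<dots> = (\<Sum>x'\<in>{x}. g x')"
  proof (rule sum.mono_neutral_right)
    show "\<forall>x'\<in>Poly_Mapping.keys u - {x}. g x' = 0"
      unfolding g_def by (intro ballI sum.neutral z) simp_all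
  qed (use x in simp_all)
  also have "\<dots> = g x" by simp
  also have "\<dots> = (\<Sum>y'\<in>{y}. ?f x y')"
    unfolding g_def
  proof (rule sum.mono_neutral_right)
    show "\<forall>y'\<in>Poly_Mapping.keys v - {y}. ?f x y' = 0"
      by (intro ballI z x) simp_all
  qed (use y in simp_all)
  finally show "Poly_Mapping.lookup (qt_mult q u v) (fst x + fst y, snd x + snd y) \<noteq> 0"
    using q u v by (simp add: is_lead_def)
  fix w assume "Poly_Mapping.lookup (qt_mult q u v) w \<noteq> 0"
  then obtain x' y' where w: "Poly_Mapping.lookup u x' \<noteq> 0" "Poly_Mapping.lookup v y' \<noteq> 0" "w = (fst x' + fst y', snd x' + snd y')"
    by (rule qt_mult_nonzero)
  have "x' = x \<or> key_less x' x" by (rule is_leadD[OF u w(1)])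
  moreover have "y' = y \<or> key_less y' y" by (rule is_leadD[OF v w(2)])
  ultimately
  show "w = (fst x + fst y, snd x + snd y) \<or> key_less w (fst x + fst y, snd x + snd y)"
    unfolding w(3) key_less_def by (auto intro: add_strict_mono)
qed

lemma qt_mult_eq_0: "q \<noteq> 0 \<Longrightarrow> qt_mult q u v = 0 \<Longrightarrow> u = 0 \<or> v = 0"
  by (metis is_lead_def is_lead_exists is_lead_mult lookup_zero)

lemma is_lead_diff:
  assumes "is_lead u x" "\<And>y. Poly_Mapping.lookup v y \<noteq> 0 \<Longrightarrow> key_less y x"
  shows "is_lead (u - v) x"
proof -
  have "Poly_Mapping.lookup v x = 0" using assms(2)[of x] by (auto simp: key_less_def)
  moreover have "y = x \<or> key_less y x" if "Poly_Mapping.lookup (u - v) y \<noteq> 0" for y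
  proof -
    have "Poly_Mapping.lookup u y \<noteq> 0 \<or> Poly_Mapping.lookup v y \<noteq> 0" using that by (auto simp: lookup_minus)
    then show ?thesis using is_leadD[OF assms(1), of y] assms(2)[of y] by blast
  qed
  ultimately show ?thesis using assms(1) unfolding is_lead_def by (simp add: lookup_minus del: split_paired_All)
qed

lemma is_lead_scale: "c \<noteq> 0 \<Longrightarrow> is_lead (qt_scale c u) x \<longleftrightarrow> is_lead u x"
  by (simp add: is_lead_def)

section \<open>Leading keys of the solution of the Q-system\<close>

definition scaled_wt :: "nat \<Rightarrow> int \<Rightarrow> wt" where
  "scaled_wt a k = (\<Sum>i\<in>{1..a}. Poly_Mapping.single i k)"

lemma scaled_wt_add: "scaled_wt a k + scaled_wt a k' = scaled_wt a (k + k')"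
  by (simp add: scaled_wt_def single_add sum.distrib)

text \<open>Twice the a-th fundamental weight and the sum of its two neighbours agree before
  position a, where they have entries 2 and 1. So the square dominates whatever the exponents of T;
  for a = N the other product is 0.\<close>

lemma Q_system_rhs_lead:
  assumes q: "q \<noteq> 0" and a: "a \<in> {1..N}" and z: "D (N + 1) = 0"
    and L: "\<And>b. b \<le> N \<Longrightarrow> is_lead (D b) (indicator_wt {1..b}, scaled_wt b k)"
  shows "is_lead (qt_mult q (D a) (D a) - qt_mult q (D (a + 1)) (D (a - 1)))
    (indicator_wt {1..a} + indicator_wt {1..a}, scaled_wt a (k + k))"
proof (rule is_lead_diff)
  have "is_lead (D a) (indicator_wt {1..a}, scaled_wt a k)" using L a by simp
  from is_lead_mult[OF q this this]
  show "is_lead (qt_mult q (D a) (D a)) (indicator_wt {1..a} + indicator_wt {1..a}, scaled_wt a (k + k))"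
    by (simp add: scaled_wt_add)
  fix y assume y: "Poly_Mapping.lookup (qt_mult q (D (a + 1)) (D (a - 1))) y \<noteq> 0"
  then have "a + 1 \<noteq> N + 1" using z by auto
  then have "a + 1 \<le> N" using a by simp
  have "is_lead (D (a + 1)) (indicator_wt {1..a + 1}, scaled_wt (a + 1) k)"
    "is_lead (D (a - 1)) (indicator_wt {1..a - 1}, scaled_wt (a - 1) k)"
    using L \<open>a + 1 \<le> N\<close> by simp_all
  from is_leadD[OF is_lead_mult[OF q this] y]
  have "fst y \<le> indicator_wt {1..a + 1} + indicator_wt {1..a - 1}"
    by (auto simp: is_lead_def key_less_def)
  also have "\<dots> < indicator_wt {1..a} + indicator_wt {1..a}"
    unfolding wt_less_iff
    unfolding lookup_add by (rule exI[of _ a]) (use a in \<open>auto simp: lookup_indicator_wt\<close>)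
  finally show "key_less y (indicator_wt {1..a} + indicator_wt {1..a}, scaled_wt a (k + k))"
    by (simp add: key_less_def)
qed

text \<open>Leading keys add under multiplication, so those of a product and of one factor determine
  that of the other factor. Thus they propagate from k = 0, 1 in both directions.\<close>

lemma opposite_Q_system_lead:
  assumes q: "q \<noteq> 0" and Q: "opposite_Q_system N q D" and I: "standard_initial_data N D"
  shows "a \<le> N \<Longrightarrow> is_lead (D a k) (indicator_wt {1..a}, scaled_wt a k)"
proof -
  let ?L = "\<lambda>k. \<forall>a\<le>N. is_lead (D a k) (indicator_wt {1..a}, scaled_wt a k)"
  have D0: "D 0 k = qt_monom 0 0" and DN: "D (N + 1) k = 0" for k
    using Q by (auto simp: opposite_Q_system_def)
  have rel: "qt_scale (q ^ a) (qt_mult q (D a (k - 1)) (D a (k + 1)))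
     = qt_mult q (D a k) (D a k) - qt_mult q (D (a + 1) k) (D (a - 1) k)" if "a \<in> {1..N}" for a k
    using Q that by (auto simp: opposite_Q_system_def)
  have L0: "is_lead (D 0 k) (indicator_wt {1..0}, scaled_wt 0 k)" for k
    unfolding D0 by (auto simp: is_lead_def lookup_qt_monom indicator_wt_def scaled_wt_def)
  have lead: "is_lead (qt_mult q (D a (k - 1)) (D a (k + 1))) (indicator_wt {1..a} + indicator_wt {1..a}, scaled_wt a (k + k))"
    if "?L k" "a \<in> {1..N}" for a k
  proof -
    have "is_lead (qt_scale (q ^ a) (qt_mult q (D a (k - 1)) (D a (k + 1)))) (indicator_wt {1..a} + indicator_wt {1..a}, scaled_wt a (k + k))"
      unfolding rel[OF that(2)] by (rule Q_system_rhs_lead[where D = "\<lambda>a. D a k", OF q that(2) DN]) (use that in blast)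
    then show ?thesis using q by (simp add: is_lead_scale)
  qed
  have up: "?L (k + 1)" if L: "?L k" "?L (k - 1)" for k
  proof (intro allI impI)
    fix a assume "a \<le> N"
    show "is_lead (D a (k + 1)) (indicator_wt {1..a}, scaled_wt a (k + 1))"
    proof (cases "a = 0")
      case True
      then show ?thesis using L0 by simp
    next
      case False
      then have a: "a \<in> {1..N}" using \<open>a \<le> N\<close> by simp
      note P = lead[OF L(1) a]
      then have "D a (k + 1) \<noteq> 0" by (auto simp: is_lead_def)
      then obtain x where x: "is_lead (D a (k + 1)) x" by (rule is_lead_exists)
      have "is_lead (D a (k - 1)) (indicator_wt {1..a}, scaled_wt a (k - 1))" using L(2) a by simp
      from is_lead_unique[OF is_lead_mult[OF q this x] P]
      have "fst x = indicator_wt {1..a}" "scaled_wt a (k - 1) + snd x = scaled_wt a (k - 1) + scaled_wt a (k + 1)"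
        by (simp_all add: scaled_wt_add)
      then have "x = (indicator_wt {1..a}, scaled_wt a (k + 1))" by (simp add: prod_eq_iff)
      then show ?thesis using x by simp
    qed
  qed
  have down: "?L (k - 1)" if L: "?L k" "?L (k + 1)" for k
  proof (intro allI impI)
    fix a assume "a \<le> N"
    show "is_lead (D a (k - 1)) (indicator_wt {1..a}, scaled_wt a (k - 1))"
    proof (cases "a = 0")
      case True
      then show ?thesis using L0 by simp
    next
      case False
      then have a: "a \<in> {1..N}" using \<open>a \<le> N\<close> by simp
      note P = lead[OF L(1) a]
      then have "D a (k - 1) \<noteq> 0" by (auto simp: is_lead_def)
      then obtain x where x: "is_lead (D a (k - 1)) x" by (rule is_lead_exists)
      have "is_lead (D a (k + 1)) (indicator_wt {1..a}, scaled_wt a (k + 1))" using L(2) a by simp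
      from is_lead_unique[OF is_lead_mult[OF q x this] P]
      have "fst x = indicator_wt {1..a}" "snd x + scaled_wt a (k + 1) = scaled_wt a (k - 1) + scaled_wt a (k + 1)"
        by (simp_all add: scaled_wt_add)
      then have "x = (indicator_wt {1..a}, scaled_wt a (k - 1))" by (simp add: prod_eq_iff)
      then show ?thesis using x by simp
    qed
  qed
  have i0: "?L 0"
  proof (intro allI impI)
    fix a assume "a \<le> N"
    show "is_lead (D a 0) (indicator_wt {1..a}, scaled_wt a 0)"
    proof (cases "a = 0")
      case False
      then have "D a 0 = qt_monom (indicator_wt {1..a}) 0" using I \<open>a \<le> N\<close>
        by (auto simp: standard_initial_data_def indicator_wt_def)
      then show ?thesis by (simp add: is_lead_def lookup_qt_monom scaled_wt_def)
    qed (use L0 in simp)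
  qed
  have i1: "?L 1"
  proof (intro allI impI)
    fix a assume "a \<le> N"
    show "is_lead (D a 1) (indicator_wt {1..a}, scaled_wt a 1)"
    proof (cases "a = 0")
      case False
      then have "D a 1 = qt_monom (indicator_wt {1..a}) (scaled_wt a 1)" using I \<open>a \<le> N\<close>
        by (auto simp: standard_initial_data_def indicator_wt_def scaled_wt_def)
      then show ?thesis by (simp add: is_lead_def lookup_qt_monom)
    qed (use L0 in simp)
  qed
  have "?L k \<and> ?L (k + 1)" for k
  proof (induction k rule: int_induct[where k = 0])
    case base
    then show ?case using i0 i1 by simp
  next
    case (step1 i)
    then show ?case using up[of "i + 1"] by simp
  next
    case (step2 i)
    then show ?case using down[of i] by simp
  qed
  then show "a \<le> N \<Longrightarrow> is_lead (D a k) (indicator_wt {1..a}, scaled_wt a k)" by blast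
qed

section \<open>Families depending on the weight through characters\<close>

text \<open>An element of the group algebra of the lattice, read as a Laurent polynomial in the
  q^(l_i).\<close>

definition char_eval :: "complex \<Rightarrow> (wt \<Rightarrow>\<^sub>0 complex) \<Rightarrow> wt \<Rightarrow> complex" where
  "char_eval q p l = (\<Sum>m\<in>Poly_Mapping.keys p. Poly_Mapping.lookup p m * q powi wt_pair m l)"

lemma char_eval_superset:
  assumes "finite A" "Poly_Mapping.keys p \<subseteq> A"
  shows "char_eval q p l = (\<Sum>m\<in>A. Poly_Mapping.lookup p m * q powi wt_pair m l)"
  unfolding char_eval_def by (rule sum.mono_neutral_left) (use assms in \<open>auto simp: in_keys_iff\<close>)

lemma char_eval_0 [simp]: "char_eval q 0 l = 0"
  by (simp add: char_eval_def)

lemma char_eval_single: "char_eval q (Poly_Mapping.single m c) l = c * q powi wt_pair m l"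
  by (simp add: char_eval_superset[of "{m}"])

lemma char_eval_add: "char_eval q (p + r) l = char_eval q p l + char_eval q r l"
proof -
  let ?A = "Poly_Mapping.keys p \<union> Poly_Mapping.keys r"
  have A: "finite ?A" "Poly_Mapping.keys p \<subseteq> ?A" "Poly_Mapping.keys r \<subseteq> ?A" "Poly_Mapping.keys (p + r) \<subseteq> ?A"
    using Poly_Mapping.keys_add[of p r] by auto
  show ?thesis
    by (simp add: char_eval_superset[OF A(1,2)] char_eval_superset[OF A(1,3)] char_eval_superset[OF A(1,4)]
        lookup_add distrib_right sum.distrib)
qed

lemma char_eval_sum: "char_eval q (\<Sum>i\<in>A. f i) l = (\<Sum>i\<in>A. char_eval q (f i) l)"
  by (induction A rule: infinite_finite_induct) (auto simp: char_eval_add)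

lemma sum_single_keys:
  fixes p :: "wt \<Rightarrow>\<^sub>0 complex"
  shows "(\<Sum>m\<in>Poly_Mapping.keys p. Poly_Mapping.single m (Poly_Mapping.lookup p m)) = p"
  by (rule poly_mapping_eqI) (simp add: lookup_sum lookup_single when_def in_keys_iff)

lemma char_eval_mult:
  assumes "q \<noteq> 0"
  shows "char_eval q (p * r) l = char_eval q p l * char_eval q r l"
proof -
  have "p * r = (\<Sum>m\<in>Poly_Mapping.keys p. Poly_Mapping.single m (Poly_Mapping.lookup p m))
      * (\<Sum>n\<in>Poly_Mapping.keys r. Poly_Mapping.single n (Poly_Mapping.lookup r n))"
    by (simp only: sum_single_keys)
  also have "char_eval q \<dots> l = (\<Sum>m\<in>Poly_Mapping.keys p. \<Sum>n\<in>Poly_Mapping.keys r.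
      (Poly_Mapping.lookup p m * q powi wt_pair m l) * (Poly_Mapping.lookup r n * q powi wt_pair n l))"
    unfolding sum_product char_eval_sum mult_single char_eval_single wt_pair_add_left
    by (intro sum.cong refl) (simp add: power_int_add assms)
  also have "\<dots> = char_eval q p l * char_eval q r l"
    unfolding char_eval_def sum_product ..
  finally show ?thesis .
qed

text \<open>Linear independence of characters. Shifting l by e_i and subtracting a multiple removes
  the character m but keeps m', because q takes different powers at their i-th entries; the number
  of characters drops.\<close>

lemma char_eval_eq_0_imp:
  assumes q: "q \<noteq> 0" "norm q < 1"
  shows "Poly_Mapping.keys p \<subseteq> lattice N \<Longrightarrow> (\<And>l. l \<in> lattice N \<Longrightarrow> char_eval q p l = 0) \<Longrightarrow> p = 0"
proof (induction "card (Poly_Mapping.keys p)" arbitrary: p rule: less_induct)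
  case less
  show ?case
  proof (rule ccontr)
    assume "p \<noteq> 0"
    then obtain m where m: "m \<in> Poly_Mapping.keys p" by fastforce
    show False
    proof (cases "Poly_Mapping.keys p = {m}")
      case True
      have "char_eval q p 0 = Poly_Mapping.lookup p m * q powi wt_pair m 0"
        by (simp add: char_eval_def True)
      then show False using less.prems(2)[of 0] m q by (simp add: in_keys_iff)
    next
      case False
      then obtain m' where m': "m' \<in> Poly_Mapping.keys p" "m' \<noteq> m" using m by blast
      then obtain i where i: "wt_entry m' i \<noteq> wt_entry m i" by (metis poly_mapping_eqI)
      have "i \<in> {1..N}"
      proof (rule ccontr)
        assume "i \<notin> {1..N}"
        then show False using i m m'(1) less.prems(1) wt_entry_lattice by (metis subsetD)
      qed
      let ?d = "\<lambda>n. q powi wt_entry n i - q powi wt_entry m i"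
      define p' where "p' = (\<Sum>n\<in>Poly_Mapping.keys p. Poly_Mapping.single n (Poly_Mapping.lookup p n * ?d n))"
      have look: "Poly_Mapping.lookup p' n = Poly_Mapping.lookup p n * ?d n" for n
        unfolding p'_def by (simp add: lookup_sum lookup_single when_def in_keys_iff)
      have sub: "Poly_Mapping.keys p' \<subseteq> Poly_Mapping.keys p - {m}" by (auto simp: in_keys_iff look)
      have "p' = 0"
      proof (rule less.hyps)
        show "card (Poly_Mapping.keys p') < card (Poly_Mapping.keys p)"
          by (rule psubset_card_mono) (use sub m in auto)
        show "Poly_Mapping.keys p' \<subseteq> lattice N" using sub less.prems(1) by auto
        fix l assume l: "l \<in> lattice N"
        have pair: "wt_pair n (l + eps i) = wt_pair n l + wt_entry n i" for n
        proof -
          have "wt_pair n (eps i) = wt_pair (indicator_wt {i}) n" by (simp add: indicator_wt_def wt_pair_commute)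
          then show ?thesis by (simp add: wt_pair_add_right wt_pair_indicator)
        qed
        have "char_eval q p' l = char_eval q p (l + eps i) - q powi wt_entry m i * char_eval q p l"
          unfolding p'_def char_eval_sum char_eval_single
          by (simp add: char_eval_def pair power_int_add q(1) sum_distrib_left sum_subtractf[symmetric] algebra_simps)
        moreover have "l + eps i \<in> lattice N" using l \<open>i \<in> {1..N}\<close> by (intro lattice_add lattice_single)
        ultimately show "char_eval q p' l = 0" using less.prems(2) l by simp
      qed
      then have "Poly_Mapping.lookup p m' * ?d m' = 0" using look[of m'] by simp
      then show False using m'(1) i powi_inj[OF q, of "wt_entry m' i" "wt_entry m i"] by (auto simp: in_keys_iff)
    qed
  qed
qed

section \<open>Functions of the weight that are sums of characters\<close>

definition reg_fun :: "nat \<Rightarrow> complex \<Rightarrow> (wt \<Rightarrow> complex) \<Rightarrow> bool" where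
  "reg_fun N q h \<longleftrightarrow> (\<exists>p. Poly_Mapping.keys p \<subseteq> lattice N \<and> (\<forall>l\<in>lattice N. h l = char_eval q p l))"

lemma reg_fun_cong: "(\<And>l. l \<in> lattice N \<Longrightarrow> h l = h' l) \<Longrightarrow> reg_fun N q h \<longleftrightarrow> reg_fun N q h'"
  unfolding reg_fun_def by simp

lemma reg_fun_char: "m \<in> lattice N \<Longrightarrow> reg_fun N q (\<lambda>l. c * q powi wt_pair m l)"
  unfolding reg_fun_def by (rule exI[of _ "Poly_Mapping.single m c"]) (auto simp: char_eval_single split: if_splits)

lemma reg_fun_const: "reg_fun N q (\<lambda>l. c)"
  using reg_fun_char[of 0 N q c] by simp

lemma reg_fun_add: "reg_fun N q h \<Longrightarrow> reg_fun N q h' \<Longrightarrow> reg_fun N q (\<lambda>l. h l + h' l)"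
  unfolding reg_fun_def
proof safe
  fix p p' assume "Poly_Mapping.keys p \<subseteq> lattice N" "Poly_Mapping.keys p' \<subseteq> lattice N"
    "\<forall>l\<in>lattice N. h l = char_eval q p l" "\<forall>l\<in>lattice N. h' l = char_eval q p' l"
  then show "\<exists>p. Poly_Mapping.keys p \<subseteq> lattice N \<and> (\<forall>l\<in>lattice N. h l + h' l = char_eval q p l)"
    using Poly_Mapping.keys_add[of p p'] by (intro exI[of _ "p + p'"]) (auto simp: char_eval_add)
qed

lemma reg_fun_mult: "q \<noteq> 0 \<Longrightarrow> reg_fun N q h \<Longrightarrow> reg_fun N q h' \<Longrightarrow> reg_fun N q (\<lambda>l. h l * h' l)"
  unfolding reg_fun_def
proof safe
  fix p p' assume *: "q \<noteq> 0" "Poly_Mapping.keys p \<subseteq> lattice N" "Poly_Mapping.keys p' \<subseteq> lattice N"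
    "\<forall>l\<in>lattice N. h l = char_eval q p l" "\<forall>l\<in>lattice N. h' l = char_eval q p' l"
  have "Poly_Mapping.keys (p * p') \<subseteq> lattice N"
  proof
    fix x assume "x \<in> Poly_Mapping.keys (p * p')"
    then obtain a b where "x = a + b" "a \<in> Poly_Mapping.keys p" "b \<in> Poly_Mapping.keys p'"
      using keys_mult[of p p'] by auto
    then show "x \<in> lattice N" using *(2,3) by (auto intro: lattice_add)
  qed
  then show "\<exists>p. Poly_Mapping.keys p \<subseteq> lattice N \<and> (\<forall>l\<in>lattice N. h l * h' l = char_eval q p l)"
    using * by (intro exI[of _ "p * p'"]) (auto simp: char_eval_mult)
qed

lemma reg_fun_sum: "(\<And>i. i \<in> A \<Longrightarrow> reg_fun N q (f i)) \<Longrightarrow> reg_fun N q (\<lambda>l. \<Sum>i\<in>A. f i l)"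
  by (induction A rule: infinite_finite_induct) (auto simp: reg_fun_const intro: reg_fun_add)

lemma reg_fun_shift:
  assumes "q \<noteq> 0" "n \<in> lattice N" "reg_fun N q h"
  shows "reg_fun N q (\<lambda>l. h (l + n))"
proof -
  obtain p where p: "Poly_Mapping.keys p \<subseteq> lattice N" "\<And>l. l \<in> lattice N \<Longrightarrow> h l = char_eval q p l"
    using assms(3) unfolding reg_fun_def by blast
  have "reg_fun N q (\<lambda>l. \<Sum>m\<in>Poly_Mapping.keys p. (Poly_Mapping.lookup p m * q powi wt_pair m n) * q powi wt_pair m l)"
    by (intro reg_fun_sum reg_fun_char) (use p in auto)
  moreover have "h (l + n) = (\<Sum>m\<in>Poly_Mapping.keys p. (Poly_Mapping.lookup p m * q powi wt_pair m n) * q powi wt_pair m l)"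
    if "l \<in> lattice N" for l
    using p(2)[OF lattice_add[OF that assms(2)]] by (simp add: char_eval_def wt_pair_add_right power_int_add assms(1) mult_ac)
  ultimately show ?thesis by (simp cong: reg_fun_cong)
qed

lemma reg_fun_qpow: "q \<noteq> 0 \<Longrightarrow> I \<subseteq> {1..N} \<Longrightarrow> reg_fun N q (\<lambda>l. qpow q I l)"
proof -
  assume "q \<noteq> 0" "I \<subseteq> {1..N}"
  moreover then have "finite I" using finite_subset by blast
  ultimately show ?thesis using reg_fun_char[OF indicator_wt_lattice, of I N q 1] by (simp add: qpow_wt_pair)
qed

text \<open>By independence the two elements of the group algebra have product 0, and the group
  algebra of an ordered group has no zero divisors. For arbitrary functions on the lattice, such as
  two with complementary supports, the conclusion fails.\<close>

lemma reg_fun_mult_eq_0: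
  assumes q: "q \<noteq> 0" "norm q < 1" and "reg_fun N q h" "reg_fun N q h'"
    and z: "\<And>l. l \<in> lattice N \<Longrightarrow> h l * h' l = 0"
  shows "(\<forall>l\<in>lattice N. h l = 0) \<or> (\<forall>l\<in>lattice N. h' l = 0)"
proof -
  obtain p p' where p: "Poly_Mapping.keys p \<subseteq> lattice N" "\<And>l. l \<in> lattice N \<Longrightarrow> h l = char_eval q p l"
    and p': "Poly_Mapping.keys p' \<subseteq> lattice N" "\<And>l. l \<in> lattice N \<Longrightarrow> h' l = char_eval q p' l"
    using assms(3,4) unfolding reg_fun_def by blast
  have "p * p' = 0"
  proof (rule char_eval_eq_0_imp[OF q])
    show "Poly_Mapping.keys (p * p') \<subseteq> lattice N"
    proof
      fix x assume "x \<in> Poly_Mapping.keys (p * p')"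
      then obtain a b where "x = a + b" "a \<in> Poly_Mapping.keys p" "b \<in> Poly_Mapping.keys p'"
        using keys_mult[of p p'] by auto
      then show "x \<in> lattice N" using p(1) p'(1) by (auto intro: lattice_add)
    qed
    fix l assume "l \<in> lattice N"
    then show "char_eval q (p * p') l = 0" using z[of l] p(2)[of l] p'(2)[of l] by (simp add: char_eval_mult q)
  qed
  then have "p = 0 \<or> p' = 0" by simp
  then show ?thesis using p(2) p'(2) by auto
qed

text \<open>
  Families of series whose coefficients at a fixed position relative to the weight l are finite sums
  of characters of l; B bounds the relative positions that occur.
\<close>

definition regular :: "nat \<Rightarrow> complex \<Rightarrow> (wt \<Rightarrow> xseries) \<Rightarrow> bool" where
  "regular N q f \<longleftrightarrow>
     (\<exists>B :: wt \<Rightarrow> complex. bounded_exps B \<and> (\<forall>l\<in>lattice N. \<forall>b. xcoeff (f l) (l + b) \<noteq> 0 \<longrightarrow> B b \<noteq> 0)) \<and>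
     (\<forall>b. reg_fun N q (\<lambda>l. xcoeff (f l) (l + b)))"

lemma regular_add:
  assumes "regular N q f" "regular N q g"
  shows "regular N q (\<lambda>l. f l + g l)"
proof -
  obtain B B' :: "wt \<Rightarrow> complex" where B: "bounded_exps B" "\<And>l b. l \<in> lattice N \<Longrightarrow> xcoeff (f l) (l + b) \<noteq> 0 \<Longrightarrow> B b \<noteq> 0"
    and B': "bounded_exps B'" "\<And>l b. l \<in> lattice N \<Longrightarrow> xcoeff (g l) (l + b) \<noteq> 0 \<Longrightarrow> B' b \<noteq> 0"
    using assms unfolding regular_def by metis
  have "bounded_exps (\<lambda>b. if B b \<noteq> 0 \<or> B' b \<noteq> 0 then 1 else 0)"
    by (rule bounded_exps_sum[OF B(1) B'(1)]) simp
  moreover have "\<forall>l\<in>lattice N. \<forall>b. xcoeff (f l + g l) (l + b) \<noteq> 0 \<longrightarrow>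
      (if B b \<noteq> 0 \<or> B' b \<noteq> 0 then 1 else 0 :: complex) \<noteq> 0"
    using B(2) B'(2) by (metis add.right_neutral xcoeff_simps(2) zero_neq_one)
  ultimately show ?thesis using assms unfolding regular_def by (auto intro: reg_fun_add)
qed

lemma regular_0: "regular N q (\<lambda>l. 0)"
proof -
  have "bounded_exps (\<lambda>g. if g = 0 then 0 else 0 :: complex)" by (rule bounded_exps_monom)
  then show ?thesis unfolding regular_def by (auto simp: reg_fun_const)
qed

lemma regular_sum: "(\<And>i. i \<in> A \<Longrightarrow> regular N q (f i)) \<Longrightarrow> regular N q (\<lambda>l. \<Sum>i\<in>A. f i l)"
  by (induction A rule: infinite_finite_induct) (auto simp: regular_0 intro: regular_add)

lemma regular_scale:
  assumes "q \<noteq> 0" "reg_fun N q h" "regular N q f"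
  shows "regular N q (\<lambda>l. xconst (h l) * f l)"
  using assms unfolding regular_def by (auto intro!: reg_fun_mult)

lemma regular_diff:
  assumes "q \<noteq> 0" "regular N q f" "regular N q g"
  shows "regular N q (\<lambda>l. f l - g l)"
  using regular_add[OF assms(2) regular_scale[OF assms(1) reg_fun_const[of N q "- 1"] assms(3)]]
  by (simp add: xconst_uminus)

lemma regular_Gamma:
  assumes "q \<noteq> 0" "I \<subseteq> {1..N}" "regular N q f"
  shows "regular N q (\<lambda>l. Gamma q I (f l))"
proof -
  have "reg_fun N q (\<lambda>l. qpow q I l * qpow q I b * xcoeff (f l) (l + b))" for b
    by (intro reg_fun_mult reg_fun_qpow reg_fun_const) (use assms in \<open>auto simp: regular_def\<close>)
  then show ?thesis using assms(1,3) unfolding regular_def by (auto simp: qpow_add)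
qed

text \<open>The common bound B makes the set of contributing exponents finite and independent of
  l.\<close>

lemma regular_mult:
  assumes q: "q \<noteq> 0" and "regular N q f"
  shows "regular N q (\<lambda>l. C * f l)"
proof -
  obtain B :: "wt \<Rightarrow> complex" where B: "bounded_exps B" "\<And>l b. l \<in> lattice N \<Longrightarrow> xcoeff (f l) (l + b) \<noteq> 0 \<Longrightarrow> B b \<noteq> 0"
    using assms unfolding regular_def by metis
  have "reg_fun N q (\<lambda>l. xcoeff (C * f l) (l + b))" for b
  proof -
    let ?A = "{a. xcoeff C a \<noteq> 0 \<and> B (b - a) \<noteq> 0}"
    have "xcoeff (C * f l) (l + b) = (\<Sum>a\<in>?A. xcoeff C a * xcoeff (f l) (l + (b - a)))" if l: "l \<in> lattice N" for l
    proof -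
      have e: "l + (b - a) = l + b - a" for a by simp
      show ?thesis unfolding e
      proof (rule xcoeff_mult_eq_sum)
        show "finite ?A" by (rule finite_conv[OF bounded_exps_xcoeff B(1)])
        fix a assume "xcoeff C a \<noteq> 0" "xcoeff (f l) (l + b - a) \<noteq> 0"
        moreover then have "B (b - a) \<noteq> 0" by (intro B(2)[OF l]) (simp only: e not_False_eq_True)
        ultimately show "a \<in> ?A" by simp
      qed
    qed
    moreover have "reg_fun N q (\<lambda>l. \<Sum>a\<in>?A. xcoeff C a * xcoeff (f l) (l + (b - a)))"
      by (intro reg_fun_sum reg_fun_mult reg_fun_const q) (use assms(2) in \<open>auto simp only: regular_def\<close>)
    ultimately show ?thesis by (simp cong: reg_fun_cong)
  qed
  moreover have "\<forall>l\<in>lattice N. \<forall>b. xcoeff (C * f l) (l + b) \<noteq> 0 \<longrightarrow>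
     (if \<exists>a. xcoeff C a \<noteq> 0 \<and> B (b - a) \<noteq> 0 then 1 else 0 :: complex) \<noteq> 0"
  proof (intro ballI allI impI)
    fix l b assume l: "l \<in> lattice N" and nz: "xcoeff (C * f l) (l + b) \<noteq> 0"
    obtain a where a: "xcoeff C a \<noteq> 0" "xcoeff (f l) (l + b - a) \<noteq> 0"
      using nz by (rule xcoeff_mult_nonzero)
    have e: "l + b - a = l + (b - a)" by simp
    have "B (b - a) \<noteq> 0" using a(2) unfolding e by (rule B(2)[OF l])
    then show "(if \<exists>a. xcoeff C a \<noteq> 0 \<and> B (b - a) \<noteq> 0 then 1 else 0 :: complex) \<noteq> 0" using a(1) by auto
  qed
  ultimately show ?thesis
    unfolding regular_def using bounded_exps_conv_supp[OF bounded_exps_xcoeff B(1), of C] by blast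
qed

lemma regular_D_op:
  assumes "q \<noteq> 0" "regular N q f"
  shows "regular N q (\<lambda>l. D_op N q a k (f l))"
  unfolding D_op_eq by (intro regular_sum regular_mult regular_Gamma assms) auto

lemma regular_shift:
  assumes q: "q \<noteq> 0" and n: "n \<in> lattice N" and f: "regular N q f"
  shows "regular N q (\<lambda>l. f (l + n))"
proof -
  obtain B :: "wt \<Rightarrow> complex" where B: "bounded_exps B" "\<And>l b. l \<in> lattice N \<Longrightarrow> xcoeff (f l) (l + b) \<noteq> 0 \<Longrightarrow> B b \<noteq> 0"
    using f unfolding regular_def by metis
  have e: "l + b = (l + n) + (b - n)" for l b by simp
  have "reg_fun N q (\<lambda>l. xcoeff (f (l + n)) (l + b))" for b
  proof -
    have "reg_fun N q (\<lambda>l. (\<lambda>l. xcoeff (f l) (l + (b - n))) (l + n))"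
      by (rule reg_fun_shift[OF q n]) (use f in \<open>simp only: regular_def\<close>)
    then show ?thesis unfolding e[symmetric] .
  qed
  moreover have "bounded_exps (\<lambda>b. if \<exists>a. (if a = n then 1 else 0 :: complex) \<noteq> 0 \<and> B (b - a) \<noteq> 0 then 1 else 0)"
    by (rule bounded_exps_conv_supp[OF bounded_exps_monom B(1)])
  moreover have "\<forall>l\<in>lattice N. \<forall>b. xcoeff (f (l + n)) (l + b) \<noteq> 0 \<longrightarrow>
      (if \<exists>a. (if a = n then 1 else 0 :: complex) \<noteq> 0 \<and> B (b - a) \<noteq> 0 then 1 else 0 :: complex) \<noteq> 0"
  proof (intro ballI allI impI)
    fix l b assume l: "l \<in> lattice N" and nz: "xcoeff (f (l + n)) (l + b) \<noteq> 0"
    have "B (b - n) \<noteq> 0" using B(2)[OF lattice_add[OF l n], of "b - n"] nz unfolding e[symmetric] .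
    then show "(if \<exists>a. (if a = n then 1 else 0 :: complex) \<noteq> 0 \<and> B (b - a) \<noteq> 0 then 1 else 0 :: complex) \<noteq> 0"
      by auto
  qed
  ultimately show ?thesis unfolding regular_def by blast
qed

lemma regular_qt_act:
  assumes q: "q \<noteq> 0" and u: "u \<in> qt_carrier N" and f: "regular N q f"
  shows "regular N q (\<lambda>l. qt_act q u f l)"
  unfolding qt_act_def case_prod_unfold
proof (intro regular_sum regular_scale regular_shift q f reg_fun_char)
  fix x assume "x \<in> Poly_Mapping.keys u"
  then have "x \<in> lattice N \<times> lattice N" using u by (auto simp: qt_carrier_def)
  then show "snd x \<in> lattice N" "fst x \<in> lattice N" by auto
qed

text \<open>
  Looking at the largest relative position in the family and the largest shift in u reduces
  injectivity to the absence of zero divisors among sums of characters.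
\<close>

lemma qt_act_injective:
  assumes q: "q \<noteq> 0" "norm q < 1" and u: "u \<in> qt_carrier N" "u \<noteq> 0" and f: "regular N q f"
    and z: "\<And>l. l \<in> lattice N \<Longrightarrow> qt_act q u f l = 0" and l: "l \<in> lattice N"
  shows "f l = 0"
proof (rule ccontr)
  assume "f l \<noteq> 0"
  obtain B :: "wt \<Rightarrow> complex" where B: "bounded_exps B" "\<And>l b. l \<in> lattice N \<Longrightarrow> xcoeff (f l) (l + b) \<noteq> 0 \<Longrightarrow> B b \<noteq> 0"
    using f unfolding regular_def by metis
  obtain M c where Mc: "\<And>b. B b \<noteq> 0 \<Longrightarrow> Poly_Mapping.keys b \<subseteq> {..M} \<and> (\<forall>i. psum i b \<le> c)"
    using B(1) unfolding bounded_exps_def by blast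
  let ?S = "{b. \<exists>l\<in>lattice N. xcoeff (f l) (l + b) \<noteq> 0}"
  obtain g where "xcoeff (f l) g \<noteq> 0" using \<open>f l \<noteq> 0\<close> xseries_eqI[of "f l" 0] by auto
  then have "xcoeff (f l) (l + (g - l)) \<noteq> 0" by simp
  then have "?S \<noteq> {}" using l by blast
  moreover have "\<And>b. b \<in> ?S \<Longrightarrow> Poly_Mapping.keys b \<subseteq> {..M} \<and> (\<forall>i. psum i b \<le> c)"
    using Mc B(2) by blast
  ultimately have "\<exists>b\<in>?S. \<forall>b'\<in>?S. b' \<le> b" by (rule bounded_wts_max)
  \<comment> \<open>The largest position relative to the weight at which any member of the family
    has a nonzero coefficient.\<close>
  then obtain b where b: "b \<in> ?S" "\<And>b'. b' \<in> ?S \<Longrightarrow> b' \<le> b" by blast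
  let ?N = "snd ` Poly_Mapping.keys u"
  have N: "finite ?N" "?N \<noteq> {}" using u(2) by auto
  define n where "n = Max ?N"
  have n: "n \<in> ?N" "\<And>n'. n' \<in> ?N \<Longrightarrow> n' \<le> n" using Max_in[OF N] Max_ge[OF N(1)] by (auto simp: n_def)
  have nl: "n \<in> lattice N" using n(1) u(1) by (auto simp: qt_carrier_def)
  let ?K = "{x \<in> Poly_Mapping.keys u. snd x = n}"
  \<comment> \<open>The part of u with the largest shift n, as an element of the group
    algebra.\<close>
  define p where "p = (\<Sum>x\<in>?K. Poly_Mapping.single (fst x) (Poly_Mapping.lookup u x))"
  have p_lookup: "Poly_Mapping.lookup p m = Poly_Mapping.lookup u (m, n)" for m
  proof -
    have "Poly_Mapping.lookup p m = (\<Sum>x\<in>?K. if x = (m, n) then Poly_Mapping.lookup u x else 0)"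
      unfolding p_def lookup_sum lookup_single when_def by (rule sum.cong) (auto simp: prod_eq_iff)
    also have "\<dots> = (if (m, n) \<in> ?K then Poly_Mapping.lookup u (m, n) else 0)" by (simp add: sum.delta)
    finally show ?thesis by (auto simp: in_keys_iff)
  qed
  obtain x0 where "x0 \<in> Poly_Mapping.keys u" "snd x0 = n" using n(1) by blast
  then have "Poly_Mapping.lookup p (fst x0) \<noteq> 0" unfolding p_lookup by (auto simp: in_keys_iff)
  then have "p \<noteq> 0" by auto
  have p_keys: "Poly_Mapping.keys p \<subseteq> lattice N"
    using u(1) by (auto simp: in_keys_iff p_lookup qt_carrier_def)
  \<comment> \<open>A smaller shift would reach the position l + n + b only from a relative position
    beyond b, where all coefficients vanish. So only the part with shift n contributes.\<close>
  have key: "char_eval q p l * xcoeff (f (l + n)) (l + n + b) = 0" if l: "l \<in> lattice N" for l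
  proof -
    let ?t = "\<lambda>x. Poly_Mapping.lookup u x * q powi wt_pair (fst x) l * xcoeff (f (l + snd x)) (l + n + b)"
    have "0 = xcoeff (qt_act q u f l) (l + n + b)" using z[OF l] by simp
    also have "\<dots> = (\<Sum>x\<in>Poly_Mapping.keys u. ?t x)"
      by (simp add: qt_act_def case_prod_unfold xcoeff_sum)
    also have "\<dots> = (\<Sum>x\<in>?K. ?t x)"
    proof (rule sum.mono_neutral_right)
      show "\<forall>x\<in>Poly_Mapping.keys u - ?K. ?t x = 0"
      proof
        fix x assume x: "x \<in> Poly_Mapping.keys u - ?K"
        then have "snd x < n" using n(2)[of "snd x"] by (force simp: order_less_le)
        have "l + snd x \<in> lattice N" using x u(1) l by (auto simp: qt_carrier_def intro!: lattice_add)
        moreover have e: "l + n + b = l + snd x + (n - snd x + b)" by simp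
        moreover have "\<not> n - snd x + b \<le> b" using \<open>snd x < n\<close> by (simp add: not_le)
        ultimately have "xcoeff (f (l + snd x)) (l + n + b) = 0" using b(2)[of "n - snd x + b"] by (metis (mono_tags, lifting) mem_Collect_eq)
        then show "?t x = 0" by simp
      qed
    qed auto
    also have "\<dots> = (\<Sum>x\<in>?K. Poly_Mapping.lookup u x * q powi wt_pair (fst x) l) * xcoeff (f (l + n)) (l + n + b)"
      unfolding sum_distrib_right by (intro sum.cong refl) auto
    also have "(\<Sum>x\<in>?K. Poly_Mapping.lookup u x * q powi wt_pair (fst x) l) = char_eval q p l"
      unfolding p_def char_eval_sum char_eval_single ..
    finally show ?thesis by simp
  qed
  have "(\<forall>l\<in>lattice N. char_eval q p l = 0) \<or> (\<forall>l\<in>lattice N. xcoeff (f (l + n)) (l + n + b) = 0)"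
  proof (rule reg_fun_mult_eq_0[OF q _ _ key])
    show "reg_fun N q (char_eval q p)" using p_keys unfolding reg_fun_def by blast
    have "reg_fun N q (\<lambda>l. xcoeff (f l) (l + b))" using f by (simp only: regular_def)
    from reg_fun_shift[OF q(1) nl this]
    show "reg_fun N q (\<lambda>l. xcoeff (f (l + n)) (l + n + b))" .
  qed
  then show False
  proof
    assume "\<forall>l\<in>lattice N. char_eval q p l = 0"
    then have "p = 0" using char_eval_eq_0_imp[OF q p_keys] by blast
    then show False using \<open>p \<noteq> 0\<close> by simp
  next
    assume *: "\<forall>l\<in>lattice N. xcoeff (f (l + n)) (l + n + b) = 0"
    obtain l where l: "l \<in> lattice N" "xcoeff (f l) (l + b) \<noteq> 0" using b(1) by blast
    have "l - n \<in> lattice N" using l nl by (intro lattice_diff)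
    then have "xcoeff (f (l - n + n)) (l - n + n + b) = 0" using * by blast
    then show False using l by simp
  qed
qed

text \<open>At l - g both the separating index and, up to the character given by the a-th partial
  sum of l, the eigenvalue gap depend on g only. Dividing by the gap multiplies by a character, so
  the recursion stays within sums of characters.\<close>

lemma regular_Psi:
  assumes q: "q \<noteq> 0" "norm q < 1"
  shows "regular N q (Psi N q)"
proof -
  have supp: "below_supp N l (Psi N q l)" and lead: "xcoeff (Psi N q l) l = 1" if "l \<in> lattice N" for l
    using joint_eigen_Psi[OF q that] by (auto simp: joint_eigen_def leading_monomial_iff)
  have "reg_fun N q (\<lambda>l. xcoeff (Psi N q l) (l - g))" for g
  proof (induction "height N g" arbitrary: g rule: less_induct)
    case less
    consider "g \<notin> Qplus N" | "g = 0" | "g \<in> Qplus N" "g \<noteq> 0" by blast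
    then show ?case
    proof cases
      case 1
      have "xcoeff (Psi N q l) (l - g) = 0" if "l \<in> lattice N" for l
        using supp[OF that] 1 unfolding below_supp_def by (metis diff_diff_eq2 add_diff_cancel_left')
      then show ?thesis by (simp add: reg_fun_const cong: reg_fun_cong)
    next
      case 2
      then show ?thesis using lead by (simp add: reg_fun_const cong: reg_fun_cong)
    next
      case 3
      define a where "a = fst_diff g"
      have a: "a \<in> {1..N}" "psum a g > 0" using fst_diff[OF 3] by (simp_all add: a_def)
      \<comment> \<open>The constant part of the gap; it is nonzero since the a-th partial sum of g
        is positive.\<close>
      define e where "e = 1 - q powi (- psum a g)"
      have e: "e \<noteq> 0" using powi_inj[OF q, of 0 "- psum a g"] a(2) by (auto simp: e_def)
      let ?I = "between N 0 g - {g}"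
      let ?t = "\<lambda>d l. (\<Sum>I\<in>index_sets N a. xcoeff (D_coeff N I 0) (d - g) * (qpow q I l * qpow q I (- d))) * xcoeff (Psi N q l) (l - d)"
      let ?h = "\<lambda>l. (1 / e) * q powi wt_pair (- indicator_wt {1..a}) l * (\<Sum>d\<in>?I. ?t d l)"
      have "reg_fun N q ?h"
      proof (intro reg_fun_char reg_fun_mult reg_fun_sum reg_fun_const reg_fun_qpow q(1))
        show "- indicator_wt {1..a} \<in> lattice N"
          using indicator_wt_lattice[of "{1..a}" N] a(1) by simp
        fix d assume d: "d \<in> ?I"
        have "height N d < height N g" by (rule height_less) (use d in \<open>auto simp: between_def\<close>)
        then show "reg_fun N q (\<lambda>l. xcoeff (Psi N q l) (l - d))" by (rule less.hyps)
      qed auto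
      moreover have "xcoeff (Psi N q l) (l - g) = ?h l" if l: "l \<in> lattice N" for l
      proof -
        have gap: "eigen_gap q l a (l - g) = q powi psum a l * e"
          using q(1) by (simp add: e_def power_int_diff power_int_minus right_diff_distrib field_simps)
        have "l - (l - g) \<in> Qplus N" using 3 by simp
        from joint_eigen_recursion[OF q(1) l joint_eigen_Psi[OF q l] this a(1)]
        have "q powi psum a l * e * xcoeff (Psi N q l) (l - g)
           = (\<Sum>n\<in>between N (l - g) l - {l - g}. D_kernel N q a (l - g) n * xcoeff (Psi N q l) n)"
          unfolding gap .
        \<comment> \<open>Substituting n = l - d makes the range of summation independent of
          l.\<close>
        also have "\<dots> = (\<Sum>d\<in>?I. ?t d l)"
        proof (rule sum.reindex_bij_witness[of _ "\<lambda>d. l - d" "\<lambda>n. l - n"])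
          fix n assume n: "n \<in> between N (l - g) l - {l - g}"
          show "l - (l - n) = n" by simp
          have e: "n - (l - g) = g - (l - n)" by simp
          have "n - (l - g) \<in> Qplus N" "l - n \<in> Qplus N" "n \<noteq> l - g" using n by (auto simp: between_def)
          then show "l - n \<in> ?I" unfolding e between_def by auto
          have "qpow q I n = qpow q I l * qpow q I (- (l - n))" for I
            unfolding qpow_add[OF q(1), symmetric] by simp
          moreover have e': "l - g - n = l - n - g" by simp
          ultimately show "?t (l - n) l = D_kernel N q a (l - g) n * xcoeff (Psi N q l) n"
            unfolding shift_kernel_def e' by simp
        next
          fix d assume d: "d \<in> ?I"
          show "l - (l - d) = d" by simp
          have "l - d - (l - g) = g - d" "l - (l - d) = d" by simp_all
          then show "l - d \<in> between N (l - g) l - {l - g}" using d unfolding between_def by auto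
        qed
        finally have *: "q powi psum a l * e * xcoeff (Psi N q l) (l - g) = (\<Sum>d\<in>?I. ?t d l)" .
        have "wt_pair (- indicator_wt {1..a}) l = - psum a l"
          using wt_pair_add_left[of "- indicator_wt {1..a}" "indicator_wt {1..a}" l] wt_pair_fundamental[OF l, of a] by simp
        then have "?h l = (1 / e) * q powi (- psum a l) * (q powi psum a l * e * xcoeff (Psi N q l) (l - g))"
          unfolding * by simp
        also have "\<dots> = xcoeff (Psi N q l) (l - g)"
          using e q(1) by (simp add: power_int_minus field_simps)
        finally show ?thesis by simp
      qed
      ultimately show ?thesis by (simp only: cong: reg_fun_cong)
    qed
  qed
  from this[of "- b" for b] have "reg_fun N q (\<lambda>l. xcoeff (Psi N q l) (l + b))" for b by simp
  moreover have "bounded_exps (\<lambda>b. if - b \<in> Qplus N then 1 else 0 :: complex)"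
    unfolding bounded_exps_def
  proof (intro exI[of _ N] exI[of _ 0] allI impI)
    fix b assume "(if - b \<in> Qplus N then 1 else 0 :: complex) \<noteq> 0"
    then have "- b \<in> Qplus N" by (auto split: if_splits)
    then have "- b \<in> lattice N" "\<And>i. psum i (- b) \<ge> 0" unfolding Qplus_iff by blast+
    then show "Poly_Mapping.keys b \<subseteq> {..N} \<and> (\<forall>i. psum i b \<le> 0)" by (auto simp: lattice_def)
  qed
  moreover have "\<forall>l\<in>lattice N. \<forall>b. xcoeff (Psi N q l) (l + b) \<noteq> 0 \<longrightarrow> (if - b \<in> Qplus N then 1 else 0 :: complex) \<noteq> 0"
  proof (intro ballI allI impI)
    fix l b assume "l \<in> lattice N" "xcoeff (Psi N q l) (l + b) \<noteq> 0"
    then have "l - (l + b) \<in> Qplus N" using supp unfolding below_supp_def by blast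
    then show "(if - b \<in> Qplus N then 1 else 0 :: complex) \<noteq> 0" by simp
  qed
  ultimately show ?thesis unfolding regular_def by blast
qed

section \<open>The quantum Q-system acting on the joint eigenfunctions\<close>

lemma D_op_0_index [simp]: "D_op N q 0 k F = F"
proof -
  have "index_sets N 0 = {{}}" using finite_subset[of _ "{1..N}"] by auto
  then have "D_op N q 0 k F = Gamma q {} F" by (simp add: D_op_eq D_coeff_def)
  also have "\<dots> = F" by (rule xseries_eqI) (simp add: qpow_def)
  finally show ?thesis .
qed

lemma D_op_gt_index: "N < a \<Longrightarrow> D_op N q a k F = 0"
proof -
  assume a: "N < a"
  have "card I \<noteq> a" if "I \<subseteq> {1..N}" for I using card_mono[OF _ that] a by simp
  then have "index_sets N a = {}" by blast
  then show ?thesis by (simp only: D_op_eq sum.empty)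
qed

lemma qt_act_scale_right: "qt_act q u (\<lambda>l. xconst c * F l) l = xconst c * qt_act q u F l"
  by (simp add: qt_act_def case_prod_unfold sum_distrib_left mult_ac)

lemma Psi_nonzero: "q \<noteq> 0 \<Longrightarrow> norm q < 1 \<Longrightarrow> l \<in> lattice N \<Longrightarrow> Psi N q l \<noteq> 0"
proof
  assume "q \<noteq> 0" "norm q < 1" "l \<in> lattice N" "Psi N q l = 0"
  then have "xcoeff 0 l = (1::complex)"
    using joint_eigen_Psi[of q l N] by (auto simp: joint_eigen_def leading_monomial_def)
  then show False by simp
qed

definition intertwines :: "nat \<Rightarrow> complex \<Rightarrow> qtorus \<Rightarrow> nat \<Rightarrow> int \<Rightarrow> bool" where
  "intertwines N q u a k \<longleftrightarrow> u \<in> qt_carrier N \<and>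
     (\<forall>l\<in>lattice N. qt_act q u (Psi N q) l = D_op N q a k (Psi N q l))"

text \<open>u acts on a family of the form D Psi, and D can be pulled out in front; so the operator
  of the left factor ends up innermost.\<close>

lemma intertwines_mult:
  assumes q: "q \<noteq> 0" and u: "intertwines N q u a k" and v: "intertwines N q v b j" and l: "l \<in> lattice N"
  shows "qt_act q (qt_mult q u v) (Psi N q) l = D_op N q b j (D_op N q a k (Psi N q l))"
proof -
  have "qt_act q (qt_mult q u v) (Psi N q) l = qt_act q u (\<lambda>l. D_op N q b j (Psi N q l)) l"
    unfolding qt_act_mult[OF q] by (rule qt_act_cong[of u N]) (use u v l in \<open>auto simp: intertwines_def\<close>)
  also have "\<dots> = D_op N q b j (qt_act q u (Psi N q) l)" by (rule D_op_qt_act[symmetric])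
  finally show ?thesis using u l by (simp add: intertwines_def)
qed

text \<open>The values a = 0 and a = N + 1 are included so that the induction hypothesis covers both
  neighbours of an index. Upwards the unknown stands to the right of a factor that acts injectively;
  downwards it stands to the left, and the relation must be turned around first.\<close>

theorem opposite_Q_system_intertwines:
  assumes q: "q \<noteq> 0" "norm q < 1" and Q: "opposite_Q_system N q D" and I: "standard_initial_data N D"
    and "a \<le> N + 1"
  shows "intertwines N q (D a k) a k"
proof -
  let ?P = "Psi N q"
  let ?E = "\<lambda>k. \<forall>a\<le>N + 1. intertwines N q (D a k) a k"
  have D0: "D 0 k = qt_monom 0 0" and DN: "D (N + 1) k = 0" for k
    using Q by (auto simp: opposite_Q_system_def)
  have carrier: "D a k \<in> qt_carrier N" if "a \<in> {1..N}" for a k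
    using Q that by (auto simp: opposite_Q_system_def)
  have rel: "qt_scale (q ^ a) (qt_mult q (D a (k - 1)) (D a (k + 1)))
     = qt_mult q (D a k) (D a k) - qt_mult q (D (a + 1) k) (D (a - 1) k)" if "a \<in> {1..N}" for a k
    using Q that by (auto simp: opposite_Q_system_def)
  have comm: "qt_mult q (D b (k + 1)) (D a k) = qt_scale (q powi int (min a b)) (qt_mult q (D a k) (D b (k + 1)))"
    if "a \<in> {1..N}" "b \<in> {1..N}" for a b k
  proof -
    have "\<bar>1::int\<bar> \<le> 1 \<longrightarrow> qt_mult q (D b (k + 1)) (D a k)
        = qt_scale (q powi (1 * int (min a b))) (qt_mult q (D a k) (D b (k + 1)))"
      using Q that unfolding opposite_Q_system_def by blast
    then show ?thesis by simp
  qed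
  have nz: "D a k \<noteq> 0" if "a \<le> N" for a k
    using opposite_Q_system_lead[OF q(1) Q I that, of k] by (auto simp: is_lead_def)
  have ends: "intertwines N q (D 0 k) 0 k" "intertwines N q (D (N + 1) k) (N + 1) k" for k
  proof -
    have "Poly_Mapping.keys (qt_monom 0 0) = {(0, 0)}" by (simp add: qt_monom_def)
    then show "intertwines N q (D 0 k) 0 k"
      unfolding D0 intertwines_def by (auto simp: qt_act_monom qt_carrier_def)
    show "intertwines N q (D (N + 1) k) (N + 1) k"
      unfolding DN intertwines_def by (auto simp: D_op_gt_index qt_carrier_def)
  qed
  have E_I: "?E k" if *: "\<And>a l. a \<in> {1..N} \<Longrightarrow> l \<in> lattice N \<Longrightarrow> qt_act q (D a k) ?P l = D_op N q a k (?P l)" for k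
  proof (intro allI impI)
    fix a assume "a \<le> N + 1"
    then consider "a = 0" | "a = N + 1" | "a \<in> {1..N}" by fastforce
    then show "intertwines N q (D a k) a k"
    proof cases
      case 3
      then show ?thesis using * carrier by (simp add: intertwines_def)
    qed (use ends in auto)
  qed
  have lead_wt: "indicator_wt {1..a} \<in> lattice N" if "a \<in> {1..N}" for a
    using that by (intro indicator_wt_lattice) auto
  have E0: "?E 0"
  proof (rule E_I)
    fix a l assume a: "a \<in> {1..N}" and l: "l \<in> lattice N"
    have "D a 0 = qt_monom (indicator_wt {1..a}) 0"
      using I a unfolding standard_initial_data_def indicator_wt_def by blast
    then have "qt_act q (D a 0) ?P l = xconst (q powi psum a l) * ?P l"
      by (simp only: qt_act_monom wt_pair_fundamental[OF l] add_0_right)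
    then show "qt_act q (D a 0) ?P l = D_op N q a 0 (?P l)"
      using joint_eigen_Psi[OF q l] a by (simp add: joint_eigen_def)
  qed
  have E1: "?E 1"
  proof (rule E_I)
    fix a l assume a: "a \<in> {1..N}" and l: "l \<in> lattice N"
    have "D a 1 = qt_monom (indicator_wt {1..a}) (indicator_wt {1..a})"
      using I a unfolding standard_initial_data_def indicator_wt_def by blast
    then show "qt_act q (D a 1) ?P l = D_op N q a 1 (?P l)"
      unfolding D_op_1_Psi[OF q l a] by (simp only: qt_act_monom wt_pair_fundamental[OF l])
  qed
  have reg: "regular N q (\<lambda>l. qt_act q u ?P l - D_op N q a k (?P l))" if "u \<in> qt_carrier N" for u a k
    by (intro regular_diff regular_qt_act regular_D_op regular_Psi q that)
  have up: "?E (k + 1)" if E: "?E k" "?E (k - 1)" for k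
  proof (rule E_I)
    fix b l assume b: "b \<in> {1..N}" and l: "l \<in> lattice N"
    obtain a where a: "b = Suc a" using b by (cases b) auto
    have iB: "intertwines N q (D b k) b k" and iC: "intertwines N q (D (b + 1) k) (b + 1) k"
      and iF: "intertwines N q (D (b - 1) k) (b - 1) k"
    proof -
      have "b \<le> N + 1" "b + 1 \<le> N + 1" "b - 1 \<le> N + 1" using b by auto
      then show "intertwines N q (D b k) b k" "intertwines N q (D (b + 1) k) (b + 1) k"
        "intertwines N q (D (b - 1) k) (b - 1) k" using E(1) by blast+
    qed
    \<comment> \<open>The defect of the claim at k + 1. The Q-systems on the two sides show that
      \<open>D b (k - 1)\<close> annihilates it.\<close>
    define G where "G = (\<lambda>l. qt_act q (D b (k + 1)) ?P l - D_op N q b (k + 1) (?P l))"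
    have "qt_act q (D b (k - 1)) G l = 0" if l: "l \<in> lattice N" for l
    proof -
      have "xconst (q ^ b) * qt_act q (qt_mult q (D b (k - 1)) (D b (k + 1))) ?P l
          = qt_act q (qt_mult q (D b k) (D b k)) ?P l - qt_act q (qt_mult q (D (b + 1) k) (D (b - 1) k)) ?P l"
        unfolding qt_act_scale[symmetric] rel[OF b] qt_act_diff ..
      also have "\<dots> = D_op N q b k (D_op N q b k (?P l)) - D_op N q (b - 1) k (D_op N q (b + 1) k (?P l))"
        using intertwines_mult[OF q(1) iB iB l] intertwines_mult[OF q(1) iC iF l] by simp
      also have "\<dots> = xconst (q ^ b) * D_op N q b (k + 1) (D_op N q b (k - 1) (?P l))"
        using D_op_Q_system[OF q, of a N k "?P l"] by (simp add: a)
      finally have "qt_act q (qt_mult q (D b (k - 1)) (D b (k + 1))) ?P l = D_op N q b (k + 1) (D_op N q b (k - 1) (?P l))"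
        using q(1) by simp
      also have "D_op N q b (k - 1) (?P l) = qt_act q (D b (k - 1)) ?P l"
        using E(2) b l by (simp add: intertwines_def)
      finally show ?thesis unfolding G_def qt_act_diff_right qt_act_mult[OF q(1)] D_op_qt_act by simp
    qed
    then have "G l = 0"
      using qt_act_injective[OF q carrier[OF b] _ _ _ l, of "k - 1" G] reg[OF carrier[OF b]] nz[of b] b
      unfolding G_def by simp
    then show "qt_act q (D b (k + 1)) ?P l = D_op N q b (k + 1) (?P l)" by (simp add: G_def)
  qed
  have down: "?E (k - 1)" if E: "?E k" "?E (k + 1)" for k
  proof (rule E_I)
    fix b l assume b: "b \<in> {1..N}" and l: "l \<in> lattice N"
    obtain a where a: "b = Suc a" using b by (cases b) auto
    have iB: "intertwines N q (D b k) b k" and iC: "intertwines N q (D (b + 1) k) (b + 1) k"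
      and iF: "intertwines N q (D (b - 1) k) (b - 1) k"
    proof -
      have "b \<le> N + 1" "b + 1 \<le> N + 1" "b - 1 \<le> N + 1" using b by auto
      then show "intertwines N q (D b k) b k" "intertwines N q (D (b + 1) k) (b + 1) k"
        "intertwines N q (D (b - 1) k) (b - 1) k" using E(1) by blast+
    qed
    let ?A = "D b (k - 1)" and ?X = "D b (k + 1)" and ?B = "D b k" and ?C = "D (b + 1) k" and ?F = "D (b - 1) k"
    have C: "?C \<in> qt_carrier N" and F: "?F \<in> qt_carrier N" using iC iF by (simp_all add: intertwines_def)
    \<comment> \<open>R = 0 is the Q-system with \<open>D b (k + 1)\<close> in front. Multiplying
      q^b A X = B B - C F by X from the left and moving X through B, C and F, at the cost of q^b,
      q^b and q^a, gives R X = 0.\<close>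
    define R where "R = qt_scale (q ^ b) (qt_mult q ?X ?A) - qt_scale (q ^ (2 * b)) (qt_mult q ?B ?B)
      + qt_scale (q ^ (b + a)) (qt_mult q ?C ?F)"
    have XB: "qt_act q ?X (qt_act q ?B f) = (\<lambda>l. xconst (q ^ b) * qt_act q ?B (qt_act q ?X f) l)" for f
    proof
      fix l show "qt_act q ?X (qt_act q ?B f) l = xconst (q ^ b) * qt_act q ?B (qt_act q ?X f) l"
        using comm[OF b b, of k] unfolding qt_act_mult[OF q(1), symmetric] by (simp add: qt_act_scale)
    qed
    have XC: "qt_act q ?X (qt_act q ?C f) = (\<lambda>l. xconst (q ^ b) * qt_act q ?C (qt_act q ?X f) l)" for f
    proof (cases "b = N")
      case True
      have z: "qt_act q u (\<lambda>l. 0) = (\<lambda>l. 0)" "qt_act q 0 f = (\<lambda>l. 0)" for u f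
        by (auto simp: qt_act_def)
      show ?thesis using DN[of k] by (simp add: True z)
    next
      case False
      then have b1: "b + 1 \<in> {1..N}" using b by auto
      show ?thesis
      proof
        fix l show "qt_act q ?X (qt_act q ?C f) l = xconst (q ^ b) * qt_act q ?C (qt_act q ?X f) l"
          using comm[OF b1 b, of k] unfolding qt_act_mult[OF q(1), symmetric] by (simp add: qt_act_scale)
      qed
    qed
    have XF: "qt_act q ?X (qt_act q ?F f) = (\<lambda>l. xconst (q ^ a) * qt_act q ?F (qt_act q ?X f) l)" for f
    proof (cases "a = 0")
      case True
      have "qt_act q (qt_monom 0 0) f = f" for f by (rule ext) (simp add: qt_act_monom)
      then show ?thesis using D0[of k] by (simp add: True a)
    next
      case False
      then have b1: "b - 1 \<in> {1..N}" using b a by auto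
      show ?thesis
      proof
        fix l show "qt_act q ?X (qt_act q ?F f) l = xconst (q ^ a) * qt_act q ?F (qt_act q ?X f) l"
          using comm[OF b1 b, of k] a unfolding qt_act_mult[OF q(1), symmetric] by (simp add: qt_act_scale)
      qed
    qed
    \<comment> \<open>The computation is carried out on operators acting on \<open>Psi\<close>,
      where composition is associative.\<close>
    have RX: "qt_act q (qt_mult q R ?X) ?P l = 0" for l
    proof -
      have "xconst (q ^ b) * qt_act q ?A (qt_act q ?X ?P) l = qt_act q ?B (qt_act q ?B ?P) l - qt_act q ?C (qt_act q ?F ?P) l" for l
        unfolding qt_act_mult[OF q(1), symmetric] qt_act_diff[symmetric] rel[OF b, symmetric] qt_act_scale ..
      then have "(\<lambda>l. xconst (q ^ b) * qt_act q ?A (qt_act q ?X ?P) l) = (\<lambda>l. qt_act q ?B (qt_act q ?B ?P) l - qt_act q ?C (qt_act q ?F ?P) l)"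
        by blast
      then have "xconst (q ^ b) * qt_act q ?X (qt_act q ?A (qt_act q ?X ?P)) l
          = qt_act q ?X (qt_act q ?B (qt_act q ?B ?P)) l - qt_act q ?X (qt_act q ?C (qt_act q ?F ?P)) l"
        unfolding qt_act_scale_right[symmetric] qt_act_diff_right[symmetric] by simp
      also have "\<dots> = xconst (q ^ (2 * b)) * qt_act q ?B (qt_act q ?B (qt_act q ?X ?P)) l
          - xconst (q ^ (b + a)) * qt_act q ?C (qt_act q ?F (qt_act q ?X ?P)) l"
        unfolding XB XC XF qt_act_scale_right by (simp add: power_add xconst_mult mult.assoc mult_2)
      finally show ?thesis
        unfolding qt_act_mult[OF q(1)] R_def qt_act_add qt_act_diff qt_act_scale by simp
    qed
    have R_carrier: "R \<in> qt_carrier N"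
      unfolding R_def by (intro qt_carrier_add qt_carrier_diff qt_carrier_scale qt_carrier_mult carrier b C F)
    \<comment> \<open>The torus has no zero divisors, so R X would be nonzero and hence act
      injectively, although it annihilates \<open>Psi\<close>.\<close>
    have "R = 0"
    proof (rule ccontr)
      assume "R \<noteq> 0"
      then have "qt_mult q R ?X \<noteq> 0" using qt_mult_eq_0[OF q(1)] nz[of b "k + 1"] b by auto
      then have "?P l = 0"
        by (rule qt_act_injective[OF q qt_carrier_mult[OF R_carrier carrier[OF b]] _ regular_Psi[OF q] RX l])
      then show False using Psi_nonzero[OF q l] by simp
    qed
    define G where "G = (\<lambda>l. qt_act q ?A ?P l - D_op N q b (k - 1) (?P l))"
    have "qt_act q ?X G l = 0" if l: "l \<in> lattice N" for l
    proof -
      have e: "xconst (q ^ b) * D_op N q b (k - 1) (D_op N q b (k + 1) (?P l))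
        = xconst (q ^ (2 * b)) * D_op N q b k (D_op N q b k (?P l))
         - xconst (q ^ (b + a)) * D_op N q (b - 1) k (D_op N q (b + 1) k (?P l))"
        using D_op_Q_system'[OF q, of N a k "?P l"]
        by (simp only: a right_diff_distrib mult.assoc[symmetric] xconst_mult[symmetric] power_add[symmetric]
            mult_2 diff_Suc_1 Suc_eq_plus1[symmetric])
      have "0 = qt_act q R ?P l" using \<open>R = 0\<close> by simp
      also have "\<dots> = xconst (q ^ b) * qt_act q (qt_mult q ?X ?A) ?P l
         - xconst (q ^ (2 * b)) * D_op N q b k (D_op N q b k (?P l))
         + xconst (q ^ (b + a)) * D_op N q (b - 1) k (D_op N q (b + 1) k (?P l))"
        using intertwines_mult[OF q(1) iB iB l] intertwines_mult[OF q(1) iC iF l]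
        by (simp add: R_def qt_act_add qt_act_diff qt_act_scale)
      also have "\<dots> = xconst (q ^ b) * (qt_act q (qt_mult q ?X ?A) ?P l - D_op N q b (k - 1) (D_op N q b (k + 1) (?P l)))"
        by (simp add: e right_diff_distrib)
      finally have "qt_act q (qt_mult q ?X ?A) ?P l = D_op N q b (k - 1) (D_op N q b (k + 1) (?P l))"
        using q(1) by simp
      also have "D_op N q b (k + 1) (?P l) = qt_act q ?X ?P l"
        using E(2) b l by (simp add: intertwines_def)
      finally show ?thesis unfolding G_def qt_act_diff_right qt_act_mult[OF q(1)] D_op_qt_act by simp
    qed
    then have "G l = 0"
      using qt_act_injective[OF q carrier[OF b] _ _ _ l, of "k + 1" G] reg[OF carrier[OF b]] nz[of b] b
      unfolding G_def by simp
    then show "qt_act q (D b (k - 1)) ?P l = D_op N q b (k - 1) (?P l)" by (simp add: G_def)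
  qed
  have "?E k \<and> ?E (k + 1)" for k
  proof (induction k rule: int_induct[where k = 0])
    case base
    then show ?case using E0 E1 by simp
  next
    case (step1 i)
    then show ?case using up[of "i + 1"] by simp
  next
    case (step2 i)
    then show ?case using down[of i] by simp
  qed
  then show ?thesis using assms(5) by blast
qed

section \<open>The limit of the Macdonald eigenfunctions\<close>

definition mac_factor :: "complex \<Rightarrow> nat \<Rightarrow> nat \<Rightarrow> xseries" where
  "mac_factor t i j = (xconst t * xvar i - xvar j) * inv_diff i j"

definition mac_coeff :: "nat \<Rightarrow> complex \<Rightarrow> nat \<Rightarrow> xseries" where
  "mac_coeff N t i = (\<Prod>j\<in>{1..N} - {i}. mac_factor t i j)"

abbreviation mac_kernel :: "nat \<Rightarrow> complex \<Rightarrow> complex \<Rightarrow> wt \<Rightarrow> wt \<Rightarrow> complex" where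
  "mac_kernel N q t \<equiv> shift_kernel q {1..N} (mac_coeff N t) (\<lambda>i. {i})"

definition mac_eigval :: "nat \<Rightarrow> complex \<Rightarrow> complex \<Rightarrow> wt \<Rightarrow> complex" where
  "mac_eigval N q t l = (\<Sum>i\<in>{1..N}. t ^ (N - i) * q powi wt_entry l i)"

lemma Macdonald_op_shift_op: "Macdonald_op N q t F = shift_op q {1..N} (mac_coeff N t) (\<lambda>i. {i}) F"
  by (simp add: Macdonald_op_def shift_op_def mac_coeff_def mac_factor_def)

lemma mac_factor_eq: "i \<noteq> j \<Longrightarrow> mac_factor t i j = xconst t * xratio i j + xratio j i"
proof -
  assume "i \<noteq> j"
  then have "inv_diff j i = - inv_diff i j" by (auto simp: inv_diff_def)
  then show ?thesis by (simp add: mac_factor_def xratio_def algebra_simps)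
qed

lemma mac_factor_neg_series:
  "i \<in> {1..N} \<Longrightarrow> j \<in> {1..N} \<Longrightarrow> i \<noteq> j \<Longrightarrow> mac_factor t i j \<in> neg_series N"
  unfolding mac_factor_eq by (intro neg_series_add neg_series_mult neg_series_xconst xratio_neg_series) auto

lemma mac_coeff_neg_series: "i \<in> {1..N} \<Longrightarrow> mac_coeff N t i \<in> neg_series N"
  unfolding mac_coeff_def by (intro neg_series_prod mac_factor_neg_series) auto

lemma mac_factor_top_eq_t:
  assumes "i < j" "i \<le> r"
  shows "top_eq r (mac_factor t i j) (xconst t)"
  using xratio_top_eq_1[OF assms] xratio_top_eq_0[OF assms] assms by (simp add: mac_factor_eq top_eq_def)

lemma mac_factor_top_eq_1:
  assumes "j < i" "j \<le> r"
  shows "top_eq r (mac_factor t i j) 1"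
  using xratio_top_eq_1[OF assms] xratio_top_eq_0[OF assms] assms by (simp add: mac_factor_eq top_eq_def)

text \<open>On the coefficients in question the N - i factors with j > i reduce to t and the others
  to 1.\<close>

lemma mac_coeff_top_eq_power:
  assumes i: "i \<in> {1..N}" "i \<le> r"
  shows "top_eq r (mac_coeff N t i) (xconst (t ^ (N - i)))"
proof -
  let ?f = "\<lambda>j. if i < j then xconst t else 1"
  have "top_eq r (mac_coeff N t i) (\<Prod>j\<in>{1..N} - {i}. ?f j)"
    unfolding mac_coeff_def
  proof (rule top_eq_prod)
    fix j assume j: "j \<in> {1..N} - {i}"
    then show "mac_factor t i j \<in> neg_series N \<and> ?f j \<in> neg_series N \<and> top_eq r (mac_factor t i j) (?f j)"
      using i mac_factor_neg_series[of i N j t] mac_factor_top_eq_t[of i j r t] mac_factor_top_eq_1[of j i r t]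
      by auto
  qed
  also have "(\<Prod>j\<in>{1..N} - {i}. ?f j) = (\<Prod>j\<in>{i<..N}. xconst t)"
    by (rule prod.mono_neutral_cong_right) (use i in auto)
  also have "\<dots> = xconst (t ^ (N - i))" by (simp add: xconst_power)
  finally show ?thesis .
qed

lemma mac_kernel_diag: "mac_kernel N q t m m = mac_eigval N q t m"
  unfolding shift_kernel_def mac_eigval_def
proof (rule sum.cong[OF refl])
  fix i assume i: "i \<in> {1..N}"
  then have "xcoeff (mac_coeff N t i) 0 = xcoeff (xconst (t ^ (N - i))) 0"
    using mac_coeff_top_eq_power[of i N N t] by (simp add: top_eq_def)
  then show "xcoeff (mac_coeff N t i) (m - m) * qpow q {i} m = t ^ (N - i) * q powi wt_entry m i"
    by (simp add: qpow_def)
qed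

text \<open>At l itself and outside l - Q+ the eigenvalue equation is automatic; elsewhere it is the
  triangular recursion.\<close>

lemma Macdonald_eigen_iff:
  assumes F: "leading_monomial N l F"
  shows "Macdonald_eigen N q t l F \<longleftrightarrow> (\<forall>m. l - m \<in> Qplus N \<longrightarrow> m \<noteq> l \<longrightarrow>
     (mac_eigval N q t l - mac_eigval N q t m) * xcoeff F m = (\<Sum>n\<in>between N m l - {m}. mac_kernel N q t m n * xcoeff F n))"
proof -
  have supp: "below_supp N l F" and Fl: "xcoeff F l = 1" using F by (auto simp: leading_monomial_iff)
  have neg: "\<And>i. i \<in> {1..N} \<Longrightarrow> mac_coeff N t i \<in> neg_series N" by (rule mac_coeff_neg_series)
  have c: "xcoeff (Macdonald_op N q t F) m = mac_eigval N q t m * xcoeff F m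
      + (\<Sum>n\<in>between N m l - {m}. mac_kernel N q t m n * xcoeff F n)" if "l - m \<in> Qplus N" for m
  proof -
    have "xcoeff (Macdonald_op N q t F) m = mac_kernel N q t m m * xcoeff F m
      + (\<Sum>n\<in>between N m l - {m}. mac_kernel N q t m n * xcoeff F n)"
      unfolding Macdonald_op_shift_op by (rule shift_op_coeff_diag[OF _ supp that]) (rule neg)
    then show ?thesis by (simp only: mac_kernel_diag)
  qed
  have B: "below_supp N l (Macdonald_op N q t F)"
    unfolding Macdonald_op_shift_op by (rule below_supp_shift_op[OF _ supp]) (rule neg)
  have z: "xcoeff (Macdonald_op N q t F) m = mac_eigval N q t l * xcoeff F m" if "l - m \<notin> Qplus N \<or> m = l" for m
    using that
  proof
    assume "l - m \<notin> Qplus N"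
    then have "xcoeff (Macdonald_op N q t F) m = 0" "xcoeff F m = 0" using B supp by (auto simp: below_supp_def)
    then show ?thesis by simp
  next
    assume "m = l"
    then show ?thesis using c[of l] by (simp add: between_self)
  qed
  have ext: "G = H \<longleftrightarrow> (\<forall>m. xcoeff G m = xcoeff H m)" for G H
    by (auto intro: xseries_eqI)
  have "Macdonald_eigen N q t l F \<longleftrightarrow> (\<forall>m. xcoeff (Macdonald_op N q t F) m = mac_eigval N q t l * xcoeff F m)"
    unfolding Macdonald_eigen_def mac_eigval_def[symmetric] ext by simp
  also have "\<dots> \<longleftrightarrow> (\<forall>m. l - m \<in> Qplus N \<longrightarrow> m \<noteq> l \<longrightarrow> xcoeff (Macdonald_op N q t F) m = mac_eigval N q t l * xcoeff F m)"
    using z by blast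
  also have "\<dots> \<longleftrightarrow> (\<forall>m. l - m \<in> Qplus N \<longrightarrow> m \<noteq> l \<longrightarrow>
     (mac_eigval N q t l - mac_eigval N q t m) * xcoeff F m = (\<Sum>n\<in>between N m l - {m}. mac_kernel N q t m n * xcoeff F n))"
  proof (intro iff_allI imp_cong refl)
    fix m assume m: "l - m \<in> Qplus N"
    show "xcoeff (Macdonald_op N q t F) m = mac_eigval N q t l * xcoeff F m \<longleftrightarrow>
      (mac_eigval N q t l - mac_eigval N q t m) * xcoeff F m = (\<Sum>n\<in>between N m l - {m}. mac_kernel N q t m n * xcoeff F n)"
      unfolding c[OF m] left_diff_distrib by (auto simp: algebra_simps)
  qed
  finally show ?thesis .
qed

lemma Macdonald_series_ex1:
  assumes "\<And>m. l - m \<in> Qplus N \<Longrightarrow> m \<noteq> l \<Longrightarrow> mac_eigval N q t l \<noteq> mac_eigval N q t m"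
  shows "\<exists>!F. is_Macdonald_series N q t l F"
proof -
  have d: "mac_eigval N q t l - mac_eigval N q t m \<noteq> 0" if "l - m \<in> Qplus N" "m \<noteq> l" for m
    using assms that by auto
  obtain F where F: "leading_monomial N l F" "\<And>m. l - m \<in> Qplus N \<Longrightarrow> m \<noteq> l \<Longrightarrow>
     (mac_eigval N q t l - mac_eigval N q t m) * xcoeff F m = (\<Sum>n\<in>between N m l - {m}. mac_kernel N q t m n * xcoeff F n)"
    by (rule triangular_solution[of l N "\<lambda>m. mac_eigval N q t l - mac_eigval N q t m" "mac_kernel N q t"])
      (rule d, assumption, assumption, blast)
  show ?thesis
  proof (rule ex1I[of _ F])
    show "is_Macdonald_series N q t l F"
    proof -
      have "Macdonald_eigen N q t l F" unfolding Macdonald_eigen_iff[OF F(1)] by (intro allI impI F(2))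
      then show ?thesis using F(1) by (simp add: is_Macdonald_series_def)
    qed
    fix G assume "is_Macdonald_series N q t l G"
    then have G: "leading_monomial N l G" "Macdonald_eigen N q t l G" by (auto simp: is_Macdonald_series_def)
    note G' = G(2)[unfolded Macdonald_eigen_iff[OF G(1)], rule_format]
    show "G = F"
      by (rule triangular_unique[OF G(1) G' F(1) F(2) d])
  qed
qed

section \<open>Coefficientwise limits of the operator coefficients\<close>

definition cw_lim :: "('a \<Rightarrow> xseries) \<Rightarrow> xseries \<Rightarrow> 'a filter \<Rightarrow> bool" where
  "cw_lim f F A \<longleftrightarrow> (\<forall>g. ((\<lambda>t. xcoeff (f t) g) \<longlongrightarrow> xcoeff F g) A)"

text \<open>For factors supported in negative roots, the exponents that contribute to a given
  coefficient of the product lie in a finite set independent of t, so the limit may be taken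
  termwise.\<close>

lemma cw_lim_mult:
  assumes f: "\<And>t. f t \<in> neg_series N" "F \<in> neg_series N" "cw_lim f F A"
    and g: "\<And>t. g t \<in> neg_series N" "G \<in> neg_series N" "cw_lim g G A"
  shows "cw_lim (\<lambda>t. f t * g t) (F * G) A"
  unfolding cw_lim_def
proof
  fix c
  have c: "xcoeff (C * D) c = (\<Sum>a\<in>between N c 0. xcoeff C a * xcoeff D (c - a))"
    if "C \<in> neg_series N" "D \<in> neg_series N" for C D
  proof (rule xcoeff_mult_eq_sum[OF finite_between])
    fix a assume "xcoeff C a \<noteq> 0" "xcoeff D (c - a) \<noteq> 0"
    then have "- a \<in> Qplus N" "- (c - a) \<in> Qplus N" using that unfolding neg_series_def by blast+
    then show "a \<in> between N c 0" by (simp add: between_def)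
  qed
  have "((\<lambda>t. \<Sum>a\<in>between N c 0. xcoeff (f t) a * xcoeff (g t) (c - a))
      \<longlongrightarrow> (\<Sum>a\<in>between N c 0. xcoeff F a * xcoeff G (c - a))) A"
    by (intro tendsto_sum tendsto_mult) (use f(3) g(3) in \<open>auto simp: cw_lim_def\<close>)
  then show "((\<lambda>t. xcoeff (f t * g t) c) \<longlongrightarrow> xcoeff (F * G) c) A"
    by (simp add: c f g)
qed

lemma cw_lim_prod:
  assumes "\<And>i t. i \<in> S \<Longrightarrow> f i t \<in> neg_series N" "\<And>i. i \<in> S \<Longrightarrow> F i \<in> neg_series N" "\<And>i. i \<in> S \<Longrightarrow> cw_lim (f i) (F i) A"
  shows "cw_lim (\<lambda>t. \<Prod>i\<in>S. f i t) (\<Prod>i\<in>S. F i) A"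
  using assms
proof (induction S rule: infinite_finite_induct)
  case (insert x S)
  then show ?case by (auto intro!: cw_lim_mult neg_series_prod)
qed (auto simp: cw_lim_def)

text \<open>
  The factors $(t x_i - x_j)/(x_i - x_j)$ with $j \ge a$ of a coefficient of the Macdonald operator, each divided
  by t, and their limit.
\<close>

definition scaled_tail :: "nat \<Rightarrow> nat \<Rightarrow> complex \<Rightarrow> nat \<Rightarrow> xseries" where
  "scaled_tail N a t i = (\<Prod>j\<in>{a..N} - {i}. xratio i j + xconst (inverse t) * xratio j i)"

definition tail :: "nat \<Rightarrow> nat \<Rightarrow> nat \<Rightarrow> xseries" where
  "tail N a i = (\<Prod>j\<in>{a..N} - {i}. xratio i j)"

lemma scaled_tail_cw_lim:
  assumes "i \<in> {1..N}" "1 \<le> a" "A \<le> at_infinity"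
  shows "cw_lim (\<lambda>t. scaled_tail N a t i) (tail N a i) A"
  unfolding scaled_tail_def tail_def
proof (rule cw_lim_prod)
  fix j assume "j \<in> {a..N} - {i}"
  then have ij: "i \<in> {1..N}" "j \<in> {1..N}" "i \<noteq> j" using assms by auto
  show "xratio i j \<in> neg_series N" by (rule xratio_neg_series) (use ij in auto)
  show "xratio i j + xconst (inverse t) * xratio j i \<in> neg_series N" for t
    by (intro neg_series_add neg_series_mult neg_series_xconst xratio_neg_series) (use ij in auto)
  have "(inverse \<longlongrightarrow> (0::complex)) A" by (rule tendsto_mono[OF assms(3) tendsto_inverse_0])
  then have "((\<lambda>t. xcoeff (xratio i j) g + inverse t * xcoeff (xratio j i) g) \<longlongrightarrow> xcoeff (xratio i j) g + 0 * xcoeff (xratio j i) g) A" for g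
    by (intro tendsto_add tendsto_const tendsto_mult)
  then show "cw_lim (\<lambda>t. xratio i j + xconst (inverse t) * xratio j i) (xratio i j) A"
    by (simp add: cw_lim_def)
qed

text \<open>The factors with j < a reduce to 1, and each of the N - a others gives up one t.\<close>

lemma mac_coeff_top_eq_tail:
  assumes i: "i \<in> {a..N}" and a: "1 \<le> a" and t: "t \<noteq> 0"
  shows "top_eq (a - 1) (mac_coeff N t i) (xconst (t ^ (N - a)) * scaled_tail N a t i)"
proof -
  let ?f = "\<lambda>j. if j < a then 1 else mac_factor t i j"
  have "top_eq (a - 1) (mac_coeff N t i) (\<Prod>j\<in>{1..N} - {i}. ?f j)"
    unfolding mac_coeff_def
  proof (rule top_eq_prod)
    fix j assume j: "j \<in> {1..N} - {i}"
    then show "mac_factor t i j \<in> neg_series N \<and> ?f j \<in> neg_series N \<and> top_eq (a - 1) (mac_factor t i j) (?f j)"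
      using i a mac_factor_neg_series[of i N j t] mac_factor_top_eq_1[of j i "a - 1" t] by auto
  qed
  also have "(\<Prod>j\<in>{1..N} - {i}. ?f j) = (\<Prod>j\<in>{a..N} - {i}. mac_factor t i j)"
    by (rule prod.mono_neutral_cong_right) (use i a in auto)
  also have "\<dots> = (\<Prod>j\<in>{a..N} - {i}. xconst t * (xratio i j + xconst (inverse t) * xratio j i))"
  proof (rule prod.cong[OF refl])
    fix j assume "j \<in> {a..N} - {i}"
    then show "mac_factor t i j = xconst t * (xratio i j + xconst (inverse t) * xratio j i)"
      using t by (simp add: mac_factor_eq distrib_left mult.assoc[symmetric] xconst_mult[symmetric])
  qed
  also have "\<dots> = xconst (t ^ (N - a)) * scaled_tail N a t i"
  proof -
    have "card ({a..N} - {i}) = N - a" using i by simp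
    then show ?thesis by (simp add: prod.distrib scaled_tail_def xconst_power)
  qed
  finally show ?thesis .
qed

text \<open>The factors belonging to the indices below a reduce to 1; those of i remain, and the
  complement of I is \<open>{a..N} - {i}\<close>.\<close>

lemma D_coeff_top_eq_tail:
  assumes "I \<subseteq> {1..N}" "i \<in> {a..N}" "1 \<le> a" "I = insert i {1..a - 1}"
  shows "top_eq (a - 1) (D_coeff N I 0) (tail N a i)"
proof -
  let ?f = "\<lambda>i' j. if i' < a then 1 else xratio i' j"
  have "top_eq (a - 1) (D_coeff N I 0) (\<Prod>i'\<in>I. \<Prod>j\<in>{1..N} - I. ?f i' j)"
    unfolding D_coeff_0
  proof (rule top_eq_prod2)
    fix i' j assume ij: "i' \<in> I" "j \<in> {1..N} - I"
    have "xratio i' j \<in> neg_series N" by (rule xratio_neg_series) (use ij assms(1) in auto)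
    moreover have "top_eq (a - 1) (xratio i' j) 1" if "i' < a"
      by (rule xratio_top_eq_1) (use that ij assms in auto)
    ultimately show "xratio i' j \<in> neg_series N \<and> ?f i' j \<in> neg_series N \<and> top_eq (a - 1) (xratio i' j) (?f i' j)"
      by simp
  qed
  also have "(\<Prod>i'\<in>I. \<Prod>j\<in>{1..N} - I. ?f i' j) = (\<Prod>j\<in>{1..N} - I. ?f i j)"
  proof -
    have "(\<Prod>i'\<in>{1..a - 1}. \<Prod>j\<in>{1..N} - I. ?f i' j) = 1" by (intro prod.neutral ballI) auto
    moreover have "i \<notin> {1..a - 1}" using assms(2) by auto
    ultimately show ?thesis unfolding assms(4) by (simp only: prod.insert finite_atLeastAtMost not_False_eq_True mult_1_right)
  qed
  also have "\<dots> = tail N a i"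
    unfolding tail_def by (rule prod.cong) (use assms in auto)
  finally show ?thesis .
qed

text \<open>An index set that misses some j < a has an inversion at j, so its coefficient vanishes
  at m - n. The sets that remain are \<open>{1..a - 1}\<close> with one further element.\<close>

lemma tail_kernel:
  assumes q: "q \<noteq> 0" and a: "a \<in> {1..N}" and top: "\<And>j. j < a \<Longrightarrow> psum j (m - n) = 0" and n: "n \<in> lattice N"
  shows "D_kernel N q a m n = q powi psum (a - 1) n * (\<Sum>i\<in>{a..N}. xcoeff (tail N a i) (m - n) * qpow q {i} n)"
proof -
  let ?J = "\<lambda>i. insert i {1..a - 1}"
  let ?t = "\<lambda>I. xcoeff (D_coeff N I 0) (m - n) * qpow q I n"
  have top': "\<forall>j\<le>a - 1. psum j (m - n) \<ge> 0" using top a by auto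
  have inj: "inj_on ?J {a..N}"
  proof (rule inj_onI)
    fix i j assume "i \<in> {a..N}" "j \<in> {a..N}" "?J i = ?J j"
    moreover have "i \<in> ?J i" by simp
    ultimately have "i \<in> ?J j" by metis
    then show "i = j" using \<open>i \<in> {a..N}\<close> a by auto
  qed
  have J: "?J i \<in> index_sets N a" if "i \<in> {a..N}" for i
    using that a by (auto simp: card_insert_if)
  have "D_kernel N q a m n = (\<Sum>I\<in>?J ` {a..N}. ?t I)"
    unfolding shift_kernel_def
  proof (rule sum.mono_neutral_right)
    show "?J ` {a..N} \<subseteq> index_sets N a" using J by blast
    show "\<forall>I\<in>index_sets N a - ?J ` {a..N}. ?t I = 0"
    proof
      fix I assume I: "I \<in> index_sets N a - ?J ` {a..N}"
      have fin: "finite I" using I finite_subset by blast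
      have "\<not> {1..a - 1} \<subseteq> I"
      proof
        assume sub: "{1..a - 1} \<subseteq> I"
        then have "card (I - {1..a - 1}) = 1" using I a fin by (simp add: card_Diff_subset)
        then obtain i where i: "I - {1..a - 1} = {i}" by (auto simp: card_1_singleton_iff)
        then have "I = ?J i" using sub by blast
        moreover have "i \<in> I" "i \<notin> {1..a - 1}" using i by blast+
        then have "i \<in> {a..N}" using I by auto
        ultimately show False using I by blast
      qed
      then obtain j where j: "j \<in> {1..a - 1}" "j \<notin> I" by blast
      have "\<not> I \<subseteq> {1..a - 1}"
      proof
        assume "I \<subseteq> {1..a - 1}"
        then have "card I \<le> a - 1" using card_mono[of "{1..a - 1}" I] by simp
        then show False using I a by auto
      qed
      then obtain i where i: "i \<in> I" "i \<notin> {1..a - 1}" by blast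
      have "i \<in> {1..N}" using i I by auto
      then have "j < i" using i j by auto
      have "top_eq (a - 1) (D_coeff N I 0) 0"
        by (rule D_coeff_top_eq_0[of I N i j]) (use I i j \<open>j < i\<close> a in auto)
      then show "?t I = 0" using top' by (simp add: top_eq_def)
    qed
  qed simp
  also have "\<dots> = (\<Sum>i\<in>{a..N}. ?t (?J i))" by (rule sum.reindex[OF inj, unfolded o_def])
  also have "\<dots> = (\<Sum>i\<in>{a..N}. q powi psum (a - 1) n * (xcoeff (tail N a i) (m - n) * qpow q {i} n))"
  proof (rule sum.cong[OF refl])
    fix i assume i: "i \<in> {a..N}"
    have "top_eq (a - 1) (D_coeff N (?J i) 0) (tail N a i)"
      by (rule D_coeff_top_eq_tail[of _ N i a]) (use i a J[OF i] in auto)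
    then have "xcoeff (D_coeff N (?J i) 0) (m - n) = xcoeff (tail N a i) (m - n)" using top' by (simp only: top_eq_def)
    moreover have "qpow q (?J i) n = q powi psum (a - 1) n * qpow q {i} n"
    proof -
      have "i \<notin> {1..a - 1}" using i a by auto
      then have "qpow q (?J i) n = qpow q {1..a - 1} n * qpow q {i} n" by (simp add: qpow_def)
      then show ?thesis using qpow_psum[OF q n] by simp
    qed
    ultimately show "?t (?J i) = q powi psum (a - 1) n * (xcoeff (tail N a i) (m - n) * qpow q {i} n)" by simp
  qed
  finally show ?thesis by (simp add: sum_distrib_left)
qed

text \<open>
  Where the first a - 1 partial sums of m and n agree, dividing the kernel of the Macdonald operator
  by the (N - a)-th power of t leaves, up to a factor, the kernel of the a-th limiting operator.
\<close>

lemma mac_kernel_split: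
  assumes a: "a \<in> {1..N}" and top: "\<And>j. j < a \<Longrightarrow> psum j (m - n) = 0" and t: "t \<noteq> 0"
  shows "mac_kernel N q t m n = (if m = n then \<Sum>i\<in>{1..<a}. t ^ (N - i) * q powi wt_entry m i else 0)
     + t ^ (N - a) * (\<Sum>i\<in>{a..N}. xcoeff (scaled_tail N a t i) (m - n) * qpow q {i} n)"
proof -
  have top': "\<forall>j\<le>a - 1. psum j (m - n) \<ge> 0" using top a by auto
  have "{1..N} = {1..<a} \<union> {a..N}" using a by auto
  then have "mac_kernel N q t m n = (\<Sum>i\<in>{1..<a}. xcoeff (mac_coeff N t i) (m - n) * qpow q {i} n)
      + (\<Sum>i\<in>{a..N}. xcoeff (mac_coeff N t i) (m - n) * qpow q {i} n)"
    unfolding shift_kernel_def by (simp only:) (rule sum.union_disjoint, auto)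
  also have "(\<Sum>i\<in>{1..<a}. xcoeff (mac_coeff N t i) (m - n) * qpow q {i} n)
     = (if m = n then \<Sum>i\<in>{1..<a}. t ^ (N - i) * q powi wt_entry m i else 0)"
  proof -
    have "xcoeff (mac_coeff N t i) (m - n) * qpow q {i} n = (if m = n then t ^ (N - i) * q powi wt_entry m i else 0)"
      if i: "i \<in> {1..<a}" for i
    proof -
      have "xcoeff (mac_coeff N t i) (m - n) = xcoeff (xconst (t ^ (N - i))) (m - n)"
        using mac_coeff_top_eq_power[of i N "a - 1" t] i a top' by (auto simp: top_eq_def)
      then show ?thesis by (simp add: qpow_def)
    qed
    then have "(\<Sum>i\<in>{1..<a}. xcoeff (mac_coeff N t i) (m - n) * qpow q {i} n)
      = (\<Sum>i\<in>{1..<a}. if m = n then t ^ (N - i) * q powi wt_entry m i else 0)"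
      by (rule sum.cong[OF refl])
    then show ?thesis by simp
  qed
  also have "(\<Sum>i\<in>{a..N}. xcoeff (mac_coeff N t i) (m - n) * qpow q {i} n)
     = t ^ (N - a) * (\<Sum>i\<in>{a..N}. xcoeff (scaled_tail N a t i) (m - n) * qpow q {i} n)"
    unfolding sum_distrib_left
  proof (rule sum.cong[OF refl])
    fix i assume i: "i \<in> {a..N}"
    have "xcoeff (mac_coeff N t i) (m - n) = xcoeff (xconst (t ^ (N - a)) * scaled_tail N a t i) (m - n)"
      using mac_coeff_top_eq_tail[OF i _ t] a top' by (auto simp: top_eq_def simp del: xcoeff_xconst_mult)
    then show "xcoeff (mac_coeff N t i) (m - n) * qpow q {i} n
        = t ^ (N - a) * (xcoeff (scaled_tail N a t i) (m - n) * qpow q {i} n)" by simp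
  qed
  finally show ?thesis .
qed

text \<open>Stated for any filter below \<open>at_infinity\<close> and any eventual choice of
  eigenfunctions, so that it serves the polynomials along all large t as well as the series along
  the nonresonant t.\<close>

lemma Macdonald_series_tendsto_Psi:
  assumes q: "q \<noteq> 0" "norm q < 1" and l: "l \<in> lattice N" and A: "A \<le> at_infinity"
    and F: "eventually (\<lambda>t. is_Macdonald_series N q t l (F t)) A"
  shows "((\<lambda>t. xcoeff (F t) m) \<longlongrightarrow> xcoeff (Psi N q l) m) A"
proof (induction "height N (l - m)" arbitrary: m rule: less_induct)
  case less
  let ?P = "Psi N q l"
  have J: "joint_eigen N q l ?P" by (rule joint_eigen_Psi[OF q l])
  consider "l - m \<notin> Qplus N" | "m = l" | "l - m \<in> Qplus N" "m \<noteq> l" by blast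
  then show ?case
  proof cases
    case 1
    have "eventually (\<lambda>t. xcoeff (F t) m = xcoeff ?P m) A"
      using F
    proof eventually_elim
      case (elim t)
      then show ?case using J 1 by (auto simp: is_Macdonald_series_def joint_eigen_def leading_monomial_def) metis
    qed
    then show ?thesis by (rule tendsto_eventually)
  next
    case 2
    have "eventually (\<lambda>t. xcoeff (F t) m = xcoeff ?P m) A"
      using F
    proof eventually_elim
      case (elim t)
      then show ?case using J 2 by (auto simp: is_Macdonald_series_def joint_eigen_def leading_monomial_def)
    qed
    then show ?thesis by (rule tendsto_eventually)
  next
    case 3
    define a where "a = fst_diff (l - m)"
    have a: "a \<in> {1..N}" "psum a (l - m) > 0" and az: "\<And>j. j < a \<Longrightarrow> psum j (l - m) = 0"
      using fst_diff[OF 3(1)] 3(2) by (auto simp: a_def)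
    let ?S = "between N m l - {m}"
    have lat: "n \<in> lattice N" if "l - n \<in> Qplus N" for n
    proof -
      have "l - n \<in> lattice N" using that by (simp add: Qplus_iff)
      then have "l - (l - n) \<in> lattice N" by (rule lattice_diff[OF l])
      then show ?thesis by simp
    qed
    have agree: "psum j (m - n) = 0" "psum j n = psum j l" if "j < a" "n \<in> between N m l" for j n
    proof -
      have "psum j (n - m) \<ge> 0" "psum j (l - n) \<ge> 0" using that(2) by (auto simp: between_def Qplus_iff simp del: psum_diff)
      then show "psum j (m - n) = 0" "psum j n = psum j l" using az[OF that(1)] by auto
    qed
    have entries: "wt_entry m i = wt_entry l i" if "i \<in> {1..<a}" for i
    proof -
      have "psum i m = psum i l" "psum (i - 1) m = psum (i - 1) l" using az[of i] az[of "i - 1"] that by auto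
      then show ?thesis using that psum_Suc[of "i - 1" m] psum_Suc[of "i - 1" l] by simp
    qed
    define R where "R = (\<lambda>t n. \<Sum>i\<in>{a..N}. xcoeff (scaled_tail N a t i) (m - n) * qpow q {i} n)"
    \<comment> \<open>The difference of the eigenvalues of l and m divided by t^(N-a); the summands
      with i < a cancel because l and m agree there.\<close>
    define br where "br = (\<lambda>t. (\<Sum>i\<in>{a..N}. inverse t ^ (i - a) * q powi wt_entry l i) - R t m)"
    \<comment> \<open>Inverse of the factor that the indices below a contribute to the limiting
      kernel; it is the same for all n in the interval.\<close>
    define c where "c = q powi (- psum (a - 1) l)"
    have split: "mac_kernel N q t m n = (if m = n then \<Sum>i\<in>{1..<a}. t ^ (N - i) * q powi wt_entry m i else 0) + t ^ (N - a) * R t n"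
      if "t \<noteq> 0" "n \<in> between N m l" for t n
      unfolding R_def by (rule mac_kernel_split[OF a(1) agree(1) that(1)]) (use that in auto)
    have eqn: "br t * xcoeff (F t) m = (\<Sum>n\<in>?S. R t n * xcoeff (F t) n)"
      if t: "t \<noteq> 0" and S: "is_Macdonald_series N q t l (F t)" for t
    proof -
      have lead: "leading_monomial N l (F t)" and eig: "Macdonald_eigen N q t l (F t)" using S by (auto simp: is_Macdonald_series_def)
      have "(mac_eigval N q t l - mac_eigval N q t m) * xcoeff (F t) m = (\<Sum>n\<in>?S. mac_kernel N q t m n * xcoeff (F t) n)"
        using Macdonald_eigen_iff[OF lead] eig 3 by blast
      also have "\<dots> = (\<Sum>n\<in>?S. t ^ (N - a) * (R t n * xcoeff (F t) n))"
        by (rule sum.cong[OF refl]) (use split[OF t] in auto)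
      finally have 1: "(mac_eigval N q t l - mac_eigval N q t m) * xcoeff (F t) m = t ^ (N - a) * (\<Sum>n\<in>?S. R t n * xcoeff (F t) n)"
        by (simp add: sum_distrib_left)
      have "mac_eigval N q t m = (\<Sum>i\<in>{1..<a}. t ^ (N - i) * q powi wt_entry m i) + t ^ (N - a) * R t m"
        using split[OF t mem_betweenI[OF 3(1)]] mac_kernel_diag by simp
      moreover have "mac_eigval N q t l = (\<Sum>i\<in>{1..<a}. t ^ (N - i) * q powi wt_entry m i)
          + t ^ (N - a) * (\<Sum>i\<in>{a..N}. inverse t ^ (i - a) * q powi wt_entry l i)"
      proof -
        have "{1..N} = {1..<a} \<union> {a..N}" using a by auto
        then have "mac_eigval N q t l = (\<Sum>i\<in>{1..<a}. t ^ (N - i) * q powi wt_entry l i) + (\<Sum>i\<in>{a..N}. t ^ (N - i) * q powi wt_entry l i)"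
          unfolding mac_eigval_def by (simp only:) (rule sum.union_disjoint, auto)
        moreover have "(\<Sum>i\<in>{a..N}. t ^ (N - i) * q powi wt_entry l i) = t ^ (N - a) * (\<Sum>i\<in>{a..N}. inverse t ^ (i - a) * q powi wt_entry l i)"
          unfolding sum_distrib_left
        proof (rule sum.cong[OF refl])
          fix i assume i: "i \<in> {a..N}"
          have "t ^ (N - a) = t ^ (N - i) * t ^ (i - a)" unfolding power_add[symmetric] using i by simp
          then have "t ^ (N - a) * inverse t ^ (i - a) = t ^ (N - i)" using t by (simp add: power_inverse)
          then show "t ^ (N - i) * q powi wt_entry l i = t ^ (N - a) * (inverse t ^ (i - a) * q powi wt_entry l i)"
            by (simp add: mult.assoc[symmetric])
        qed
        moreover have "(\<Sum>i\<in>{1..<a}. t ^ (N - i) * q powi wt_entry l i) = (\<Sum>i\<in>{1..<a}. t ^ (N - i) * q powi wt_entry m i)"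
          by (rule sum.cong[OF refl]) (simp add: entries)
        ultimately show ?thesis by simp
      qed
      ultimately have "mac_eigval N q t l - mac_eigval N q t m = t ^ (N - a) * br t"
        by (simp add: br_def right_diff_distrib)
      then have "t ^ (N - a) * (br t * xcoeff (F t) m) = t ^ (N - a) * (\<Sum>n\<in>?S. R t n * xcoeff (F t) n)"
        using 1 by (simp add: mult.assoc)
      then show ?thesis using t by simp
    qed
    have inv0: "((\<lambda>t::complex. inverse t) \<longlongrightarrow> 0) A" by (rule tendsto_mono[OF A tendsto_inverse_0])
    have R_lim: "((\<lambda>t. R t n) \<longlongrightarrow> c * D_kernel N q a m n) A" if n: "n \<in> between N m l" for n
    proof -
      have "((\<lambda>t. R t n) \<longlongrightarrow> (\<Sum>i\<in>{a..N}. xcoeff (tail N a i) (m - n) * qpow q {i} n)) A"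
        unfolding R_def
        by (intro tendsto_sum tendsto_mult tendsto_const)
          (use scaled_tail_cw_lim[of _ N a A] A a in \<open>auto simp: cw_lim_def\<close>)
      also have "(\<Sum>i\<in>{a..N}. xcoeff (tail N a i) (m - n) * qpow q {i} n) = c * D_kernel N q a m n"
      proof -
        have nl: "n \<in> lattice N" using n lat by (auto simp: between_def)
        have "psum (a - 1) n = psum (a - 1) l" using agree(2)[of "a - 1" n] n a by simp
        then have "c * q powi psum (a - 1) n = 1" using q(1) by (simp add: c_def power_int_minus)
        moreover have "D_kernel N q a m n = q powi psum (a - 1) n * (\<Sum>i\<in>{a..N}. xcoeff (tail N a i) (m - n) * qpow q {i} n)"
          by (rule tail_kernel[OF q(1) a(1) agree(1) nl]) (use n in auto)
        ultimately show ?thesis by (simp add: mult.assoc[symmetric])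
      qed
      finally show ?thesis .
    qed
    define b where "b = c * eigen_gap q l a m"
    have b0: "b \<noteq> 0" using eigen_gap_nonzero[OF q 3] q(1) by (simp add: b_def c_def a_def)
    have br_lim: "(br \<longlongrightarrow> b) A"
    proof -
      have "((\<lambda>t. \<Sum>i\<in>{a..N}. inverse t ^ (i - a) * q powi wt_entry l i) \<longlongrightarrow> (\<Sum>i\<in>{a..N}. 0 ^ (i - a) * q powi wt_entry l i)) A"
        by (intro tendsto_sum tendsto_mult tendsto_const tendsto_power inv0)
      also have "(\<Sum>i\<in>{a..N}. 0 ^ (i - a) * q powi wt_entry l i) = (\<Sum>i\<in>{a..N}. if i = a then q powi wt_entry l i else 0)"
        by (rule sum.cong) auto
      also have "\<dots> = q powi wt_entry l a" using a by (simp add: sum.delta')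
      also have "q powi wt_entry l a = c * q powi psum a l"
      proof -
        have "psum a l = psum (a - 1) l + wt_entry l a" using a psum_Suc[of "a - 1" l] by simp
        then show ?thesis using q(1) by (simp add: c_def power_int_add power_int_minus)
      qed
      finally have 1: "((\<lambda>t. \<Sum>i\<in>{a..N}. inverse t ^ (i - a) * q powi wt_entry l i) \<longlongrightarrow> c * q powi psum a l) A" .
      have "((\<lambda>t. R t m) \<longlongrightarrow> c * q powi psum a m) A"
        using R_lim[OF mem_betweenI[OF 3(1)]] D_kernel_diag[OF q(1) a(1) lat[OF 3(1)]] by simp
      from tendsto_diff[OF 1 this] show ?thesis unfolding br_def b_def by (simp add: right_diff_distrib)
    qed
    have num_lim: "((\<lambda>t. \<Sum>n\<in>?S. R t n * xcoeff (F t) n) \<longlongrightarrow> b * xcoeff ?P m) A"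
    proof -
      have "((\<lambda>t. \<Sum>n\<in>?S. R t n * xcoeff (F t) n) \<longlongrightarrow> (\<Sum>n\<in>?S. c * D_kernel N q a m n * xcoeff ?P n)) A"
        by (intro tendsto_sum tendsto_mult R_lim less.hyps) (auto intro: between_height_less)
      also have "(\<Sum>n\<in>?S. c * D_kernel N q a m n * xcoeff ?P n) = b * xcoeff ?P m"
        using joint_eigen_recursion[OF q(1) l J 3(1) a(1)] by (simp add: b_def mult.assoc sum_distrib_left[symmetric])
      finally show ?thesis .
    qed
    have "((\<lambda>t. (\<Sum>n\<in>?S. R t n * xcoeff (F t) n) / br t) \<longlongrightarrow> b * xcoeff ?P m / b) A"
      by (rule tendsto_divide[OF num_lim br_lim b0])
    moreover have "eventually (\<lambda>t. (\<Sum>n\<in>?S. R t n * xcoeff (F t) n) / br t = xcoeff (F t) m) A"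
    proof -
      have "eventually (\<lambda>t. br t \<noteq> 0) A" using br_lim b0 by (rule tendsto_imp_eventually_ne)
      moreover have "eventually (\<lambda>t::complex. t \<noteq> 0) A"
      proof -
        have "eventually (\<lambda>t::complex. t \<noteq> 0) at_infinity"
          unfolding eventually_at_infinity by (rule exI[of _ 1]) auto
        then show ?thesis using A by (rule filter_leD[rotated])
      qed
      ultimately show ?thesis using F
      proof eventually_elim
        case (elim t)
        then show ?case using eqn[of t] by (simp add: field_simps)
      qed
    qed
    ultimately have "((\<lambda>t. xcoeff (F t) m) \<longlongrightarrow> b * xcoeff ?P m / b) A" by (rule Lim_transform_eventually)
    then show ?thesis using b0 by simp
  qed
qed

lemma coeffwise_limit_eq:
  assumes "A \<noteq> bot" "\<And>g. ((\<lambda>t. xcoeff (P t) g) \<longlongrightarrow> xcoeff F g) A"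
  shows "coeffwise_limit P A = F"
  unfolding coeffwise_limit_def
proof (rule the_equality)
  show "\<forall>g. ((\<lambda>t. xcoeff (P t) g) \<longlongrightarrow> xcoeff F g) A" using assms(2) by blast
  fix G assume "\<forall>g. ((\<lambda>t. xcoeff (P t) g) \<longlongrightarrow> xcoeff G g) A"
  then show "G = F" using tendsto_unique[OF assms(1)] assms(2) by (blast intro: xseries_eqI)
qed

section \<open>Resonances and the filter of the limit\<close>

lemma countable_lattice: "countable (lattice N)"
proof (rule countable_image_inj_on)
  show "countable ((\<lambda>g. map (wt_entry g) [1..<Suc N]) ` lattice N)" by simp
  show "inj_on (\<lambda>g. map (wt_entry g) [1..<Suc N]) (lattice N)"
  proof (rule inj_onI)
    fix g h assume gh: "g \<in> lattice N" "h \<in> lattice N" "map (wt_entry g) [1..<Suc N] = map (wt_entry h) [1..<Suc N]"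
    show "g = h"
    proof (rule poly_mapping_eqI)
      fix i show "wt_entry g i = wt_entry h i"
      proof (cases "i \<in> {1..N}")
        case True
        then show ?thesis using gh(3) by auto
      qed (use gh wt_entry_lattice in auto)
    qed
  qed
qed

text \<open>The difference of the eigenvalues is a polynomial in t whose coefficients q^(l_i) -
  q^(m_i) are not all 0.\<close>

lemma finite_mac_resonances:
  assumes q: "q \<noteq> 0" "norm q < 1" and "l \<in> lattice N" "m \<in> lattice N" "m \<noteq> l"
  shows "finite {t. mac_eigval N q t l = mac_eigval N q t m}"
proof -
  define p where "p = (\<Sum>i\<in>{1..N}. monom (q powi wt_entry l i - q powi wt_entry m i) (N - i))"
  have p: "poly p t = mac_eigval N q t l - mac_eigval N q t m" for t
    by (simp add: p_def poly_sum poly_monom mac_eigval_def sum_subtractf[symmetric] algebra_simps)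
  obtain i where i: "wt_entry l i \<noteq> wt_entry m i" using assms(5) by (metis poly_mapping_eqI)
  have iN: "i \<in> {1..N}"
    by (rule ccontr) (use i wt_entry_lattice[OF assms(3), of i] wt_entry_lattice[OF assms(4), of i] in simp)
  have "coeff p (N - i) = (\<Sum>j\<in>{1..N}. if j = i then q powi wt_entry l j - q powi wt_entry m j else 0)"
    unfolding p_def coeff_sum by (rule sum.cong) (use iN in auto)
  also have "\<dots> = q powi wt_entry l i - q powi wt_entry m i" using iN by simp
  also have "\<dots> \<noteq> 0" using powi_inj[OF q] i by auto
  finally have "p \<noteq> 0" by auto
  then have "finite {t. poly p t = 0}" by (rule poly_roots_finite)
  then show ?thesis unfolding p by simp
qed

lemma at_infinity_nontrivial: "at_infinity \<noteq> (bot :: complex filter)"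
proof
  assume "at_infinity = (bot :: complex filter)"
  then have "eventually (\<lambda>t::complex. False) at_infinity" by simp
  then obtain b where b: "\<And>t::complex. norm t \<ge> b \<Longrightarrow> False" unfolding eventually_at_infinity by blast
  show False by (rule b[of "of_real \<bar>b\<bar>"]) simp
qed

text \<open>Along a trivial filter every series would be a limit. The resonant t lie in a countable
  union of finite sets, whereas every neighbourhood of infinity contains an uncountable
  interval.\<close>

lemma Macdonald_series_filter_nontrivial:
  assumes q: "q \<noteq> 0" "norm q < 1" and l: "l \<in> lattice N"
  shows "inf at_infinity (principal {t. \<exists>!F. is_Macdonald_series N q t l F}) \<noteq> bot"
proof
  let ?S = "{t. \<exists>!F. is_Macdonald_series N q t l F}"
  assume "inf at_infinity (principal ?S) = bot"
  then have "eventually (\<lambda>t. False) (inf at_infinity (principal ?S))" by simp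
  then have "eventually (\<lambda>t. t \<notin> ?S) at_infinity" unfolding eventually_inf_principal by simp
  then obtain b where b: "\<And>t. norm t \<ge> b \<Longrightarrow> t \<notin> ?S" unfolding eventually_at_infinity by blast
  let ?M = "{m \<in> lattice N. m \<noteq> l}"
  let ?B = "\<Union>m\<in>?M. {t. mac_eigval N q t l = mac_eigval N q t m}"
  have "countable ?M" using countable_lattice by (rule countable_subset[rotated]) auto
  then have "countable ?B" by (rule countable_UN) (use finite_mac_resonances[OF q l] countable_finite in auto)
  have "complex_of_real ` {\<bar>b\<bar><..<\<bar>b\<bar> + 1} \<subseteq> ?B"
  proof
    fix t assume "t \<in> complex_of_real ` {\<bar>b\<bar><..<\<bar>b\<bar> + 1}"
    then have "norm t \<ge> b" by auto
    then have "t \<notin> ?S" by (rule b)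
    then have "\<not> (\<forall>m. l - m \<in> Qplus N \<longrightarrow> m \<noteq> l \<longrightarrow> mac_eigval N q t l \<noteq> mac_eigval N q t m)"
      using Macdonald_series_ex1[of l N q t] by blast
    then obtain m where m: "l - m \<in> Qplus N" "m \<noteq> l" "mac_eigval N q t l = mac_eigval N q t m" by blast
    have "l - m \<in> lattice N" using m(1) by (simp add: Qplus_iff)
    then have "l - (l - m) \<in> lattice N" by (rule lattice_diff[OF l])
    then show "t \<in> ?B" using m by auto
  qed
  then have "countable (complex_of_real ` {\<bar>b\<bar><..<\<bar>b\<bar> + 1})" using \<open>countable ?B\<close> countable_subset by blast
  then have "countable {\<bar>b\<bar><..<\<bar>b\<bar> + 1}" by (rule countable_image_inj_on) (auto simp: inj_on_def)
  then show False using uncountable_open_interval[of "\<bar>b\<bar>" "\<bar>b\<bar> + 1"] by simp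
qed

theorem qWhittaker_series_eq_Psi:
  assumes q: "q \<noteq> 0" "norm q < 1" and l: "l \<in> lattice N"
  shows "qWhittaker_series N q l = Psi N q l"
  unfolding qWhittaker_series_def
proof (rule coeffwise_limit_eq[OF Macdonald_series_filter_nontrivial[OF assms]])
  fix g
  show "((\<lambda>t. xcoeff (Macdonald_series N q t l) g) \<longlongrightarrow> xcoeff (Psi N q l) g)
     (inf at_infinity (principal {t. \<exists>!F. is_Macdonald_series N q t l F}))"
  proof (rule Macdonald_series_tendsto_Psi[OF assms])
    have "is_Macdonald_series N q t l (Macdonald_series N q t l)" if "\<exists>!F. is_Macdonald_series N q t l F" for t
      unfolding Macdonald_series_def by (rule theI'[OF that])
    then show "eventually (\<lambda>t. is_Macdonald_series N q t l (Macdonald_series N q t l))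
       (inf at_infinity (principal {t. \<exists>!F. is_Macdonald_series N q t l F}))"
      unfolding eventually_inf_principal by simp
  qed simp
qed

section \<open>Existence of the Macdonald polynomials\<close>

definition esym :: "nat set \<Rightarrow> nat \<Rightarrow> xseries" where
  "esym A r = (\<Sum>I | I \<subseteq> A \<and> card I = r. xmonom (indicator_wt I))"

lemma esym_0: "finite A \<Longrightarrow> esym A 0 = 1"
proof -
  assume "finite A"
  then have "{I. I \<subseteq> A \<and> card I = 0} = {{}}" using finite_subset by fastforce
  then show ?thesis by (simp add: esym_def indicator_wt_def)
qed

lemma esym_gt: "finite A \<Longrightarrow> card A < r \<Longrightarrow> esym A r = 0"
proof -
  assume A: "finite A" "card A < r"
  have "card I \<noteq> r" if "I \<subseteq> A" for I using card_mono[OF A(1) that] A(2) by simp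
  then have "{I. I \<subseteq> A \<and> card I = r} = {}" by blast
  then show ?thesis by (simp only: esym_def sum.empty)
qed

lemma esym_insert:
  assumes "finite A" "i \<notin> A"
  shows "esym (insert i A) (Suc r) = xvar i * esym A r + esym A (Suc r)"
proof -
  have "xmonom (indicator_wt (insert i I)) = xvar i * xmonom (indicator_wt I)" if "I \<subseteq> A" for I
  proof -
    have "finite I" "i \<notin> I" using that assms finite_subset by auto
    then show ?thesis by (simp add: indicator_wt_def xmonom_mult)
  qed
  then show ?thesis
    unfolding esym_def sum_subsets_split[OF assms] sum_distrib_left
    by (intro arg_cong2[of _ _ _ _ "(+)"] sum.cong refl) auto
qed

lemma Gamma_esym:
  assumes "i \<notin> A" "finite A"
  shows "Gamma q {i} (esym A r) = esym A r"
  unfolding esym_def Gamma_sum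
proof (rule sum.cong[OF refl])
  fix I assume I: "I \<in> {I. I \<subseteq> A \<and> card I = r}"
  then have "finite I" "i \<notin> I" using assms finite_subset by auto
  then show "Gamma q {i} (xmonom (indicator_wt I)) = xmonom (indicator_wt I)"
    by (simp add: Gamma_xmonom qpow_def lookup_indicator_wt)
qed

text \<open>Vieta's formula. T is kept general because it is used at the nodes x_i and at t
  x_i.\<close>

lemma prod_diff_esym:
  assumes "finite A"
  shows "(\<Prod>j\<in>A. T - xvar j) = (\<Sum>k\<le>card A. (- 1) ^ k * esym A k * T ^ (card A - k))"
  using assms
proof (induction A rule: finite_induct)
  case empty
  then show ?case by (simp add: esym_0)
next
  case (insert i A)
  let ?n = "card A"
  have "(\<Sum>k\<le>Suc ?n. (- 1) ^ k * esym (insert i A) k * T ^ (Suc ?n - k))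
     = T ^ Suc ?n + (\<Sum>k\<le>?n. (- 1) ^ Suc k * (xvar i * esym A k + esym A (Suc k)) * T ^ (?n - k))"
    unfolding sum.atMost_Suc_shift using insert by (simp add: esym_0 esym_insert)
  also have "(\<Sum>k\<le>?n. (- 1) ^ Suc k * (xvar i * esym A k + esym A (Suc k)) * T ^ (?n - k))
     = (\<Sum>k\<le>?n. (- 1) ^ Suc k * esym A (Suc k) * T ^ (?n - k)) - xvar i * (\<Sum>k\<le>?n. (- 1) ^ k * esym A k * T ^ (?n - k))"
    unfolding sum_distrib_left sum_subtractf[symmetric] by (intro sum.cong refl) (simp add: algebra_simps)
  also have "T ^ Suc ?n + ((\<Sum>k\<le>?n. (- 1) ^ Suc k * esym A (Suc k) * T ^ (?n - k)) - xvar i * (\<Sum>k\<le>?n. (- 1) ^ k * esym A k * T ^ (?n - k)))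
     = (\<Sum>k\<le>Suc ?n. (- 1) ^ k * esym A k * T ^ (Suc ?n - k)) - xvar i * (\<Sum>k\<le>?n. (- 1) ^ k * esym A k * T ^ (?n - k))"
    unfolding sum.atMost_Suc_shift using insert by (simp add: esym_0)
  also have "(\<Sum>k\<le>Suc ?n. (- 1) ^ k * esym A k * T ^ (Suc ?n - k)) = T * (\<Sum>k\<le>?n. (- 1) ^ k * esym A k * T ^ (?n - k))"
  proof -
    have "(\<Sum>k\<le>Suc ?n. (- 1) ^ k * esym A k * T ^ (Suc ?n - k)) = (\<Sum>k\<le>?n. (- 1) ^ k * esym A k * T ^ (Suc ?n - k))"
      using insert by (simp add: esym_gt)
    also have "\<dots> = T * (\<Sum>k\<le>?n. (- 1) ^ k * esym A k * T ^ (?n - k))"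
      unfolding sum_distrib_left by (intro sum.cong refl) (simp add: Suc_diff_le mult_ac)
    finally show ?thesis .
  qed
  finally show ?case using insert by (simp add: left_diff_distrib)
qed

text \<open>Symmetric polynomials are described by generators because the effect of a shift on them
  is determined by induction; invariance under permutations is recovered in
  \<open>is_sym_poly_sym_ring\<close>.\<close>

inductive_set sym_ring :: "nat \<Rightarrow> xseries set" for N where
  const: "xconst c \<in> sym_ring N"
| esym: "esym {1..N} r \<in> sym_ring N"
| add: "F \<in> sym_ring N \<Longrightarrow> G \<in> sym_ring N \<Longrightarrow> F + G \<in> sym_ring N"
| mult: "F \<in> sym_ring N \<Longrightarrow> G \<in> sym_ring N \<Longrightarrow> F * G \<in> sym_ring N"

lemma sym_ring_0: "0 \<in> sym_ring N" and sym_ring_1: "1 \<in> sym_ring N"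
  using sym_ring.const[of 0 N] sym_ring.const[of 1 N] by simp_all

lemma sym_ring_uminus: "F \<in> sym_ring N \<Longrightarrow> - F \<in> sym_ring N"
  using sym_ring.mult[OF sym_ring.const[of "- 1"], of F N] by (simp add: xconst_uminus)

lemma sym_ring_diff: "F \<in> sym_ring N \<Longrightarrow> G \<in> sym_ring N \<Longrightarrow> F - G \<in> sym_ring N"
  using sym_ring.add[OF _ sym_ring_uminus, of F N G] by simp

lemma sym_ring_sum: "(\<And>i. i \<in> A \<Longrightarrow> f i \<in> sym_ring N) \<Longrightarrow> (\<Sum>i\<in>A. f i) \<in> sym_ring N"
  by (induction A rule: infinite_finite_induct) (auto simp: sym_ring_0 intro: sym_ring.add)

lemma sym_ring_prod: "(\<And>i. i \<in> A \<Longrightarrow> f i \<in> sym_ring N) \<Longrightarrow> (\<Prod>i\<in>A. f i) \<in> sym_ring N"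
  by (induction A rule: infinite_finite_induct) (auto simp: sym_ring_1 intro: sym_ring.mult)

lemma sym_ring_power: "F \<in> sym_ring N \<Longrightarrow> F ^ n \<in> sym_ring N"
  by (induction n) (auto simp: sym_ring_1 intro: sym_ring.mult)

definition sym_polys :: "nat \<Rightarrow> xseries poly set" where
  "sym_polys N = {p. \<forall>n. coeff p n \<in> sym_ring N}"

lemma sym_polys_0: "0 \<in> sym_polys N"
  by (simp add: sym_polys_def sym_ring_0)

lemma sym_polys_pCons: "F \<in> sym_ring N \<Longrightarrow> p \<in> sym_polys N \<Longrightarrow> pCons F p \<in> sym_polys N"
  by (auto simp: sym_polys_def coeff_pCons split: nat.split)

lemma sym_polys_add: "p \<in> sym_polys N \<Longrightarrow> r \<in> sym_polys N \<Longrightarrow> p + r \<in> sym_polys N"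
  by (auto simp: sym_polys_def intro: sym_ring.add)

lemma sym_polys_diff: "p \<in> sym_polys N \<Longrightarrow> r \<in> sym_polys N \<Longrightarrow> p - r \<in> sym_polys N"
  by (auto simp: sym_polys_def intro: sym_ring_diff)

lemma sym_polys_mult: "p \<in> sym_polys N \<Longrightarrow> r \<in> sym_polys N \<Longrightarrow> p * r \<in> sym_polys N"
  by (auto simp: sym_polys_def coeff_mult intro!: sym_ring_sum sym_ring.mult)

lemma sym_polys_smult: "F \<in> sym_ring N \<Longrightarrow> p \<in> sym_polys N \<Longrightarrow> smult F p \<in> sym_polys N"
  by (auto simp: sym_polys_def intro: sym_ring.mult)

lemma sym_polys_monom: "F \<in> sym_ring N \<Longrightarrow> monom F n \<in> sym_polys N"
  by (auto simp: sym_polys_def sym_ring_0)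

lemma sym_polys_sum: "(\<And>i. i \<in> A \<Longrightarrow> f i \<in> sym_polys N) \<Longrightarrow> (\<Sum>i\<in>A. f i) \<in> sym_polys N"
  by (induction A rule: infinite_finite_induct) (auto simp: sym_polys_0 intro: sym_polys_add)

text \<open>e_(r+1) of all variables is x_i e_r + e_(r+1) of the others. Solving for the last term
  builds the polynomial recursively and independently of i.\<close>

lemma esym_without:
  "\<exists>p\<in>sym_polys N. \<forall>i\<in>{1..N}. esym ({1..N} - {i}) r = poly p (xvar i)"
proof (induction r)
  case 0
  have "pCons 1 0 \<in> sym_polys N" by (intro sym_polys_pCons sym_polys_0 sym_ring_1)
  moreover have "\<forall>i\<in>{1..N}. esym ({1..N} - {i}) 0 = poly (pCons 1 0) (xvar i)" by (simp add: esym_0)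
  ultimately show ?case by blast
next
  case (Suc r)
  then obtain p where p: "p \<in> sym_polys N" "\<And>i. i \<in> {1..N} \<Longrightarrow> esym ({1..N} - {i}) r = poly p (xvar i)" by blast
  have "pCons (esym {1..N} (Suc r)) 0 - pCons 0 p \<in> sym_polys N"
    by (intro sym_polys_diff sym_polys_pCons sym_polys_0 sym_ring_0 sym_ring.esym p)
  moreover have "\<forall>i\<in>{1..N}. esym ({1..N} - {i}) (Suc r) = poly (pCons (esym {1..N} (Suc r)) 0 - pCons 0 p) (xvar i)"
  proof
    fix i assume i: "i \<in> {1..N}"
    have "esym (insert i ({1..N} - {i})) (Suc r) = xvar i * esym ({1..N} - {i}) r + esym ({1..N} - {i}) (Suc r)"
      by (rule esym_insert) auto
    moreover have "insert i ({1..N} - {i}) = {1..N}" using i by auto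
    ultimately show "esym ({1..N} - {i}) (Suc r) = poly (pCons (esym {1..N} (Suc r)) 0 - pCons 0 p) (xvar i)"
      using p(2)[OF i] by simp
  qed
  ultimately show ?case by blast
qed

text \<open>One polynomial p serves all i. This turns the Macdonald operator into a sum of the
  values of one polynomial at the nodes x_i with Lagrange weights.\<close>

lemma Gamma_sym_ring:
  assumes q: "q \<noteq> 0"
  shows "F \<in> sym_ring N \<Longrightarrow> \<exists>p\<in>sym_polys N. \<forall>i\<in>{1..N}. Gamma q {i} F = poly p (xvar i)"
proof (induction rule: sym_ring.induct)
  case (const c)
  have "pCons (xconst c) 0 \<in> sym_polys N" by (intro sym_polys_pCons sym_polys_0 sym_ring.const)
  moreover have "\<forall>i\<in>{1..N}. Gamma q {i} (xconst c) = poly (pCons (xconst c) 0) (xvar i)" by simp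
  ultimately show ?case by blast
next
  case (esym r)
  show ?case
  proof (cases r)
    case 0
    have "pCons 1 0 \<in> sym_polys N" by (intro sym_polys_pCons sym_polys_0 sym_ring_1)
    moreover have "\<forall>i\<in>{1..N}. Gamma q {i} (esym {1..N} r) = poly (pCons 1 0) (xvar i)" by (simp add: 0 esym_0)
    ultimately show ?thesis by blast
  next
    case (Suc r')
    obtain p where p: "p \<in> sym_polys N" "\<And>i. i \<in> {1..N} \<Longrightarrow> esym ({1..N} - {i}) r' = poly p (xvar i)"
      using esym_without by blast
    obtain p' where p': "p' \<in> sym_polys N" "\<And>i. i \<in> {1..N} \<Longrightarrow> esym ({1..N} - {i}) (Suc r') = poly p' (xvar i)"
      using esym_without by blast
    have "pCons 0 (smult (xconst q) p) + p' \<in> sym_polys N"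
      by (intro sym_polys_add sym_polys_pCons sym_polys_smult sym_ring_0 sym_ring.const p p')
    moreover have "\<forall>i\<in>{1..N}. Gamma q {i} (esym {1..N} r) = poly (pCons 0 (smult (xconst q) p) + p') (xvar i)"
    proof
      fix i assume i: "i \<in> {1..N}"
      have "esym (insert i ({1..N} - {i})) (Suc r') = xvar i * esym ({1..N} - {i}) r' + esym ({1..N} - {i}) (Suc r')"
        by (rule esym_insert) auto
      moreover have "insert i ({1..N} - {i}) = {1..N}" using i by auto
      ultimately have "Gamma q {i} (esym {1..N} r) = Gamma q {i} (xvar i) * esym ({1..N} - {i}) r' + esym ({1..N} - {i}) (Suc r')"
        by (simp add: Suc Gamma_add Gamma_mult[OF q] Gamma_esym)
      then show "Gamma q {i} (esym {1..N} r) = poly (pCons 0 (smult (xconst q) p) + p') (xvar i)"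
        using p(2)[OF i] p'(2)[OF i] by (simp add: Gamma_xvar mult_ac)
    qed
    ultimately show ?thesis by blast
  qed
next
  case (add F G)
  then obtain p p' where "p \<in> sym_polys N" "p' \<in> sym_polys N" "\<forall>i\<in>{1..N}. Gamma q {i} F = poly p (xvar i)"
    "\<forall>i\<in>{1..N}. Gamma q {i} G = poly p' (xvar i)" by blast
  then show ?case by (intro bexI[of _ "p + p'"]) (auto simp: Gamma_add intro: sym_polys_add)
next
  case (mult F G)
  then obtain p p' where "p \<in> sym_polys N" "p' \<in> sym_polys N" "\<forall>i\<in>{1..N}. Gamma q {i} F = poly p (xvar i)"
    "\<forall>i\<in>{1..N}. Gamma q {i} G = poly p' (xvar i)" by blast
  then show ?case by (intro bexI[of _ "p * p'"]) (auto simp: Gamma_mult[OF q] intro: sym_polys_mult)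
qed

section \<open>Lagrange interpolation and closure under the Macdonald operator\<close>

definition lagrange_weight :: "nat \<Rightarrow> nat \<Rightarrow> xseries" where
  "lagrange_weight N i = (\<Prod>j\<in>{1..N} - {i}. inv_diff i j)"

lemma lagrange_weight_mult: "lagrange_weight N i * (\<Prod>j\<in>{1..N} - {i}. xvar i - xvar j) = 1"
  unfolding lagrange_weight_def prod.distrib[symmetric] by (rule prod.neutral) (simp add: inv_diff_mult)

lemma xvar_inj: "xvar i = xvar j \<longleftrightarrow> i = j"
proof
  assume "xvar i = xvar j"
  then have "xcoeff (xvar i) (eps i) = xcoeff (xvar j) (eps i)" by simp
  then show "i = j" by (auto split: if_splits)
qed simp

text \<open>Lagrange interpolation of $Z^n$ at the nodes $x_1, \dots, x_N$.\<close>

lemma power_sum_lagrange_small: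
  assumes "n < N"
  shows "(\<Sum>i\<in>{1..N}. xvar i ^ n * lagrange_weight N i) \<in> sym_ring N"
proof -
  define L where "L = (\<lambda>i. \<Prod>j\<in>{1..N} - {i}. [:- xvar j, 1:])"
  define f where "f = (\<Sum>i\<in>{1..N}. smult (xvar i ^ n * lagrange_weight N i) (L i)) - monom 1 n"
  have L_deg: "degree (L i) = N - 1" "lead_coeff (L i) = 1" if "i \<in> {1..N}" for i
  proof -
    have "degree (L i) = (\<Sum>j\<in>{1..N} - {i}. degree [:- xvar j, 1:])"
      unfolding L_def by (rule degree_prod_eq_sum_degree) auto
    also have "\<dots> = card ({1..N} - {i})" by simp
    also have "\<dots> = N - 1" using that by simp
    finally show "degree (L i) = N - 1" .
    show "lead_coeff (L i) = 1" unfolding L_def lead_coeff_prod by simp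
  qed
  have "degree f \<le> N - 1"
    unfolding f_def
  proof (intro degree_diff_le degree_sum_le)
    fix i assume "i \<in> {1..N}"
    then show "degree (smult (xvar i ^ n * lagrange_weight N i) (L i)) \<le> N - 1"
      using L_deg(1) degree_smult_le by metis
  next
    show "degree (monom (1::xseries) n) \<le> N - 1" using degree_monom_le[of "1::xseries" n] assms by simp
  qed simp
  have root: "poly f (xvar k) = 0" if k: "k \<in> {1..N}" for k
  proof -
    have "(\<Sum>i\<in>{1..N}. xvar i ^ n * lagrange_weight N i * poly (L i) (xvar k))
       = (\<Sum>i\<in>{1..N}. if i = k then xvar k ^ n else 0)"
    proof (rule sum.cong[OF refl])
      fix i assume i: "i \<in> {1..N}"
      have pL: "poly (L i) (xvar k) = (\<Prod>j\<in>{1..N} - {i}. xvar k - xvar j)"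
        by (simp add: L_def poly_prod)
      show "xvar i ^ n * lagrange_weight N i * poly (L i) (xvar k) = (if i = k then xvar k ^ n else 0)"
      proof (cases "i = k")
        case True
        then have "lagrange_weight N i * poly (L i) (xvar k) = 1"
          using lagrange_weight_mult[of N i] unfolding pL by simp
        then show ?thesis using True by (simp add: mult.assoc)
      next
        case False
        then have "poly (L i) (xvar k) = 0" unfolding pL using k by (intro prod_zero) auto
        then show ?thesis using False by simp
      qed
    qed
    also have "\<dots> = xvar k ^ n" using k by simp
    finally show ?thesis by (simp add: f_def poly_sum poly_monom)
  qed
  have "f = 0"
  proof (rule ccontr)
    assume "f \<noteq> 0"
    have "xvar ` {1..N} \<subseteq> {x. poly f x = 0}" using root by auto
    then have "card (xvar ` {1..N}) \<le> card {x. poly f x = 0}"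
      by (rule card_mono[OF poly_roots_finite[OF \<open>f \<noteq> 0\<close>]])
    also have "\<dots> \<le> N - 1" using card_poly_roots_bound[OF \<open>f \<noteq> 0\<close>] \<open>degree f \<le> N - 1\<close> by simp
    finally show False using assms by (simp add: card_image inj_on_def xvar_inj)
  qed
  \<comment> \<open>Compares coefficients in degree N - 1, where the interpolation polynomials are
    monic.\<close>
  then have "coeff f (N - 1) = 0" by simp
  moreover have "coeff f (N - 1) = (\<Sum>i\<in>{1..N}. xvar i ^ n * lagrange_weight N i) - (if n = N - 1 then 1 else 0)"
  proof -
    have "coeff (L i) (N - 1) = 1" if "i \<in> {1..N}" for i using L_deg[OF that] by simp
    then show ?thesis by (simp add: f_def coeff_sum)
  qed
  ultimately have "(\<Sum>i\<in>{1..N}. xvar i ^ n * lagrange_weight N i) = (if n = N - 1 then 1 else 0)" by simp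
  then show ?thesis by (simp add: sym_ring_0 sym_ring_1)
qed

text \<open>These sums are 0 or complete symmetric polynomials. Each x_i is a root of the product of
  all Z - x_j, so x_i^N reduces to lower powers with symmetric coefficients that do not depend on
  i.\<close>

lemma power_sum_lagrange: "(\<Sum>i\<in>{1..N}. xvar i ^ n * lagrange_weight N i) \<in> sym_ring N"
proof (induction n rule: less_induct)
  case (less n)
  show ?case
  proof (cases "n < N")
    case True
    then show ?thesis by (rule power_sum_lagrange_small)
  next
    case False
    have rec: "xvar i ^ n = - (\<Sum>k<N. (- 1) ^ Suc k * esym {1..N} (Suc k) * xvar i ^ (n - Suc k))" if i: "i \<in> {1..N}" for i
    proof -
      have "0 = (\<Prod>j\<in>{1..N}. xvar i - xvar j)" by (rule sym, rule prod_zero) (use i in auto)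
      also have "\<dots> = (\<Sum>k\<le>N. (- 1) ^ k * esym {1..N} k * xvar i ^ (N - k))"
        using prod_diff_esym[of "{1..N}" "xvar i"] by simp
      also have "\<dots> = xvar i ^ N + (\<Sum>k<N. (- 1) ^ Suc k * esym {1..N} (Suc k) * xvar i ^ (N - Suc k))"
        using sum.atMost_shift[of "\<lambda>k. (- 1) ^ k * esym {1..N} k * xvar i ^ (N - k)" N] by (simp add: esym_0)
      finally have "xvar i ^ N = - (\<Sum>k<N. (- 1) ^ Suc k * esym {1..N} (Suc k) * xvar i ^ (N - Suc k))"
        by (simp add: eq_neg_iff_add_eq_0)
      then have "xvar i ^ (n - N) * xvar i ^ N = - (\<Sum>k<N. (- 1) ^ Suc k * esym {1..N} (Suc k) * (xvar i ^ (n - N) * xvar i ^ (N - Suc k)))"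
        by (simp only: sum_distrib_left mult_minus_right mult.left_commute)
      moreover have "xvar i ^ (n - N) * xvar i ^ N = xvar i ^ n" using False by (simp add: power_add[symmetric])
      moreover have "xvar i ^ (n - N) * xvar i ^ (N - Suc k) = xvar i ^ (n - Suc k)" if "k < N" for k
        using False that by (simp add: power_add[symmetric])
      ultimately show ?thesis by simp
    qed
    have "(\<Sum>i\<in>{1..N}. xvar i ^ n * lagrange_weight N i)
       = (\<Sum>i\<in>{1..N}. \<Sum>k<N. - ((- 1) ^ Suc k * esym {1..N} (Suc k) * (xvar i ^ (n - Suc k) * lagrange_weight N i)))"
    proof (rule sum.cong[OF refl])
      fix i assume "i \<in> {1..N}"
      then show "xvar i ^ n * lagrange_weight N i
        = (\<Sum>k<N. - ((- 1) ^ Suc k * esym {1..N} (Suc k) * (xvar i ^ (n - Suc k) * lagrange_weight N i)))"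
        unfolding rec[OF \<open>i \<in> {1..N}\<close>] by (simp only: sum_negf sum_distrib_right mult_minus_left mult.assoc)
    qed
    also have "\<dots> = (\<Sum>k<N. - ((- 1) ^ Suc k * esym {1..N} (Suc k) * (\<Sum>i\<in>{1..N}. xvar i ^ (n - Suc k) * lagrange_weight N i)))"
      by (subst sum.swap) (simp only: sum_negf sum_distrib_left)
    also have "\<dots> \<in> sym_ring N"
    proof (rule sym_ring_sum)
      fix k assume "k \<in> {..<N}"
      then have H: "(\<Sum>i\<in>{1..N}. xvar i ^ (n - Suc k) * lagrange_weight N i) \<in> sym_ring N"
        using less.IH[of "n - Suc k"] False by simp
      have C: "(- 1) ^ Suc k * esym {1..N} (Suc k) \<in> sym_ring N"
        by (intro sym_ring.mult sym_ring.esym sym_ring_power sym_ring_uminus sym_ring_1)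
      show "- ((- 1) ^ Suc k * esym {1..N} (Suc k) * (\<Sum>i\<in>{1..N}. xvar i ^ (n - Suc k) * lagrange_weight N i)) \<in> sym_ring N"
        by (rule sym_ring_uminus) (rule sym_ring.mult[OF C H])
    qed
    finally show ?thesis .
  qed
qed

text \<open>Both the product of the t x_i - x_j and the shifted function are values at x_i of
  polynomials with symmetric coefficients. Expanding in powers of x_i leaves the sums of
  \<open>power_sum_lagrange\<close>, in which the poles have cancelled.\<close>

lemma Macdonald_op_sym_ring:
  assumes q: "q \<noteq> 0" and F: "F \<in> sym_ring N"
  shows "Macdonald_op N q t F \<in> sym_ring N"
proof -
  obtain p where p: "p \<in> sym_polys N" "\<And>i. i \<in> {1..N} \<Longrightarrow> Gamma q {i} F = poly p (xvar i)"
    using Gamma_sym_ring[OF q F] by blast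
  have "\<forall>k. \<exists>p\<in>sym_polys N. \<forall>i\<in>{1..N}. esym ({1..N} - {i}) k = poly p (xvar i)"
    using esym_without by blast
  then obtain s where s: "\<And>k. s k \<in> sym_polys N" "\<And>k i. i \<in> {1..N} \<Longrightarrow> esym ({1..N} - {i}) k = poly (s k) (xvar i)"
    by metis
  \<comment> \<open>Vieta's formula at T = t x_i, with the powers of t moved into the
    coefficients.\<close>
  define r where "r = (\<Sum>k\<le>N - 1. smult ((- 1) ^ k * xconst t ^ (N - 1 - k)) (s k * monom 1 (N - 1 - k)))"
  have r: "r \<in> sym_polys N"
    unfolding r_def by (intro sym_polys_sum sym_polys_smult sym_polys_mult sym_polys_monom s sym_ring.mult
      sym_ring_power sym_ring_uminus sym_ring_1 sym_ring.const)
  have num: "(\<Prod>j\<in>{1..N} - {i}. xconst t * xvar i - xvar j) = poly r (xvar i)" if i: "i \<in> {1..N}" for i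
  proof -
    have "card ({1..N} - {i}) = N - 1" using i by simp
    then have "(\<Prod>j\<in>{1..N} - {i}. xconst t * xvar i - xvar j)
       = (\<Sum>k\<le>N - 1. (- 1) ^ k * esym ({1..N} - {i}) k * (xconst t * xvar i) ^ (N - 1 - k))"
      using prod_diff_esym[of "{1..N} - {i}" "xconst t * xvar i"] by simp
    also have "\<dots> = poly r (xvar i)"
      unfolding r_def poly_sum using s(2)[OF i]
      by (intro sum.cong refl) (simp add: poly_monom power_mult_distrib mult_ac)
    finally show ?thesis .
  qed
  define P where "P = r * p"
  have P: "coeff P n \<in> sym_ring N" for n using sym_polys_mult[OF r p(1)] by (simp add: P_def sym_polys_def)
  have "Macdonald_op N q t F = (\<Sum>i\<in>{1..N}. poly P (xvar i) * lagrange_weight N i)"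
    unfolding Macdonald_op_def
  proof (rule sum.cong[OF refl])
    fix i assume i: "i \<in> {1..N}"
    show "(\<Prod>j\<in>{1..N} - {i}. (xconst t * xvar i - xvar j) * inv_diff i j) * Gamma q {i} F = poly P (xvar i) * lagrange_weight N i"
      unfolding prod.distrib num[OF i] p(2)[OF i] P_def lagrange_weight_def by (simp add: mult_ac)
  qed
  also have "\<dots> = (\<Sum>i\<in>{1..N}. \<Sum>n\<le>degree P. coeff P n * (xvar i ^ n * lagrange_weight N i))"
    by (simp add: poly_altdef sum_distrib_right mult.assoc)
  also have "\<dots> = (\<Sum>n\<le>degree P. coeff P n * (\<Sum>i\<in>{1..N}. xvar i ^ n * lagrange_weight N i))"
    by (subst sum.swap) (simp add: sum_distrib_left)
  also have "\<dots> \<in> sym_ring N" by (intro sym_ring_sum sym_ring.mult P power_sum_lagrange)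
  finally show ?thesis .
qed

section \<open>Permutation invariance and leading monomials of symmetric polynomials\<close>

lemma lookup_map_key: "inj p \<Longrightarrow> wt_entry (Poly_Mapping.map_key p g) k = wt_entry g (p k)"
  by (simp add: map_key.rep_eq)

lemma xcoeff_esym:
  assumes "finite A"
  shows "xcoeff (esym A r) g = (if \<exists>I\<subseteq>A. card I = r \<and> g = indicator_wt I then 1 else 0)"
proof (cases "\<exists>I\<subseteq>A. card I = r \<and> g = indicator_wt I")
  case True
  then obtain I where I: "I \<subseteq> A" "card I = r" "g = indicator_wt I" by blast
  have "xcoeff (esym A r) g = (\<Sum>J | J \<subseteq> A \<and> card J = r. if J = I then 1 else 0)"
    unfolding esym_def xcoeff_sum
  proof (rule sum.cong[OF refl])
    fix J assume "J \<in> {J. J \<subseteq> A \<and> card J = r}"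
    then have "finite J" "finite I" using I assms finite_subset by auto
    then show "xcoeff (xmonom (indicator_wt J)) g = (if J = I then 1 else 0)"
      using I(3) indicator_wt_inj[of J I] by auto
  qed
  also have "\<dots> = 1" using I assms by simp
  finally show ?thesis using True by simp
next
  case False
  have "xcoeff (esym A r) g = (\<Sum>J | J \<subseteq> A \<and> card J = r. 0)"
    unfolding esym_def xcoeff_sum by (rule sum.cong[OF refl]) (use False in auto)
  then show ?thesis using False by simp
qed

lemma is_sym_poly_sym_ring: "F \<in> sym_ring N \<Longrightarrow> is_sym_poly N F"
proof (induction rule: sym_ring.induct)
  case (const c)
  have "finite {g. xcoeff (xconst c) g \<noteq> 0}" by (rule finite_subset[of _ "{0}"]) (auto split: if_splits)
  moreover have "Poly_Mapping.map_key p g = 0 \<longleftrightarrow> g = 0" if "p permutes {1..N}" for p and g :: wt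
  proof
    have inj: "inj p" and surj: "surj p" using permutes_inj[OF that] permutes_surj[OF that] by blast+
    assume z: "Poly_Mapping.map_key p g = 0"
    show "g = 0"
    proof (rule poly_mapping_eqI)
      fix k obtain j where "k = p j" using surj by blast
      then show "wt_entry g k = wt_entry 0 k" using lookup_map_key[OF inj, of g j] z by simp
    qed
  next
    assume "g = 0"
    then show "Poly_Mapping.map_key p g = 0"
      by (intro poly_mapping_eqI) (simp add: lookup_map_key[OF permutes_inj[OF that]])
  qed
  ultimately show ?case unfolding is_sym_poly_def by (auto split: if_splits)
next
  case (esym r)
  have c: "xcoeff (esym {1..N} r) g = (if \<exists>I\<subseteq>{1..N}. card I = r \<and> g = indicator_wt I then 1 else 0)" for g
    by (rule xcoeff_esym) simp
  have "{g. xcoeff (esym {1..N} r) g \<noteq> 0} \<subseteq> indicator_wt ` Pow {1..N}" unfolding c by auto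
  then have "finite {g. xcoeff (esym {1..N} r) g \<noteq> 0}" by (rule finite_subset) simp
  moreover have "g \<in> lattice N \<and> (\<forall>i. wt_entry g i \<ge> 0)" if nz: "xcoeff (esym {1..N} r) g \<noteq> 0" for g
  proof -
    obtain I where I: "I \<subseteq> {1..N}" "g = indicator_wt I" using nz unfolding c by (auto split: if_splits)
    have "finite I" using I(1) by (rule finite_subset) simp
    then show ?thesis using I indicator_wt_lattice[OF I(1)] by (simp add: lookup_indicator_wt)
  qed
  moreover have "xcoeff (esym {1..N} r) (Poly_Mapping.map_key p g) = xcoeff (esym {1..N} r) g"
    if p: "p permutes {1..N}" for p g
  proof -
    have inj: "inj p" and surj: "surj p" using permutes_inj[OF p] permutes_surj[OF p] by blast+
    have "(\<exists>I\<subseteq>{1..N}. card I = r \<and> Poly_Mapping.map_key p g = indicator_wt I) \<longleftrightarrow> (\<exists>I\<subseteq>{1..N}. card I = r \<and> g = indicator_wt I)"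
    proof
      assume "\<exists>I\<subseteq>{1..N}. card I = r \<and> Poly_Mapping.map_key p g = indicator_wt I"
      then obtain I where I: "I \<subseteq> {1..N}" "card I = r" "Poly_Mapping.map_key p g = indicator_wt I" by blast
      have finI: "finite I" using I(1) by (rule finite_subset) simp
      have "g = indicator_wt (p ` I)"
      proof (rule poly_mapping_eqI)
        fix k obtain j where j: "k = p j" using surj by blast
        have "wt_entry g k = wt_entry (indicator_wt I) j" using lookup_map_key[OF inj, of g j] I(3) j by simp
        also have "\<dots> = wt_entry (indicator_wt (p ` I)) k"
          using finI j inj by (simp add: lookup_indicator_wt inj_image_mem_iff)
        finally show "wt_entry g k = wt_entry (indicator_wt (p ` I)) k" .
      qed
      moreover have "p ` I \<subseteq> {1..N}" using I(1) permutes_image[OF p] by blast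
      moreover have "card (p ` I) = r" using I(2) inj by (simp add: card_image inj_on_subset)
      ultimately show "\<exists>I\<subseteq>{1..N}. card I = r \<and> g = indicator_wt I" by blast
    next
      assume "\<exists>I\<subseteq>{1..N}. card I = r \<and> g = indicator_wt I"
      then obtain I where I: "I \<subseteq> {1..N}" "card I = r" "g = indicator_wt I" by blast
      have finI: "finite I" using I(1) by (rule finite_subset) simp
      have inv: "inv p permutes {1..N}" using p by (rule permutes_inv)
      have J: "inv p ` I \<subseteq> {1..N}" using I(1) permutes_image[OF inv] by blast
      have "Poly_Mapping.map_key p g = indicator_wt (inv p ` I)"
      proof (rule poly_mapping_eqI)
        fix j
        have "j \<in> inv p ` I \<longleftrightarrow> p j \<in> I" by (auto simp: permutes_inverses[OF p] intro!: rev_image_eqI)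
        then show "wt_entry (Poly_Mapping.map_key p g) j = wt_entry (indicator_wt (inv p ` I)) j"
          using finI I(3) by (simp add: lookup_map_key[OF inj] lookup_indicator_wt)
      qed
      moreover have "card (inv p ` I) = r"
        using I(2) permutes_inj[OF inv] by (simp add: card_image inj_on_subset)
      ultimately show "\<exists>I\<subseteq>{1..N}. card I = r \<and> Poly_Mapping.map_key p g = indicator_wt I" using J by blast
    qed
    then show ?thesis unfolding c by simp
  qed
  ultimately show ?case unfolding is_sym_poly_def by blast
next
  case (add F G)
  have "{g. xcoeff (F + G) g \<noteq> 0} \<subseteq> {g. xcoeff F g \<noteq> 0} \<union> {g. xcoeff G g \<noteq> 0}" by auto
  then have "finite {g. xcoeff (F + G) g \<noteq> 0}"
    by (rule finite_subset) (use add.IH in \<open>simp add: is_sym_poly_def\<close>)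
  moreover have "g \<in> lattice N \<and> (\<forall>i. wt_entry g i \<ge> 0)" if "xcoeff (F + G) g \<noteq> 0" for g
  proof -
    have "xcoeff F g \<noteq> 0 \<or> xcoeff G g \<noteq> 0" using that by auto
    then show ?thesis using add.IH unfolding is_sym_poly_def by blast
  qed
  moreover have "xcoeff (F + G) (Poly_Mapping.map_key p g) = xcoeff (F + G) g" if "p permutes {1..N}" for p g
    using add.IH that by (simp add: is_sym_poly_def)
  ultimately show ?case unfolding is_sym_poly_def by blast
next
  case (mult F G)
  let ?A = "{g. xcoeff F g \<noteq> 0}" and ?B = "{g. xcoeff G g \<noteq> 0}"
  have fin: "finite ?A" "finite ?B" using mult.IH by (simp_all add: is_sym_poly_def)
  have supp: "\<exists>a b. xcoeff F a \<noteq> 0 \<and> xcoeff G b \<noteq> 0 \<and> g = a + b" if nz: "xcoeff (F * G) g \<noteq> 0" for g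
  proof -
    obtain a where "xcoeff F a \<noteq> 0" "xcoeff G (g - a) \<noteq> 0" using nz by (rule xcoeff_mult_nonzero)
    then show ?thesis by (intro exI[of _ a] exI[of _ "g - a"]) simp
  qed
  have "{g. xcoeff (F * G) g \<noteq> 0} \<subseteq> (\<lambda>(a, b). a + b) ` (?A \<times> ?B)" using supp by force
  then have "finite {g. xcoeff (F * G) g \<noteq> 0}" by (rule finite_subset) (use fin in simp)
  moreover have "g \<in> lattice N \<and> (\<forall>i. wt_entry g i \<ge> 0)" if nz: "xcoeff (F * G) g \<noteq> 0" for g
  proof -
    obtain a b where ab: "xcoeff F a \<noteq> 0" "xcoeff G b \<noteq> 0" "g = a + b" using supp[OF nz] by blast
    then have "a \<in> lattice N" "b \<in> lattice N" "\<forall>i. wt_entry a i \<ge> 0" "\<forall>i. wt_entry b i \<ge> 0"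
      using mult.IH unfolding is_sym_poly_def by blast+
    then show ?thesis by (simp add: ab(3) lattice_add lookup_add)
  qed
  moreover have "xcoeff (F * G) (Poly_Mapping.map_key p g) = xcoeff (F * G) g" if p: "p permutes {1..N}" for p g
  proof -
    have inj: "inj p" by (rule permutes_inj[OF p])
    have F: "xcoeff F (Poly_Mapping.map_key p a) = xcoeff F a" and G: "xcoeff G (Poly_Mapping.map_key p a) = xcoeff G a" for a
      using mult.IH p unfolding is_sym_poly_def by blast+
    have inv: "inv p permutes {1..N}" using p by (rule permutes_inv)
    have inj': "inj (inv p)" by (rule permutes_inj[OF inv])
    have pinv: "p (inv p j) = j" "inv p (p j) = j" for j using permutes_inverses[OF p] by auto
    have comp: "Poly_Mapping.map_key p (Poly_Mapping.map_key (inv p) a) = a"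
      "Poly_Mapping.map_key (inv p) (Poly_Mapping.map_key p a) = a" for a :: wt
      by (rule poly_mapping_eqI, simp add: lookup_map_key[OF inj] lookup_map_key[OF inj'] pinv)+
    have diff: "Poly_Mapping.map_key p g - Poly_Mapping.map_key p a = Poly_Mapping.map_key p (g - a)" for a
      by (rule poly_mapping_eqI) (simp add: lookup_map_key[OF inj] lookup_minus)
    have F': "xcoeff F (Poly_Mapping.map_key (inv p) a) = xcoeff F a" for a
      using F[of "Poly_Mapping.map_key (inv p) a"] comp(1)[of a] by simp
    have "xcoeff (F * G) (Poly_Mapping.map_key p g) = (\<Sum>a\<in>?A. xcoeff F a * xcoeff G (Poly_Mapping.map_key p g - a))"
      by (rule xcoeff_mult_eq_sum) (use fin in auto)
    also have "\<dots> = (\<Sum>a\<in>?A. xcoeff F a * xcoeff G (g - a))"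
    proof (rule sum.reindex_bij_witness[of _ "Poly_Mapping.map_key p" "Poly_Mapping.map_key (inv p)"])
      fix a assume "a \<in> ?A"
      show "Poly_Mapping.map_key p (Poly_Mapping.map_key (inv p) a) = a" by (rule comp)
      show "Poly_Mapping.map_key (inv p) a \<in> ?A" using \<open>a \<in> ?A\<close> F' by simp
      have "xcoeff G (Poly_Mapping.map_key p g - a) = xcoeff G (g - Poly_Mapping.map_key (inv p) a)"
        using diff[of "Poly_Mapping.map_key (inv p) a"] G[of "g - Poly_Mapping.map_key (inv p) a"] comp(1)[of a] by simp
      then show "xcoeff F (Poly_Mapping.map_key (inv p) a) * xcoeff G (g - Poly_Mapping.map_key (inv p) a)
          = xcoeff F a * xcoeff G (Poly_Mapping.map_key p g - a)" using F'[of a] by simp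
    next
      fix a assume "a \<in> ?A"
      show "Poly_Mapping.map_key (inv p) (Poly_Mapping.map_key p a) = a" by (rule comp)
      show "Poly_Mapping.map_key p a \<in> ?A" using \<open>a \<in> ?A\<close> F by simp
    qed
    also have "\<dots> = xcoeff (F * G) g"
      by (rule xcoeff_mult_eq_sum[symmetric]) (use fin in auto)
    finally show ?thesis .
  qed
  ultimately show ?case unfolding is_sym_poly_def by blast
qed

lemma leading_monomial_mult:
  assumes "leading_monomial N l F" "leading_monomial N l' G"
  shows "leading_monomial N (l + l') (F * G)"
  unfolding leading_monomial_def
proof (intro conjI allI impI)
  have F: "xcoeff F l = 1" "\<And>g. xcoeff F g \<noteq> 0 \<Longrightarrow> l - g \<in> Qplus N"
    and G: "xcoeff G l' = 1" "\<And>g. xcoeff G g \<noteq> 0 \<Longrightarrow> l' - g \<in> Qplus N"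
    using assms by (simp_all add: leading_monomial_def)
  have "xcoeff (F * G) (l + l') = (\<Sum>a\<in>{l}. xcoeff F a * xcoeff G (l + l' - a))"
  proof (rule xcoeff_mult_eq_sum)
    fix a assume a: "xcoeff F a \<noteq> 0" "xcoeff G (l + l' - a) \<noteq> 0"
    have e: "l' - (l + l' - a) = - (l - a)" by simp
    have "l - a = 0" by (rule Qplus_antisym[OF F(2)[OF a(1)] G(2)[OF a(2), unfolded e]])
    then show "a \<in> {l}" by simp
  qed simp
  then show "xcoeff (F * G) (l + l') = 1" using F(1) G(1) by simp
  fix c assume "xcoeff (F * G) c \<noteq> 0"
  then obtain a where a: "xcoeff F a \<noteq> 0" "xcoeff G (c - a) \<noteq> 0" by (rule xcoeff_mult_nonzero)
  have "(l - a) + (l' - (c - a)) \<in> Qplus N" by (rule Qplus_add[OF F(2)[OF a(1)] G(2)[OF a(2)]])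
  then show "l + l' - c \<in> Qplus N" by (simp add: algebra_simps)
qed

lemma leading_monomial_prod:
  "(\<And>i. i \<in> A \<Longrightarrow> leading_monomial N (w i) (f i)) \<Longrightarrow> leading_monomial N (\<Sum>i\<in>A. w i) (\<Prod>i\<in>A. f i)"
proof (induction A rule: infinite_finite_induct)
  case (insert x A)
  then show ?case by (simp add: leading_monomial_mult)
qed (auto simp: leading_monomial_def)

lemma leading_monomial_esym:
  assumes "r \<le> N"
  shows "leading_monomial N (indicator_wt {1..r}) (esym {1..N} r)"
  unfolding leading_monomial_def
proof (intro conjI allI impI)
  have "\<exists>I\<subseteq>{1..N}. card I = r \<and> indicator_wt {1..r} = indicator_wt I"
    by (rule exI[of _ "{1..r}"]) (use assms in auto)
  then show "xcoeff (esym {1..N} r) (indicator_wt {1..r}) = 1" by (simp only: xcoeff_esym finite_atLeastAtMost if_True)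
  fix g assume "xcoeff (esym {1..N} r) g \<noteq> 0"
  then have "\<exists>I\<subseteq>{1..N}. card I = r \<and> g = indicator_wt I"
    unfolding xcoeff_esym[OF finite_atLeastAtMost] by (meson)
  then obtain I where "I \<subseteq> {1..N}" "card I = r" "g = indicator_wt I" by blast
  then show "indicator_wt {1..r} - g \<in> Qplus N" using fundamental_minus_indicator[of I N r] by blast
qed

text \<open>The product of the e_i to the powers l_i - l_(i+1), with l_(N+1) = 0: its leading
  exponent is the corresponding sum of fundamental weights, which is l.\<close>

lemma partition_leading_exists:
  assumes l: "is_partition N l"
  shows "\<exists>F\<in>sym_ring N. leading_monomial N l F"
proof -
  define c where "c = (\<lambda>i. nat (wt_entry l i - wt_entry l (i + 1)))"
  have lat: "l \<in> lattice N" using l by (simp add: is_partition_def)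
  have c: "int (c i) = wt_entry l i - wt_entry l (i + 1)" if i: "i \<in> {1..N}" for i
  proof -
    have "wt_entry l i \<ge> wt_entry l (i + 1)"
    proof (cases "i = N")
      case True
      then show ?thesis using wt_entry_lattice[OF lat, of "i + 1"] l i by (simp add: is_partition_def)
    next
      case False
      then show ?thesis using l i by (simp add: is_partition_def)
    qed
    then show ?thesis by (simp add: c_def)
  qed
  let ?F = "\<Prod>i\<in>{1..N}. \<Prod>j<c i. esym {1..N} i"
  have "leading_monomial N (\<Sum>i\<in>{1..N}. \<Sum>j<c i. indicator_wt {1..i}) ?F"
    by (intro leading_monomial_prod leading_monomial_esym) simp
  also have "(\<Sum>i\<in>{1..N}. \<Sum>j<c i. indicator_wt {1..i}) = l"
  proof (rule poly_mapping_eqI)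
    fix k
    have "wt_entry (\<Sum>i\<in>{1..N}. \<Sum>j<c i. indicator_wt {1..i}) k = (\<Sum>i\<in>{1..N}. int (c i) * (if k \<in> {1..i} then 1 else 0))"
      unfolding lookup_sum lookup_indicator_wt[OF finite_atLeastAtMost] by simp
    also have "\<dots> = wt_entry l k"
    proof (cases "k \<in> {1..N}")
      case True
      have "(\<Sum>i\<in>{1..N}. int (c i) * (if k \<in> {1..i} then 1 else 0)) = (\<Sum>i\<in>{k..N}. wt_entry l i - wt_entry l (i + 1))"
        by (rule sum.mono_neutral_cong_right) (use True c in auto)
      also have "\<dots> = wt_entry l k - wt_entry l (N + 1)"
        using sum_Suc_diff[of k N "\<lambda>i. - wt_entry l i"] True by simp
      finally show ?thesis using wt_entry_lattice[OF lat, of "N + 1"] by simp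
    next
      case False
      then have "(\<Sum>i\<in>{1..N}. int (c i) * (if k \<in> {1..i} then 1 else 0)) = 0" by (intro sum.neutral) auto
      then show ?thesis using wt_entry_lattice[OF lat False] by simp
    qed
    finally show "wt_entry (\<Sum>i\<in>{1..N}. \<Sum>j<c i. indicator_wt {1..i}) k = wt_entry l k" .
  qed
  finally have "leading_monomial N l ?F" .
  moreover have "?F \<in> sym_ring N" by (intro sym_ring_prod sym_ring.esym)
  ultimately show ?thesis by blast
qed

text \<open>The exponents that can occur in a symmetric polynomial below l. Nonnegativity of the
  entries makes the set finite, so that a polynomial meets only finitely many resonances.\<close>

definition mac_support :: "nat \<Rightarrow> wt \<Rightarrow> wt set" where
  "mac_support N l = {m \<in> lattice N. (\<forall>i. wt_entry m i \<ge> 0) \<and> l - m \<in> Qplus N}"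

lemma finite_mac_support: "finite (mac_support N l)"
proof -
  let ?B = "\<Sum>j\<in>Poly_Mapping.keys l. \<bar>wt_entry l j\<bar>"
  have "mac_support N l \<subseteq> {g. Poly_Mapping.keys g \<subseteq> {..N} \<and> (\<forall>i. \<bar>psum i g\<bar> \<le> ?B)}"
  proof
    fix g assume g: "g \<in> mac_support N l"
    have "\<bar>psum i g\<bar> \<le> ?B" for i
    proof -
      have "psum i g \<ge> 0" unfolding psum_def by (rule sum_nonneg) (use g in \<open>auto simp: mac_support_def\<close>)
      moreover have "psum i (l - g) \<ge> 0" using g by (auto simp: mac_support_def Qplus_iff simp del: psum_diff)
      ultimately show ?thesis using psum_le_total[of i l] by simp
    qed
    moreover have "Poly_Mapping.keys g \<subseteq> {..N}" using g by (auto simp: mac_support_def lattice_def)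
    ultimately show "g \<in> {g. Poly_Mapping.keys g \<subseteq> {..N} \<and> (\<forall>i. \<bar>psum i g\<bar> \<le> ?B)}" by simp
  qed
  then show ?thesis using finite_bounded_wts finite_subset by blast
qed

lemma sym_poly_supp:
  "is_sym_poly N F \<Longrightarrow> below_supp N l F \<Longrightarrow> xcoeff F m \<noteq> 0 \<Longrightarrow> m \<in> mac_support N l"
  unfolding is_sym_poly_def below_supp_def mac_support_def by blast

lemma Macdonald_op_add_scale: "Macdonald_op N q t (F + xconst c * G) = Macdonald_op N q t F + xconst c * Macdonald_op N q t G"
  unfolding Macdonald_op_def Gamma_add Gamma_xconst_mult distrib_left sum.distrib sum_distrib_left
  by (simp only: mult.left_commute)

text \<open>
  Repeatedly removing the largest monomial from the defect of the eigenvalue equation; only finitely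
  many monomials can occur.
\<close>

lemma Macdonald_eigen_sym_ring_exists:
  assumes q: "q \<noteq> 0" and l: "is_partition N l"
    and res: "\<And>m. m \<in> mac_support N l \<Longrightarrow> m \<noteq> l \<Longrightarrow> mac_eigval N q t l \<noteq> mac_eigval N q t m"
  shows "\<exists>F\<in>sym_ring N. leading_monomial N l F \<and> Macdonald_eigen N q t l F"
proof -
  let ?E = "mac_eigval N q t"
  define H where "H = (\<lambda>F. Macdonald_op N q t F + xconst (- ?E l) * F)"
  have H_eq: "H G = Macdonald_op N q t G + xconst (- ?E l) * G" for G by (simp only: H_def)
  \<comment> \<open>The admissible exponents that do not exceed the largest exponent of the defect;
    the size of this finite set is the induction measure.\<close>
  let ?M = "\<lambda>F. {b \<in> mac_support N l. \<exists>s. xcoeff (H F) s \<noteq> 0 \<and> b \<le> s}"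
  have neg: "\<And>i. i \<in> {1..N} \<Longrightarrow> mac_coeff N t i \<in> neg_series N" by (rule mac_coeff_neg_series)
  have diag: "xcoeff (Macdonald_op N q t F) m = ?E m * xcoeff F m + (\<Sum>n\<in>between N m l - {m}. mac_kernel N q t m n * xcoeff F n)"
    if "below_supp N l F" "l - m \<in> Qplus N" for F m
  proof -
    have "xcoeff (Macdonald_op N q t F) m = mac_kernel N q t m m * xcoeff F m
      + (\<Sum>n\<in>between N m l - {m}. mac_kernel N q t m n * xcoeff F n)"
      unfolding Macdonald_op_shift_op by (rule shift_op_coeff_diag[OF _ that]) (rule neg)
    then show ?thesis by (simp only: mac_kernel_diag)
  qed
  have D_supp: "below_supp N l (Macdonald_op N q t F)" if "below_supp N l F" for F
    unfolding Macdonald_op_shift_op by (rule below_supp_shift_op[OF _ that]) (rule neg)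
  have H_supp: "below_supp N l (H F)" if "below_supp N l F" for F
    using below_supp_diff[OF D_supp[OF that] below_supp_xconst_mult[OF that, of "?E l"]]
    by (simp add: H_def xconst_uminus)
  have H_sym: "H F \<in> sym_ring N" if "F \<in> sym_ring N" for F
    unfolding H_def by (intro sym_ring.add sym_ring.mult sym_ring.const Macdonald_op_sym_ring[OF q] that)
  have H_lin: "H (F + xconst c * G) = H F + xconst c * H G" for F G c
    unfolding H_def Macdonald_op_add_scale by (simp add: algebra_simps)
  have "\<exists>P\<in>sym_ring N. leading_monomial N l P \<and> Macdonald_eigen N q t l P"
    if "F \<in> sym_ring N" "leading_monomial N l F" for F
    using that
  proof (induction "card (?M F)" arbitrary: F rule: less_induct)
    case less
    have supp: "below_supp N l F" and Fl: "xcoeff F l = 1" using less.prems by (auto simp: leading_monomial_iff)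
    show ?case
    proof (cases "H F = 0")
      case True
      then have "Macdonald_eigen N q t l F"
        unfolding Macdonald_eigen_def mac_eigval_def[symmetric] H_def by (simp add: xconst_uminus)
      then show ?thesis using less.prems by blast
    next
      case False
      then obtain m where m: "xcoeff (H F) m \<noteq> 0" "\<And>g. xcoeff (H F) g \<noteq> 0 \<Longrightarrow> g \<le> m" by (metis xcoeff_max)
      have Hs: "below_supp N l (H F)" by (rule H_supp[OF supp])
      have mB: "m \<in> mac_support N l"
        by (rule sym_poly_supp[OF is_sym_poly_sym_ring[OF H_sym[OF less.prems(1)]] Hs m(1)])
      have Hl: "xcoeff (H F) l = 0" using diag[OF supp, of l] by (simp add: H_def between_self Fl)
      then have "m \<noteq> l" using m(1) by auto
      \<comment> \<open>H multiplies the top monomial m of the defect by ?E m - ?E l, so adding c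
        times the defect to F cancels it.\<close>
      define c where "c = 1 / (?E l - ?E m)"
      have c: "1 + c * (?E m - ?E l) = 0" using res[OF mB \<open>m \<noteq> l\<close>] by (simp add: c_def field_simps)
      define F' where "F' = F + xconst c * H F"
      have F'_sym: "F' \<in> sym_ring N" unfolding F'_def by (intro sym_ring.add sym_ring.mult sym_ring.const H_sym less.prems)
      have F'_lead: "leading_monomial N l F'"
        unfolding leading_monomial_iff F'_def below_supp_def
      proof (intro conjI allI impI)
        show "xcoeff (F + xconst c * H F) l = 1" by (simp add: Fl Hl)
        fix g assume "xcoeff (F + xconst c * H F) g \<noteq> 0"
        then have "xcoeff F g \<noteq> 0 \<or> xcoeff (H F) g \<noteq> 0" by auto
        then show "l - g \<in> Qplus N" using supp Hs by (auto simp: below_supp_def)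
      qed
      have HF': "xcoeff (H F') g = xcoeff (H F) g + c * (xcoeff (Macdonald_op N q t (H F)) g - ?E l * xcoeff (H F) g)" for g
        unfolding F'_def H_lin by (simp add: H_eq[of "H F"])
      have lt: "g < m" if g: "xcoeff (H F') g \<noteq> 0" for g
      proof -
        have "l - g \<in> Qplus N" using H_supp[of F'] F'_lead g by (auto simp: leading_monomial_iff below_supp_def)
        \<comment> \<open>The exponents between g and l are lexicographically at least g; if g
          exceeded m, the defect would vanish at all of them.\<close>
        have le: "g \<le> m"
        proof (rule ccontr)
          assume "\<not> g \<le> m"
          then have z: "xcoeff (H F) g = 0" using m(2) by blast
          have "xcoeff (H F) n = 0" if n: "n \<in> between N g l" for n
          proof -
            have "0 \<le> n - g" using n by (intro Qplus_nonneg[of _ N]) (auto simp: between_def)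
            then have "\<not> n \<le> m" using \<open>\<not> g \<le> m\<close> by auto
            then show ?thesis using m(2) by blast
          qed
          then have "(\<Sum>n\<in>between N g l - {g}. mac_kernel N q t g n * xcoeff (H F) n) = 0" by (intro sum.neutral) auto
          then have "xcoeff (H F') g = 0" using HF'[of g] diag[OF Hs \<open>l - g \<in> Qplus N\<close>] z by simp
          then show False using g by simp
        qed
        moreover have "g \<noteq> m"
        proof
          assume "g = m"
          have "(\<Sum>n\<in>between N m l - {m}. mac_kernel N q t m n * xcoeff (H F) n) = 0"
          proof (rule sum.neutral, rule ballI)
            fix n assume n: "n \<in> between N m l - {m}"
            then have "0 \<le> n - m" by (intro Qplus_nonneg[of _ N]) (auto simp: between_def)
            then have "\<not> n \<le> m" using n by auto
            then show "mac_kernel N q t m n * xcoeff (H F) n = 0" using m(2) by auto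
          qed
          then have "xcoeff (Macdonald_op N q t (H F)) m = ?E m * xcoeff (H F) m"
            using diag[OF Hs, of m] mB by (simp add: mac_support_def)
          then have "xcoeff (H F') m = (1 + c * (?E m - ?E l)) * xcoeff (H F) m"
            using HF'[of m] by (simp add: algebra_simps)
          then show False using c g \<open>g = m\<close> by simp
        qed
        ultimately show ?thesis by simp
      qed
      have "?M F' \<subset> ?M F"
      proof
        show "?M F' \<subseteq> ?M F"
        proof
          fix b assume "b \<in> ?M F'"
          then obtain s where s: "b \<in> mac_support N l" "xcoeff (H F') s \<noteq> 0" "b \<le> s" by blast
          then have "b \<le> m" using lt[of s] by simp
          then show "b \<in> ?M F" using s(1) m(1) by blast
        qed
        have "m \<in> ?M F" using mB m(1) by blast
        moreover have "m \<notin> ?M F'"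
        proof
          assume "m \<in> ?M F'"
          then obtain s where "xcoeff (H F') s \<noteq> 0" "m \<le> s" by blast
          then show False using lt[of s] by simp
        qed
        ultimately show "?M F' \<noteq> ?M F" by blast
      qed
      then have "card (?M F') < card (?M F)" by (rule psubset_card_mono[rotated]) (simp add: finite_mac_support)
      then show ?thesis by (rule less.hyps[OF _ F'_sym F'_lead])
    qed
  qed
  then show ?thesis using partition_leading_exists[OF l] by blast
qed

text \<open>A symmetric polynomial below l vanishes outside the finite set
  \<open>mac_support\<close>, so it suffices that no resonance occurs at its elements.\<close>

lemma is_Macdonald_poly_unique:
  assumes res: "\<And>m. m \<in> mac_support N l \<Longrightarrow> m \<noteq> l \<Longrightarrow> mac_eigval N q t l \<noteq> mac_eigval N q t m"
    and P: "is_Macdonald_poly N q t l P" and Q: "is_Macdonald_poly N q t l Q"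
  shows "P = Q"
proof (rule xseries_eqI)
  fix m
  have PL: "leading_monomial N l P" and QL: "leading_monomial N l Q" using P Q by (auto simp: is_Macdonald_poly_def)
  show "xcoeff P m = xcoeff Q m"
  proof (induction "height N (l - m)" arbitrary: m rule: less_induct)
    case less
    consider "m = l" | "m \<notin> mac_support N l" | "m \<in> mac_support N l" "m \<noteq> l" by blast
    then show ?case
    proof cases
      case 1
      then show ?thesis using PL QL by (simp add: leading_monomial_def)
    next
      case 2
      have "xcoeff P m = 0" using sym_poly_supp[of N P l m] 2 P PL by (auto simp: is_Macdonald_poly_def leading_monomial_iff)
      moreover have "xcoeff Q m = 0" using sym_poly_supp[of N Q l m] 2 Q QL by (auto simp: is_Macdonald_poly_def leading_monomial_iff)
      ultimately show ?thesis by simp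
    next
      case 3
      have m: "l - m \<in> Qplus N" using 3 by (simp add: mac_support_def)
      have eP: "Macdonald_eigen N q t l P" and eQ: "Macdonald_eigen N q t l Q" using P Q by (auto simp: is_Macdonald_poly_def)
      have "(\<Sum>n\<in>between N m l - {m}. mac_kernel N q t m n * xcoeff P n) = (\<Sum>n\<in>between N m l - {m}. mac_kernel N q t m n * xcoeff Q n)"
        by (intro sum.cong refl) (use less between_height_less in auto)
      then have "(mac_eigval N q t l - mac_eigval N q t m) * xcoeff P m = (mac_eigval N q t l - mac_eigval N q t m) * xcoeff Q m"
        using eP[unfolded Macdonald_eigen_iff[OF PL], rule_format, OF m 3(2)]
          eQ[unfolded Macdonald_eigen_iff[OF QL], rule_format, OF m 3(2)] by simp
      then show ?thesis using res[OF 3] by simp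
    qed
  qed
qed

lemma eventually_notin_finite:
  assumes "finite (T :: complex set)"
  shows "eventually (\<lambda>t. t \<notin> T) at_infinity"
  unfolding eventually_at_infinity
proof (intro exI allI impI notI)
  fix t assume t: "(\<Sum>x\<in>T. norm x) + 1 \<le> norm t" "t \<in> T"
  have "norm t \<le> (\<Sum>x\<in>T. norm x)" using member_le_sum[OF t(2), of norm] assms by simp
  then show False using t(1) by simp
qed

text \<open>For all but finitely many t the Macdonald polynomial exists and is in particular a
  series eigenfunction, so the limit already computed for the series applies.\<close>

theorem qWhittaker_eq_Psi:
  assumes q: "q \<noteq> 0" "norm q < 1" and l: "is_partition N l"
  shows "qWhittaker N q l = Psi N q l"
  unfolding qWhittaker_def
proof (rule coeffwise_limit_eq[OF at_infinity_nontrivial])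
  have lat: "l \<in> lattice N" using l by (simp add: is_partition_def)
  let ?T = "\<Union>m\<in>mac_support N l - {l}. {t. mac_eigval N q t l = mac_eigval N q t m}"
  have "finite ?T"
    using finite_mac_support[of N l] finite_mac_resonances[OF q lat] by (auto simp: mac_support_def)
  then have "eventually (\<lambda>t. t \<notin> ?T) at_infinity" by (rule eventually_notin_finite)
  then have ev: "eventually (\<lambda>t. is_Macdonald_series N q t l (Macdonald_poly N q t l)) at_infinity"
  proof eventually_elim
    case (elim t)
    then have res: "mac_eigval N q t l \<noteq> mac_eigval N q t m" if "m \<in> mac_support N l" "m \<noteq> l" for m
      using that by blast
    obtain F where "F \<in> sym_ring N" "leading_monomial N l F" "Macdonald_eigen N q t l F"
      using Macdonald_eigen_sym_ring_exists[OF q(1) l res] by blast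
    then have F: "is_Macdonald_poly N q t l F" by (simp add: is_Macdonald_poly_def is_sym_poly_sym_ring)
    have "Macdonald_poly N q t l = F"
      unfolding Macdonald_poly_def
    proof (rule the_equality)
      show "G = F" if "is_Macdonald_poly N q t l G" for G by (rule is_Macdonald_poly_unique[OF res that F])
    qed (rule F)
    then have "is_Macdonald_poly N q t l (Macdonald_poly N q t l)" using F by simp
    then show ?case by (simp add: is_Macdonald_poly_def is_Macdonald_series_def)
  qed
  fix g
  show "((\<lambda>t. xcoeff (Macdonald_poly N q t l) g) \<longlongrightarrow> xcoeff (Psi N q l) g) at_infinity"
    by (rule Macdonald_series_tendsto_Psi[OF q lat order_refl ev])
qed

lemma qWhittaker_ext_eq_Psi:
  "q \<noteq> 0 \<Longrightarrow> norm q < 1 \<Longrightarrow> l \<in> lattice N \<Longrightarrow> qWhittaker_ext N q l = Psi N q l"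
  by (simp add: qWhittaker_ext_def qWhittaker_eq_Psi qWhittaker_series_eq_Psi)

theorem theorem2p6:
  fixes N :: nat and q :: complex and Dbar :: "nat \<Rightarrow> int \<Rightarrow> qtorus"
    and a :: nat and k :: int and l :: wt
  assumes "q \<noteq> 0" and "norm q < 1"
    and "opposite_Q_system N q Dbar"
    and "standard_initial_data N Dbar"
    and "a \<in> {1..N}"
    and "is_partition N l"
  shows "qt_act q (Dbar a k) (qWhittaker_ext N q) l = D_op N q a k (qWhittaker N q l)"
proof -
  have l: "l \<in> lattice N" using assms(6) by (simp add: is_partition_def)
  have I: "intertwines N q (Dbar a k) a k"
    by (rule opposite_Q_system_intertwines[OF assms(1-4)]) (use assms(5) in simp)
  \<comment> \<open>The shifts in \<open>Dbar\<close> may leave the partitions, but both cases of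
    \<open>qWhittaker_ext\<close> agree with \<open>Psi\<close> on the whole lattice.\<close>
  have "qt_act q (Dbar a k) (qWhittaker_ext N q) l = qt_act q (Dbar a k) (Psi N q) l"
    by (rule qt_act_cong[OF _ l]) (use I assms(1,2) in \<open>simp_all add: intertwines_def qWhittaker_ext_eq_Psi\<close>)
  also have "\<dots> = D_op N q a k (Psi N q l)" using I l by (simp add: intertwines_def)
  also have "Psi N q l = qWhittaker N q l" using qWhittaker_eq_Psi[OF assms(1,2,6)] by simp
  finally show ?thesis .
qed

end
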